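(* Let $\mathcal{H}\in C^2(\mathbb{R}^{2d},\mathbb{R})$ and let $x$ be a quasi-periodic orbit of the Hamiltonian system $\dot x=J\mathcal{H}'(x)$. Let $\gamma$ be the fundamental solution of $\dot z=J\mathcal{H}''(x(t))z$, i.e. $\dot\gamma(t)=J\mathcal{H}''(x(t))\gamma(t)$, $\gamma(0)=I$. Then $\lim_{T\to\infty}\frac{i_1(\gamma,[0,T])}{T}$ exists and $$\mathcal{I}(\Lambda(x))=\mathcal{I}^-(\Lambda(x))=\lim_{T\to\infty}\frac{i_1(\gamma,[0,T])}{T}$$ (that is, both sets are the single point given by the limit).
   Context: Let $d\ge 1$, $I$ the identity matrix, $J=\begin{pmatrix}0&-I\\ I&0\end{pmatrix}$ the standard $2d\times 2d$ symplectic matrix, $\mathrm{Sp}(2d)=\{M\in GL(\mathbb{R}^{2d}): M^TJM=J\}$, $\mathbb{U}$ the unit circle in $\mathbb{C}$, and $\mathrm{Sym}(2d,\mathbb{R})$ the real symmetric $2d\times 2d$ matrices. For bounded $B\in C^0(\mathbb{R},\mathrm{Sym}(2d,\mathbb{R}))$, $\gamma=\gamma_B$ is the fundamental solution: $\dot\gamma(t)=JB(t)\gamma(t)$, $\gamma(0)=I$. Maslov-type index: for $\omega\in\mathbb{U}$ let $\mathrm{Sp}(2d)^0_\omega=\{M\in\mathrm{Sp}(2d):\det(M-\omega I)=0\}$, a codimension-one hypersurface co-oriented at $M$ by the direction $\frac{d}{dt}Me^{tJ}|_{t=0}$. For a continuous path $\gamma:[a,b]\to\mathrm{Sp}(2d)$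 and $M\in\mathrm{Sp}(2d)$, $\iota(\omega M,\gamma,[a,b])\in\mathbb{Z}$ is the intersection number of the path $t\mapsto e^{-\epsilon J}\gamma(t)M^{-1}$, $t\in[a,b]$, with the co-oriented hypersurface $\mathrm{Sp}(2d)^0_\omega$, for $\epsilon>0$ sufficiently small. For a path on $[0,T]$ with $\gamma(0)=I$, $i_\omega(\gamma,[0,T])=\iota(\omega I,\gamma,[0,T])-\frac12\dim_{\mathbb{C}}\ker(I-\omega I)$; thus $i_1(\gamma,[0,T])=\iota(I,\gamma,[0,T])-d$. Mean indices: $\mathcal{I}_U(B)=\limsup_{l\to+\infty}\frac{i_1(\gamma,[0,l])}{l}$, $\mathcal{I}_L(B)=\liminf_{l\to+\infty}\frac{i_1(\gamma,[0,l])}{l}$, $\mathcal{I}^-_U(B)=\limsup_{l\to+\infty}\frac{i_1(\gamma,[0,-l])}{-l}$, $\mathcal{I}^-_L(B)=\liminf_{l\to+\infty}\frac{i_1(\gamma,[0,-l])}{-l}$, where $i_1(\gamma,[0,-l])$ is the index $i_1$ of the path $t\mapsto\gamma(-t)$, $t\in[0,l]$. Set $\mathcal{I}(B)=[\mathcal{I}_L(B),\mathcal{I}_U(B)]$ and $\mathcal{I}^-(B)=[\mathcal{I}^-_L(B),\mathcal{I}^-_U(B)]$; when such an interval is a single point it is identified with that number. For an orbit $x$ of $\dot x=J\mathcal{H}'(x)$ ($\mathcal{H}'$ gradient, $\mathcal{H}''$ Hessian), $\mathcal{I}(x)=\mathcal{I}(B)$ and $\mathcal{I}^-(x)=\mathcal{I}^-(B)$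 with $B(t)=\mathcal{H}''(x(t))$; for $\xi\in\mathbb{R}^{2d}$, $\mathcal{I}(\xi)=\mathcal{I}(x)$, $\mathcal{I}^-(\xi)=\mathcal{I}^-(x)$, where $x(0)=\xi$. For a set $\Lambda$ invariant under the Hamiltonian flow, $\mathcal{I}(\Lambda)=\bigcup_{\xi\in\Lambda}\mathcal{I}(\xi)$, $\mathcal{I}^-(\Lambda)=\bigcup_{\xi\in\Lambda}\mathcal{I}^-(\xi)$. Let $\Lambda(x)=\overline{\{x(t):t\in\mathbb{R}\}}$. The orbit $x$ is quasi-periodic if there are a torus $\mathbb{T}^m$, a homeomorphism $D:\mathbb{T}^m\to\Lambda(x)$ and $\omega=(\omega_1,\dots,\omega_m)\in\mathbb{R}^m$ with $\omega_1,\dots,\omega_m$ linearly independent over $\mathbb{Q}$ such that $x(t)=D(D^{-1}(x(0))+\omega t)$ for all $t$. *)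

theory Defs
  imports "HOL-Analysis.Analysis"
begin

text \<open>
  The index type \<^typ>\<open>'d + 'd\<close> splits \<open>\<real>\<^bsup>2d\<^esup>\<close>, \<open>d = CARD('d)\<close>, into its
  two blocks of \<open>d\<close> coordinates.
\<close>

type_synonym 'd phase = "real ^ ('d + 'd)"
type_synonym 'd phase_matrix = "real ^ ('d + 'd) ^ ('d + 'd)"

definition J :: "'d::finite phase_matrix" where
  "J = (\<chi> i j. case (i, j) of
          (Inl k, Inr l) \<Rightarrow> (if k = l then -1 else 0)
        | (Inr k, Inl l) \<Rightarrow> (if k = l then 1 else 0)
        | _ \<Rightarrow> 0)"

definition Sp :: "'d::finite phase_matrix set" where
  "Sp = {M. invertible M \<and> transpose M ** J ** M = J}"

text \<open>
  The multiplication of the class \<^class>\<open>times\<close> on vectors is componentwise, so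
  \<^const>\<open>exp\<close> is not the matrix exponential.
\<close>

definition matrix_exp :: "real ^ 'n ^ 'n \<Rightarrow> real ^ 'n ^ 'n::finite" where
  "matrix_exp A = (\<Sum>k. (1 / fact k) *\<^sub>R (((**) A) ^^ k) (mat 1))"


section \<open>The hypersurface \<open>Sp(2d)\<^sup>0\<^sub>\<omega>\<close> and intersection numbers\<close>

definition shifted_matrix :: "complex \<Rightarrow> 'd::finite phase_matrix \<Rightarrow> complex ^ ('d + 'd) ^ ('d + 'd)" where
  "shifted_matrix \<omega> M = (\<chi> i j. complex_of_real (M $ i $ j)) - mat \<omega>"

definition Sp0 :: "complex \<Rightarrow> 'd::finite phase_matrix set" where
  "Sp0 \<omega> = {M \<in> Sp. det (shifted_matrix \<omega> M) = 0}"

definition complex_nullity :: "complex ^ 'n ^ 'n \<Rightarrow> nat" where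
  "complex_nullity A = vec.dim {v :: complex ^ 'n. A *v v = 0}"

text \<open>
  \<^term>\<open>Sp0 \<omega>\<close> is singular; its regular part consists of the \<open>M\<close> with
  \<open>dim ker (M - \<omega> I) = 1\<close>. On \<^const>\<open>Sp\<close> the function \<open>\<omega>\<^bsup>-d\<^esup> det (M - \<omega> I)\<close> is
  real-valued, and at regular points of \<^term>\<open>Sp0 \<omega>\<close> its differential does not vanish on the
  co-orienting direction \<open>d/ds M e\<^bsup>sJ\<^esup>\<close>. So the tangent space of \<^term>\<open>Sp0 \<omega>\<close> there is the
  kernel of the differential of \<open>det (M - \<omega> I)\<close>, and the component of a velocity
  \<open>\<eta>'(t)\<close> along the co-orienting direction, modulo this tangent space, is the
  (real) quotient of the derivatives of \<open>det (M - \<omega> I)\<close> in the two directions.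
\<close>

definition det_velocity :: "complex \<Rightarrow> (real \<Rightarrow> 'd::finite phase_matrix) \<Rightarrow> real \<Rightarrow> complex" where
  "det_velocity \<omega> \<eta> t = vector_derivative (\<lambda>s. det (shifted_matrix \<omega> (\<eta> s))) (at t)"

definition crossing_coefficient ::
    "complex \<Rightarrow> (real \<Rightarrow> 'd::finite phase_matrix) \<Rightarrow> real \<Rightarrow> real" where
  "crossing_coefficient \<omega> \<eta> t =
     Re (det_velocity \<omega> \<eta> t / det_velocity \<omega> (\<lambda>s. \<eta> t ** matrix_exp (s *\<^sub>R J)) 0)"

definition crossings :: "complex \<Rightarrow> (real \<Rightarrow> 'd::finite phase_matrix) \<Rightarrow> real set" where
  "crossings \<omega> \<eta> = {t \<in> {0..1}. \<eta> t \<in> Sp0 \<omega>}"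

text \<open>
  Transverse paths have only finitely many crossings, all of them at interior times.
\<close>

definition transverse_path :: "complex \<Rightarrow> (real \<Rightarrow> 'd::finite phase_matrix) \<Rightarrow> bool" where
  "transverse_path \<omega> \<eta> \<longleftrightarrow>
     path \<eta> \<and> path_image \<eta> \<subseteq> Sp \<and> \<eta> piecewise_C1_differentiable_on {0..1} \<and>
     pathstart \<eta> \<notin> Sp0 \<omega> \<and> pathfinish \<eta> \<notin> Sp0 \<omega> \<and>
     (\<forall>t \<in> crossings \<omega> \<eta>. \<eta> differentiable (at t) \<and>
        complex_nullity (shifted_matrix \<omega> (\<eta> t)) = 1 \<and> crossing_coefficient \<omega> \<eta> t \<noteq> 0)"

definition crossing_number :: "complex \<Rightarrow> (real \<Rightarrow> 'd::finite phase_matrix) \<Rightarrow> int" where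
  "crossing_number \<omega> \<eta> =
     (\<Sum>t \<in> crossings \<omega> \<eta>. if crossing_coefficient \<omega> \<eta> t > 0 then 1 else -1)"

text \<open>
  For a path in \<^const>\<open>Sp\<close> with endpoints off \<^term>\<open>Sp0 \<omega>\<close>: count the signed crossings of a
  transverse path homotopic to it with fixed endpoints. The count does not depend on the choice,
  as the singular part of \<^term>\<open>Sp0 \<omega>\<close> has codimension at least three in \<^const>\<open>Sp\<close>.
\<close>

definition intersection_number :: "complex \<Rightarrow> (real \<Rightarrow> 'd::finite phase_matrix) \<Rightarrow> int" where
  "intersection_number \<omega> p =
     (THE n. \<exists>\<eta>. homotopic_paths Sp p \<eta> \<and> transverse_path \<omega> \<eta> \<and> crossing_number \<omega> \<eta> = n)"


section \<open>The Maslov-type index\<close>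

text \<open>
  \<open>maslov_iota \<omega> M \<gamma> a b\<close> is \<open>\<iota>(\<omega> M, \<gamma>, [a, b])\<close>; \<^const>\<open>subpath\<close> reparametrizes
  over the unit interval.
\<close>

definition maslov_iota ::
    "complex \<Rightarrow> 'd::finite phase_matrix \<Rightarrow> (real \<Rightarrow> 'd phase_matrix) \<Rightarrow> real \<Rightarrow> real \<Rightarrow> int" where
  "maslov_iota \<omega> M \<gamma> a b =
     (THE n. \<forall>\<^sub>F \<epsilon> in at_right 0.
        intersection_number \<omega>
          (subpath a b (\<lambda>t. matrix_exp (- (\<epsilon> *\<^sub>R J)) ** \<gamma> t ** matrix_inv M)) = n)"

definition maslov_index :: "complex \<Rightarrow> (real \<Rightarrow> 'd::finite phase_matrix) \<Rightarrow> real \<Rightarrow> real" where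
  "maslov_index \<omega> \<gamma> T =
     of_int (maslov_iota \<omega> (mat 1) \<gamma> 0 T)
       - 1 / 2 * of_nat (complex_nullity (shifted_matrix \<omega> (mat 1 :: 'd phase_matrix)))"


section \<open>Linear Hamiltonian systems and mean indices\<close>

definition is_fundamental_solution ::
    "(real \<Rightarrow> 'd::finite phase_matrix) \<Rightarrow> (real \<Rightarrow> 'd phase_matrix) \<Rightarrow> bool" where
  "is_fundamental_solution B \<gamma> \<longleftrightarrow>
     \<gamma> 0 = mat 1 \<and> (\<forall>t. (\<gamma> has_vector_derivative J ** B t ** \<gamma> t) (at t))"

definition fundamental_solution ::
    "(real \<Rightarrow> 'd::finite phase_matrix) \<Rightarrow> real \<Rightarrow> 'd phase_matrix" where
  "fundamental_solution B = (THE \<gamma>. is_fundamental_solution B \<gamma>)"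

definition forward_mean :: "(real \<Rightarrow> 'd::finite phase_matrix) \<Rightarrow> real \<Rightarrow> real" where
  "forward_mean B l = maslov_index 1 (fundamental_solution B) l / l"

definition backward_mean :: "(real \<Rightarrow> 'd::finite phase_matrix) \<Rightarrow> real \<Rightarrow> real" where
  "backward_mean B l = maslov_index 1 (\<lambda>t. fundamental_solution B (- t)) l / (- l)"

text \<open>
  For bounded \<open>B\<close> the endpoints are finite; \<^typ>\<open>ereal\<close> makes the limits superior and
  inferior meaningful for every \<open>B\<close>.
\<close>

definition mean_index :: "(real \<Rightarrow> 'd::finite phase_matrix) \<Rightarrow> ereal set" where
  "mean_index B = {Liminf at_top (\<lambda>l. ereal (forward_mean B l)) ..
                   Limsup at_top (\<lambda>l. ereal (forward_mean B l))}"

definition mean_index_minus :: "(real \<Rightarrow> 'd::finite phase_matrix) \<Rightarrow> ereal set" where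
  "mean_index_minus B = {Liminf at_top (\<lambda>l. ereal (backward_mean B l)) ..
                         Limsup at_top (\<lambda>l. ereal (backward_mean B l))}"


section \<open>Hamiltonian orbits\<close>

definition gradient :: "('d::finite phase \<Rightarrow> real) \<Rightarrow> 'd phase \<Rightarrow> 'd phase" where
  "gradient H z = (THE g. GDERIV H z :> g)"

definition hessian :: "('d::finite phase \<Rightarrow> real) \<Rightarrow> 'd phase \<Rightarrow> 'd phase_matrix" where
  "hessian H z = jacobian (gradient H) (at z)"

definition C2_function :: "('d::finite phase \<Rightarrow> real) \<Rightarrow> bool" where
  "C2_function H \<longleftrightarrow>
     (\<forall>z. H differentiable (at z)) \<and> (\<forall>z. gradient H differentiable (at z)) \<and>
     continuous_on UNIV (hessian H)"

definition hamiltonian_orbit :: "('d::finite phase \<Rightarrow> real) \<Rightarrow> (real \<Rightarrow> 'd phase) \<Rightarrow> bool" where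
  "hamiltonian_orbit H x \<longleftrightarrow> (\<forall>t. (x has_vector_derivative J *v gradient H (x t)) (at t))"

definition orbit_from :: "('d::finite phase \<Rightarrow> real) \<Rightarrow> 'd phase \<Rightarrow> real \<Rightarrow> 'd phase" where
  "orbit_from H \<xi> = (THE x. hamiltonian_orbit H x \<and> x 0 = \<xi>)"

definition mean_index_set :: "('d::finite phase \<Rightarrow> real) \<Rightarrow> 'd phase set \<Rightarrow> ereal set" where
  "mean_index_set H \<Lambda> = (\<Union>\<xi>\<in>\<Lambda>. mean_index (\<lambda>t. hessian H (orbit_from H \<xi> t)))"

definition mean_index_minus_set :: "('d::finite phase \<Rightarrow> real) \<Rightarrow> 'd phase set \<Rightarrow> ereal set" where
  "mean_index_minus_set H \<Lambda> = (\<Union>\<xi>\<in>\<Lambda>. mean_index_minus (\<lambda>t. hessian H (orbit_from H \<xi> t)))"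

definition orbit_closure :: "(real \<Rightarrow> 'd::finite phase) \<Rightarrow> 'd phase set" where
  "orbit_closure x = closure (range x)"


section \<open>Quasi-periodic orbits\<close>

text \<open>
  The torus \<open>(\<real>/\<int>)\<^sup>m\<close>, with each circle \<open>\<real>/\<int>\<close> realized as the complex unit circle via
  \<open>s \<mapsto> exp(2\<pi>is)\<close>, so that translations become rotations.
\<close>

definition torus :: "nat \<Rightarrow> (nat \<Rightarrow> complex) topology" where
  "torus m = product_topology (\<lambda>_. top_of_set (sphere 0 1)) {..<m}"

definition torus_translate :: "nat \<Rightarrow> (nat \<Rightarrow> complex) \<Rightarrow> (nat \<Rightarrow> real) \<Rightarrow> nat \<Rightarrow> complex" where
  "torus_translate m \<theta> v = (\<lambda>i\<in>{..<m}. \<theta> i * cis (2 * pi * v i))"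

definition rationally_independent :: "nat \<Rightarrow> (nat \<Rightarrow> real) \<Rightarrow> bool" where
  "rationally_independent m \<omega> \<longleftrightarrow>
     (\<forall>q :: nat \<Rightarrow> rat. (\<Sum>i<m. of_rat (q i) * \<omega> i) = 0 \<longrightarrow> (\<forall>i<m. q i = 0))"

definition quasi_periodic :: "(real \<Rightarrow> 'd::finite phase) \<Rightarrow> bool" where
  "quasi_periodic x \<longleftrightarrow>
     (\<exists>m D E \<omega>. homeomorphic_maps (torus m) (top_of_set (orbit_closure x)) D E \<and>
        rationally_independent m \<omega> \<and>
        (\<forall>t. x t = D (torus_translate m (E (x 0)) (\<lambda>i. \<omega> i * t))))"

end

theory Submission
  imports Defs "HOL-Computational_Algebra.Fundamental_Theorem_Algebra"
begin

text \<open>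
  The index counts signed crossings of \<open>det (M - 1) = 0\<close>, which is awkward to estimate along
  a path. The proof replaces it by the change of argument of one nowhere vanishing
  function on \<open>Sp\<close>. For symplectic \<open>M\<close> consider the pencil determinant
  \<open>cdet z M = det ((M - 1) + z J (M + 1))\<close>. It is \<open>det (M - 1)\<close> at \<open>z = 0\<close>, and it does not
  vanish at non-zero imaginary \<open>z\<close>, because \<open>J (M - 1) (M + 1)\<^sup>-\<^sup>1\<close> is formally a
  symmetric matrix (\<open>cdet_imaginary_nonzero\<close>). For small \<open>\<delta> > 0\<close> one has
  \<open>cdet (- \<i> \<delta>) M = det (M - 1) - \<i> \<delta> k(M) + \<dots>\<close>, where on the
  hypersurface \<open>k(M)\<close> is twice the derivative of \<open>det (M - 1)\<close> in the co-orienting direction.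
  So along a transverse path the curve \<open>cdet (- \<i> \<delta>)\<close> makes one half turn for each
  crossing, with the sign of that crossing, and \<open>\<pi>\<close> times their signed number is the
  limit of the change of argument as \<open>\<delta> \<rightarrow> 0\<close> (\<open>transverse_has_arg_index\<close>).
  This limit is invariant under homotopies whose end points stay off the hypersurface.
  Every path with such end points has a transverse representative
  (\<open>transversal_class_exists\<close>): in a Cayley chart a symmetric matrix is moved by rank one
  steps, along which the defining determinant is affine, so that its zeros are simple.
  Hence the intersection number in the definition of the index is well defined.

  For fixed \<open>M\<close> the function \<open>s \<mapsto> cdet (- \<i> s) M\<close> is a polynomial, whose change of
  argument on \<open>s > 0\<close> is at most \<open>\<pi>\<close> times its degree. Therefore \<open>\<pi>\<close> times the index
  differs by a bounded amount from the \<^emph>\<open>turning\<close>, the change of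
  argument of \<open>cdet (- \<i>)\<close> along the path (\<open>maslov_iota_bound\<close>). Up to a constant factor
  \<open>cdet (- \<i>) M\<close> is the complex determinant of the complex linear part of \<open>M\<close>. This
  description makes the turning quasi-invariant under right translation
  (\<open>turn_right_translation\<close>): the complex linear part of \<open>M\<^sub>1 M\<^sub>2\<close> is joined to
  the product of those of \<open>M\<^sub>1\<close> and \<open>M\<^sub>2\<close> by a polynomial path of matrices that an
  indefinite Hermitian form keeps invertible, and again the argument changes by at most
  \<open>\<pi>\<close> times the degree.

  The orbit closure \<open>X\<close> is homeomorphic to a torus on which time translation acts by
  rotations. Hence it carries an isometric flow, in which the given orbit is dense within
  a uniformly bounded time; by passage to limits of translates each of its trajectories is
  an orbit of the Hamiltonian system. Let \<open>r \<xi> t\<close> be the turning on \<open>[0, t]\<close> of the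
  fundamental solution along the orbit of \<open>\<xi> \<in> X\<close>. The cocycle relation and
  quasi-invariance give
  \<open>\<bar>r \<xi> (s + t) - r \<xi> s - r (\<phi> \<xi> s) t\<bar> \<le> C\<close>. Chopping a long
  time interval into pieces of length \<open>T\<close> costs \<open>C / T\<close> per unit of time, and on each piece
  the turnings of nearby points, which stay nearby for all times, differ by at most \<open>C\<close>. So
  \<open>r \<xi> t / t\<close> converges to one limit, uniformly in \<open>\<xi> \<in> X\<close>, and taking \<open>s = - t\<close> in
  the quasi-additivity relation gives the same limit in backward time
  (\<open>mean_converges_uniformly\<close>). Division by \<open>\<pi>\<close> turns this into the statement on the mean
  indices.
\<close>

section \<open>Matrix algebra and the derivative of the determinant\<close>

lemma bounded_bilinear_matrix_mult:
  "bounded_bilinear ((**) :: ('a::{euclidean_space,real_normed_field})^'n^'m \<Rightarrow> 'a^'p^'n \<Rightarrow> 'a^'p^'m)"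
proof -
  have s1: "(r *\<^sub>R A) ** B = r *\<^sub>R (A ** B)" "A ** (r *\<^sub>R B) = r *\<^sub>R (A ** B)"
    for r and A :: "'a^'n^'m" and B :: "'a^'p^'n"
    by (simp_all add: matrix_matrix_mult_def vec_eq_iff scaleR_sum_right)
  have d: "(A + C) ** B = A ** B + C ** B" for A C :: "'a^'n^'m" and B :: "'a^'p^'n"
    by (simp add: matrix_matrix_mult_def vec_eq_iff algebra_simps sum.distrib)
  show ?thesis
    unfolding bilinear_conv_bounded_bilinear[symmetric] bilinear_def
    by (auto intro!: linearI simp: s1 d matrix_add_ldistrib)
qed

lemmas continuous_on_matrix_mult [continuous_intros] =
  bounded_bilinear.continuous_on[OF bounded_bilinear_matrix_mult]
lemmas has_vector_derivative_matrix_mult =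
  bounded_bilinear.has_vector_derivative[OF bounded_bilinear_matrix_mult]

lemma matrix_add_left: "(A + B) ** C = A ** C + B ** C"
  for A B :: "('a::{euclidean_space,real_normed_field})^'n^'m"
  by (rule bounded_bilinear.add_left[OF bounded_bilinear_matrix_mult])
lemma matrix_diff_left: "(A - B) ** C = A ** C - B ** C"
  for A B :: "('a::{euclidean_space,real_normed_field})^'n^'m"
  by (rule bounded_bilinear.diff_left[OF bounded_bilinear_matrix_mult])
lemma matrix_diff_right: "C ** (A - B) = C ** A - C ** B"
  for C :: "('a::{euclidean_space,real_normed_field})^'n^'m"
  by (rule bounded_bilinear.diff_right[OF bounded_bilinear_matrix_mult])
lemma matrix_neg_left: "(- A) ** B = - (A ** B)"
  for A :: "('a::{euclidean_space,real_normed_field})^'n^'m"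
  by (rule bounded_bilinear.minus_left[OF bounded_bilinear_matrix_mult])
lemma matrix_neg_right: "A ** (- B) = - (A ** B)"
  for A :: "('a::{euclidean_space,real_normed_field})^'n^'m"
  by (rule bounded_bilinear.minus_right[OF bounded_bilinear_matrix_mult])
lemma matrix_scaleR_left: "(r *\<^sub>R A) ** C = r *\<^sub>R (A ** C)"
  for A :: "('a::{euclidean_space,real_normed_field})^'n^'m"
  by (rule bounded_bilinear.scaleR_left[OF bounded_bilinear_matrix_mult])
lemma matrix_scaleR_right: "A ** (r *\<^sub>R C) = r *\<^sub>R (A ** C)"
  for A :: "('a::{euclidean_space,real_normed_field})^'n^'m"
  by (rule bounded_bilinear.scaleR_right[OF bounded_bilinear_matrix_mult])
lemma matrix_zero_left: "0 ** A = 0"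
  for A :: "('a::{euclidean_space,real_normed_field})^'n^'m"
  by (rule bounded_bilinear.zero_left[OF bounded_bilinear_matrix_mult])
lemma matrix_zero_right: "A ** 0 = 0"
  for A :: "('a::{euclidean_space,real_normed_field})^'n^'m"
  by (rule bounded_bilinear.zero_right[OF bounded_bilinear_matrix_mult])
lemmas matrix_alg = matrix_add_left matrix_add_ldistrib matrix_diff_left matrix_diff_right matrix_neg_left matrix_neg_right
  matrix_scaleR_left matrix_scaleR_right matrix_zero_left matrix_zero_right

lemma continuous_on_det [continuous_intros]:
  fixes f :: "'b::topological_space \<Rightarrow> ('a::real_normed_field)^'n^'n"
  assumes "continuous_on S f"
  shows "continuous_on S (\<lambda>x. det (f x))"
  unfolding det_def by (intro continuous_intros assms)

lemma differentiable_prod: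
  fixes f :: "'i \<Rightarrow> 'b::real_normed_vector \<Rightarrow> 'a::real_normed_field"
  assumes "finite I" "\<And>i. i \<in> I \<Longrightarrow> f i differentiable (at x within S)"
  shows "(\<lambda>x. \<Prod>i\<in>I. f i x) differentiable (at x within S)"
  using assms by (induction I rule: finite_induct) (auto intro!: differentiable_mult)

lemma differentiable_vec_nth_nth: "(\<lambda>A::real^'n^'m. A $ i $ j) differentiable (at x within S)"
  by (intro bounded_linear_imp_differentiable bounded_linear_compose[OF bounded_linear_vec_nth bounded_linear_vec_nth])

lemma differentiable_det: "(det :: real^'n^'n \<Rightarrow> real) differentiable (at x within S)"
proof -
  have "(\<lambda>A::real^'n^'n. \<Sum>p | p permutes (UNIV :: 'n set). of_int (sign p) * (\<Prod>i\<in>UNIV. A $ i $ p i)) differentiable (at x within S)"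
    by (intro differentiable_sum ballI differentiable_mult differentiable_const differentiable_prod
          differentiable_vec_nth_nth finite_permutations) auto
  then show ?thesis
    by (simp add: det_def[abs_def])
qed

definition ddet :: "real^'n^'n \<Rightarrow> real^'n^'n \<Rightarrow> real" where
  "ddet A = frechet_derivative det (at A)"

lemma det_has_derivative: "(det has_derivative ddet A) (at A)"
  unfolding ddet_def using differentiable_det frechet_derivative_works by blast

lemma linear_ddet: "linear (ddet A)"
  using det_has_derivative has_derivative_linear by blast

lemma det_path_has_derivative:
  assumes "(f has_vector_derivative Y) (at t within S)"
  shows "((\<lambda>t. det (f t)) has_vector_derivative ddet (f t) Y) (at t within S)"
proof -
  have "(det has_derivative ddet (f t)) (at (f t) within f ` S)"
    using det_has_derivative has_derivative_at_withinI by blast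
  then show ?thesis
    using vector_derivative_diff_chain_within[OF assms] by (simp add: o_def)
qed

lemma ddet_eq:
  assumes "((\<lambda>s. det (A + s *\<^sub>R Y)) has_vector_derivative c) (at 0)"
  shows "ddet A Y = c"
proof -
  have "((\<lambda>s. A + s *\<^sub>R Y) has_vector_derivative Y) (at 0)"
    by (auto intro!: derivative_eq_intros)
  from det_path_has_derivative[OF this]
  have "((\<lambda>s. det (A + s *\<^sub>R Y)) has_vector_derivative ddet A Y) (at 0)" by simp
  with assms show ?thesis using vector_derivative_unique_at by blast
qed

text \<open>
  A multiple \<open>Z A\<close> of a singular \<open>A\<close> stays in the singular matrices to all orders:
  \<open>A + s Z A = (1 + s Z) A\<close>. This discards the irrelevant part of a velocity at a crossing.
\<close>

lemma ddet_mult_left: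
  fixes A Z :: "real^'n^'n"
  assumes "det A = 0" shows "ddet A (Z ** A) = 0"
proof (rule ddet_eq)
  have "det (A + s *\<^sub>R (Z ** A)) = 0" for s
  proof -
    have "A + s *\<^sub>R (Z ** A) = (mat 1 + s *\<^sub>R Z) ** A"
      by (simp add: matrix_add_left matrix_scaleR_left)
    then show ?thesis by (simp add: det_mul assms)
  qed
  then show "((\<lambda>s. det (A + s *\<^sub>R (Z ** A))) has_vector_derivative 0) (at 0)" by simp
qed

lemma ddet_mult_right:
  fixes A Z :: "real^'n^'n"
  assumes "det A = 0" shows "ddet A (A ** Z) = 0"
proof (rule ddet_eq)
  have "det (A + s *\<^sub>R (A ** Z)) = 0" for s
  proof -
    have "A + s *\<^sub>R (A ** Z) = A ** (mat 1 + s *\<^sub>R Z)"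
      by (simp add: matrix_add_ldistrib matrix_scaleR_right)
    then show ?thesis by (simp add: det_mul assms)
  qed
  then show "((\<lambda>s. det (A + s *\<^sub>R (A ** Z))) has_vector_derivative 0) (at 0)" by simp
qed

section \<open>Determinants of matrix pencils\<close>

text \<open>
  The polynomial \<open>z \<mapsto> det (A + z B)\<close>, as an element of the polynomial ring, so that
  its degree and its roots are available.
\<close>

definition pdet :: "'a::comm_ring_1^'n^'n \<Rightarrow> 'a^'n^'n \<Rightarrow> 'a poly" where
  "pdet A B = det (\<chi> i j. [:A $ i $ j, B $ i $ j:])"

lemma mat_mult_nth [simp]: "(mat z ** B) $ i $ j = z * (B $ i $ j)" for B :: "'a::comm_ring_1^'n^'n"
  by (simp add: matrix_matrix_mult_def mat_def if_distrib if_distribR sum.delta cong: if_cong)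

lemma mat_mult_commute: "A ** mat z = mat z ** A" for A :: "'a::comm_ring_1^'n^'n"
  by (simp add: vec_eq_iff) (simp add: matrix_matrix_mult_def mat_def if_distrib if_distribR sum.delta mult.commute cong: if_cong)

lemma poly_pdet: "poly (pdet A B) z = det (A + mat z ** B)"
  by (simp add: pdet_def det_def poly_sum poly_prod)

lemma degree_le_1: "degree [:a, b:] \<le> 1"
  by simp

lemma degree_pdet: "degree (pdet A B) \<le> CARD('n)" for A B :: "'a::{comm_ring_1,idom}^'n^'n"
proof -
  have "degree (of_int (sign p) * (\<Prod>i\<in>UNIV. [:A $ i $ p i, B $ i $ p i:])) \<le> CARD('n)" for p :: "'n \<Rightarrow> 'n"
  proof -
    have "degree (\<Prod>i\<in>UNIV. [:A $ i $ p i, B $ i $ p i:]) \<le> (\<Sum>i\<in>(UNIV::'n set). 1)"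
      by (rule order.trans[OF degree_prod_sum_le]) (auto simp del: degree_pCons_eq_if sum_constant intro!: sum_mono degree_le_1 simp flip: One_nat_def)
    moreover have "degree (of_int (sign p) * q) \<le> degree q" for q :: "'a poly"
      using degree_mult_le[of "of_int (sign p) :: 'a poly" q] by simp
    ultimately show ?thesis
      using order.trans by fastforce
  qed
  then show ?thesis
    unfolding pdet_def det_def by (intro degree_sum_le) (auto simp: finite_permutations)
qed

section \<open>Real matrices acting on complex vectors\<close>

definition cpx :: "real^'n^'m \<Rightarrow> complex^'n^'m" where
  "cpx A = (\<chi> i j. of_real (A $ i $ j))"

lemma cpx_nth [simp]: "cpx A $ i $ j = of_real (A $ i $ j)" by (simp add: cpx_def)
lemma cpx_mult: "cpx (A ** B) = cpx A ** cpx B"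
  by (simp add: vec_eq_iff matrix_matrix_mult_def)
lemma cpx_add: "cpx (A + B) = cpx A + cpx B" by (simp add: vec_eq_iff)
lemma cpx_diff: "cpx (A - B) = cpx A - cpx B" by (simp add: vec_eq_iff)
lemma cpx_mat: "cpx (mat r) = mat (of_real r)" by (simp add: vec_eq_iff mat_def)
lemma det_cpx: "det (cpx A) = of_real (det A)" by (simp add: det_def)
lemma continuous_on_cpx [continuous_intros]:
  assumes "continuous_on S f" shows "continuous_on S (\<lambda>x. cpx (f x))"
  unfolding cpx_def by (intro continuous_intros assms)

lemma shifted_matrix_one: "shifted_matrix 1 M = cpx (M - mat 1)"
  by (simp add: shifted_matrix_def vec_eq_iff mat_def)

lemma det_shifted: "det (shifted_matrix 1 M) = of_real (det (M - mat 1))"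
  by (simp add: shifted_matrix_one det_cpx)

definition re_vec :: "complex^'n \<Rightarrow> real^'n" where "re_vec v = (\<chi> i. Re (v $ i))"
definition im_vec :: "complex^'n \<Rightarrow> real^'n" where "im_vec v = (\<chi> i. Im (v $ i))"

lemma re_vec_cpx: "re_vec (cpx A *v v) = A *v re_vec v"
  by (simp add: vec_eq_iff re_vec_def matrix_vector_mult_def)
lemma im_vec_cpx: "im_vec (cpx A *v v) = A *v im_vec v"
  by (simp add: vec_eq_iff im_vec_def matrix_vector_mult_def)
lemma mat_vec: "mat z *v (v::'a::comm_ring_1^'n) = z *s v"
  by (simp add: vec_eq_iff matrix_vector_mult_def mat_def if_distrib if_distribR sum.delta cong: if_cong)
lemma re_vec_add: "re_vec (u + v) = re_vec u + re_vec v" by (simp add: vec_eq_iff re_vec_def)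
lemma im_vec_add: "im_vec (u + v) = im_vec u + im_vec v" by (simp add: vec_eq_iff im_vec_def)
lemma re_vec_diff: "re_vec (u - v) = re_vec u - re_vec v" by (simp add: vec_eq_iff re_vec_def)
lemma im_vec_diff: "im_vec (u - v) = im_vec u - im_vec v" by (simp add: vec_eq_iff im_vec_def)
lemma re_vec_smult: "re_vec (z *s v) = Re z *\<^sub>R re_vec v - Im z *\<^sub>R im_vec v" by (simp add: vec_eq_iff re_vec_def im_vec_def)
lemma im_vec_smult: "im_vec (z *s v) = Re z *\<^sub>R im_vec v + Im z *\<^sub>R re_vec v" by (simp add: vec_eq_iff re_vec_def im_vec_def)
lemma reim_eq_0: "v = 0 \<longleftrightarrow> re_vec v = 0 \<and> im_vec v = 0"
  by (auto simp: vec_eq_iff re_vec_def im_vec_def complex_eq_iff)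
lemmas reim_simps = re_vec_add im_vec_add re_vec_diff im_vec_diff re_vec_smult im_vec_smult re_vec_cpx im_vec_cpx mat_vec

lemma det_eq_0_iff_ker: "det A = 0 \<longleftrightarrow> (\<exists>v. v \<noteq> 0 \<and> A *v v = 0)" for A :: "'a::field^'n^'n"
  using invertible_det_nz[of A] invertible_left_inverse[of A] matrix_left_invertible_ker[of A] by blast

section \<open>The standard symplectic form\<close>

lemma sum_UNIV_Plus: "(\<Sum>k\<in>UNIV. f k) = (\<Sum>k\<in>UNIV. f (Inl k)) + (\<Sum>k\<in>UNIV. f (Inr k))"
  for f :: "'a::finite + 'b::finite \<Rightarrow> 'c::comm_monoid_add"
  unfolding UNIV_Plus_UNIV[symmetric] by (subst sum.Plus) auto

lemma J_J: "J ** J = (- mat 1 :: 'd::finite phase_matrix)"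
proof -
  have "(J ** J) $ i $ j = (- mat 1 :: 'd phase_matrix) $ i $ j" for i j :: "'d + 'd"
    by (cases i; cases j)
      (auto simp: matrix_matrix_mult_def J_def mat_def sum_UNIV_Plus if_distrib if_distribR sum.delta cong: if_cong)
  then show ?thesis by (simp add: vec_eq_iff)
qed

lemma transpose_J: "transpose J = (- J :: 'd::finite phase_matrix)"
proof -
  have "transpose J $ i $ j = (- J :: 'd phase_matrix) $ i $ j" for i j :: "'d + 'd"
    by (cases i; cases j) (auto simp: transpose_def J_def)
  then show ?thesis by (simp add: vec_eq_iff)
qed

lemma J_J_vec: "J *v (J *v v) = - v"
proof -
  have "J *v (J *v v) = (J ** J) *v v" by (simp add: matrix_vector_mul_assoc)
  also have "\<dots> = - v" by (simp add: J_J matrix_vector_mult_def vec_eq_iff mat_def if_distrib if_distribR sum.delta sum_negf cong: if_cong)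
  finally show ?thesis .
qed

lemma inner_matrix_vec: "(A *v u) \<bullet> v = u \<bullet> (transpose A *v v)" for A :: "real^'n^'m"
  by (metis dot_lmul_matrix inner_commute transpose_matrix_vector)

lemma neg_mat_vec: "(- A) *v v = - (A *v v)" for A :: "real^'n^'m"
  by (simp add: matrix_vector_mult_def vec_eq_iff sum_negf)

lemma J_inner: "(J *v u) \<bullet> v = - (u \<bullet> (J *v v))"
  by (simp add: inner_matrix_vec transpose_J neg_mat_vec)

lemma J_inner_J: "(J *v u) \<bullet> (J *v v) = u \<bullet> v"
  by (simp add: J_inner J_J_vec)

lemma Sp_inner: "M \<in> Sp \<Longrightarrow> (M *v u) \<bullet> (J *v (M *v w)) = u \<bullet> (J *v w)"
  by (simp add: inner_matrix_vec Sp_def matrix_vector_mul_assoc matrix_mul_assoc)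

lemma SpI:
  assumes "transpose M ** J ** M = (J :: 'd::finite phase_matrix)"
  shows "M \<in> Sp"
proof -
  have "(- J ** transpose M ** J) ** M = - J ** (transpose M ** J ** M)"
    by (simp add: matrix_mul_assoc)
  also have "\<dots> = mat 1" by (simp add: assms matrix_neg_left J_J)
  finally have "invertible M" using invertible_left_inverse by blast
  with assms show ?thesis by (simp add: Sp_def)
qed

lemma SpD: "M \<in> Sp \<Longrightarrow> transpose M ** J ** M = J" by (simp add: Sp_def)

lemma Sp_mult: assumes "A \<in> Sp" "B \<in> Sp" shows "A ** B \<in> Sp"
proof (rule SpI)
  have "transpose (A ** B) ** J ** (A ** B) = transpose B ** (transpose A ** J ** A) ** B"
    by (simp add: matrix_transpose_mul matrix_mul_assoc)
  then show "transpose (A ** B) ** J ** (A ** B) = J" using assms by (simp add: SpD)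
qed

definition spinv :: "'d::finite phase_matrix \<Rightarrow> 'd phase_matrix" where
  "spinv M = - (J ** transpose M ** J)"

lemma spinv_left: "M \<in> Sp \<Longrightarrow> spinv M ** M = mat 1"
proof -
  assume "M \<in> Sp"
  then have "J ** transpose M ** J ** M = J ** J"
    by (metis SpD matrix_mul_assoc)
  then show ?thesis by (simp add: spinv_def matrix_neg_left J_J)
qed

lemma spinv_right: "M \<in> Sp \<Longrightarrow> M ** spinv M = mat 1"
  using spinv_left matrix_left_right_inverse by blast

lemma spinv_Sp: "M \<in> Sp \<Longrightarrow> spinv M \<in> Sp"
proof -
  assume M: "M \<in> Sp"
  have "transpose (spinv M) ** J ** spinv M = transpose (spinv M) ** (transpose M ** J ** M) ** spinv M"
    using M by (simp add: SpD)
  also have "\<dots> = transpose (M ** spinv M) ** J ** (M ** spinv M)"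
    by (simp add: matrix_transpose_mul matrix_mul_assoc)
  also have "\<dots> = J" using M by (simp add: spinv_right transpose_mat)
  finally show ?thesis by (rule SpI)
qed

lemma continuous_on_transpose [continuous_intros]:
  assumes "continuous_on S f" shows "continuous_on S (\<lambda>x. transpose (f x) :: 'a::real_normed_vector^'n^'m)"
  unfolding transpose_def by (intro continuous_intros assms)

lemma continuous_on_spinv [continuous_intros]:
  "continuous_on S f \<Longrightarrow> continuous_on S (\<lambda>x. spinv (f x))"
  unfolding spinv_def by (intro continuous_intros)

section \<open>Change of argument along a path\<close>

text \<open>
  The change of a continuous argument of \<open>c\<close> from \<open>a\<close> to \<open>b\<close>, read off from the imaginary part
  of any continuous logarithm. Intervals are written as segments so that \<open>b < a\<close> is allowed,
  with the opposite sign.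
\<close>

definition arg_change :: "(real \<Rightarrow> complex) \<Rightarrow> real \<Rightarrow> real \<Rightarrow> real" where
  "arg_change c a b = (SOME r. \<exists>l. continuous_on (closed_segment a b) l \<and>
      (\<forall>t\<in>closed_segment a b. c t = exp (l t)) \<and> r = Im (l b) - Im (l a))"

text \<open>
  The difference of two logarithms of the same function is continuous with values in the
  discrete set \<open>2 \<pi> \<i> \<int>\<close>, hence constant. This makes \<open>arg_change\<close> independent of
  the choice of logarithm.
\<close>

lemma logarithms_differ_by_constant:
  fixes l l' :: "'a::topological_space \<Rightarrow> complex"
  assumes "connected S" "continuous_on S l" "continuous_on S l'"
    and "\<And>t. t \<in> S \<Longrightarrow> exp (l t) = exp (l' t)"
    and "a \<in> S" "b \<in> S"
  shows "l b - l a = l' b - l' a"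
proof -
  let ?f = "\<lambda>t. l t - l' t"
  have "?f constant_on S"
  proof (rule continuous_discrete_range_constant[OF assms(1)])
    show "continuous_on S ?f" by (intro continuous_intros assms)
    fix x assume x: "x \<in> S"
    have "2 * pi \<le> norm (?f y - ?f x)" if "y \<in> S" "?f y \<noteq> ?f x" for y
    proof -
      have "exp (?f y - ?f x) = 1"
        using assms(4)[OF that(1)] assms(4)[OF x] by (simp add: exp_diff)
      then obtain n :: int where n: "Re (?f y - ?f x) = 0" "Im (?f y - ?f x) = of_int (2 * n) * pi"
        unfolding exp_eq_1 by blast
      with that have "n \<noteq> 0" by (auto simp: complex_eq_iff)
      then have "1 \<le> \<bar>real_of_int n\<bar>" by linarith
      then have "2 * pi \<le> \<bar>Im (?f y - ?f x)\<bar>" by (subst n) (simp add: abs_mult)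
      also have "\<dots> \<le> norm (?f y - ?f x)" by (rule abs_Im_le_cmod)
      finally show ?thesis .
    qed
    then show "\<exists>e>0. \<forall>y. y \<in> S \<and> ?f y \<noteq> ?f x \<longrightarrow> e \<le> norm (?f y - ?f x)"
      by (intro exI[of _ "2 * pi"]) auto
  qed
  with assms(5,6) have "?f a = ?f b" by (auto simp: constant_on_def)
  then show ?thesis by (simp add: algebra_simps)
qed

lemma arg_change_eq:
  assumes "continuous_on (closed_segment a b) l" "\<And>t. t \<in> closed_segment a b \<Longrightarrow> c t = exp (l t)"
  shows "arg_change c a b = Im (l b) - Im (l a)"
  unfolding arg_change_def
proof (rule some_equality)
  show "\<exists>l'. continuous_on (closed_segment a b) l' \<and>
      (\<forall>t\<in>closed_segment a b. c t = exp (l' t)) \<and> Im (l b) - Im (l a) = Im (l' b) - Im (l' a)"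
    using assms by blast
  fix r assume "\<exists>l. continuous_on (closed_segment a b) l \<and>
      (\<forall>t\<in>closed_segment a b. c t = exp (l t)) \<and> r = Im (l b) - Im (l a)"
  then obtain l' where "continuous_on (closed_segment a b) l'"
     "\<forall>t\<in>closed_segment a b. c t = exp (l' t)" "r = Im (l' b) - Im (l' a)" by blast
  then show "r = Im (l b) - Im (l a)"
    using logarithms_differ_by_constant[of "closed_segment a b" l l' a b] assms
    by (auto simp: complex_eq_iff)
qed

lemma exists_logarithm:
  fixes S :: "'a::real_normed_vector set"
  assumes "convex S" "continuous_on S c" "\<And>t. t \<in> S \<Longrightarrow> c t \<noteq> (0::complex)"
  obtains l where "continuous_on S l" "\<And>t. t \<in> S \<Longrightarrow> c t = exp (l t)"
  using continuous_logarithm_on_contractible[OF assms(2) convex_imp_contractible[OF assms(1)]] assms(3) by metis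

lemma arg_change_comp:
  fixes L :: "'a::topological_space \<Rightarrow> complex"
  assumes "continuous_on S L" "\<And>x. x \<in> S \<Longrightarrow> F x = exp (L x)"
    and "continuous_on (closed_segment a b) h" "h ` closed_segment a b \<subseteq> S"
  shows "arg_change (\<lambda>t. F (h t)) a b = Im (L (h b)) - Im (L (h a))"
proof (rule arg_change_eq)
  show "continuous_on (closed_segment a b) (\<lambda>t. L (h t))"
    using continuous_on_compose2[OF assms(1,3)] assms(4) by blast
qed (use assms in blast)

lemma arg_change_cong:
  assumes "\<And>t. t \<in> closed_segment a b \<Longrightarrow> c t = c' t"
  shows "arg_change c a b = arg_change c' a b"
  unfolding arg_change_def using assms by (simp cong: conj_cong)

text \<open>
  A zero-free function on a rectangle has a continuous logarithm, whose total change
  around the boundary is zero. All homotopy arguments below use this form.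
\<close>

lemma arg_change_rectangle:
  fixes F :: "real \<times> real \<Rightarrow> complex"
  assumes c: "continuous_on (closed_segment u v \<times> closed_segment a b) F"
    and nz: "\<And>s t. s \<in> closed_segment u v \<Longrightarrow> t \<in> closed_segment a b \<Longrightarrow> F (s, t) \<noteq> 0"
  shows "arg_change (\<lambda>t. F (v, t)) a b - arg_change (\<lambda>t. F (u, t)) a b =
         arg_change (\<lambda>s. F (s, b)) u v - arg_change (\<lambda>s. F (s, a)) u v"
proof -
  let ?S = "closed_segment u v \<times> closed_segment a b"
  obtain L where L: "continuous_on ?S L" "\<And>t. t \<in> ?S \<Longrightarrow> F t = exp (L t)"
    using exists_logarithm[of ?S F] c nz by (auto simp: convex_Times)
  have h: "arg_change (\<lambda>t. F (s, t)) a b = Im (L (s, b)) - Im (L (s, a))" if "s \<in> closed_segment u v" for s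
    by (rule arg_change_comp[OF L]) (use that in \<open>auto intro!: continuous_intros\<close>)
  have v: "arg_change (\<lambda>s. F (s, t)) u v = Im (L (v, t)) - Im (L (u, t))" if "t \<in> closed_segment a b" for t
    by (rule arg_change_comp[OF L]) (use that in \<open>auto intro!: continuous_intros\<close>)
  show ?thesis by (simp add: h v)
qed

lemma arg_change_mult:
  assumes "continuous_on (closed_segment a b) c" "\<And>t. t \<in> closed_segment a b \<Longrightarrow> c t \<noteq> 0"
    and "continuous_on (closed_segment a b) c'" "\<And>t. t \<in> closed_segment a b \<Longrightarrow> c' t \<noteq> 0"
  shows "arg_change (\<lambda>t. c t * c' t) a b = arg_change c a b + arg_change c' a b"
proof -
  obtain l where l: "continuous_on (closed_segment a b) l" "\<And>t. t \<in> closed_segment a b \<Longrightarrow> c t = exp (l t)"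
    using exists_logarithm[of "closed_segment a b" c] assms by auto
  obtain l' where l': "continuous_on (closed_segment a b) l'" "\<And>t. t \<in> closed_segment a b \<Longrightarrow> c' t = exp (l' t)"
    using exists_logarithm[of "closed_segment a b" c'] assms by auto
  have "arg_change (\<lambda>t. c t * c' t) a b = Im (l b + l' b) - Im (l a + l' a)"
    by (rule arg_change_eq) (auto intro!: continuous_intros l l' simp: l l' exp_add)
  then show ?thesis by (simp add: arg_change_eq[OF l] arg_change_eq[OF l'])
qed

lemma arg_change_const:
  assumes "k \<noteq> 0" shows "arg_change (\<lambda>t. k) a b = 0"
proof -
  have "arg_change (\<lambda>t. k) a b = Im (Ln k) - Im (Ln k)"
    by (rule arg_change_eq[of a b "\<lambda>t. Ln k"]) (use assms in \<open>auto intro!: continuous_intros\<close>)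
  then show ?thesis by simp
qed

lemma arg_change_cmult:
  assumes "k \<noteq> 0" "continuous_on (closed_segment a b) c" "\<And>t. t \<in> closed_segment a b \<Longrightarrow> c t \<noteq> 0"
  shows "arg_change (\<lambda>t. k * c t) a b = arg_change c a b"
  using arg_change_mult[of a b "\<lambda>t. k" c] assms arg_change_const[of k] by simp

lemma arg_change_combine:
  assumes S: "convex S" "continuous_on S c" "\<And>t. t \<in> S \<Longrightarrow> c t \<noteq> 0" and "x \<in> S" "y \<in> S" "z \<in> S"
  shows "arg_change c x y + arg_change c y z = arg_change c x z"
proof -
  obtain l where l: "continuous_on S l" "\<And>t. t \<in> S \<Longrightarrow> c t = exp (l t)"
    using exists_logarithm[OF S] by blast
  have "arg_change c a b = Im (l b) - Im (l a)" if "a \<in> S" "b \<in> S" for a b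
  proof (rule arg_change_eq)
    have "closed_segment a b \<subseteq> S" using that S(1) by (simp add: closed_segment_subset)
    then show "continuous_on (closed_segment a b) l" "\<And>t. t \<in> closed_segment a b \<Longrightarrow> c t = exp (l t)"
      using l continuous_on_subset by blast+
  qed
  then show ?thesis using assms by simp
qed

lemma arg_change_reparam:
  assumes S: "convex S" "continuous_on S c" "\<And>t. t \<in> S \<Longrightarrow> c t \<noteq> 0"
    and "continuous_on (closed_segment a b) h" "h ` closed_segment a b \<subseteq> S"
  shows "arg_change (\<lambda>t. c (h t)) a b = arg_change c (h a) (h b)"
proof -
  obtain l where l: "continuous_on S l" "\<And>t. t \<in> S \<Longrightarrow> c t = exp (l t)"
    using exists_logarithm[OF S] by blast
  have "h a \<in> S" "h b \<in> S" using assms(5) by auto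
  then have "closed_segment (h a) (h b) \<subseteq> S" using S(1) by (simp add: closed_segment_subset)
  then have "arg_change c (h a) (h b) = Im (l (h b)) - Im (l (h a))"
    by (intro arg_change_eq) (use l continuous_on_subset in blast)+
  then show ?thesis using arg_change_comp[OF l assms(4,5)] by simp
qed

text \<open>
  On a curve inside the open half plane \<open>Re (w c) > 0\<close> the principal branch of \<open>Ln (w c)\<close>
  serves as a continuous logarithm.
\<close>

lemma arg_change_half_plane:
  assumes "continuous_on (closed_segment a b) c" "\<And>t. t \<in> closed_segment a b \<Longrightarrow> Re (w * c t) > 0"
  shows "arg_change c a b = Im (Ln (w * c b)) - Im (Ln (w * c a))"
proof -
  have w: "w \<noteq> 0" using assms(2)[of a] by auto
  have nz: "w * c t \<noteq> 0" if "t \<in> closed_segment a b" for t using assms(2)[OF that] by force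
  have "arg_change c a b = Im (Ln (w * c b) - Ln w) - Im (Ln (w * c a) - Ln w)"
  proof (rule arg_change_eq)
    have "w * c t \<notin> \<real>\<^sub>\<le>\<^sub>0" if "t \<in> closed_segment a b" for t
      using assms(2)[OF that] complex_nonpos_Reals_iff by force
    then show "continuous_on (closed_segment a b) (\<lambda>t. Ln (w * c t) - Ln w)"
      by (intro continuous_intros assms) auto
    show "c t = exp (Ln (w * c t) - Ln w)" if "t \<in> closed_segment a b" for t
      using nz[OF that] w by (simp add: exp_diff)
  qed
  then show ?thesis by simp
qed

lemma abs_arg_change_half_plane:
  assumes "continuous_on (closed_segment a b) c" "\<And>t. t \<in> closed_segment a b \<Longrightarrow> Re (w * c t) > 0"
  shows "\<bar>arg_change c a b\<bar> \<le> pi"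
proof -
  have "\<bar>Im (Ln (w * c t))\<bar> < pi / 2" if "t \<in> closed_segment a b" for t
  proof -
    have "Re (w * c t) > 0" using assms(2)[OF that] .
    then have "w * c t \<noteq> 0" by force
    with \<open>Re (w * c t) > 0\<close> show ?thesis using Re_Ln_pos_lt by blast
  qed
  from this[of a] this[of b]
  have "\<bar>Im (Ln (w * c a))\<bar> < pi / 2" "\<bar>Im (Ln (w * c b))\<bar> < pi / 2" by auto
  moreover have "arg_change c a b = Im (Ln (w * c b)) - Im (Ln (w * c a))"
    by (rule arg_change_half_plane[OF assms])
  ultimately show ?thesis by linarith
qed

text \<open>The quotient \<open>c' / c\<close> stays in the right half plane.\<close>

lemma arg_change_near:
  assumes "continuous_on (closed_segment a b) c" "continuous_on (closed_segment a b) c'"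
    and near: "\<And>t. t \<in> closed_segment a b \<Longrightarrow> norm (c' t - c t) < norm (c t)"
  shows "\<bar>arg_change c' a b - arg_change c a b\<bar> \<le> pi"
proof -
  have nz: "c t \<noteq> 0" if "t \<in> closed_segment a b" for t using near[OF that] by auto
  have pos: "Re (1 * (c' t / c t)) > 0" if "t \<in> closed_segment a b" for t
  proof -
    have "norm (c' t / c t - 1) < 1"
      using near[OF that] nz[OF that] by (simp add: diff_divide_distrib[symmetric] norm_divide divide_less_eq field_simps
           flip: diff_divide_eq_iff)
    then have "\<bar>Re (c' t / c t - 1)\<bar> < 1" using abs_Re_le_cmod order.strict_trans1 by blast
    then show ?thesis by auto
  qed
  have cont: "continuous_on (closed_segment a b) (\<lambda>t. c' t / c t)"
    by (intro continuous_intros assms) (use nz in auto)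
  have "arg_change c' a b = arg_change (\<lambda>t. c t * (c' t / c t)) a b"
    by (rule arg_change_cong) (use nz in auto)
  also have "\<dots> = arg_change c a b + arg_change (\<lambda>t. c' t / c t) a b"
    by (rule arg_change_mult) (use assms nz cont pos in \<open>force+\<close>)
  finally show ?thesis using abs_arg_change_half_plane[OF cont, of 1] pos by auto
qed

text \<open>
  Each linear factor \<open>t - z\<close> keeps the real segment inside an open half plane and so
  contributes at most \<open>\<pi>\<close>.
\<close>

lemma abs_arg_change_poly:
  fixes p :: "complex poly"
  assumes "\<And>t. t \<in> closed_segment a b \<Longrightarrow> poly p (of_real t) \<noteq> 0"
  shows "\<bar>arg_change (\<lambda>t. poly p (of_real t)) a b\<bar> \<le> pi * degree p"
  using assms
proof (induction "degree p" arbitrary: p)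
  case 0
  then obtain k where "p = [:k:]" by (metis degree_eq_zeroE)
  with 0 arg_change_const[of k a b] show ?case by (auto dest: spec[of _ a])
next
  case (Suc n)
  then have "\<not> constant (poly p)" by (simp add: constant_degree)
  then obtain z where z: "poly p z = 0" using fundamental_theorem_of_algebra by blast
  then obtain q where p: "p = [:- z, 1:] * q" using poly_eq_0_iff_dvd unfolding dvd_def by blast
  have q0: "q \<noteq> 0" using Suc.hyps(2) p by auto
  have dq: "degree p = Suc (degree q)" unfolding p using q0 by (subst degree_mult_eq) auto
  have zt: "of_real t - z \<noteq> 0" "poly q (of_real t) \<noteq> 0" if "t \<in> closed_segment a b" for t
    using Suc.prems[OF that] p by auto
  have c: "continuous_on (closed_segment a b) (\<lambda>t. of_real t - z)" by (intro continuous_intros)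
  have "\<exists>w. \<forall>t\<in>closed_segment a b. Re (w * (of_real t - z)) > 0"
  proof (cases "Im z = 0")
    case False
    then show ?thesis
      by (intro exI[of _ "if Im z > 0 then \<i> else - \<i>"]) auto
  next
    case True
    then have ne: "Re z \<notin> closed_segment a b"
      using zt(1)[of "Re z"] by (auto simp: complex_eq_iff)
    then have "(\<forall>t\<in>closed_segment a b. t > Re z) \<or> (\<forall>t\<in>closed_segment a b. t < Re z)"
      by (auto simp: closed_segment_eq_real_ivl split: if_splits)
    then show ?thesis
    proof
      assume "\<forall>t\<in>closed_segment a b. t > Re z"
      then show ?thesis by (intro exI[of _ 1]) auto
    next
      assume "\<forall>t\<in>closed_segment a b. t < Re z"
      then show ?thesis by (intro exI[of _ "-1"]) auto
    qed
  qed
  then obtain w where w: "\<And>t. t \<in> closed_segment a b \<Longrightarrow> Re (w * (of_real t - z)) > 0" by blast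
  have "arg_change (\<lambda>t. poly p (of_real t)) a b =
        arg_change (\<lambda>t. (of_real t - z) * poly q (of_real t)) a b"
    by (rule arg_change_cong) (simp add: p algebra_simps)
  also have "\<dots> = arg_change (\<lambda>t. of_real t - z) a b + arg_change (\<lambda>t. poly q (of_real t)) a b"
    by (rule arg_change_mult) (use zt in \<open>auto intro!: continuous_intros\<close>)
  finally have "\<bar>arg_change (\<lambda>t. poly p (of_real t)) a b\<bar> \<le> pi + pi * degree q"
    using abs_arg_change_half_plane[OF c w] Suc.hyps(1)[of q] zt dq Suc.hyps(2) by auto
  also have "\<dots> = pi * degree p" by (simp add: dq algebra_simps)
  finally show ?case .
qed

text \<open>
  In a half plane only the end values matter, so the curves need to converge at the two
  ends only; in between they may come arbitrarily close to zero.
\<close>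

lemma tendsto_arg_change:
  assumes "\<forall>\<^sub>F x in G. continuous_on (closed_segment a b) (F x)"
    and "\<forall>\<^sub>F x in G. \<forall>t\<in>closed_segment a b. Re (w * F x t) > 0"
    and "((\<lambda>x. F x a) \<longlongrightarrow> fa) G" "((\<lambda>x. F x b) \<longlongrightarrow> fb) G"
    and "w * fa \<notin> \<real>\<^sub>\<le>\<^sub>0" "w * fb \<notin> \<real>\<^sub>\<le>\<^sub>0"
  shows "((\<lambda>x. arg_change (F x) a b) \<longlongrightarrow> Im (Ln (w * fb)) - Im (Ln (w * fa))) G"
proof (rule Lim_transform_eventually)
  show "((\<lambda>x. Im (Ln (w * F x b)) - Im (Ln (w * F x a))) \<longlongrightarrow> Im (Ln (w * fb)) - Im (Ln (w * fa))) G"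
    by (intro tendsto_intros assms)
  show "\<forall>\<^sub>F x in G. Im (Ln (w * F x b)) - Im (Ln (w * F x a)) = arg_change (F x) a b"
    using assms(1,2) by eventually_elim (rule arg_change_half_plane[symmetric]; blast)
qed

section \<open>The determinant of the symplectic pencil\<close>

text \<open>
  The pencil \<open>(M - 1) + z J (M + 1)\<close> connects \<open>det (M - 1)\<close>, the defining function of the
  hypersurface, to functions without zeros on \<open>Sp\<close>. Multiplication by \<open>J\<close> on the left turns
  the Cayley transform of \<open>M\<close> into a symmetric matrix, which is why its zeros in \<open>z\<close> stay away
  from the imaginary axis.
\<close>

definition cdet :: "complex \<Rightarrow> 'd::finite phase_matrix \<Rightarrow> complex" where
  "cdet z M = det (cpx (M - mat 1) + mat z ** cpx (J ** (M + mat 1)))"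

lemma cdet_0: "cdet 0 M = of_real (det (M - mat 1))"
proof -
  have "mat 0 ** cpx (J ** (M + mat 1)) = 0" by (simp add: vec_eq_iff)
  then show ?thesis by (simp add: cdet_def det_cpx)
qed

lemma cdet_poly: "cdet z M = poly (pdet (cpx (M - mat 1)) (cpx (J ** (M + mat 1)))) z"
  by (simp add: cdet_def poly_pdet)

lemma continuous_on_mat [continuous_intros]:
  assumes "continuous_on S f" shows "continuous_on S (\<lambda>x. mat (f x) :: 'a::real_normed_field^'n^'n)"
  unfolding mat_def
proof (intro continuous_intros)
  fix i j :: 'n show "continuous_on S (\<lambda>x. if i = j then f x else 0)"
    using assms by (cases "i = j") auto
qed

lemma continuous_on_cdet [continuous_intros]:
  assumes "continuous_on S f" "continuous_on S g" shows "continuous_on S (\<lambda>x. cdet (f x) (g x))"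
  unfolding cdet_def by (intro continuous_intros assms)

text \<open>
  For invertible \<open>M + 1\<close> this says that \<open>J (M - 1) (M + 1)\<^sup>-\<^sup>1\<close> is symmetric; this
  form is meaningful for every symplectic \<open>M\<close>.
\<close>

lemma Sp_cayley_symmetric:
  assumes "M \<in> Sp"
  shows "((M + mat 1) *v u) \<bullet> (J *v ((M - mat 1) *v w)) = ((M + mat 1) *v w) \<bullet> (J *v ((M - mat 1) *v u))"
proof -
  have e: "((M + mat 1) *v u) \<bullet> (J *v ((M - mat 1) *v w)) = - ((M *v u) \<bullet> (J *v w)) + u \<bullet> (J *v (M *v w))" for u w
    by (simp add: matrix_vector_mult_add_rdistrib matrix_vector_mult_diff_rdistrib
       matrix_vector_mult_diff_distrib inner_add_left inner_diff_right Sp_inner[OF assms])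
  have "u \<bullet> (J *v (M *v w)) = - ((M *v w) \<bullet> (J *v u))" for u w
    using J_inner[of u "M *v w"] by (simp add: inner_commute)
  then show ?thesis unfolding e by simp
qed

text \<open>
  Split a kernel vector into real and imaginary parts \<open>p + \<i> q\<close> and put \<open>a = (M + 1) p\<close>,
  \<open>b = (M + 1) q\<close>. The symmetry above forces
  \<open>s (\<bar>a\<bar>\<^sup>2 + \<bar>b\<bar>\<^sup>2) = 0\<close>. So \<open>M + 1\<close> annihilates \<open>p\<close> and \<open>q\<close>; by
  the kernel equation so does \<open>M - 1\<close>, and the difference of the two matrices is \<open>2\<close>.
\<close>

lemma cdet_imaginary_nonzero:
  assumes M: "M \<in> Sp" and s: "s \<noteq> 0"
  shows "cdet (\<i> * of_real s) M \<noteq> 0"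
proof
  assume "cdet (\<i> * of_real s) M = 0"
  then obtain v where v0: "v \<noteq> 0"
    and v: "(cpx (M - mat 1) + mat (\<i> * of_real s) ** cpx (J ** (M + mat 1))) *v v = 0"
    unfolding cdet_def det_eq_0_iff_ker by blast
  let ?p = "re_vec v" and ?q = "im_vec v"
  from v have v': "cpx (M - mat 1) *v v + (\<i> * of_real s) *s (cpx (J ** (M + mat 1)) *v v) = 0"
    by (simp add: matrix_vector_mult_add_rdistrib mat_vec flip: matrix_vector_mul_assoc)
  have re: "(M - mat 1) *v ?p = s *\<^sub>R (J *v ((M + mat 1) *v ?q))"
    using arg_cong[OF v', of re_vec] by (simp add: reim_simps matrix_vector_mul_assoc) (simp add: re_vec_def zero_vec_def[symmetric])
  have im: "(M - mat 1) *v ?q = - (s *\<^sub>R (J *v ((M + mat 1) *v ?p)))"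
    using arg_cong[OF v', of im_vec] by (simp add: reim_simps matrix_vector_mul_assoc eq_neg_iff_add_eq_0) (simp add: im_vec_def zero_vec_def[symmetric])
  let ?a = "(M + mat 1) *v ?p" and ?b = "(M + mat 1) *v ?q"
  have "?b \<bullet> (J *v ((M - mat 1) *v ?p)) = - s * (?b \<bullet> ?b)"
    unfolding re by (simp add: J_J_vec matrix_vector_mult_scaleR)
  moreover have "?a \<bullet> (J *v ((M - mat 1) *v ?q)) = s * (?a \<bullet> ?a)"
    unfolding im by (simp add: J_J_vec matrix_vector_mult_scaleR flip: scaleR_minus_left)
  ultimately have "s * (?a \<bullet> ?a + ?b \<bullet> ?b) = 0"
    using Sp_cayley_symmetric[OF M, of ?p ?q] by (simp add: algebra_simps)
  with s have "?a \<bullet> ?a + ?b \<bullet> ?b = 0" by simp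
  then have ab: "?a = 0" "?b = 0"
    using inner_ge_zero[of ?a] inner_ge_zero[of ?b] inner_eq_zero_iff by (metis add_nonneg_eq_0_iff)+
  have "2 *\<^sub>R u = (M + mat 1) *v u - (M - mat 1) *v u" for u
    by (simp add: matrix_vector_mult_add_rdistrib matrix_vector_mult_diff_rdistrib scaleR_2)
  from this[of ?p] this[of ?q] have "?p = 0" "?q = 0"
    using re im ab by simp_all
  with v0 show False using reim_eq_0 by blast
qed

lemma cdet_minus_imaginary_nonzero: "M \<in> Sp \<Longrightarrow> s \<noteq> 0 \<Longrightarrow> cdet (- \<i> * of_real s) M \<noteq> 0"
  using cdet_imaginary_nonzero[of M "- s"] by simp

section \<open>The pencil near the hypersurface\<close>

text \<open>
  The pencil at real arguments. Its real coefficients give the expansion of \<open>cdet\<close> in powers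
  of \<open>z\<close>.
\<close>

definition real_pencil :: "'d::finite phase_matrix \<Rightarrow> real poly" where
  "real_pencil M = pdet (M - mat 1) (J ** (M + mat 1))"

lemma coeff_prod_linear_continuous:
  fixes f g :: "'i \<Rightarrow> 'b::topological_space \<Rightarrow> real"
  assumes "finite I" "\<And>i. i \<in> I \<Longrightarrow> continuous_on S (f i)" "\<And>i. i \<in> I \<Longrightarrow> continuous_on S (g i)"
  shows "continuous_on S (\<lambda>x. coeff (\<Prod>i\<in>I. [:f i x, g i x:]) k)"
  using assms
proof (induction I arbitrary: k rule: finite_induct)
  case empty
  then show ?case by (simp add: coeff_1)
next
  case (insert i I)
  then show ?case
    by (cases k) (auto simp: coeff_pCons_0 algebra_simps intro!: continuous_intros)
qed

lemma continuous_on_coeff_pdet: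
  fixes f g :: "'b::topological_space \<Rightarrow> real^'n^'n"
  assumes "continuous_on S f" "continuous_on S g"
  shows "continuous_on S (\<lambda>x. coeff (pdet (f x) (g x)) k)"
proof -
  have e: "coeff (of_int c * p) k = of_int c * coeff p k" for c and p :: "real poly"
    by (simp add: of_int_poly)
  show ?thesis
    unfolding pdet_def det_def
    by (simp add: coeff_sum e) (intro continuous_intros coeff_prod_linear_continuous assms finite_UNIV; simp)
qed

lemma degree_real_pencil: "degree (real_pencil M) \<le> CARD('d + 'd)" for M :: "'d::finite phase_matrix"
  unfolding real_pencil_def by (rule degree_pdet)

text \<open>Two polynomials that agree on the real axis are equal.\<close>

lemma cdet_eq_sum:
  fixes M :: "'d::finite phase_matrix"
  shows "cdet z M = (\<Sum>k\<le>CARD('d + 'd). of_real (coeff (real_pencil M) k) * z ^ k)"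
proof -
  let ?n = "CARD('d + 'd)"
  define p where "p = pdet (cpx (M - mat 1)) (cpx (J ** (M + mat 1)))"
  define q :: "complex poly" where "q = (\<Sum>k\<le>?n. monom (of_real (coeff (real_pencil M) k)) k)"
  have "poly (p - q) (of_real s) = 0" for s :: real
  proof -
    have c: "mat (complex_of_real s) = cpx (mat s)" by (simp add: cpx_mat)
    have "poly p (of_real s) = of_real (poly (real_pencil M) s)"
      by (simp add: p_def real_pencil_def poly_pdet c flip: cpx_mult cpx_add det_cpx)
    also have "poly (real_pencil M) s = (\<Sum>k\<le>?n. coeff (real_pencil M) k * s ^ k)"
      by (subst poly_as_sum_of_monoms'[OF degree_real_pencil, symmetric]) (simp add: poly_sum poly_monom)
    finally show ?thesis by (simp add: q_def poly_sum poly_monom)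
  qed
  then have "range complex_of_real \<subseteq> {z. poly (p - q) z = 0}" by blast
  \<comment> \<open>A non-zero polynomial has finitely many roots.\<close>
  moreover have "infinite (range complex_of_real)"
    by (simp add: finite_image_iff inj_on_def infinite_UNIV_char_0)
  ultimately have "p - q = 0" using poly_roots_finite finite_subset by blast
  then have "cdet z M = poly q z" by (simp add: cdet_poly p_def)
  then show ?thesis by (simp add: q_def poly_sum poly_monom)
qed

lemma ddet_eq_coeff: "coeff (pdet A B) 1 = ddet A B" for A B :: "real^'n^'n"
proof -
  have "A + s *\<^sub>R B = A + mat s ** B" for s by (simp add: vec_eq_iff)
  then have "(\<lambda>s. det (A + s *\<^sub>R B)) = poly (pdet A B)"
    by (auto simp: poly_pdet)
  moreover have "(poly (pdet A B) has_vector_derivative poly (pderiv (pdet A B)) 0) (at 0)"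
    using poly_DERIV has_real_derivative_iff_has_vector_derivative by blast
  ultimately have "ddet A B = poly (pderiv (pdet A B)) 0" by (intro ddet_eq) simp
  then show ?thesis by (simp add: poly_0_coeff_0 coeff_pderiv)
qed

text \<open>The derivative of \<open>cdet z M\<close> at \<open>z = 0\<close>.\<close>

definition pencil_slope :: "'d::finite phase_matrix \<Rightarrow> real" where
  "pencil_slope M = ddet (M - mat 1) (J ** (M + mat 1))"

lemma pencil_slope_coeff: "pencil_slope M = coeff (real_pencil M) 1"
  by (simp add: pencil_slope_def real_pencil_def ddet_eq_coeff[simplified])

lemma continuous_on_coeff_real_pencil: "continuous_on S (\<lambda>M. coeff (real_pencil M) k)"
  unfolding real_pencil_def by (intro continuous_on_coeff_pdet continuous_intros)

lemma real_pencil_0: "coeff (real_pencil M) 0 = det (M - mat 1)"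
proof -
  have "M - mat 1 + mat 0 ** (J ** (M + mat 1)) = M - mat 1" by (simp add: vec_eq_iff)
  then show ?thesis by (simp add: real_pencil_def poly_pdet flip: poly_0_coeff_0)
qed

text \<open>
  At a singular \<open>M - 1\<close> the derivative of the determinant kills \<open>(M - 1) J\<close> and \<open>J (M - 1)\<close>. So
  it agrees on \<open>M J\<close> (the co-orienting direction) and on \<open>J\<close>, and \<open>J (M + 1) = J (M - 1) + 2 J\<close>
  contributes twice this value.
\<close>

lemma ddet_eq_J:
  assumes "det (M - mat 1) = 0"
  shows "ddet (M - mat 1) (M ** J) = ddet (M - mat 1) J" "pencil_slope M = 2 * ddet (M - mat 1) J"
proof -
  have a: "M ** J = (M - mat 1) ** J + J"
    by (simp add: matrix_diff_left)
  show "ddet (M - mat 1) (M ** J) = ddet (M - mat 1) J"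
    by (subst a) (simp add: linear_add[OF linear_ddet] ddet_mult_right[OF assms])
  have b: "J ** (M + mat 1) = J ** (M - mat 1) + 2 *\<^sub>R J"
    by (simp add: matrix_diff_right matrix_add_ldistrib scaleR_2)
  show "pencil_slope M = 2 * ddet (M - mat 1) J"
    unfolding pencil_slope_def
    by (subst b) (simp add: linear_add[OF linear_ddet] linear_scale[OF linear_ddet] ddet_mult_left[OF assms])
qed

text \<open>
  The quotient \<open>(cdet (- \<i> \<delta>) M - det (M - 1)) / \<delta>\<close>, written as a
  polynomial in \<open>\<delta>\<close> so that it extends continuously to \<open>\<delta> = 0\<close>.
\<close>

definition pencil_quotient :: "real \<Rightarrow> 'd::finite phase_matrix \<Rightarrow> complex" where
  "pencil_quotient \<delta> M = (\<Sum>k<CARD('d + 'd). of_real (coeff (real_pencil M) (Suc k)) * (- \<i>) ^ Suc k * of_real \<delta> ^ k)"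

lemma cdet_expand: "cdet (- \<i> * of_real \<delta>) M = of_real (det (M - mat 1)) + of_real \<delta> * pencil_quotient \<delta> M"
  for M :: "'d::finite phase_matrix"
proof -
  let ?n = "CARD('d + 'd)"
  have "cdet (- \<i> * of_real \<delta>) M = of_real (coeff (real_pencil M) 0) +
      (\<Sum>k<?n. of_real (coeff (real_pencil M) (Suc k)) * (- \<i> * of_real \<delta>) ^ Suc k)"
    unfolding cdet_eq_sum by (subst sum.atMost_shift) (simp del: power_Suc)
  also have "(\<Sum>k<?n. of_real (coeff (real_pencil M) (Suc k)) * (- \<i> * of_real \<delta>) ^ Suc k) = of_real \<delta> * pencil_quotient \<delta> M"
    unfolding pencil_quotient_def sum_distrib_left by (rule sum.cong) (simp_all only: power_mult_distrib power_Suc mult_ac)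
  finally show ?thesis by (simp only: real_pencil_0)
qed

lemma pencil_quotient_0: "pencil_quotient 0 M = - \<i> * of_real (pencil_slope M)" for M :: "'d::finite phase_matrix"
proof -
  have "pencil_quotient 0 M = (\<Sum>k<CARD('d + 'd). if k = 0 then - \<i> * of_real (pencil_slope M) else 0)"
    unfolding pencil_quotient_def by (rule sum.cong) (auto simp: pencil_slope_coeff power_0_left)
  then show ?thesis by (simp add: sum.delta)
qed

lemma continuous_on_pencil_quotient [continuous_intros]:
  assumes "continuous_on S f" "continuous_on S g" shows "continuous_on S (\<lambda>x. pencil_quotient (f x) (g x))"
proof -
  have "continuous_on S (\<lambda>x. coeff (real_pencil (g x)) k)" for k
    using continuous_on_compose2[OF continuous_on_coeff_real_pencil[of UNIV k] assms(2)] by simp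
  then show ?thesis unfolding pencil_quotient_def by (intro continuous_intros assms)
qed

section \<open>The co-orienting coefficient of a crossing\<close>

text \<open>
  Since \<open>J\<^sup>2 = - 1\<close>, the exponential series splits into the cosine and sine series.
\<close>

lemma matrix_exp_J: "matrix_exp (s *\<^sub>R J) = cos s *\<^sub>R mat 1 + sin s *\<^sub>R (J :: 'd::finite phase_matrix)"
proof -
  let ?J = "J :: 'd phase_matrix"
  have pow: "(((**) (s *\<^sub>R ?J)) ^^ k) (mat 1) = (fact k * cos_coeff k * s ^ k) *\<^sub>R mat 1 + (fact k * sin_coeff k * s ^ k) *\<^sub>R ?J" for k
  proof (induction k)
    case 0
    then show ?case by (simp add: cos_coeff_0 sin_coeff_0)
  next
    case (Suc k)
    have "(((**) (s *\<^sub>R ?J)) ^^ Suc k) (mat 1)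
        = (s * (fact k * cos_coeff k * s ^ k)) *\<^sub>R ?J - (s * (fact k * sin_coeff k * s ^ k)) *\<^sub>R mat 1"
      unfolding funpow.simps o_apply Suc by (simp add: matrix_add_ldistrib matrix_scaleR_left
         matrix_scaleR_right J_J mult_ac)
    then show ?case by (simp add: cos_coeff_Suc sin_coeff_Suc field_simps del: of_nat_Suc)
  qed
  have "(\<lambda>k. (cos_coeff k *\<^sub>R s ^ k) *\<^sub>R (mat 1 :: 'd phase_matrix) + (sin_coeff k *\<^sub>R s ^ k) *\<^sub>R ?J) sums
     (cos s *\<^sub>R mat 1 + sin s *\<^sub>R ?J)"
    by (intro sums_add bounded_linear.sums[OF bounded_linear_scaleR_left] cos_converges sin_converges)
  moreover have "(1 / fact k) *\<^sub>R (((**) (s *\<^sub>R ?J)) ^^ k) (mat 1) =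
      (cos_coeff k *\<^sub>R s ^ k) *\<^sub>R mat 1 + (sin_coeff k *\<^sub>R s ^ k) *\<^sub>R ?J" for k
    unfolding pow by (simp add: scaleR_add_right)
  ultimately show ?thesis
    unfolding matrix_exp_def by (simp add: sums_unique[symmetric])
qed

lemma det_velocity_J: "det_velocity 1 (\<lambda>s. M ** matrix_exp (s *\<^sub>R J)) 0 = of_real (ddet (M - mat 1) (M ** J))"
proof -
  have "((\<lambda>s. M ** (cos s *\<^sub>R mat 1 + sin s *\<^sub>R J) - mat 1) has_vector_derivative (M ** J)) (at 0)"
  proof -
    have "((\<lambda>s. (cos s *\<^sub>R mat 1 + sin s *\<^sub>R J)) has_vector_derivative J) (at 0)"
      by (auto intro!: derivative_eq_intros)
    from has_vector_derivative_matrix_mult[OF has_vector_derivative_const[of M] this]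
    show ?thesis by (auto intro!: derivative_eq_intros)
  qed
  from det_path_has_derivative[OF this]
  have "((\<lambda>s. det (M ** (cos s *\<^sub>R mat 1 + sin s *\<^sub>R J) - mat 1)) has_vector_derivative ddet (M - mat 1) (M ** J)) (at 0)"
    by simp
  then have "((\<lambda>s. complex_of_real (det (M ** (cos s *\<^sub>R mat 1 + sin s *\<^sub>R J) - mat 1))) has_vector_derivative of_real (ddet (M - mat 1) (M ** J))) (at 0)"
    using has_vector_derivative_of_real has_real_derivative_iff_has_vector_derivative by blast
  then show ?thesis
    unfolding det_velocity_def matrix_exp_J det_shifted by (rule vector_derivative_at)
qed

lemma det_velocity_path:
  assumes "(\<eta> has_vector_derivative Y) (at t)"
  shows "det_velocity 1 \<eta> t = of_real (ddet (\<eta> t - mat 1) Y)"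
proof -
  have "((\<lambda>s. \<eta> s - mat 1) has_vector_derivative Y) (at t)"
    by (auto intro!: derivative_eq_intros assms)
  from has_vector_derivative_of_real[OF det_path_has_derivative[OF this,
      folded has_real_derivative_iff_has_vector_derivative]]
  show ?thesis
    unfolding det_velocity_def det_shifted by (rule vector_derivative_at)
qed

text \<open>
  The pencil slope is twice the co-orienting derivative, which explains the factor \<open>2\<close>.
\<close>

lemma crossing_coefficient_eq:
  assumes "(\<eta> has_vector_derivative Y) (at t)" "det (\<eta> t - mat 1) = 0"
  shows "crossing_coefficient 1 \<eta> t = 2 * ddet (\<eta> t - mat 1) Y / pencil_slope (\<eta> t)"
  using ddet_eq_J[OF assms(2)]
  by (simp add: crossing_coefficient_def det_velocity_path[OF assms(1)] det_velocity_J flip: of_real_divide)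

section \<open>Signed crossings as a limit of argument changes\<close>

lemma tendsto_uniformly_at_zero:
  fixes F :: "real \<times> real \<Rightarrow> complex"
  assumes "continuous_on ({0..1} \<times> {a..b}) F" "e > 0"
  shows "\<forall>\<^sub>F \<delta> in at_right 0. \<forall>s\<in>{a..b}. norm (F (\<delta>, s) - F (0, s)) < e"
proof -
  have "uniformly_continuous_on ({0..1} \<times> {a..b}) F"
    by (intro compact_uniformly_continuous assms compact_Times) auto
  then obtain d where d: "d > 0"
    "\<And>x y. x \<in> {0..1} \<times> {a..b} \<Longrightarrow> y \<in> {0..1} \<times> {a..b} \<Longrightarrow> dist y x < d \<Longrightarrow> dist (F y) (F x) < e"
    unfolding uniformly_continuous_on_def using assms(2) by metis
  have "\<forall>\<^sub>F \<delta> in at_right 0. \<delta> \<in> {0<..<min d 1}"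
    using d(1) by (intro eventually_at_right_real) auto
  then show ?thesis
  proof eventually_elim
    case (elim \<delta>)
    then show ?case
      using d(2)[of "(0, s)" "(\<delta>, s)" for s] by (auto simp: dist_Pair_Pair dist_norm)
  qed
qed

lemma continuous_on_snd_comp:
  assumes "continuous_on B q" shows "continuous_on (A \<times> B) (\<lambda>x. q (snd x))"
  using continuous_on_compose2[OF assms continuous_on_snd[OF continuous_on_id], of "A \<times> B"] by auto

text \<open>
  Where \<open>det (M - 1)\<close> has no zeros along the path, it keeps its sign, and
  \<open>cdet (- \<i> \<delta>)\<close> converges uniformly to it. So for small \<open>\<delta>\<close> the curve stays
  in a half plane and its end points approach the real axis on the same side.
\<close>

lemma arg_change_off_hypersurface:
  fixes q :: "real \<Rightarrow> 'd::finite phase_matrix"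
  assumes ab: "a \<le> b" and q: "continuous_on {a..b} q" and off: "\<And>t. t \<in> {a..b} \<Longrightarrow> det (q t - mat 1) \<noteq> 0"
  shows "((\<lambda>\<delta>. arg_change (\<lambda>t. cdet (- \<i> * of_real \<delta>) (q t)) a b) \<longlongrightarrow> 0) (at_right 0)"
proof -
  let ?f = "\<lambda>t. det (q t - mat 1)"
  let ?F = "\<lambda>\<delta> t. cdet (- \<i> * of_real \<delta>) (q t)"
  have cf: "continuous_on {a..b} ?f" by (intro continuous_intros q)
  have "connected (?f ` {a..b})" by (rule connected_continuous_image[OF cf]) simp
  then have iv: "is_interval (?f ` {a..b})" by (simp add: is_interval_connected_1)
  have no0: "0 \<notin> ?f ` {a..b}" using off by auto
  have sgn: "(\<forall>t\<in>{a..b}. ?f t > 0) \<or> (\<forall>t\<in>{a..b}. ?f t < 0)"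
  proof (rule ccontr)
    assume "\<not> ?thesis"
    then obtain s t where st: "s \<in> {a..b}" "t \<in> {a..b}" "?f s \<le> 0" "?f t \<ge> 0" by (auto simp: not_less)
    have "0 \<in> ?f ` {a..b}" by (rule mem_is_interval_1_I[OF iv _ _ st(3,4)]) (use st in auto)
    with no0 show False by blast
  qed
  define w :: real where "w = (if ?f a > 0 then 1 else -1)"
  have w: "w * ?f t > 0" if "t \<in> {a..b}" for t
  proof (cases "?f a > 0")
    case True
    with sgn ab have "\<forall>t\<in>{a..b}. ?f t > 0" by force
    with True that show ?thesis by (simp add: w_def)
  next
    case False
    with sgn ab have "\<forall>t\<in>{a..b}. ?f t < 0" by force
    with False that show ?thesis by (simp add: w_def)
  qed
  obtain t0 where t0: "t0 \<in> {a..b}" "\<And>t. t \<in> {a..b} \<Longrightarrow> w * ?f t0 \<le> w * ?f t"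
  proof -
    have "continuous_on {a..b} (\<lambda>t. w * ?f t)" by (intro continuous_intros q)
    from continuous_attains_inf[OF compact_Icc _ this] ab that show ?thesis by auto
  qed
  define m where "m = w * ?f t0"
  have m: "m > 0" using w t0 m_def by auto
  have cF: "continuous_on ({0..1} \<times> {a..b}) (\<lambda>x. ?F (fst x) (snd x))"
    by (intro continuous_intros continuous_on_snd_comp q)
  have seg: "closed_segment a b = {a..b}" using ab by (simp add: closed_segment_eq_real_ivl)
  have "((\<lambda>\<delta>. arg_change (?F \<delta>) a b) \<longlongrightarrow> Im (Ln (of_real w * of_real (?f b))) - Im (Ln (of_real w * of_real (?f a)))) (at_right 0)"
  proof (rule tendsto_arg_change)
    show "\<forall>\<^sub>F x in at_right 0. continuous_on (closed_segment a b) (?F x)"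
      unfolding seg by (intro always_eventually allI continuous_intros q)
    show "\<forall>\<^sub>F x in at_right 0. \<forall>t\<in>closed_segment a b. 0 < Re (of_real w * ?F x t)"
      using tendsto_uniformly_at_zero[OF cF m]
    proof eventually_elim
      case (elim \<delta>)
      show ?case
      proof
        fix t assume "t \<in> closed_segment a b"
        then have t: "t \<in> {a..b}" by (simp add: seg)
        have "norm (?F \<delta> t - of_real (?f t)) < m" using elim t by (simp add: cdet_0)
        then have "\<bar>Re (?F \<delta> t) - ?f t\<bar> < m" using abs_Re_le_cmod[of "?F \<delta> t - of_real (?f t)"] by simp
        moreover have "m \<le> w * ?f t" using t0 t m_def by auto
        moreover have "w = 1 \<or> w = -1" by (simp add: w_def)
        ultimately show "0 < Re (of_real w * ?F \<delta> t)" by auto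
      qed
    qed
    have "((\<lambda>\<delta>. ?F \<delta> t) \<longlongrightarrow> of_real (?f t)) (at_right 0)" if "t \<in> {a..b}" for t
    proof (rule tendstoI)
      fix e :: real assume "e > 0"
      from tendsto_uniformly_at_zero[OF cF this] show "\<forall>\<^sub>F x in at_right 0. dist (?F x t) (of_real (?f t)) < e"
        by eventually_elim (use that in \<open>auto simp: dist_norm cdet_0\<close>)
    qed
    then show "((\<lambda>\<delta>. ?F \<delta> a) \<longlongrightarrow> of_real (?f a)) (at_right 0)" "((\<lambda>\<delta>. ?F \<delta> b) \<longlongrightarrow> of_real (?f b)) (at_right 0)"
      using ab by auto
    show "of_real w * complex_of_real (?f a) \<notin> \<real>\<^sub>\<le>\<^sub>0" "of_real w * complex_of_real (?f b) \<notin> \<real>\<^sub>\<le>\<^sub>0"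
      using w[of a] w[of b] ab by (auto simp: complex_nonpos_Reals_iff)
  qed
  moreover have "Im (Ln (of_real w * of_real (?f t))) = 0" if "t \<in> {a..b}" for t
    using w[OF that] by (simp flip: of_real_mult add: Ln_of_real)
  ultimately show ?thesis using ab by simp
qed

lemma Im_Ln_imaginary: "r \<noteq> 0 \<Longrightarrow> Im (Ln (\<i> * of_real r)) = sgn r * (pi / 2)"
proof (cases "r > 0")
  case True
  then show ?thesis by (subst Ln_times_ii) auto
next
  case False
  assume "r \<noteq> 0"
  with False have "r < 0" by simp
  then have "Im (Ln (of_real r)) = pi" by (subst Im_Ln_eq_pi) auto
  with \<open>r < 0\<close> show ?thesis by (subst Ln_times_ii) auto
qed

text \<open>
  Near a transversal crossing \<open>cdet (- \<i> \<delta>) = f - \<i> \<delta> k + \<dots>\<close>,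
  where \<open>f = det (q - 1)\<close> changes sign with derivative \<open>D\<close> and \<open>k \<noteq> 0\<close> is the pencil
  slope. The curve passes from the half line of sign \<open>- D\<close> to that of sign \<open>D\<close> through the
  lower half plane if \<open>k > 0\<close>, through the upper one if \<open>k < 0\<close>: half a turn,
  counter-clockwise exactly if \<open>D / k > 0\<close>, which is the sign of the crossing coefficient.
\<close>

lemma arg_change_at_crossing:
  fixes q :: "real \<Rightarrow> 'd::finite phase_matrix"
  assumes t: "0 < t" "t < 1" and q: "continuous_on {0..1} q"
    and zero: "det (q t - mat 1) = 0" and qd: "(q has_vector_derivative Y) (at t)"
    and coef: "crossing_coefficient 1 q t \<noteq> 0"
  shows "\<exists>e0>0. \<forall>e. 0 < e \<and> e \<le> e0 \<longrightarrow> 0 < t - e \<and> t + e < 1 \<and>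
      (\<forall>s\<in>{t-e..t+e}. det (q s - mat 1) = 0 \<longrightarrow> s = t) \<and>
      ((\<lambda>\<delta>. arg_change (\<lambda>t. cdet (- \<i> * of_real \<delta>) (q t)) (t - e) (t + e)) \<longlongrightarrow>
         pi * (if crossing_coefficient 1 q t > 0 then 1 else -1)) (at_right 0)"
proof -
  let ?f = "\<lambda>t. det (q t - mat 1)"
  let ?F = "\<lambda>\<delta> t. cdet (- \<i> * of_real \<delta>) (q t)"
  define D where "D = ddet (q t - mat 1) Y"
  define k where "k = pencil_slope (q t)"
  have co: "crossing_coefficient 1 q t = 2 * D / k"
    using crossing_coefficient_eq[OF qd zero] by (simp add: D_def k_def)
  with coef have nz: "D \<noteq> 0" "k \<noteq> 0" by auto
  have "((\<lambda>s. q s - mat 1) has_vector_derivative Y) (at t)"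
    by (auto intro!: derivative_eq_intros qd)
  from det_path_has_derivative[OF this] have fD: "(?f has_real_derivative D) (at t)"
    by (simp add: D_def has_real_derivative_iff_has_vector_derivative)
  \<comment> \<open>The signs \<open>\<sigma>\<close> of \<open>D\<close> and \<open>\<tau>\<close> of \<open>k\<close> reduce the four cases to one.\<close>
  define \<sigma> :: real where "\<sigma> = sgn D"
  have \<sigma>: "\<sigma> = 1 \<or> \<sigma> = -1" "\<sigma> * D > 0" using nz by (auto simp: \<sigma>_def sgn_if)
  have "((\<lambda>s. \<sigma> * ?f s) has_real_derivative \<sigma> * D) (at t)" by (intro DERIV_cmult fD)
  from DERIV_pos_inc_right[OF this \<sigma>(2)] DERIV_pos_inc_left[OF this \<sigma>(2)] zero
  obtain d1 d2 where d12: "d1 > 0" "d2 > 0" "\<And>h. 0 < h \<Longrightarrow> h < d1 \<Longrightarrow> \<sigma> * ?f (t + h) > 0"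
     "\<And>h. 0 < h \<Longrightarrow> h < d2 \<Longrightarrow> \<sigma> * ?f (t - h) < 0" by auto
  define \<tau> :: real where "\<tau> = sgn k"
  have \<tau>: "\<tau> = 1 \<or> \<tau> = -1" "\<tau> * k > 0" using nz by (auto simp: \<tau>_def sgn_if)
  \<comment> \<open>The quotient is close to \<open>- \<i> k\<close> for \<open>(\<delta>, s)\<close> near \<open>(0, t)\<close>; so multiplication
      by \<open>\<i> \<tau>\<close> takes the curve to the right half plane, whatever the real part \<open>f\<close> is.\<close>
  have "continuous_on (UNIV \<times> {0..1}) (\<lambda>x. pencil_quotient (fst x) (q (snd x)))"
    by (intro continuous_intros continuous_on_snd_comp q)
  then have "\<exists>d>0. \<forall>x\<in>UNIV \<times> {0..1}. dist x (0, t) < d \<longrightarrow>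
       dist (pencil_quotient (fst x) (q (snd x))) (pencil_quotient (fst (0, t)) (q (snd (0::real, t)))) < \<bar>k\<bar>"
    using t nz(2) unfolding continuous_on_iff by auto
  then obtain d3 where d3: "d3 > 0" "\<And>\<delta> s. s \<in> {0..1} \<Longrightarrow> dist (\<delta>, s) (0, t) < d3 \<Longrightarrow>
       dist (pencil_quotient \<delta> (q s)) (pencil_quotient 0 (q t)) < \<bar>k\<bar>" by auto
  define e0 where "e0 = Min {d1/2, d2/2, d3/3, t/2, (1-t)/2}"
  have e0: "e0 > 0" "e0 < d1" "e0 < d2" "e0 < d3 / 2" "e0 < t" "e0 < 1 - t"
    unfolding e0_def using d12 d3 t by (auto simp: min_less_iff_disj)
  show ?thesis
  proof (rule exI[of _ e0], intro conjI allI impI)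
    show "e0 > 0" by fact
    fix e assume e: "0 < e \<and> e \<le> e0"
    show "0 < t - e" "t + e < 1" using e e0 by auto
    show "\<forall>s\<in>{t - e..t + e}. det (q s - mat 1) = 0 \<longrightarrow> s = t"
    proof (intro ballI impI, rule ccontr)
      fix s assume s: "s \<in> {t - e..t + e}" "?f s = 0" "s \<noteq> t"
      show False
      proof (cases "s > t")
        case True
        then show False using d12(3)[of "s - t"] s e e0 by auto
      next
        case False
        then show False using d12(4)[of "t - s"] s e e0 by auto
      qed
    qed
    have seg: "closed_segment (t - e) (t + e) = {t - e..t + e}" using e by (simp add: closed_segment_eq_real_ivl)
    have sub: "{t - e..t + e} \<subseteq> {0..1}" using e e0 by auto
    have cF: "continuous_on ({0..1} \<times> {0..1}) (\<lambda>x. ?F (fst x) (snd x))"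
      by (intro continuous_intros continuous_on_snd_comp q)
    have A: "((\<lambda>\<delta>. arg_change (?F \<delta>) (t - e) (t + e)) \<longlongrightarrow>
         Im (Ln ((\<i> * of_real \<tau>) * of_real (?f (t + e)))) - Im (Ln ((\<i> * of_real \<tau>) * of_real (?f (t - e))))) (at_right 0)"
    proof (rule tendsto_arg_change)
      show "\<forall>\<^sub>F x in at_right 0. continuous_on (closed_segment (t - e) (t + e)) (?F x)"
        unfolding seg by (intro always_eventually allI continuous_intros continuous_on_subset[OF q] sub)
      have "\<forall>\<^sub>F \<delta> in at_right 0. \<delta> \<in> {0<..<d3 / 2}"
        using d3(1) by (intro eventually_at_right_real) auto
      then show "\<forall>\<^sub>F \<delta> in at_right 0. \<forall>s\<in>closed_segment (t - e) (t + e). 0 < Re (\<i> * of_real \<tau> * ?F \<delta> s)"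
      proof eventually_elim
        case (elim \<delta>)
        show ?case
        proof
          fix s assume "s \<in> closed_segment (t - e) (t + e)"
          then have s: "s \<in> {t - e..t + e}" "s \<in> {0..1}" using sub seg by auto
          have "dist (\<delta>, s) (0, t) \<le> \<bar>\<delta>\<bar> + \<bar>s - t\<bar>"
            using sqrt_sum_squares_le_sum_abs[of \<delta> "s - t"] by (simp add: dist_norm norm_Pair)
          also have "\<dots> < d3" using elim s e e0 by auto
          finally have "dist (pencil_quotient \<delta> (q s)) (- \<i> * of_real k) < \<bar>k\<bar>"
            using d3(2)[of s \<delta>] s by (simp add: pencil_quotient_0 k_def)
          then have "\<bar>Im (pencil_quotient \<delta> (q s)) + k\<bar> < \<bar>k\<bar>"
            using abs_Im_le_cmod[of "pencil_quotient \<delta> (q s) - (- \<i> * of_real k)"] by (simp add: dist_norm)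
          then have "\<tau> * Im (pencil_quotient \<delta> (q s)) < 0" using \<tau> by auto
          then have "\<delta> * (\<tau> * Im (pencil_quotient \<delta> (q s))) < 0" using elim by (simp add: mult_pos_neg)
          moreover have "Re (\<i> * of_real \<tau> * ?F \<delta> s) = - (\<delta> * (\<tau> * Im (pencil_quotient \<delta> (q s))))"
            unfolding cdet_expand by (simp add: algebra_simps)
          ultimately show "0 < Re (\<i> * of_real \<tau> * ?F \<delta> s)" by linarith
        qed
      qed
      have "((\<lambda>\<delta>. ?F \<delta> s) \<longlongrightarrow> of_real (?f s)) (at_right 0)" if "s \<in> {0..1}" for s
      proof (rule tendstoI)
        fix r :: real assume "r > 0"
        from tendsto_uniformly_at_zero[OF cF this] show "\<forall>\<^sub>F x in at_right 0. dist (?F x s) (of_real (?f s)) < r"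
          by eventually_elim (use that in \<open>auto simp: dist_norm cdet_0\<close>)
      qed
      then show "((\<lambda>\<delta>. ?F \<delta> (t - e)) \<longlongrightarrow> of_real (?f (t - e))) (at_right 0)" "((\<lambda>\<delta>. ?F \<delta> (t + e)) \<longlongrightarrow> of_real (?f (t + e))) (at_right 0)"
        using sub e by auto
      show "\<i> * of_real \<tau> * complex_of_real (?f (t - e)) \<notin> \<real>\<^sub>\<le>\<^sub>0" "\<i> * of_real \<tau> * complex_of_real (?f (t + e)) \<notin> \<real>\<^sub>\<le>\<^sub>0"
        using d12(3)[of e] d12(4)[of e] e e0 \<tau>(1) by (auto simp: complex_nonpos_Reals_iff)
    qed
    have B: "Im (Ln ((\<i> * of_real \<tau>) * of_real (?f (t + e)))) = \<tau> * \<sigma> * (pi / 2)"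
    proof -
      have "\<sigma> * ?f (t + e) > 0" using d12(3)[of e] e e0 by auto
      then have "\<tau> * ?f (t + e) \<noteq> 0" "sgn (\<tau> * ?f (t + e)) = \<tau> * \<sigma>"
        using \<tau>(1) \<sigma>(1) by auto
      then have "Im (Ln (\<i> * of_real (\<tau> * ?f (t + e)))) = (\<tau> * \<sigma>) * (pi / 2)"
        using Im_Ln_imaginary[of "\<tau> * ?f (t + e)"] by simp
      then show ?thesis by (simp only: of_real_mult mult.assoc)
    qed
    have C: "Im (Ln ((\<i> * of_real \<tau>) * of_real (?f (t - e)))) = - (\<tau> * \<sigma>) * (pi / 2)"
    proof -
      have "\<sigma> * ?f (t - e) < 0" using d12(4)[of e] e e0 by auto
      then have "\<tau> * ?f (t - e) \<noteq> 0" "sgn (\<tau> * ?f (t - e)) = - (\<tau> * \<sigma>)"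
        using \<tau>(1) \<sigma>(1) by auto
      then have "Im (Ln (\<i> * of_real (\<tau> * ?f (t - e)))) = - (\<tau> * \<sigma>) * (pi / 2)"
        using Im_Ln_imaginary[of "\<tau> * ?f (t - e)"] by simp
      then show ?thesis by (simp only: of_real_mult mult.assoc)
    qed
    have D: "\<tau> * \<sigma> = (if crossing_coefficient 1 q t > 0 then 1 else -1)"
      unfolding co \<tau>_def \<sigma>_def using nz by (auto simp: sgn_if zero_less_divide_iff divide_less_0_iff)
    show "((\<lambda>\<delta>. arg_change (?F \<delta>) (t - e) (t + e)) \<longlongrightarrow>
         pi * (if crossing_coefficient 1 q t > 0 then 1 else -1)) (at_right 0)"
      using A unfolding B C D[symmetric] by (simp add: algebra_simps)
  qed
qed

text \<open>Crossings are isolated by the previous lemma and form a compact set.\<close>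

lemma finite_crossings:
  assumes "transverse_path 1 (\<eta> :: real \<Rightarrow> 'd::finite phase_matrix)"
  shows "finite (crossings 1 \<eta>)"
proof (rule ccontr)
  assume inf: "infinite (crossings 1 \<eta>)"
  from assms have \<eta>: "continuous_on {0..1} \<eta>" "\<eta> ` {0..1} \<subseteq> Sp" "\<eta> 0 \<notin> Sp0 1" "\<eta> 1 \<notin> Sp0 1"
    and tr: "\<And>t. t \<in> crossings 1 \<eta> \<Longrightarrow> \<eta> differentiable (at t) \<and> crossing_coefficient 1 \<eta> t \<noteq> 0"
    by (auto simp: transverse_path_def path_def path_image_def pathstart_def pathfinish_def)
  have cr: "crossings 1 \<eta> = {t \<in> {0..1}. det (\<eta> t - mat 1) = 0}"
    using \<eta>(2) by (auto simp: crossings_def Sp0_def det_shifted)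
  have "closed (crossings 1 \<eta>)"
    unfolding cr by (intro continuous_closed_preimage_constant continuous_intros \<eta>)
  moreover have "bounded (crossings 1 \<eta>)"
    by (rule bounded_subset[of "{0..1}"]) (auto simp: crossings_def)
  ultimately have "compact (crossings 1 \<eta>)" using compact_eq_bounded_closed by blast
  with inf obtain t where t: "t \<in> crossings 1 \<eta>" "t islimpt crossings 1 \<eta>"
    using compact_eq_Bolzano_Weierstrass by blast
  have "t \<in> {0..1}" "\<eta> t \<in> Sp0 1" using t(1) by (simp_all add: crossings_def)
  then have "0 \<le> t" "t \<le> 1" "t \<noteq> 0" "t \<noteq> 1" using \<eta>(3,4) by auto
  then have t01: "0 < t" "t < 1" by linarith+
  obtain Y where Y: "(\<eta> has_vector_derivative Y) (at t)"
    using tr[OF t(1)] vector_derivative_works by blast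
  obtain e0 where e0: "e0 > 0" "\<And>e s. 0 < e \<Longrightarrow> e \<le> e0 \<Longrightarrow> s \<in> {t-e..t+e} \<Longrightarrow> det (\<eta> s - mat 1) = 0 \<Longrightarrow> s = t"
    using arg_change_at_crossing[OF t01 \<eta>(1) _ Y] t(1) tr[OF t(1)] unfolding cr by blast
  from t(2) e0(1) obtain s where "s \<in> crossings 1 \<eta>" "s \<noteq> t" "dist s t < e0"
    unfolding islimpt_approachable by blast
  moreover from this have "s \<in> {t-e0..t+e0}" by (auto simp: dist_real_def abs_less_iff)
  ultimately show False using e0(2)[of e0 s] e0(1) unfolding cr by auto
qed

definition crossing_sign :: "(real \<Rightarrow> 'd::finite phase_matrix) \<Rightarrow> real \<Rightarrow> int" where
  "crossing_sign \<eta> t = (if crossing_coefficient 1 \<eta> t > 0 then 1 else -1)"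

text \<open>
  Induction on the number of crossings in \<open>[a, b]\<close>: cut out a small interval around the
  first one, where the limit is \<open>\<plusminus> \<pi>\<close>; to its left the limit is \<open>0\<close>.
\<close>

lemma arg_change_transverse_segment:
  assumes tp: "transverse_path 1 (\<eta> :: real \<Rightarrow> 'd::finite phase_matrix)"
    and "0 \<le> a" "a \<le> b" "b \<le> 1" "det (\<eta> a - mat 1) \<noteq> 0" "det (\<eta> b - mat 1) \<noteq> 0"
  shows "((\<lambda>\<delta>. arg_change (\<lambda>t. cdet (- \<i> * of_real \<delta>) (\<eta> t)) a b) \<longlongrightarrow>
           pi * of_int (\<Sum>t\<in>crossings 1 \<eta> \<inter> {a..b}. crossing_sign \<eta> t)) (at_right 0)"
  using assms(2-)
proof (induction "card (crossings 1 \<eta> \<inter> {a..b})" arbitrary: a rule: less_induct)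
  case less
  from tp have \<eta>: "continuous_on {0..1} \<eta>" "\<eta> ` {0..1} \<subseteq> Sp"
    and tr: "\<And>t. t \<in> crossings 1 \<eta> \<Longrightarrow> \<eta> differentiable (at t) \<and> crossing_coefficient 1 \<eta> t \<noteq> 0"
    by (auto simp: transverse_path_def path_def path_image_def pathstart_def pathfinish_def)
  have cr: "crossings 1 \<eta> = {t \<in> {0..1}. det (\<eta> t - mat 1) = 0}"
    using \<eta>(2) by (auto simp: crossings_def Sp0_def det_shifted)
  let ?Z = "\<lambda>a. crossings 1 \<eta> \<inter> {a..b}"
  have fin: "finite (?Z a)" for a using finite_crossings[OF tp] by blast
  show ?case
  proof (cases "?Z a = {}")
    case True
    have "((\<lambda>\<delta>. arg_change (\<lambda>t. cdet (- \<i> * of_real \<delta>) (\<eta> t)) a b) \<longlongrightarrow> 0) (at_right 0)"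
    proof (rule arg_change_off_hypersurface)
      show "continuous_on {a..b} \<eta>" using \<eta>(1) less.prems by (auto intro: continuous_on_subset)
      show "det (\<eta> t - mat 1) \<noteq> 0" if "t \<in> {a..b}" for t
      proof -
        have "t \<notin> crossings 1 \<eta>" using True that by blast
        then show ?thesis using that less.prems unfolding cr by simp
      qed
    qed (use less.prems in auto)
    then show ?thesis using True by simp
  next
    case False
    define t where "t = Min (?Z a)"
    have tZ: "t \<in> ?Z a" using Min_in[OF fin False] by (simp add: t_def)
    have tmin: "t \<le> s" if "s \<in> ?Z a" for s using Min_le[OF fin that] by (simp add: t_def)
    have t0: "det (\<eta> t - mat 1) = 0" using tZ unfolding cr by simp
    then have "t \<noteq> a" "t \<noteq> b" using less.prems by auto
    moreover have "a \<le> t" "t \<le> b" using tZ by simp_all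
    ultimately have tab: "a < t" "t < b" by linarith+
    have t01: "0 < t" "t < 1" using tab less.prems by auto
    have tc: "t \<in> crossings 1 \<eta>" using tZ by simp
    obtain Y where Y: "(\<eta> has_vector_derivative Y) (at t)"
      using tr[OF tc] vector_derivative_works by blast
    obtain e0 where e0: "e0 > 0" "\<And>e. 0 < e \<Longrightarrow> e \<le> e0 \<Longrightarrow> 0 < t - e \<and> t + e < 1 \<and>
      (\<forall>s\<in>{t-e..t+e}. det (\<eta> s - mat 1) = 0 \<longrightarrow> s = t) \<and>
      ((\<lambda>\<delta>. arg_change (\<lambda>t. cdet (- \<i> * of_real \<delta>) (\<eta> t)) (t - e) (t + e)) \<longlongrightarrow>
         pi * (if crossing_coefficient 1 \<eta> t > 0 then 1 else -1)) (at_right 0)"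
      using arg_change_at_crossing[OF t01 \<eta>(1) t0 Y] tr[OF tc] by blast
    define e where "e = min e0 (min ((t - a) / 2) ((b - t) / 2))"
    have "e \<le> (t - a) / 2" unfolding e_def by (rule min.coboundedI2) (rule min.cobounded1)
    moreover have "e \<le> (b - t) / 2" unfolding e_def by (rule min.coboundedI2) (rule min.cobounded2)
    moreover have "e > 0" "e \<le> e0" using e0(1) tab by (simp_all add: e_def)
    ultimately have e: "e > 0" "e \<le> e0" "a < t - e" "t + e < b" using tab by auto
    note E = e0(2)[OF e(1,2)]
    have iso: "s = t" if "s \<in> {t-e..t+e}" "det (\<eta> s - mat 1) = 0" for s using E that by blast
    have nza: "det (\<eta> (t - e) - mat 1) \<noteq> 0" using iso[of "t - e"] e by auto
    have nzb: "det (\<eta> (t + e) - mat 1) \<noteq> 0" using iso[of "t + e"] e by auto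
    have Z: "?Z a = insert t (?Z (t + e))"
    proof -
      have "s = t \<or> t + e \<le> s" if "s \<in> ?Z a" for s
        using tmin[OF that] iso[of s] that e unfolding cr by force
      moreover have "?Z (t + e) \<subseteq> ?Z a" using e by auto
      ultimately show ?thesis using tZ by fastforce
    qed
    have tn: "t \<notin> ?Z (t + e)" using e by auto
    have "card (?Z (t + e)) < card (?Z a)" unfolding Z using fin tn by simp
    then have L3: "((\<lambda>\<delta>. arg_change (\<lambda>t. cdet (- \<i> * of_real \<delta>) (\<eta> t)) (t + e) b) \<longlongrightarrow>
           pi * of_int (\<Sum>t\<in>?Z (t + e). crossing_sign \<eta> t)) (at_right 0)"
      using less.hyps[of "t + e"] less.prems nzb e t01 by auto
    have L1: "((\<lambda>\<delta>. arg_change (\<lambda>t. cdet (- \<i> * of_real \<delta>) (\<eta> t)) a (t - e)) \<longlongrightarrow> 0) (at_right 0)"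
    proof (rule arg_change_off_hypersurface)
      show "continuous_on {a..t-e} \<eta>" by (rule continuous_on_subset[OF \<eta>(1)]) (use less.prems e t01 in auto)
      show "det (\<eta> s - mat 1) \<noteq> 0" if "s \<in> {a..t-e}" for s
        using tmin[of s] that less.prems e t01 tab unfolding cr by auto
    qed (use e in auto)
    have L2: "((\<lambda>\<delta>. arg_change (\<lambda>t. cdet (- \<i> * of_real \<delta>) (\<eta> t)) (t - e) (t + e)) \<longlongrightarrow> pi * of_int (crossing_sign \<eta> t)) (at_right 0)"
    proof -
      have "real_of_int (crossing_sign \<eta> t) = (if crossing_coefficient 1 \<eta> t > 0 then 1 else -1)" by (simp add: crossing_sign_def)
      then show ?thesis using E by (simp only:)
    qed
    have comb: "\<forall>\<^sub>F \<delta> in at_right 0.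
       arg_change (\<lambda>t. cdet (- \<i> * of_real \<delta>) (\<eta> t)) a (t - e) + arg_change (\<lambda>t. cdet (- \<i> * of_real \<delta>) (\<eta> t)) (t - e) (t + e)
        + arg_change (\<lambda>t. cdet (- \<i> * of_real \<delta>) (\<eta> t)) (t + e) b = arg_change (\<lambda>t. cdet (- \<i> * of_real \<delta>) (\<eta> t)) a b"
      using eventually_at_right_less[of 0]
    proof eventually_elim
      case (elim \<delta>)
      have c: "continuous_on {0..1} (\<lambda>t. cdet (- \<i> * of_real \<delta>) (\<eta> t))" by (intro continuous_intros \<eta>)
      have nz: "cdet (- \<i> * of_real \<delta>) (\<eta> t) \<noteq> 0" if "t \<in> {0..1}" for t
        using cdet_minus_imaginary_nonzero[of "\<eta> t" \<delta>] subsetD[OF \<eta>(2) imageI[OF that]] elim by auto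
      show ?case
        using arg_change_combine[OF _ c nz, of a "t - e" "t + e"] arg_change_combine[OF _ c nz, of a "t + e" b]
          less.prems e t01 by auto
    qed
    have "((\<lambda>\<delta>. arg_change (\<lambda>t. cdet (- \<i> * of_real \<delta>) (\<eta> t)) a b) \<longlongrightarrow>
       0 + pi * of_int (crossing_sign \<eta> t) + pi * of_int (\<Sum>t\<in>?Z (t + e). crossing_sign \<eta> t)) (at_right 0)"
      by (rule Lim_transform_eventually[OF _ comb]) (intro tendsto_add L1 L2 L3)
    moreover have "(\<Sum>t\<in>?Z a. crossing_sign \<eta> t) = crossing_sign \<eta> t + (\<Sum>t\<in>?Z (t + e). crossing_sign \<eta> t)"
      unfolding Z by (rule sum.insert[OF fin tn])
    ultimately show ?thesis by (simp add: algebra_simps)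
  qed
qed

text \<open>
  The limit \<open>r\<close> is \<open>\<pi>\<close> times the intersection number when \<open>p\<close> is transverse, but the limit
  makes sense for every continuous path and is visibly a homotopy invariant.
\<close>

definition has_arg_index :: "(real \<Rightarrow> 'd::finite phase_matrix) \<Rightarrow> real \<Rightarrow> bool" where
  "has_arg_index p r \<longleftrightarrow> ((\<lambda>\<delta>. arg_change (\<lambda>t. cdet (- \<i> * of_real \<delta>) (p t)) 0 1) \<longlongrightarrow> r) (at_right 0)"

lemma transverse_has_arg_index:
  assumes tp: "transverse_path 1 (\<eta> :: real \<Rightarrow> 'd::finite phase_matrix)"
  shows "has_arg_index \<eta> (pi * of_int (crossing_number 1 \<eta>))"
proof -
  from tp have "\<eta> 0 \<notin> Sp0 1" "\<eta> 1 \<notin> Sp0 1" "\<eta> 0 \<in> Sp" "\<eta> 1 \<in> Sp"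
    by (auto simp: transverse_path_def path_image_def pathstart_def pathfinish_def)
  then have "det (\<eta> 0 - mat 1) \<noteq> 0" "det (\<eta> 1 - mat 1) \<noteq> 0" by (auto simp: Sp0_def det_shifted)
  moreover have "crossings 1 \<eta> \<inter> {0..1} = crossings 1 \<eta>" by (auto simp: crossings_def)
  ultimately show ?thesis
    using arg_change_transverse_segment[OF tp, of 0 1]
    by (simp add: has_arg_index_def crossing_number_def crossing_sign_def[abs_def])
qed

lemma has_arg_index_unique: "has_arg_index p r \<Longrightarrow> has_arg_index p r' \<Longrightarrow> r = r'"
  unfolding has_arg_index_def by (rule tendsto_unique) auto

text \<open>
  For each \<open>\<delta> > 0\<close> the function \<open>cdet (- \<i> \<delta>)\<close> has no zeros on the whole
  rectangle, and on the two sides traced by the end points its change of argument tends to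
  \<open>0\<close>.
\<close>

lemma has_arg_index_homotopy:
  fixes h :: "real \<times> real \<Rightarrow> 'd::finite phase_matrix"
  assumes ab: "u \<le> v" and h: "continuous_on ({u..v} \<times> {0..1}) h" "h ` ({u..v} \<times> {0..1}) \<subseteq> Sp"
    and off: "\<And>s. s \<in> {u..v} \<Longrightarrow> det (h (s, 0) - mat 1) \<noteq> 0" "\<And>s. s \<in> {u..v} \<Longrightarrow> det (h (s, 1) - mat 1) \<noteq> 0"
    and r: "has_arg_index (\<lambda>t. h (u, t)) r"
  shows "has_arg_index (\<lambda>t. h (v, t)) r"
proof -
  have seg: "closed_segment u v = {u..v}" "closed_segment 0 1 = {0..1::real}" using ab by (auto simp: closed_segment_eq_real_ivl)
  have c: "continuous_on {u..v} (\<lambda>s. h (s, t))" if "t \<in> {0..1}" for t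
    by (rule continuous_on_compose2[OF h(1)]) (use that in \<open>auto intro!: continuous_intros\<close>)
  have e: "\<forall>\<^sub>F \<delta> in at_right 0. arg_change (\<lambda>t. cdet (- \<i> * of_real \<delta>) (h (u, t))) 0 1
       + arg_change (\<lambda>s. cdet (- \<i> * of_real \<delta>) (h (s, 1))) u v - arg_change (\<lambda>s. cdet (- \<i> * of_real \<delta>) (h (s, 0))) u v
       = arg_change (\<lambda>t. cdet (- \<i> * of_real \<delta>) (h (v, t))) 0 1"
    using eventually_at_right_less[of 0]
  proof eventually_elim
    case (elim \<delta>)
    have "continuous_on ({u..v} \<times> {0..1}) (\<lambda>x. cdet (- \<i> * of_real \<delta>) (h x))" by (intro continuous_intros h)
    moreover have "cdet (- \<i> * of_real \<delta>) (h (s, t)) \<noteq> 0" if "s \<in> {u..v}" "t \<in> {0..1}" for s t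
      using cdet_minus_imaginary_nonzero[of "h (s, t)" \<delta>] subsetD[OF h(2) imageI[of "(s, t)"]] that elim by auto
    ultimately show ?case
      using arg_change_rectangle[of u v 0 1 "\<lambda>x. cdet (- \<i> * of_real \<delta>) (h x)"] unfolding seg by auto
  qed
  have "((\<lambda>\<delta>. arg_change (\<lambda>t. cdet (- \<i> * of_real \<delta>) (h (v, t))) 0 1) \<longlongrightarrow> r + 0 - 0) (at_right 0)"
    by (rule Lim_transform_eventually[OF _ e])
       (intro tendsto_add tendsto_diff r[unfolded has_arg_index_def] arg_change_off_hypersurface ab c off; simp)
  then show ?thesis by (simp add: has_arg_index_def)
qed

lemma has_arg_index_homotopic_paths:
  assumes "homotopic_paths Sp p (q :: real \<Rightarrow> 'd::finite phase_matrix)" "pathstart p \<notin> Sp0 1" "pathfinish p \<notin> Sp0 1"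
    and "has_arg_index p r"
  shows "has_arg_index q r"
proof -
  obtain h :: "real \<times> real \<Rightarrow> 'd phase_matrix" where h: "continuous_on ({0..1} \<times> {0..1}) h" and h': "h \<in> ({0..1} \<times> {0..1}) \<rightarrow> Sp"
    and hp: "\<forall>x\<in>{0..1}. h (0, x) = p x" and hq: "\<forall>x\<in>{0..1}. h (1, x) = q x"
    and he: "\<forall>t\<in>{0..1}. pathstart (h \<circ> Pair t) = pathstart p \<and> pathfinish (h \<circ> Pair t) = pathfinish p"
    using assms(1) unfolding homotopic_paths by blast
  have h: "continuous_on ({0..1} \<times> {0..1}) h" "h ` ({0..1} \<times> {0..1}) \<subseteq> Sp" using h h' by blast+
  have p: "\<And>x. x \<in> {0..1} \<Longrightarrow> h (0, x) = p x" and q: "\<And>x. x \<in> {0..1} \<Longrightarrow> h (1, x) = q x"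
    and e: "\<And>t. t \<in> {0..1} \<Longrightarrow> pathstart (h \<circ> Pair t) = pathstart p" "\<And>t. t \<in> {0..1} \<Longrightarrow> pathfinish (h \<circ> Pair t) = pathfinish p"
    using hp hq he by blast+
  have in_Sp: "h (t, x) \<in> Sp" if "t \<in> {0..1}" "x \<in> {0..1}" for t x using subsetD[OF h(2) imageI[of "(t, x)"]] that by auto
  have cong: "has_arg_index p' r = has_arg_index q' r" if "\<And>x. x \<in> {0..1} \<Longrightarrow> p' x = q' x" for p' q' :: "real \<Rightarrow> 'd phase_matrix"
  proof -
    have "arg_change (\<lambda>t. cdet z (p' t)) 0 1 = arg_change (\<lambda>t. cdet z (q' t)) 0 1" for z
      by (rule arg_change_cong) (use that in \<open>auto simp: closed_segment_eq_real_ivl\<close>)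
    then show ?thesis by (simp add: has_arg_index_def)
  qed
  have "has_arg_index (\<lambda>t. h (1, t)) r"
  proof (rule has_arg_index_homotopy[OF _ h])
    show "det (h (s, 0) - mat 1) \<noteq> 0" if "s \<in> {0..1}" for s
      using e(1)[OF that] assms(2) in_Sp[of 0 0] p[of 0] by (auto simp: pathstart_def Sp0_def det_shifted)
    show "det (h (s, 1) - mat 1) \<noteq> 0" if "s \<in> {0..1}" for s
      using e(2)[OF that] assms(3) in_Sp[of 0 1] p[of 1] by (auto simp: pathfinish_def Sp0_def det_shifted)
    show "has_arg_index (\<lambda>t. h (0, t)) r" using cong[of "\<lambda>t. h (0, t)" p] p assms(4) by auto
  qed simp
  then show ?thesis using cong[of "\<lambda>t. h (1, t)" q] q by auto
qed

text \<open>A polynomial in \<open>s\<close> without zeros on the positive half line.\<close>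

lemma abs_arg_change_cdet_param:
  fixes M :: "'d::finite phase_matrix"
  assumes "M \<in> Sp" "0 < u" "0 < v"
  shows "\<bar>arg_change (\<lambda>s. cdet (- \<i> * of_real s) M) u v\<bar> \<le> pi * CARD('d + 'd)"
proof -
  let ?p = "pdet (cpx (M - mat 1)) (cpx (J ** (M + mat 1)))"
  \<comment> \<open>The substitution \<open>z = - \<i> s\<close>.\<close>
  let ?q = "?p \<circ>\<^sub>p [:0, - \<i>:]"
  have q: "cdet (- \<i> * of_real s) M = poly ?q (of_real s)" for s
    by (simp add: cdet_poly poly_pcompose mult.commute)
  have "degree ?q \<le> degree ?p" by (rule order.trans[OF degree_pcompose_le]) simp
  also have "\<dots> \<le> CARD('d + 'd)" by (rule degree_pdet)
  finally have d: "degree ?q \<le> CARD('d + 'd)" .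
  have "\<bar>arg_change (\<lambda>s. poly ?q (of_real s)) u v\<bar> \<le> pi * degree ?q"
  proof (rule abs_arg_change_poly)
    fix t assume "t \<in> closed_segment u v"
    then have "t \<noteq> 0" using assms by (auto simp: closed_segment_eq_real_ivl split: if_splits)
    then show "poly ?q (of_real t) \<noteq> 0" using cdet_minus_imaginary_nonzero[OF assms(1)] by (simp only: q[symmetric])
  qed
  also have "\<dots> \<le> pi * CARD('d + 'd)" using d by (intro mult_left_mono) auto
  finally show ?thesis by (simp only: q)
qed

text \<open>
  The parameter \<open>- \<i>\<close> is one of the admissible values of \<open>z\<close>; comparing with
  \<open>- \<i> \<delta>\<close>, \<open>\<delta> \<rightarrow> 0\<close>, yields the index up to a bounded error.
\<close>

definition turn :: "(real \<Rightarrow> 'd::finite phase_matrix) \<Rightarrow> real \<Rightarrow> real \<Rightarrow> real" where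
  "turn p a b = arg_change (\<lambda>t. cdet (- \<i>) (p t)) a b"

text \<open>
  Move the parameter from \<open>1\<close> to \<open>\<delta>\<close>: on the rectangle \<open>[\<delta>, 1] \<times> [0, 1]\<close>
  the discrepancy sits on the two sides where the matrix is constant, and each is bounded
  by the degree of the pencil.
\<close>

lemma has_arg_index_bound:
  fixes p :: "real \<Rightarrow> 'd::finite phase_matrix"
  assumes p: "path p" "path_image p \<subseteq> Sp" and r: "has_arg_index p r"
  shows "\<bar>r - turn p 0 1\<bar> \<le> 2 * pi * CARD('d + 'd)"
proof (rule tendsto_upperbound)
  show "((\<lambda>\<delta>. \<bar>arg_change (\<lambda>t. cdet (- \<i> * of_real \<delta>) (p t)) 0 1 - turn p 0 1\<bar>) \<longlongrightarrow> \<bar>r - turn p 0 1\<bar>) (at_right 0)"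
    by (intro tendsto_intros r[unfolded has_arg_index_def])
  have pc: "continuous_on {0..1} p" and pS: "\<And>t. t \<in> {0..1} \<Longrightarrow> p t \<in> Sp" using p by (auto simp: path_def path_image_def)
  show "\<forall>\<^sub>F \<delta> in at_right 0. \<bar>arg_change (\<lambda>t. cdet (- \<i> * of_real \<delta>) (p t)) 0 1 - turn p 0 1\<bar> \<le> 2 * pi * CARD('d + 'd)"
    using eventually_at_right_less[of 0]
  proof eventually_elim
    case (elim \<delta>)
    let ?F = "\<lambda>x. cdet (- \<i> * of_real (fst x)) (p (snd x))"
    have seg: "closed_segment 0 1 = {0..1::real}" by (auto simp: closed_segment_eq_real_ivl)
    have pos: "s > 0" if "s \<in> closed_segment 1 \<delta>" for s
      using elim that by (auto simp: closed_segment_eq_real_ivl split: if_splits)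
    have "continuous_on (closed_segment 1 \<delta> \<times> {0..1}) ?F"
      by (intro continuous_intros continuous_on_snd_comp pc)
    moreover have "?F (s, t) \<noteq> 0" if "s \<in> closed_segment 1 \<delta>" "t \<in> {0..1}" for s t
      using cdet_minus_imaginary_nonzero[OF pS[OF that(2)], of s] pos[OF that(1)] by auto
    ultimately have "arg_change (\<lambda>t. cdet (- \<i> * of_real \<delta>) (p t)) 0 1 - turn p 0 1 =
       arg_change (\<lambda>s. cdet (- \<i> * of_real s) (p 1)) 1 \<delta> - arg_change (\<lambda>s. cdet (- \<i> * of_real s) (p 0)) 1 \<delta>"
      using arg_change_rectangle[of 1 \<delta> 0 1 ?F] unfolding seg turn_def by simp
    then show ?case
      using abs_arg_change_cdet_param[OF pS[of 0], of 1 \<delta>] abs_arg_change_cdet_param[OF pS[of 1], of 1 \<delta>] elim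
      by auto
  qed
qed auto

section \<open>Rank one perturbations\<close>

definition outer :: "'a::semiring_1^'n \<Rightarrow> 'a^'m \<Rightarrow> 'a^'m^'n" where
  "outer u v = (\<chi> i j. u $ i * v $ j)"

lemma outer_nth [simp]: "outer u v $ i $ j = u $ i * v $ j" by (simp add: outer_def)

lemma outer_vec: "outer u v *v x = (\<Sum>j\<in>UNIV. v $ j * x $ j) *s u" for u :: "'a::field^'n"
  by (simp add: vec_eq_iff matrix_vector_mult_def sum_distrib_right sum_distrib_left mult_ac)

lemma outer_vec_real: "outer u v *v x = (v \<bullet> x) *\<^sub>R u" for u :: "real^'n"
  by (simp add: vec_eq_iff matrix_vector_mult_def sum_distrib_right sum_distrib_left inner_vec_def mult_ac)

lemma mult_outer: "A ** outer u v = outer (A *v u) v" for A :: "'a::comm_ring_1^'n^'m"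
  by (simp add: vec_eq_iff matrix_matrix_mult_def matrix_vector_mult_def sum_distrib_left mult_ac)

lemma outer_mult: "outer u v ** A = outer u (transpose A *v v)" for A :: "'a::comm_ring_1^'n^'m"
  by (simp add: vec_eq_iff matrix_matrix_mult_def matrix_vector_mult_def transpose_def sum_distrib_left mult_ac)

lemma outer_axis_right: "outer u (c *s axis k 1) = (\<chi> i j. if j = k then c * u $ i else 0)" for c :: "'a::comm_ring_1"
  by (simp add: vec_eq_iff axis_def)

lemma outer_add_left: "outer (a + b) v = outer a v + outer b v" for a b :: "real^'n"
  by (simp add: vec_eq_iff algebra_simps)

lemma outer_scaleR_left: "outer (c *\<^sub>R a) v = c *\<^sub>R outer a v" for a :: "real^'n"
  by (simp add: vec_eq_iff)

lemma det_column_affine: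
  fixes A :: "'a::comm_ring_1^'n^'n"
  shows "\<exists>b. \<forall>t. det (A + (\<chi> i j. if j = k then t * u $ i else 0)) = det A + t * b"
proof (intro exI allI)
  fix t
  let ?r = "\<lambda>j. column j A"
  have "det (A + (\<chi> i j. if j = k then t * u $ i else 0)) = det (transpose (A + (\<chi> i j. if j = k then t * u $ i else 0)))"
    by simp
  also have "transpose (A + (\<chi> i j. if j = k then t * u $ i else 0)) = (\<chi> j. if j = k then ?r j + t *s u else ?r j)"
    by (simp add: vec_eq_iff transpose_def column_def)
  also have "det \<dots> = det (\<chi> j. if j = k then ?r j else ?r j) + det (\<chi> j. if j = k then t *s u else ?r j)"
    by (rule det_row_add)
  also have "det (\<chi> j. if j = k then t *s u else ?r j) = t * det (\<chi> j. if j = k then u else ?r j)"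
    by (rule det_row_mul)
  also have "(\<chi> j. if j = k then ?r j else ?r j) = transpose A" by (simp add: vec_eq_iff transpose_def column_def)
  finally show "det (A + (\<chi> i j. if j = k then t * u $ i else 0)) = det A + t * det (\<chi> j. if j = k then u else ?r j)"
    by simp
qed

text \<open>
  An orthogonal change of basis takes \<open>v\<close> to a multiple of a coordinate vector, and then the
  perturbation affects a single column.
\<close>

lemma det_rank_one_affine:
  fixes A :: "real^'n^'n"
  shows "\<exists>b. \<forall>t. det (A + t *\<^sub>R outer u v) = det A + t * b"
proof (cases "v = 0")
  case True
  then have "outer u v = 0" by (simp add: vec_eq_iff)
  then show ?thesis by (intro exI[of _ 0]) simp
next
  case False
  define a where "a = (1 / norm v) *\<^sub>R v"
  have "norm a = 1" using False by (simp add: a_def)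
  then obtain Q :: "real^'n^'n" and k where Q: "orthogonal_matrix Q" "Q *v axis k 1 = a"
    using orthogonal_matrix_exists_basis by metis
  have QQ: "transpose Q ** Q = mat 1" "Q ** transpose Q = mat 1" using Q(1) by (auto simp: orthogonal_matrix_def)
  have "transpose Q *v v = norm v *\<^sub>R (transpose Q *v a)" using False by (simp add: a_def matrix_vector_mult_scaleR)
  also have "transpose Q *v a = axis k 1" by (simp add: Q(2)[symmetric] matrix_vector_mul_assoc QQ)
  finally have Qv: "transpose Q *v v = norm v *s axis k 1" by (simp add: scalar_mult_eq_scaleR)
  obtain b where b: "\<And>t. det (A ** Q + (\<chi> i j. if j = k then t * u $ i else 0)) = det (A ** Q) + t * b"
    using det_column_affine[of "A ** Q" k u] by auto
  have dQ: "det Q * det Q = 1" using QQ(1) by (metis det_I det_mul det_transpose)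
  have "det (A + t *\<^sub>R outer u v) = det A + t * (norm v * b * det Q)" for t
  proof -
    have "(A + t *\<^sub>R outer u v) ** Q = A ** Q + (\<chi> i j. if j = k then (t * norm v) * u $ i else 0)"
      by (simp add: matrix_add_left matrix_scaleR_left
          outer_mult Qv outer_axis_right del: transpose_matrix_vector) (simp add: vec_eq_iff)
    then have "det (A + t *\<^sub>R outer u v) * det Q = det A * det Q + (t * norm v) * b"
      using b[of "t * norm v"] by (simp flip: det_mul)
    then have "det (A + t *\<^sub>R outer u v) * det Q * det Q = (det A * det Q + (t * norm v) * b) * det Q" by simp
    then have "det (A + t *\<^sub>R outer u v) * (det Q * det Q) = det A * (det Q * det Q) + t * (norm v * b * det Q)"
      by (simp add: algebra_simps)
    then show ?thesis by (simp only: dQ mult_1_right)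
  qed
  then show ?thesis by blast
qed

lemma rank_one_kernel:
  fixes C :: "'a::field^'n^'n"
  assumes "det C \<noteq> 0"
  obtains z where "\<And>x. (C + outer u v) *v x = 0 \<Longrightarrow> \<exists>k. x = k *s z"
proof -
  obtain D where D: "D ** C = mat 1" using assms invertible_det_nz invertible_left_inverse by blast
  have "\<exists>k. x = k *s (D *v u)" if "(C + outer u v) *v x = 0" for x
  proof -
    let ?s = "\<Sum>j\<in>UNIV. v $ j * x $ j"
    have "C *v x + ?s *s u = 0" using that by (simp add: matrix_vector_mult_add_rdistrib outer_vec)
    then have "C *v x = (- ?s) *s u" by (simp add: eq_neg_iff_add_eq_0 vec_eq_iff)
    then have "D *v (C *v x) = (- ?s) *s (D *v u)" by (simp add: vector_scalar_commute[symmetric])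
    then have "x = (- ?s) *s (D *v u)" by (simp add: matrix_vector_mul_assoc D)
    then show ?thesis by blast
  qed
  then show thesis using that by blast
qed

section \<open>Non-degeneracy of the co-orientation at simple zeros\<close>

text \<open>
  If \<open>M - 1\<close> has a one-dimensional kernel, spanned by a unit vector \<open>v\<close>, then \<open>w = J v\<close> spans
  the orthogonal complement of its range, because \<open>M\<close> is symplectic. So all derivatives of
  the determinant at \<open>A = M - 1\<close> are multiples of the one in the direction \<open>w v\<^sup>T\<close>, and
  the direction \<open>J\<close> gives exactly this one. If it vanished, the determinant would have no
  non-zero derivative at all.
\<close>

lemma ddet_J_nonzero:
  fixes M :: "'d::finite phase_matrix"
  assumes M: "M \<in> Sp" and det0: "det (M - mat 1) = 0"
    and ker: "\<And>x. (M - mat 1) *v x = 0 \<Longrightarrow> \<exists>k. x = k *s z"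
    and Y: "ddet (M - mat 1) Y \<noteq> 0"
  shows "ddet (M - mat 1) J \<noteq> 0"
proof
  assume J0: "ddet (M - mat 1) J = 0"
  define A where "A = M - mat 1"
  obtain v0 where v0: "v0 \<noteq> 0" "A *v v0 = 0" using det0 det_eq_0_iff_ker unfolding A_def by blast
  define v where "v = (1 / norm v0) *\<^sub>R v0"
  have v: "v \<bullet> v = 1" "A *v v = 0" using v0 by (auto simp: v_def matrix_vector_mult_scaleR power2_norm_eq_inner[symmetric] power2_eq_square)
  have vnz: "v \<noteq> 0" using v(1) by auto
  have kerv: "\<exists>c. x = c *\<^sub>R v" if x: "A *v x = 0" for x
  proof -
    obtain k1 k2 where k: "x = k1 *s z" "v = k2 *s z" using ker[of x] ker[of v] x v unfolding A_def by blast
    with vnz have "k2 \<noteq> 0" by auto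
    with k have "x = (k1 / k2) *\<^sub>R v" by (simp add: scalar_mult_eq_scaleR)
    then show ?thesis by blast
  qed
  \<comment> \<open>The vector \<open>w\<close> is orthogonal to the range of \<open>A\<close>: \<open>w \<bullet> M x = w \<bullet> x\<close>
      because \<open>M v = v\<close>.\<close>
  define w where "w = J *v v"
  have ww: "w \<bullet> w = 1" by (simp add: w_def J_inner_J v)
  have Mv: "M *v v = v" using v(2) by (simp add: A_def matrix_vector_mult_diff_rdistrib)
  have wA: "w \<bullet> (A *v x) = 0" for x
  proof -
    have "w \<bullet> (M *v x) = - ((M *v v) \<bullet> (J *v (M *v x)))" using J_inner[of v "M *v x"] by (simp add: w_def Mv)
    also have "\<dots> = w \<bullet> x" using Sp_inner[OF M] J_inner[of v x] by (simp add: w_def)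
    finally show ?thesis by (simp add: A_def matrix_vector_mult_diff_rdistrib inner_diff_right)
  qed
  \<comment> \<open>Adding \<open>w v\<^sup>T\<close> makes \<open>A\<close> invertible; \<open>D\<close> is the inverse, with \<open>D w = v\<close>.\<close>
  define B where "B = A + outer w v"
  have Bx: "B *v x = A *v x + (v \<bullet> x) *\<^sub>R w" for x by (simp add: B_def matrix_vector_mult_add_rdistrib outer_vec_real)
  have "det B \<noteq> 0"
  proof
    assume "det B = 0"
    then obtain x where x: "x \<noteq> 0" "B *v x = 0" using det_eq_0_iff_ker by blast
    then have "w \<bullet> (A *v x + (v \<bullet> x) *\<^sub>R w) = 0" using Bx by simp
    then have vx: "v \<bullet> x = 0" by (simp add: inner_add_right wA ww)
    with x Bx have "A *v x = 0" by simp
    then obtain c where "x = c *\<^sub>R v" using kerv by blast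
    with vx v x(1) show False by simp
  qed
  then obtain D where D: "B ** D = mat 1" "D ** B = mat 1"
    using invertible_det_nz[of B] unfolding invertible_def by blast
  have Bv: "B *v v = w" by (simp add: Bx v)
  then have Dw: "D *v w = v" by (metis D(2) matrix_vector_mul_assoc matrix_vector_mul_lid)
  have A0: "det A = 0" using det0 by (simp add: A_def)
  note lin = linear_add[OF linear_ddet] linear_scale[OF linear_ddet]
  \<comment> \<open>Modulo multiples of \<open>A\<close> from the left and the right, every \<open>X\<close> is a multiple of
      \<open>w v\<^sup>T\<close>.\<close>
  have dec: "ddet A X = (v \<bullet> (D *v (X *v v))) * ddet A (outer w v)" for X
  proof -
    let ?y = "X *v v"
    have "X = X ** (D ** B)" by (simp add: D)
    also have "\<dots> = (X ** D) ** A + outer (X *v (D *v w)) v"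
      unfolding B_def by (simp add: matrix_add_ldistrib matrix_mul_assoc mult_outer matrix_vector_mul_assoc)
    finally have X: "X = (X ** D) ** A + outer ?y v" by (simp add: Dw)
    have "?y = B *v (D *v ?y)" by (metis D(1) matrix_vector_mul_assoc matrix_vector_mul_lid)
    also have "\<dots> = A *v (D *v ?y) + (v \<bullet> (D *v ?y)) *\<^sub>R w" by (rule Bx)
    finally have y: "outer ?y v = A ** outer (D *v ?y) v + (v \<bullet> (D *v ?y)) *\<^sub>R outer w v"
      by (metis mult_outer outer_add_left outer_scaleR_left)
    have "ddet A X = ddet A (outer ?y v)"
      by (subst X) (simp add: lin ddet_mult_left[OF A0])
    also have "\<dots> = (v \<bullet> (D *v ?y)) * ddet A (outer w v)"
      by (subst y) (simp add: lin ddet_mult_right[OF A0])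
    finally show ?thesis .
  qed
  from dec[of J] have "ddet A (outer w v) = 0" using J0 by (simp add: A_def[symmetric] w_def[symmetric] Dw v)
  with dec[of Y] Y show False by (simp add: A_def)
qed

text \<open>Caratheodory's criterion: a continuous difference quotient.\<close>

lemma has_vector_derivative_caratheodory:
  fixes f :: "real \<Rightarrow> 'a::real_normed_vector"
  assumes "\<forall>\<^sub>F t in at t0. f t - f t0 = (t - t0) *\<^sub>R g t" "(g \<longlongrightarrow> l) (at t0)"
  shows "(f has_vector_derivative l) (at t0)"
  unfolding has_vector_derivative_def has_derivative_at_within
proof (intro conjI bounded_linear_scaleR_left)
  have "((\<lambda>t. norm (g t - l)) \<longlongrightarrow> 0) (at t0)"
    using assms(2) Lim_null tendsto_norm_zero by blast
  moreover have "\<forall>\<^sub>F t in at t0. norm ((f t - f t0 - (t - t0) *\<^sub>R l) /\<^sub>R norm (t - t0)) \<le> norm (g t - l)"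
    using assms(1) eventually_neq_at_within[of t0 t0 UNIV]
  proof eventually_elim
    case (elim t)
    then have "f t - f t0 - (t - t0) *\<^sub>R l = (t - t0) *\<^sub>R (g t - l)"
      by (simp add: algebra_simps)
    then show ?case using elim by (simp add: abs_mult)
  qed
  ultimately show "((\<lambda>t. (f t - f t0 - (t - t0) *\<^sub>R l) /\<^sub>R norm (t - t0)) \<longlongrightarrow> 0) (at t0)"
    by (rule Lim_null_comparison[rotated])
qed

section \<open>Matrix inversion along affine paths\<close>

text \<open>
  The inverse by explicit formulas in the entries, which makes its continuity evident.
\<close>

definition cramer_inv :: "real^'n^'n \<Rightarrow> real^'n^'n" where
  "cramer_inv A = (\<chi> i j. det (\<chi> k l. if l = i then (mat 1 :: real^'n^'n) $ k $ j else A $ k $ l) / det A)"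

lemma cramer_inv_right: fixes A :: "real^'n^'n" assumes "det A \<noteq> 0" shows "A ** cramer_inv A = mat 1"
proof -
  have "A *v column j (cramer_inv A) = column j (mat 1)" for j :: 'n
  proof -
    have "column j (cramer_inv A) = (\<chi> i. det (\<chi> k l. if l = i then (column j (mat 1 :: real^'n^'n)) $ k else A $ k $ l) / det A)"
      by (simp add: cramer_inv_def column_def cong: if_cong)
    then show ?thesis using cramer[OF assms] by blast
  qed
  moreover have "A *v column j (cramer_inv A) = column j (A ** cramer_inv A)" for j
    by (simp add: column_def matrix_vector_mult_def matrix_matrix_mult_def)
  ultimately show ?thesis by (simp add: column_def vec_eq_iff)
qed

lemma cramer_inv_left: "det A \<noteq> 0 \<Longrightarrow> cramer_inv A ** A = mat 1"
  using cramer_inv_right matrix_left_right_inverse by blast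

lemma continuous_on_cramer_inv [continuous_intros]:
  fixes f :: "'b::topological_space \<Rightarrow> real^'n^'n"
  assumes "continuous_on S f" "\<And>x. x \<in> S \<Longrightarrow> det (f x) \<noteq> 0"
  shows "continuous_on S (\<lambda>x. cramer_inv (f x))"
proof -
  have "continuous_on S (\<lambda>x. if l = i then c else f x $ k $ l)" for i k l :: 'n and c
    by (cases "l = i") (auto intro!: continuous_intros assms)
  then show ?thesis
    unfolding cramer_inv_def by (intro continuous_intros assms) (use assms(2) in auto)
qed

text \<open>
  From the resolvent identity
  \<open>X\<^sup>-\<^sup>1 - Y\<^sup>-\<^sup>1 = X\<^sup>-\<^sup>1 (Y - X) Y\<^sup>-\<^sup>1\<close>.
\<close>

lemma cramer_inv_affine_has_vector_derivative:
  fixes A B :: "real^'n^'n"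
  assumes nz: "\<And>t. t \<in> T \<Longrightarrow> det (A + t *\<^sub>R B) \<noteq> 0" and T: "open T" "t0 \<in> T"
  shows "((\<lambda>t. cramer_inv (A + t *\<^sub>R B)) has_vector_derivative - (cramer_inv (A + t0 *\<^sub>R B) ** B ** cramer_inv (A + t0 *\<^sub>R B))) (at t0)"
proof -
  let ?A = "\<lambda>t. A + t *\<^sub>R B"
  let ?I = "\<lambda>t. cramer_inv (A + t *\<^sub>R B)"
  have diff: "?I t - ?I t0 = (t - t0) *\<^sub>R (- (?I t ** B ** ?I t0))" if "t \<in> T" for t
  proof -
    have gen: "P ** (Y - X) ** Q = P - Q" if "P ** X = mat 1" "Y ** Q = mat 1" for P Q X Y :: "real^'n^'n"
    proof -
      have "P ** Y ** Q = P" by (simp add: that flip: matrix_mul_assoc)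
      then show ?thesis
        by (simp add: matrix_diff_left matrix_diff_right that)
    qed
    have "?I t ** (?A t0 - ?A t) ** ?I t0 = ?I t - ?I t0"
      by (rule gen[OF cramer_inv_left[OF nz[OF that]] cramer_inv_right[OF nz[OF T(2)]]])
    moreover have "?A t0 - ?A t = - ((t - t0) *\<^sub>R B)" by (simp add: algebra_simps)
    ultimately show ?thesis
      by (simp add: matrix_neg_right matrix_neg_left matrix_scaleR_left matrix_scaleR_right)
  qed
  have "continuous_on T ?I" by (intro continuous_intros nz)
  then have "isCont ?I t0" using T continuous_on_eq_continuous_at by blast
  then have "((\<lambda>t. - (?I t ** B ** ?I t0)) \<longlongrightarrow> - (?I t0 ** B ** ?I t0)) (at t0)"
    unfolding isCont_def by (intro tendsto_minus bounded_bilinear.tendsto[OF bounded_bilinear_matrix_mult] tendsto_const)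
  moreover have "\<forall>\<^sub>F t in at t0. ?I t - ?I t0 = (t - t0) *\<^sub>R (- (?I t ** B ** ?I t0))"
    using eventually_at_in_open[OF T] by eventually_elim (use diff in blast)
  ultimately show ?thesis by (intro has_vector_derivative_caratheodory)
qed

section \<open>Cayley charts of the symplectic group\<close>

abbreviation Sym :: "(real^'n^'n) set" where "Sym \<equiv> {S. transpose S = S}"

text \<open>
  The Cayley transform \<open>S \<mapsto> (1 + J S) (1 - J S)\<^sup>-\<^sup>1\<close> parametrizes a
  neighbourhood of \<open>1\<close> in \<open>Sp\<close> by symmetric matrices; left multiplication by \<open>G\<close> moves it to \<open>G\<close>.
\<close>

definition chart :: "'d::finite phase_matrix \<Rightarrow> 'd phase_matrix \<Rightarrow> 'd phase_matrix" where
  "chart G S = G ** (mat 1 + J ** S) ** cramer_inv (mat 1 - J ** S)"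

text \<open>
  Clearing the denominator in \<open>chart G S - 1\<close> leaves an expression that is affine in \<open>S\<close>. Rank
  one changes of \<open>S\<close> therefore change its determinant affinely.
\<close>

definition chart_det :: "'d::finite phase_matrix \<Rightarrow> 'd phase_matrix \<Rightarrow> 'd phase_matrix" where
  "chart_det G S = G ** (mat 1 + J ** S) - (mat 1 - J ** S)"

text \<open>The domain of the chart.\<close>

definition regular :: "'d::finite phase_matrix \<Rightarrow> bool" where
  "regular S \<longleftrightarrow> det (mat 1 - J ** S) \<noteq> 0"

lemma transpose_add: "transpose (A + B) = transpose A + transpose B" for A :: "real^'n^'m"
  by (simp add: transpose_def vec_eq_iff)
lemma transpose_diff: "transpose (A - B) = transpose A - transpose B" for A :: "real^'n^'m"
  by (simp add: transpose_def vec_eq_iff)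
lemma chart_minus_one:
  assumes "regular S"
  shows "(chart G S - mat 1) ** (mat 1 - J ** S) = chart_det G S"
proof -
  have "chart G S ** (mat 1 - J ** S) = G ** (mat 1 + J ** S)"
    unfolding chart_def using cramer_inv_left[of "mat 1 - J ** S"] assms
    by (simp add: regular_def flip: matrix_mul_assoc)
  then show ?thesis by (simp only: chart_det_def matrix_diff_left matrix_mul_lid)
qed

lemma det_chart_minus_one:
  assumes "regular S"
  shows "det (chart G S - mat 1) = det (chart_det G S) / det (mat 1 - J ** S)"
  using chart_minus_one[OF assms, of G, symmetric] assms
  by (simp add: det_mul regular_def)

text \<open>
  For symmetric \<open>S\<close> the matrices \<open>P = 1 + J S\<close> and \<open>N = 1 - J S\<close> satisfy
  \<open>P\<^sup>T J P = N\<^sup>T J N\<close>.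
\<close>

lemma chart_in_Sp:
  assumes G: "G \<in> Sp" and S: "S \<in> Sym" "regular S"
  shows "chart G S \<in> Sp"
proof -
  let ?P = "mat 1 + J ** S" and ?N = "mat 1 - J ** S"
  have tJS: "transpose (J ** S) = - (S ** J)" using S(1) by (simp add: matrix_transpose_mul transpose_J matrix_neg_right)
  have JJS: "J ** (J ** S) = - S" for S :: "'a phase_matrix" by (simp add: matrix_mul_assoc J_J matrix_neg_left)
  have SJJ: "S ** J ** J = - S" for S :: "'a phase_matrix" by (simp add: J_J matrix_neg_right flip: matrix_mul_assoc)
  have "transpose ?P ** J ** ?P = transpose ?N ** J ** ?N"
    by (simp add: transpose_add transpose_diff tJS transpose_mat matrix_alg JJS SJJ)
  moreover have congr: "transpose (P ** Q) ** J ** (P ** Q) = transpose Q ** (transpose P ** J ** P) ** Q" for P Q :: "'a phase_matrix"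
    by (simp add: matrix_transpose_mul matrix_mul_assoc)
  ultimately have "transpose (?P ** cramer_inv ?N) ** J ** (?P ** cramer_inv ?N) = transpose (?N ** cramer_inv ?N) ** J ** (?N ** cramer_inv ?N)"
    by (simp only: congr)
  then have "?P ** cramer_inv ?N \<in> Sp" using cramer_inv_right[of ?N] S(2) by (intro SpI) (simp add: regular_def transpose_mat)
  then show ?thesis unfolding chart_def using Sp_mult[OF G] by (simp flip: matrix_mul_assoc)
qed

lemma continuous_on_chart [continuous_intros]:
  assumes "continuous_on T f" "\<And>x. x \<in> T \<Longrightarrow> regular (f x)"
  shows "continuous_on T (\<lambda>x. chart G (f x))"
  unfolding chart_def by (intro continuous_intros assms) (use assms(2) in \<open>auto simp: regular_def\<close>)

lemma chart_segment_derivative: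
  assumes T: "open T" "\<And>t. t \<in> T \<Longrightarrow> regular (S + t *\<^sub>R E)"
  shows "\<exists>D. continuous_on T D \<and> (\<forall>t\<in>T. ((\<lambda>t. chart G (S + t *\<^sub>R E)) has_vector_derivative D t) (at t))"
proof -
  let ?I = "\<lambda>t. cramer_inv (mat 1 - J ** (S + t *\<^sub>R E))"
  let ?D = "\<lambda>t. G ** (mat 1 + J ** (S + t *\<^sub>R E)) ** (?I t ** (J ** E) ** ?I t) + G ** (J ** E) ** ?I t"
  have eq: "mat 1 - J ** (S + t *\<^sub>R E) = (mat 1 - J ** S) + t *\<^sub>R (- (J ** E))" for t
    by (simp add: matrix_alg)
  have nz: "det (mat 1 - J ** (S + t *\<^sub>R E)) \<noteq> 0" if "t \<in> T" for t using T(2)[OF that] by (simp add: regular_def)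
  have cont: "continuous_on T ?D"
    by (intro continuous_intros nz)
  have "((\<lambda>t. chart G (S + t *\<^sub>R E)) has_vector_derivative ?D t) (at t)" if t: "t \<in> T" for t
  proof -
    have "(?I has_vector_derivative - (?I t ** (- (J ** E)) ** ?I t)) (at t)"
      unfolding eq by (rule cramer_inv_affine_has_vector_derivative[OF _ T(1) t]) (use nz eq in auto)
    then have I: "(?I has_vector_derivative ?I t ** (J ** E) ** ?I t) (at t)" by (simp add: matrix_alg)
    have "((\<lambda>t. mat 1 + J ** S + t *\<^sub>R (J ** E)) has_vector_derivative J ** E) (at t)"
      by (auto intro!: derivative_eq_intros)
    then have "((\<lambda>t. mat 1 + J ** (S + t *\<^sub>R E)) has_vector_derivative J ** E) (at t)"
      by (simp add: matrix_alg add.assoc)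
    from has_vector_derivative_matrix_mult[OF has_vector_derivative_const[of G] this]
    have "((\<lambda>t. G ** (mat 1 + J ** (S + t *\<^sub>R E))) has_vector_derivative G ** (J ** E)) (at t)"
      by simp
    from has_vector_derivative_matrix_mult[OF this I] show ?thesis by (simp add: chart_def)
  qed
  with cont show ?thesis by blast
qed

lemma open_regular: "open {S. regular S}"
  unfolding regular_def by (intro open_Collect_neq continuous_intros)

lemma regular_segment_open: "open {t. regular (S + t *\<^sub>R E)}"
proof -
  have "open ((\<lambda>t. S + t *\<^sub>R E) -` {S. regular S})"
    by (intro open_vimage open_regular continuous_intros)
  then show ?thesis by (simp add: vimage_def)
qed

lemma transverse_chart_segment:
  fixes S E :: "'d::finite phase_matrix"
  assumes G: "G \<in> Sp" and sym: "S \<in> Sym" "E \<in> Sym"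
    and reg: "\<And>t. t \<in> {0..1} \<Longrightarrow> regular (S + t *\<^sub>R E)"
    and ends: "det (chart_det G S) \<noteq> 0" "det (chart_det G (S + E)) \<noteq> 0"
    and cross: "\<And>t Y. t \<in> {0..1} \<Longrightarrow> det (chart_det G (S + t *\<^sub>R E)) = 0 \<Longrightarrow>
        ((\<lambda>t. chart G (S + t *\<^sub>R E)) has_vector_derivative Y) (at t) \<Longrightarrow>
        complex_nullity (shifted_matrix 1 (chart G (S + t *\<^sub>R E))) = 1 \<and>
        crossing_coefficient 1 (\<lambda>t. chart G (S + t *\<^sub>R E)) t \<noteq> 0"
  shows "transverse_path 1 (\<lambda>t. chart G (S + t *\<^sub>R E))"
proof -
  let ?\<eta> = "\<lambda>t. chart G (S + t *\<^sub>R E)"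
  have symt: "S + t *\<^sub>R E \<in> Sym" for t using sym by (simp add: transpose_add transpose_scalar)
  let ?T = "{t. regular (S + t *\<^sub>R E)}"
  obtain D where D: "continuous_on ?T D" "\<And>t. t \<in> ?T \<Longrightarrow> (?\<eta> has_vector_derivative D t) (at t)"
    using chart_segment_derivative[where T = ?T, OF regular_segment_open, where G = G and S = S and E = E] by auto
  have sub: "{0..1} \<subseteq> ?T" using reg by auto
  have c: "continuous_on {0..1} ?\<eta>" by (intro continuous_intros reg)
  have inSp: "?\<eta> t \<in> Sp" if "t \<in> {0..1}" for t using chart_in_Sp[OF G symt reg[OF that]] .
  have Sp0: "?\<eta> t \<in> Sp0 1 \<longleftrightarrow> det (chart_det G (S + t *\<^sub>R E)) = 0" if "t \<in> {0..1}" for t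
    using inSp[OF that] reg[OF that] by (simp add: Sp0_def det_shifted det_chart_minus_one regular_def)
  have "?\<eta> C1_differentiable_on {0..1}"
    unfolding C1_differentiable_on_def using D sub continuous_on_subset by blast
  then have "?\<eta> piecewise_C1_differentiable_on {0..1}" by (rule C1_differentiable_imp_piecewise)
  moreover have "?\<eta> differentiable (at t)" if "t \<in> {0..1}" for t
    using D(2) sub that differentiableI_vector by blast
  moreover have cr: "complex_nullity (shifted_matrix 1 (?\<eta> t)) = 1 \<and> crossing_coefficient 1 ?\<eta> t \<noteq> 0"
    if "t \<in> {0..1}" "det (chart_det G (S + t *\<^sub>R E)) = 0" for t
    using cross[OF that D(2)] sub that by blast
  ultimately show ?thesis
    unfolding transverse_path_def path_def path_image_def pathstart_def pathfinish_def
    using c inSp Sp0[of 0] Sp0[of 1] ends cr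
    by (auto simp: crossings_def Sp0)
qed

section \<open>Rank one segments are transverse\<close>

lemma transpose_outer: "transpose (outer v v) = outer v v" for v :: "real^'n"
  by (simp add: transpose_def vec_eq_iff)

lemma cpx_outer: "cpx (outer u v) = outer (\<chi> i. of_real (u $ i)) (\<chi> i. of_real (v $ i))"
  by (simp add: vec_eq_iff)

lemma complex_nullity_1:
  assumes "\<And>x. A *v x = 0 \<Longrightarrow> \<exists>k. x = k *s z" "det A = 0"
  shows "complex_nullity A = 1"
proof -
  obtain x where x: "x \<noteq> 0" "A *v x = 0" using assms(2) det_eq_0_iff_ker by blast
  then obtain k where k: "x = k *s z" using assms(1) by blast
  with x have z: "z \<noteq> 0" "k \<noteq> 0" by auto
  have "A *v z = 0"
  proof -
    have "k *s (A *v z) = 0" using x k by (simp add: vector_scalar_commute)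
    then show ?thesis using z by simp
  qed
  then have "{v. A *v v = 0} = vec.span {z}"
    using assms(1) by (auto simp: vec.span_singleton vector_scalar_commute)
  then show ?thesis unfolding complex_nullity_def using z by (simp add: vec.dim_span vec.dim_singleton)
qed

lemma chart_det_rank_one:
  "chart_det G (S + t *\<^sub>R outer v v) = chart_det G S + t *\<^sub>R outer ((G + mat 1) *v (J *v v)) v"
proof -
  have "(G + mat 1) ** (J ** outer v v) = G ** (J ** outer v v) + J ** outer v v" by (simp add: matrix_alg)
  then show ?thesis
    unfolding chart_det_def mult_outer[symmetric] by (simp add: matrix_alg scaleR_add_right)
qed

lemma kernel_times_invertible:
  fixes A N :: "'a::field^'n^'n"
  assumes N: "det N \<noteq> 0" and ker: "\<And>x. (A ** N) *v x = 0 \<Longrightarrow> \<exists>k. x = k *s z" and x: "A *v x = 0"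
  shows "\<exists>k. x = k *s (N *v z)"
proof -
  obtain P where P: "N ** P = mat 1" using N invertible_det_nz unfolding invertible_def by blast
  have xx: "N *v (P *v x) = x" by (simp add: matrix_vector_mul_assoc P)
  then have "(A ** N) *v (P *v x) = 0" using x by (simp flip: matrix_vector_mul_assoc)
  then obtain k where "P *v x = k *s z" using ker by blast
  then have "x = k *s (N *v z)" using xx by (simp add: vector_scalar_commute)
  then show ?thesis by blast
qed

text \<open>
  Along \<open>S + t c v v\<^sup>T\<close> the determinant of \<open>chart_det\<close> is affine in \<open>t\<close> and not zero at
  the ends, so any zero is simple; this is transversality once the co-orienting derivative
  is known to be non-zero. As a rank one perturbation of an invertible matrix, a singular
  value of \<open>chart_det\<close> has a one-dimensional kernel, over the reals and over the complex
  numbers.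
\<close>

lemma rank_one_segment_transverse:
  fixes S :: "'d::finite phase_matrix"
  assumes G: "G \<in> Sp" and sym: "S \<in> Sym"
    and reg: "\<And>t. t \<in> {0..1} \<Longrightarrow> regular (S + t *\<^sub>R (c *\<^sub>R outer v v))"
    and ends: "det (chart_det G S) \<noteq> 0" "det (chart_det G (S + c *\<^sub>R outer v v)) \<noteq> 0"
  shows "transverse_path 1 (\<lambda>t. chart G (S + t *\<^sub>R (c *\<^sub>R outer v v)))"
proof (rule transverse_chart_segment[OF G sym _ reg ends])
  show "c *\<^sub>R outer v v \<in> Sym" by (simp add: transpose_scalar transpose_outer)
  fix t Y assume t: "t \<in> {0..1}" and zero: "det (chart_det G (S + t *\<^sub>R (c *\<^sub>R outer v v))) = 0"
    and Y: "((\<lambda>t. chart G (S + t *\<^sub>R (c *\<^sub>R outer v v))) has_vector_derivative Y) (at t)"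
  let ?S = "\<lambda>t. S + t *\<^sub>R (c *\<^sub>R outer v v)"
  let ?N = "\<lambda>t. mat 1 - J ** ?S t"
  let ?\<eta> = "\<lambda>t. chart G (?S t)"
  let ?A = "?\<eta> t - mat 1"
  let ?C = "chart_det G S"
  let ?u = "(G + mat 1) *v (J *v v)"
  have regt: "regular (?S t)" using reg[OF t] .
  have cd: "chart_det G (?S s) = ?C + (s * c) *\<^sub>R outer ?u v" for s
    using chart_det_rank_one[of G S "s * c" v] by simp
  have detA: "det ?A = 0" using det_chart_minus_one[OF regt, of G] zero by simp
  have symt: "?S t \<in> Sym" using sym by (simp add: transpose_add transpose_scalar transpose_outer)
  have eta_Sp: "?\<eta> t \<in> Sp" by (rule chart_in_Sp[OF G symt regt])
  have AN: "?A ** ?N t = ?C + outer ((t * c) *\<^sub>R ?u) v"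
    using chart_minus_one[OF regt, of G] by (simp only: cd outer_scaleR_left)
  have detN: "det (?N t) \<noteq> 0" using regt by (simp add: regular_def)
  obtain z where z: "\<And>x. (?C + outer ((t * c) *\<^sub>R ?u) v) *v x = 0 \<Longrightarrow> \<exists>k. x = k *s z"
    using rank_one_kernel[OF ends(1)] by metis
  have kerA: "\<exists>k. x = k *s (?N t *v z)" if "?A *v x = 0" for x
    by (rule kernel_times_invertible[OF detN _ that]) (use z in \<open>simp only: AN\<close>)
  have detCc: "det (cpx ?C) \<noteq> 0" using ends(1) by (simp add: det_cpx)
  obtain zc where zc: "\<And>x. (cpx ?C + outer (\<chi> i. of_real (((t * c) *\<^sub>R ?u) $ i)) (\<chi> i. of_real (v $ i))) *v x = 0 \<Longrightarrow> \<exists>k. x = k *s zc"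
    using rank_one_kernel[OF detCc] by metis
  have "cpx ?A ** cpx (?N t) = cpx ?C + outer (\<chi> i. of_real (((t * c) *\<^sub>R ?u) $ i)) (\<chi> i. of_real (v $ i))"
    by (simp only: cpx_mult[symmetric] AN cpx_add cpx_outer)
  then have kerAc: "\<exists>k. x = k *s (cpx (?N t) *v zc)" if "cpx ?A *v x = 0" for x
    by (intro kernel_times_invertible[OF _ _ that]) (use zc detN in \<open>simp_all add: det_cpx\<close>)
  have null: "complex_nullity (shifted_matrix 1 (?\<eta> t)) = 1"
    unfolding shifted_matrix_one by (rule complex_nullity_1[OF kerAc]) (simp_all only: det_cpx detA of_real_0)
  obtain b where b: "\<And>s. det (?C + s *\<^sub>R outer ?u v) = det ?C + s * b"
    using det_rank_one_affine[of ?C ?u v] by blast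
  define g where "g s = det ?C + s * (c * b)" for s
  have g: "det (chart_det G (?S s)) = g s" for s by (simp only: cd b g_def mult.assoc)
  have gt: "g t = 0" using zero g by simp
  then have cb: "c * b \<noteq> 0" using ends(1) by (auto simp: g_def)
  have dY: "((\<lambda>s. det (?\<eta> s - mat 1)) has_real_derivative ddet ?A Y) (at t)"
  proof -
    have "((\<lambda>s. ?\<eta> s - mat 1) has_vector_derivative Y) (at t)"
      using has_vector_derivative_diff[OF Y has_vector_derivative_const[of "mat 1"]] by simp
    from det_path_has_derivative[OF this] show ?thesis by (simp add: has_real_derivative_iff_has_vector_derivative)
  qed
  have dN: "(\<lambda>s. det (?N s)) differentiable (at t)"
  proof -
    have "(?N has_vector_derivative - (J ** (c *\<^sub>R outer v v))) (at t)"
      unfolding matrix_add_ldistrib matrix_scaleR_right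
      by (auto intro!: derivative_eq_intros simp: matrix_alg)
    from det_path_has_derivative[OF this] show ?thesis using differentiableI_vector by blast
  qed
  then obtain e where e: "((\<lambda>s. det (?N s)) has_real_derivative e) (at t)"
    using real_differentiable_def by blast
  have "((\<lambda>s. det (?\<eta> s - mat 1) * det (?N s)) has_real_derivative ddet ?A Y * det (?N t)) (at t)"
    using DERIV_mult[OF dY e] by (simp only: detA mult_zero_right add_0_right)
  moreover have "\<forall>\<^sub>F s in nhds t. det (?\<eta> s - mat 1) * det (?N s) = g s"
  proof -
    have "\<forall>\<^sub>F s in nhds t. s \<in> {s. regular (?S s)}"
      by (rule eventually_nhds_in_open[OF regular_segment_open]) (use regt in simp)
    then show ?thesis
      by eventually_elim (simp add: det_chart_minus_one g[symmetric] regular_def)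
  qed
  ultimately have "(g has_real_derivative ddet ?A Y * det (?N t)) (at t)"
    by (rule DERIV_cong_ev[OF refl _ refl, THEN iffD1, rotated])
  moreover have "(g has_real_derivative c * b) (at t)"
    unfolding g_def by (auto intro!: derivative_eq_intros)
  ultimately have "ddet ?A Y * det (?N t) = c * b" by (rule DERIV_unique)
  with cb have Ynz: "ddet ?A Y \<noteq> 0" by auto
  have "ddet ?A J \<noteq> 0" by (rule ddet_J_nonzero[OF eta_Sp detA kerA Ynz])
  then have "crossing_coefficient 1 ?\<eta> t \<noteq> 0"
    using crossing_coefficient_eq[OF Y detA] ddet_eq_J(2)[OF detA] Ynz by simp
  with null show "complex_nullity (shifted_matrix 1 (?\<eta> t)) = 1 \<and> crossing_coefficient 1 ?\<eta> t \<noteq> 0" by blast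
qed

lemma differentiable_cong_nhds:
  fixes f g :: "real \<Rightarrow> 'a::real_normed_vector"
  assumes ev: "eventually (\<lambda>s. f s = g s) (nhds t)" and g: "g differentiable (at t)"
  shows "f differentiable (at t)"
proof -
  have "f t = g t" using ev eventually_nhds_x_imp_x by blast
  then have "(f has_vector_derivative D) (at t) = (g has_vector_derivative D) (at t)" for D
    by (intro has_vector_derivative_cong_ev) (use ev in \<open>auto elim: eventually_mono\<close>)
  then show ?thesis using g vector_derivative_works differentiableI_vector by blast
qed

section \<open>Joining transverse paths\<close>

lemma crossing_coefficient_cong:
  assumes "eventually (\<lambda>s. f s = g s) (nhds t)"
  shows "crossing_coefficient 1 f t = crossing_coefficient 1 g t"
proof -
  have "f t = g t" using assms eventually_nhds_x_imp_x by blast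
  moreover have "det_velocity 1 f t = det_velocity 1 g t"
    unfolding det_velocity_def
    by (rule vector_derivative_cong_eq) (use assms in \<open>auto elim: eventually_mono\<close>)
  ultimately show ?thesis by (simp add: crossing_coefficient_def)
qed

text \<open>
  The crossing coefficient is linear in the velocity, so its sign survives a change of
  speed.
\<close>

lemma crossing_affine_reparam:
  assumes f: "\<And>s. f s = \<eta> (a * s + b)" and \<eta>: "\<eta> differentiable (at (a * t + b))"
    and zero: "det (\<eta> (a * t + b) - mat 1) = 0" and a: "a > 0"
  shows "f differentiable (at t)" "crossing_coefficient 1 f t = a * crossing_coefficient 1 \<eta> (a * t + b)"
proof -
  let ?Y = "vector_derivative \<eta> (at (a * t + b))"
  have fe: "f = \<eta> \<circ> (\<lambda>s. a * s + b)" using f by (simp add: fun_eq_iff)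
  have Y: "(\<eta> has_vector_derivative ?Y) (at (a * t + b))" using \<eta> vector_derivative_works by blast
  have "((\<lambda>s. a * s + b) has_vector_derivative a) (at t)" by (auto intro!: derivative_eq_intros)
  from vector_diff_chain_at[OF this Y] have d: "(f has_vector_derivative a *\<^sub>R ?Y) (at t)"
    using fe by simp
  then show "f differentiable (at t)" using differentiableI_vector by blast
  have ft: "f t = \<eta> (a * t + b)" by (rule f)
  have "det (f t - mat 1) = 0" using zero ft by simp
  from crossing_coefficient_eq[OF d this] crossing_coefficient_eq[OF Y zero]
  show "crossing_coefficient 1 f t = a * crossing_coefficient 1 \<eta> (a * t + b)"
    by (simp add: ft linear_scale[OF linear_ddet])
qed

lemma transverse_path_join:
  assumes p: "transverse_path 1 p" and q: "transverse_path 1 q" and pq: "pathfinish p = pathstart q"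
  shows "transverse_path 1 (p +++ q)"
proof -
  have 1: "path (p +++ q)" "path_image (p +++ q) \<subseteq> Sp" "pathstart (p +++ q) \<notin> Sp0 1" "pathfinish (p +++ q) \<notin> Sp0 1"
    using p q pq by (auto simp: transverse_path_def path_image_join)
  have "valid_path (p +++ q)"
    by (rule valid_path_join) (use p q pq in \<open>auto simp: transverse_path_def valid_path_def\<close>)
  then have 2: "(p +++ q) piecewise_C1_differentiable_on {0..1}" by (simp add: valid_path_def)
  have 3: "(p +++ q) differentiable (at t) \<and> complex_nullity (shifted_matrix 1 ((p +++ q) t)) = 1 \<and>
      crossing_coefficient 1 (p +++ q) t \<noteq> 0" if t: "t \<in> crossings 1 (p +++ q)" for t
  proof -
    have t01: "t \<in> {0..1}" and tS: "(p +++ q) t \<in> Sp0 1" using t by (auto simp: crossings_def)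
    have ne: "t \<noteq> 1/2"
    proof
      assume "t = 1/2"
      then have "(p +++ q) t = pathfinish p" by (simp only: joinpaths_def pathfinish_def) simp
      with tS p show False by (simp add: transverse_path_def)
    qed
    show ?thesis
    proof (cases "t < 1/2")
      case True
      let ?f = "\<lambda>s. p (2 * s + 0)"
      have ev: "\<forall>\<^sub>F s in nhds t. (p +++ q) s = ?f s"
      proof -
        have "\<forall>\<^sub>F s in nhds t. s \<in> {..<1/2}" by (rule eventually_nhds_in_open) (use True in auto)
        then show ?thesis by eventually_elim (simp add: joinpaths_def)
      qed
      have eq: "(p +++ q) t = p (2 * t + 0)" using True by (simp add: joinpaths_def)
      have c: "2 * t + 0 \<in> crossings 1 p" using tS t01 True eq by (auto simp: crossings_def)
      then have z: "det (p (2 * t + 0) - mat 1) = 0" by (simp add: crossings_def Sp0_def det_shifted)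
      have pd: "p differentiable (at (2 * t + 0))" "complex_nullity (shifted_matrix 1 (p (2 * t + 0))) = 1"
         "crossing_coefficient 1 p (2 * t + 0) \<noteq> 0"
        using p c by (auto simp: transverse_path_def)
      note R = crossing_affine_reparam[of ?f p 2 0 t, OF refl pd(1) z zero_less_numeral]
      have "(p +++ q) differentiable (at t)"
        by (rule differentiable_cong_nhds[OF ev R(1)])
      moreover have "crossing_coefficient 1 (p +++ q) t \<noteq> 0"
        using crossing_coefficient_cong[OF ev] R(2) pd(3) by simp
      ultimately show ?thesis using pd(2) eq by simp
    next
      case False
      with ne have gt: "t > 1/2" by simp
      let ?f = "\<lambda>s. q (2 * s + -1)"
      have ev: "\<forall>\<^sub>F s in nhds t. (p +++ q) s = ?f s"
      proof -
        have "\<forall>\<^sub>F s in nhds t. s \<in> {1/2<..}" by (rule eventually_nhds_in_open) (use gt in auto)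
        then show ?thesis by eventually_elim (simp add: joinpaths_def)
      qed
      have eq: "(p +++ q) t = q (2 * t + -1)" using gt by (simp add: joinpaths_def)
      have c: "2 * t + -1 \<in> crossings 1 q" using tS t01 gt eq by (auto simp: crossings_def)
      then have z: "det (q (2 * t + -1) - mat 1) = 0" by (simp add: crossings_def Sp0_def det_shifted)
      have pd: "q differentiable (at (2 * t + -1))" "complex_nullity (shifted_matrix 1 (q (2 * t + -1))) = 1"
         "crossing_coefficient 1 q (2 * t + -1) \<noteq> 0"
        using q c by (auto simp: transverse_path_def)
      note R = crossing_affine_reparam[of ?f q 2 "-1" t, OF refl pd(1) z zero_less_numeral]
      have "(p +++ q) differentiable (at t)"
        by (rule differentiable_cong_nhds[OF ev R(1)])
      moreover have "crossing_coefficient 1 (p +++ q) t \<noteq> 0"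
        using crossing_coefficient_cong[OF ev] R(2) pd(3) by simp
      ultimately show ?thesis using pd(2) eq by simp
    qed
  qed
  from 1 2 3 show ?thesis by (simp add: transverse_path_def)
qed

section \<open>Transverse paths inside a chart\<close>

text \<open>
  The symmetric matrices \<open>S\<close> and \<open>S'\<close> are joined inside the ball of radius \<open>r\<close> by a path whose
  image under the chart is transverse. The path is recorded in the chart, where it is
  homotopic to any other path with the same ends by convexity.
\<close>

definition reach :: "'d::finite phase_matrix \<Rightarrow> real \<Rightarrow> 'd phase_matrix \<Rightarrow> 'd phase_matrix \<Rightarrow> bool" where
  "reach G r S S' \<longleftrightarrow> (\<exists>\<sigma>. path \<sigma> \<and> path_image \<sigma> \<subseteq> Sym \<inter> ball 0 r \<and> pathstart \<sigma> = S \<and> pathfinish \<sigma> = S' \<and>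
      transverse_path 1 (chart G \<circ> \<sigma>))"

lemma reach_trans: "reach G r S S' \<Longrightarrow> reach G r S' S'' \<Longrightarrow> reach G r S S''"
proof -
  assume "reach G r S S'" "reach G r S' S''"
  then obtain \<sigma> \<tau> where s: "path \<sigma>" "path_image \<sigma> \<subseteq> Sym \<inter> ball 0 r" "pathstart \<sigma> = S" "pathfinish \<sigma> = S'" "transverse_path 1 (chart G \<circ> \<sigma>)"
    and t: "path \<tau>" "path_image \<tau> \<subseteq> Sym \<inter> ball 0 r" "pathstart \<tau> = S'" "pathfinish \<tau> = S''" "transverse_path 1 (chart G \<circ> \<tau>)"
    unfolding reach_def by blast
  have "transverse_path 1 (chart G \<circ> (\<sigma> +++ \<tau>))"
    unfolding path_compose_join
    by (rule transverse_path_join[OF s(5) t(5)]) (simp add: pathfinish_compose pathstart_compose s t)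
  moreover have "path (\<sigma> +++ \<tau>)" "path_image (\<sigma> +++ \<tau>) \<subseteq> Sym \<inter> ball 0 r"
    using s t by (auto simp: path_image_join)
  ultimately show ?thesis unfolding reach_def using s t by (intro exI[of _ "\<sigma> +++ \<tau>"]) auto
qed

lemma convex_Sym_ball: "convex (Sym \<inter> ball 0 r :: (real^'n^'n) set)"
proof (rule convex_Int)
  show "convex (Sym :: (real^'n^'n) set)"
    by (rule convexI) (simp add: transpose_add transpose_scalar)
qed (rule convex_ball)

lemma reach_segment:
  assumes "S \<in> Sym \<inter> ball 0 r" "S + E \<in> Sym \<inter> ball 0 r" "transverse_path 1 (\<lambda>t. chart G (S + t *\<^sub>R E))"
  shows "reach G r S (S + E)"
proof -
  have "chart G \<circ> linepath S (S + E) = (\<lambda>t. chart G (S + t *\<^sub>R E))"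
    by (simp add: fun_eq_iff linepath_def algebra_simps)
  moreover have "path_image (linepath S (S + E)) \<subseteq> Sym \<inter> ball 0 r"
    using closed_segment_subset[OF assms(1,2) convex_Sym_ball] by (simp add: path_image_linepath)
  ultimately show ?thesis unfolding reach_def using assms(3) by (intro exI[of _ "linepath S (S + E)"]) auto
qed

lemma segment_in_Sym_ball:
  assumes "S \<in> Sym \<inter> ball 0 r" "S + E \<in> Sym \<inter> ball 0 r" "t \<in> {0..1}"
  shows "S + t *\<^sub>R E \<in> Sym \<inter> ball 0 r"
proof -
  have "(1 - t) *\<^sub>R S + t *\<^sub>R (S + E) \<in> Sym \<inter> ball 0 r"
    using convexD_alt[OF convex_Sym_ball assms(1,2)] assms(3) by auto
  then show ?thesis by (simp add: algebra_simps)
qed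

lemma reach_no_crossing:
  fixes G :: "'d::finite phase_matrix"
  assumes G: "G \<in> Sp" and reg: "\<And>S :: 'd phase_matrix. S \<in> ball 0 r \<Longrightarrow> regular S"
    and S: "S \<in> Sym \<inter> ball 0 r" "S + E \<in> Sym \<inter> ball 0 r"
    and off: "\<And>t. t \<in> {0..1} \<Longrightarrow> det (chart_det G (S + t *\<^sub>R E)) \<noteq> 0"
  shows "reach G r S (S + E)"
proof (rule reach_segment[OF S transverse_chart_segment[OF G]])
  show "S \<in> Sym" using S by blast
  have "transpose (S + E) = S + E" "transpose S = S" using S by auto
  then show "E \<in> Sym" by (simp add: transpose_add)
  show "regular (S + t *\<^sub>R E)" if "t \<in> {0..1}" for t by (rule reg[OF IntD2[OF segment_in_Sym_ball[OF S that]]])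
  show "det (chart_det G S) \<noteq> 0" "det (chart_det G (S + E)) \<noteq> 0" using off[of 0] off[of 1] by auto
qed (use off in blast)

lemma reach_rank_one:
  fixes G :: "'d::finite phase_matrix"
  assumes G: "G \<in> Sp" and reg: "\<And>S :: 'd phase_matrix. S \<in> ball 0 r \<Longrightarrow> regular S"
    and S: "S \<in> Sym \<inter> ball 0 r" "S + c *\<^sub>R outer v v \<in> Sym \<inter> ball 0 r"
    and off: "det (chart_det G S) \<noteq> 0" "det (chart_det G (S + c *\<^sub>R outer v v)) \<noteq> 0"
  shows "reach G r S (S + c *\<^sub>R outer v v)"
proof (rule reach_segment[OF S rank_one_segment_transverse[OF G]])
  show "S \<in> Sym" using S by blast
  show "regular (S + t *\<^sub>R (c *\<^sub>R outer v v))" if "t \<in> {0..1}" for t by (rule reg[OF IntD2[OF segment_in_Sym_ball[OF S that]]])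
qed (use off in auto)

text \<open>
  The summands are added one at a time. A step may end on the hypersurface; then its
  length is increased slightly, which leaves the hypersurface because the determinant is
  affine along the step and not zero at its start. This spoils the end point by less than
  \<open>\<epsilon>\<close>.
\<close>

lemma reach_approx:
  fixes G :: "'d::finite phase_matrix"
  assumes G: "G \<in> Sp" and reg: "\<And>S :: 'd phase_matrix. S \<in> ball 0 r \<Longrightarrow> regular S" and "finite K"
  shows "S \<in> Sym \<Longrightarrow> det (chart_det G S) \<noteq> 0 \<Longrightarrow> \<epsilon> > 0 \<Longrightarrow>
      norm S + (\<Sum>k\<in>K. \<bar>c k\<bar> * norm (outer (v k) (v k))) + \<epsilon> \<le> r \<Longrightarrow>
      \<exists>S'\<in>Sym. reach G r S S' \<and> det (chart_det G S') \<noteq> 0 \<and> norm (S' - (S + (\<Sum>k\<in>K. c k *\<^sub>R outer (v k) (v k)))) < \<epsilon>"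
  using assms(3)
proof (induction K arbitrary: \<epsilon> rule: finite_induct)
  case empty
  then have "reach G r S (S + 0)"
    by (intro reach_no_crossing[OF G reg]) auto
  with empty show ?case by (intro bexI[of _ S]) auto
next
  case (insert k K)
  let ?E = "outer (v k) (v k)"
  let ?T = "S + (\<Sum>k\<in>K. c k *\<^sub>R outer (v k) (v k))"
  have sum: "(\<Sum>k\<in>insert k K. \<bar>c k\<bar> * norm (outer (v k) (v k))) = \<bar>c k\<bar> * norm ?E + (\<Sum>k\<in>K. \<bar>c k\<bar> * norm (outer (v k) (v k)))"
     "(\<Sum>k\<in>insert k K. c k *\<^sub>R outer (v k) (v k)) = c k *\<^sub>R ?E + (\<Sum>k\<in>K. c k *\<^sub>R outer (v k) (v k))"
    using insert by auto
  have le: "norm S + (\<Sum>k\<in>K. \<bar>c k\<bar> * norm (outer (v k) (v k))) + \<bar>c k\<bar> * norm ?E + \<epsilon> \<le> r"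
    using insert.prems(4) sum by simp
  have "norm S + (\<Sum>k\<in>K. \<bar>c k\<bar> * norm (outer (v k) (v k))) + \<epsilon> / 2 \<le> r"
    using le insert.prems(3) mult_nonneg_nonneg[OF abs_ge_zero[of "c k"] norm_ge_zero[of ?E]] by linarith
  with insert.IH[of "\<epsilon> / 2"] insert.prems obtain S1 where S1: "S1 \<in> Sym" "reach G r S S1" "det (chart_det G S1) \<noteq> 0" "norm (S1 - ?T) < \<epsilon> / 2"
    by auto
  obtain b where b: "\<And>t. det (chart_det G (S1 + t *\<^sub>R ?E)) = det (chart_det G S1) + t * b"
    using det_rank_one_affine[of "chart_det G S1"] unfolding chart_det_rank_one by metis
  \<comment> \<open>An affine function that is not zero at \<open>0\<close> cannot vanish at both \<open>c k\<close> and \<open>c k + h\<close>.\<close>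
  define h where "h = \<epsilon> / (2 * (norm ?E + 1))"
  have h: "h > 0" "h * norm ?E < \<epsilon> / 2"
    using insert.prems(3) by (auto simp: h_def field_simps add_pos_nonneg intro: add_nonneg_pos)
  have "det (chart_det G (S1 + c k *\<^sub>R ?E)) \<noteq> 0 \<or> det (chart_det G (S1 + (c k + h) *\<^sub>R ?E)) \<noteq> 0"
  proof (rule ccontr)
    assume "\<not> ?thesis"
    then have "h * b = 0" unfolding b by (auto simp: algebra_simps)
    with h have "b = 0" by simp
    with S1(3) b[of "c k"] \<open>\<not> ?thesis\<close> show False by auto
  qed
  then obtain c' where c': "c' = c k \<or> c' = c k + h" "det (chart_det G (S1 + c' *\<^sub>R ?E)) \<noteq> 0" by blast
  have d: "norm ((c' - c k) *\<^sub>R ?E) < \<epsilon> / 2" using c'(1) h insert.prems(3) by auto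
  let ?S' = "S1 + c' *\<^sub>R ?E"
  have "?S' - (S + (\<Sum>k\<in>insert k K. c k *\<^sub>R outer (v k) (v k))) = (S1 - ?T) + (c' - c k) *\<^sub>R ?E"
    unfolding sum by (simp add: algebra_simps)
  moreover have "norm ((S1 - ?T) + (c' - c k) *\<^sub>R ?E) < \<epsilon>"
    by (rule norm_triangle_lt) (use S1(4) d in linarith)
  ultimately have close: "norm (?S' - (S + (\<Sum>k\<in>insert k K. c k *\<^sub>R outer (v k) (v k)))) < \<epsilon>"
    by (simp only:)
  have nT: "norm (?T) \<le> norm S + (\<Sum>k\<in>K. \<bar>c k\<bar> * norm (outer (v k) (v k)))"
    by (rule order.trans[OF norm_triangle_ineq]) (auto intro!: order.trans[OF norm_sum] sum_mono)
  have nS1: "norm S1 \<le> norm (S1 - ?T) + norm ?T" using norm_triangle_ineq[of "S1 - ?T" ?T] by simp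
  have r1: "norm S1 < r" using nS1 nT S1(4) le insert.prems(3) mult_nonneg_nonneg[OF abs_ge_zero[of "c k"] norm_ge_zero[of ?E]] by linarith
  have "norm ?S' \<le> norm S1 + norm ((c' - c k) *\<^sub>R ?E) + norm (c k *\<^sub>R ?E)"
  proof -
    have "?S' = S1 + ((c' - c k) *\<^sub>R ?E + c k *\<^sub>R ?E)" by (simp add: algebra_simps)
    then have "norm ?S' = norm (S1 + ((c' - c k) *\<^sub>R ?E + c k *\<^sub>R ?E))" by (rule arg_cong)
    then show ?thesis using norm_triangle_ineq[of S1 "(c' - c k) *\<^sub>R ?E + c k *\<^sub>R ?E"] norm_triangle_ineq[of "(c' - c k) *\<^sub>R ?E" "c k *\<^sub>R ?E"] by linarith
  qed
  then have r2: "norm ?S' < r" using nS1 nT S1(4) le d by simp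
  have sym': "?S' \<in> Sym" using S1(1) by (simp add: transpose_add transpose_scalar transpose_outer)
  have "reach G r S1 ?S'"
    by (rule reach_rank_one[OF G reg]) (use S1 r1 r2 sym' c' in auto)
  with S1(2) have "reach G r S ?S'" by (rule reach_trans)
  with sym' close c'(2) show ?case by blast
qed

text \<open>
  With the coefficients \<open>dyad_coeff\<close> these vectors realize the polarization identity
  \<open>(e\<^sub>i + e\<^sub>j) (e\<^sub>i + e\<^sub>j)\<^sup>T - (e\<^sub>i - e\<^sub>j) (e\<^sub>i - e\<^sub>j)\<^sup>T = 2 (e\<^sub>i e\<^sub>j\<^sup>T + e\<^sub>j e\<^sub>i\<^sup>T)\<close>.
\<close>

definition dyad_vec :: "'n \<times> 'n \<times> bool \<Rightarrow> real^'n" where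
  "dyad_vec = (\<lambda>(i, j, b). axis i 1 + (if b then 1 else - 1) *\<^sub>R axis j 1)"

definition dyad_coeff :: "real^'n^'n \<Rightarrow> 'n \<times> 'n \<times> bool \<Rightarrow> real" where
  "dyad_coeff S = (\<lambda>(i, j, b). (if b then 1 else - 1) * (S $ i $ j / 4))"

lemma symmetric_dyad_decomposition:
  fixes S :: "real^'n::finite^'n"
  assumes "S \<in> Sym"
  shows "S = (\<Sum>k\<in>UNIV. dyad_coeff S k *\<^sub>R outer (dyad_vec k) (dyad_vec k))"
proof -
  have sym: "S $ k $ l = S $ l $ k" for k l
  proof -
    have "transpose S $ k $ l = S $ k $ l" using assms by simp
    then show ?thesis by (simp add: transpose_def)
  qed
  have "(\<Sum>k\<in>UNIV. dyad_coeff S k *\<^sub>R outer (dyad_vec k) (dyad_vec k)) $ k $ l = S $ k $ l" for k l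
  proof -
    have "(\<Sum>k\<in>UNIV. dyad_coeff S k *\<^sub>R outer (dyad_vec k) (dyad_vec k)) $ k $ l
       = (\<Sum>i\<in>UNIV. \<Sum>j\<in>UNIV. \<Sum>b\<in>UNIV. dyad_coeff S (i, j, b) * (dyad_vec (i, j, b) $ k * dyad_vec (i, j, b) $ l))"
      by (simp add: sum.cartesian_product UNIV_Times_UNIV case_prod_unfold)
    also have "\<dots> = (\<Sum>i\<in>UNIV. \<Sum>j\<in>UNIV. (if j = l then (if i = k then S $ i $ l / 2 else 0) else 0) + (if j = k then (if i = l then S $ i $ k / 2 else 0) else 0))"
      by (intro sum.cong refl) (auto simp: UNIV_bool dyad_coeff_def dyad_vec_def axis_def)
    also have "\<dots> = (\<Sum>i\<in>UNIV. (if i = k then S $ i $ l / 2 else 0) + (if i = l then S $ i $ k / 2 else 0))"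
      by (simp add: sum.distrib)
    also have "\<dots> = S $ k $ l / 2 + S $ l $ k / 2"
      by (simp add: sum.distrib)
    also have "\<dots> = S $ k $ l" using sym[of k l] by simp
    finally show ?thesis .
  qed
  then show ?thesis by (simp add: vec_eq_iff)
qed

text \<open>
  Decompose \<open>S2 - S1\<close> into rank one matrices and follow them approximately; the remaining
  short segment ends at \<open>S2\<close>, so it stays in the open set where the determinant is not zero.
\<close>

lemma reach_locally:
  assumes r: "r > 0"
  obtains r0 where "r0 > 0" "r0 \<le> r"
    "\<And>G S1 S2 :: 'd::finite phase_matrix. G \<in> Sp \<Longrightarrow> (\<And>S :: 'd phase_matrix. S \<in> ball 0 r \<Longrightarrow> regular S) \<Longrightarrow>
       S1 \<in> Sym \<inter> ball 0 r0 \<Longrightarrow> S2 \<in> Sym \<inter> ball 0 r0 \<Longrightarrow>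
       det (chart_det G S1) \<noteq> 0 \<Longrightarrow> det (chart_det G S2) \<noteq> 0 \<Longrightarrow> reach G r S1 S2"
proof
  define C where "C = (\<Sum>k\<in>UNIV. norm (outer (dyad_vec k) (dyad_vec k) :: 'd phase_matrix))"
  have C: "C \<ge> 0" unfolding C_def by (intro sum_nonneg) auto
  \<comment> \<open>Two points of norm below \<open>r0\<close> are joined by dyadic steps of total length at most
      \<open>2 C r0\<close>, so half of the radius \<open>r\<close> remains for the errors.\<close>
  define r0 where "r0 = r / (2 * (1 + 2 * C))"
  show r0: "r0 > 0" using r C by (simp add: r0_def)
  show "r0 \<le> r" using r C by (simp add: r0_def field_simps)
  have "r0 * (2 * (1 + 2 * C)) = r" using C by (simp add: r0_def)
  then have r0r: "r0 + 2 * C * r0 = r / 2" by (simp add: algebra_simps)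
  fix G S1 S2 :: "'d phase_matrix"
  assume G: "G \<in> Sp" and reg: "\<And>S :: 'd phase_matrix. S \<in> ball 0 r \<Longrightarrow> regular S"
    and S1: "S1 \<in> Sym \<inter> ball 0 r0" and S2: "S2 \<in> Sym \<inter> ball 0 r0"
    and off: "det (chart_det G S1) \<noteq> 0" "det (chart_det G S2) \<noteq> 0"
  have "open {S. det (chart_det G S) \<noteq> 0}"
    unfolding chart_det_def by (intro open_Collect_neq continuous_intros)
  then obtain e where e: "e > 0" "\<And>S. dist S2 S < e \<Longrightarrow> det (chart_det G S) \<noteq> 0"
    using off(2) unfolding open_contains_ball by (auto simp: subset_eq)
  define \<epsilon> where "\<epsilon> = min (r / 2) e"
  have \<epsilon>: "\<epsilon> > 0" "\<epsilon> \<le> r / 2" "\<epsilon> \<le> e" using e r by (auto simp: \<epsilon>_def)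
  let ?c = "dyad_coeff (S2 - S1)"
  have sym: "S2 - S1 \<in> Sym" using S1 S2 by (simp add: transpose_diff)
  have cb: "\<bar>?c k\<bar> \<le> norm (S2 - S1)" for k
  proof -
    obtain i j b where k: "k = (i, j, b)" by (cases k) auto
    have "\<bar>?c k\<bar> \<le> \<bar>(S2 - S1) $ i $ j\<bar>" by (simp add: k dyad_coeff_def abs_mult)
    also have "\<dots> \<le> norm ((S2 - S1) $ i)" by (rule component_le_norm_cart)
    also have "\<dots> \<le> norm (S2 - S1)" by (rule Finite_Cartesian_Product.norm_nth_le)
    finally show ?thesis .
  qed
  have "(\<Sum>k\<in>UNIV. \<bar>?c k\<bar> * norm (outer (dyad_vec k) (dyad_vec k) :: 'd phase_matrix)) \<le> (\<Sum>k\<in>UNIV. norm (S2 - S1) * norm (outer (dyad_vec k) (dyad_vec k) :: 'd phase_matrix))"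
    by (intro sum_mono mult_right_mono cb) auto
  also have "\<dots> = norm (S2 - S1) * C" by (simp add: C_def sum_distrib_left)
  also have "\<dots> \<le> 2 * r0 * C"
  proof -
    have "norm (S2 - S1) \<le> 2 * r0" using norm_triangle_ineq4[of S2 S1] S1 S2 by simp
    then show ?thesis using C by (intro mult_right_mono) auto
  qed
  finally have "norm S1 + (\<Sum>k\<in>UNIV. \<bar>?c k\<bar> * norm (outer (dyad_vec k) (dyad_vec k) :: 'd phase_matrix)) + \<epsilon> \<le> r"
    using S1 r0r \<epsilon>(2) by (simp add: mult_ac)
  from reach_approx[OF G reg finite _ off(1) \<epsilon>(1) this] S1
  obtain S' where S': "S' \<in> Sym" "reach G r S1 S'" "norm (S' - (S1 + (\<Sum>k\<in>UNIV. ?c k *\<^sub>R outer (dyad_vec k) (dyad_vec k)))) < \<epsilon>"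
    by auto
  then have close: "norm (S' - S2) < \<epsilon>" by (simp flip: symmetric_dyad_decomposition[OF sym])
  have "norm S' \<le> norm (S' - S2) + norm S2" using norm_triangle_ineq[of "S' - S2" S2] by simp
  moreover have "norm S2 < r / 2" using S2 r0r r0 C by (simp add: add_increasing2) (smt (verit) mult_nonneg_nonneg)
  ultimately have "norm S' < r" using close \<epsilon>(2) by linarith
  have "reach G r S' (S' + (S2 - S'))"
  proof (rule reach_no_crossing[OF G reg])
    show "S' \<in> Sym \<inter> ball 0 r" using S' \<open>norm S' < r\<close> by simp
    show "S' + (S2 - S') \<in> Sym \<inter> ball 0 r" using S2 \<open>r0 \<le> r\<close> by simp
    show "det (chart_det G (S' + t *\<^sub>R (S2 - S'))) \<noteq> 0" if t: "t \<in> {0..1}" for t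
    proof (rule e(2))
      have "S2 - (S' + t *\<^sub>R (S2 - S')) = (1 - t) *\<^sub>R (S2 - S')" by (simp add: algebra_simps)
      then have "dist S2 (S' + t *\<^sub>R (S2 - S')) = (1 - t) * norm (S' - S2)" using t by (simp add: dist_norm norm_minus_commute)
      also have "\<dots> \<le> 1 * norm (S' - S2)" using t by (intro mult_right_mono) auto
      finally show "dist S2 (S' + t *\<^sub>R (S2 - S')) < e" using close \<epsilon>(3) by simp
    qed
  qed auto
  with S'(2) show "reach G r S1 S2" using reach_trans by fastforce
qed

section \<open>Transverse representatives of short paths\<close>

text \<open>The inverse Cayley transform, \<open>- J (N - 1) (N + 1)\<^sup>-\<^sup>1\<close>.\<close>

definition chart_inv :: "'d::finite phase_matrix \<Rightarrow> 'd phase_matrix" where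
  "chart_inv N = - (J ** (N - mat 1) ** cramer_inv (N + mat 1))"

lemma cramer_inv_unique:
  fixes A B :: "real^'n^'n"
  assumes "A ** B = mat 1" shows "cramer_inv A = B"
proof -
  have "det A \<noteq> 0" using assms by (metis det_I det_mul mult_zero_left zero_neq_one)
  have "cramer_inv A = cramer_inv A ** (A ** B)" by (simp add: assms)
  also have "\<dots> = B" using cramer_inv_left[OF \<open>det A \<noteq> 0\<close>] by (simp add: matrix_mul_assoc)
  finally show ?thesis .
qed

lemma
  assumes N: "N \<in> Sp" and d: "det (N + mat 1) \<noteq> 0"
  shows chart_inv_Sym: "chart_inv N \<in> Sym" and chart_chart_inv: "chart G (chart_inv N) = G ** N"
proof -
  let ?N1 = "N + mat 1" and ?Q = "cramer_inv (N + mat 1)"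
  have Q: "?N1 ** ?Q = mat 1" "?Q ** ?N1 = mat 1" using cramer_inv_right[OF d] cramer_inv_left[OF d] by auto
  define W where "W = transpose N ** J - J ** N"
  have "transpose W = W" by (simp add: W_def transpose_diff matrix_transpose_mul transpose_J matrix_alg)
  have K: "chart_inv N ** ?N1 = - (J ** (N - mat 1))"
    unfolding chart_inv_def matrix_neg_left by (simp add: Q flip: matrix_mul_assoc)
  have "transpose ?N1 ** (chart_inv N ** ?N1) = W"
    unfolding K W_def using SpD[OF N] by (simp add: transpose_add transpose_mat matrix_alg matrix_mul_assoc)
  then have "transpose ?Q ** (transpose ?N1 ** (chart_inv N ** ?N1)) ** ?Q = transpose ?Q ** W ** ?Q" by simp
  moreover have "transpose ?Q ** (transpose ?N1 ** (chart_inv N ** ?N1)) ** ?Q = transpose (?N1 ** ?Q) ** chart_inv N ** (?N1 ** ?Q)"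
    by (simp add: matrix_transpose_mul matrix_mul_assoc)
  ultimately have "chart_inv N = transpose ?Q ** W ** ?Q" by (simp add: Q transpose_mat)
  then show "chart_inv N \<in> Sym" using \<open>transpose W = W\<close> by (simp add: matrix_transpose_mul matrix_mul_assoc)
  have JK: "J ** chart_inv N = (N - mat 1) ** ?Q"
    by (simp add: chart_inv_def matrix_neg_right matrix_mul_assoc J_J matrix_neg_left matrix_diff_left)
  have 1: "mat 1 = ?N1 ** ?Q" by (simp add: Q)
  have "mat 1 + J ** chart_inv N = (?N1 + (N - mat 1)) ** ?Q" unfolding JK by (subst 1) (simp only: matrix_add_left)
  moreover have "?N1 + (N - mat 1) = 2 *\<^sub>R N" by (simp add: scaleR_2)
  ultimately have P: "mat 1 + J ** chart_inv N = 2 *\<^sub>R (N ** ?Q)" by (simp only: matrix_scaleR_left)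
  have "mat 1 - J ** chart_inv N = (?N1 - (N - mat 1)) ** ?Q" unfolding JK by (subst 1) (simp only: matrix_diff_left)
  moreover have "?N1 - (N - mat 1) = 2 *\<^sub>R mat 1" by (simp add: scaleR_2)
  ultimately have Mi: "mat 1 - J ** chart_inv N = 2 *\<^sub>R ?Q" by (simp only: matrix_scaleR_left matrix_mul_lid)
  have "cramer_inv (mat 1 - J ** chart_inv N) = (1/2) *\<^sub>R ?N1"
    unfolding Mi by (rule cramer_inv_unique) (simp add: matrix_scaleR_left matrix_scaleR_right Q)
  then show "chart G (chart_inv N) = G ** N"
    unfolding chart_def P by (simp add: matrix_scaleR_left matrix_scaleR_right Q flip: matrix_mul_assoc)
qed

text \<open>
  The chart at \<open>G\<close> has size independent of \<open>G\<close>, because it is a left translate of the chart at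
  \<open>1\<close>. In the chart the path and the transverse path with the same ends lie in a convex set.
\<close>

lemma transverse_locally:
  obtains \<delta> where "\<delta> > 0"
    "\<And>(G :: 'd::finite phase_matrix) p. G \<in> Sp \<Longrightarrow> path p \<Longrightarrow> path_image p \<subseteq> {M \<in> Sp. norm (spinv G ** M - mat 1) < \<delta>} \<Longrightarrow>
       pathstart p \<notin> Sp0 1 \<Longrightarrow> pathfinish p \<notin> Sp0 1 \<Longrightarrow> \<exists>\<eta>. transverse_path 1 \<eta> \<and> homotopic_paths Sp p \<eta>"
proof -
  have "regular (0 :: 'd phase_matrix)" by (simp add: regular_def)
  then obtain r where r: "r > 0" and reg: "\<And>S :: 'd phase_matrix. S \<in> ball 0 r \<Longrightarrow> regular S"
    using open_regular[where 'a='d] unfolding open_contains_ball by (auto simp: subset_eq)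
  obtain r0 where r0: "r0 > 0" "r0 \<le> r"
    and R0: "\<And>G S1 S2 :: 'd phase_matrix. G \<in> Sp \<Longrightarrow> (\<And>S :: 'd phase_matrix. S \<in> ball 0 r \<Longrightarrow> regular S) \<Longrightarrow> S1 \<in> Sym \<inter> ball 0 r0 \<Longrightarrow> S2 \<in> Sym \<inter> ball 0 r0 \<Longrightarrow>
       det (chart_det G S1) \<noteq> 0 \<Longrightarrow> det (chart_det G S2) \<noteq> 0 \<Longrightarrow> reach G r S1 S2"
    by (rule reach_locally[OF r, where 'd='d]) blast
  note R = R0[OF _ reg]
  let ?U = "{N :: 'd phase_matrix. det (N + mat 1) \<noteq> 0}"
  have U: "open ?U" by (intro open_Collect_neq continuous_intros)
  have ck: "continuous_on ?U chart_inv" unfolding chart_inv_def by (intro continuous_intros) auto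
  have "open (?U \<inter> chart_inv -` ball 0 r0)" using continuous_open_preimage[OF ck U] by simp
  moreover have "mat 1 \<in> ?U \<inter> chart_inv -` ball 0 r0"
  proof -
    have "mat 1 + mat 1 = (2::real) *\<^sub>R (mat 1 :: 'd phase_matrix)" by (simp add: scaleR_2)
    moreover have "(2 *\<^sub>R mat 1 :: 'd phase_matrix) ** ((1/2) *\<^sub>R mat 1) = mat 1" by (simp add: matrix_alg)
    ultimately have "det (mat 1 + mat 1 :: 'd phase_matrix) \<noteq> 0" by (metis det_I det_mul mult_zero_left zero_neq_one)
    moreover have "chart_inv (mat 1 :: 'd phase_matrix) = 0"
    proof -
      have "(J :: 'd phase_matrix) ** 0 ** X = 0" for X :: "'d phase_matrix"
        by (simp add: vec_eq_iff matrix_matrix_mult_def)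
      then show ?thesis by (simp add: chart_inv_def)
    qed
    ultimately show ?thesis using r0 by simp
  qed
  ultimately obtain \<delta> where \<delta>: "\<delta> > 0" "ball (mat 1) \<delta> \<subseteq> ?U \<inter> chart_inv -` ball 0 r0"
    unfolding open_contains_ball by blast
  have "\<exists>\<eta>. transverse_path 1 \<eta> \<and> homotopic_paths Sp p \<eta>"
    if G: "G \<in> Sp" and p: "path p" "path_image p \<subseteq> {M \<in> Sp. norm (spinv G ** M - mat 1) < \<delta>}"
    and off: "pathstart p \<notin> Sp0 1" "pathfinish p \<notin> Sp0 1" for G :: "'d phase_matrix" and p
  proof -
    let ?N = "\<lambda>t. spinv G ** p t"
    let ?S = "\<lambda>t. chart_inv (?N t)"
    have pt: "p t \<in> Sp" "norm (?N t - mat 1) < \<delta>" if "t \<in> {0..1}" for t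
    proof -
      have "p t \<in> path_image p" using that by (simp add: path_image_def)
      with p(2) show "p t \<in> Sp" "norm (?N t - mat 1) < \<delta>" by blast+
    qed
    have NSp: "?N t \<in> Sp" if "t \<in> {0..1}" for t using Sp_mult[OF spinv_Sp[OF G] pt(1)[OF that]] .
    have "?N t \<in> ball (mat 1) \<delta>" if "t \<in> {0..1}" for t
      using pt(2)[OF that] by (simp add: dist_norm norm_minus_commute)
    with \<delta>(2) have NU: "?N t \<in> ?U" "?S t \<in> ball 0 r0" if "t \<in> {0..1}" for t using that by blast+
    have Ssym: "?S t \<in> Sym" if "t \<in> {0..1}" for t using chart_inv_Sym[OF NSp[OF that]] NU(1)[OF that] by blast
    have chS: "chart G (?S t) = p t" if "t \<in> {0..1}" for t
    proof -
      have "chart G (?S t) = G ** ?N t" using chart_chart_inv[OF NSp[OF that]] NU(1)[OF that] by blast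
      then show ?thesis by (simp add: matrix_mul_assoc spinv_right[OF G])
    qed
    have cN: "continuous_on {0..1} ?N" using p(1) unfolding path_def by (intro continuous_intros)
    have "path ?S" unfolding path_def
      by (rule continuous_on_compose2[OF ck cN]) (use NU in blast)
    have Sball: "?S t \<in> ball 0 r" if "t \<in> {0..1}" for t using NU(2)[OF that] subset_ball[OF r0(2)] by blast
    have Simg: "path_image ?S \<subseteq> Sym \<inter> ball 0 r" unfolding path_image_def using Ssym Sball by blast
    have regS: "regular (?S t)" if "t \<in> {0..1}" for t using reg[OF Sball[OF that]] .
    have offS: "det (chart_det G (?S t)) \<noteq> 0" if "t \<in> {0..1}" "p t \<notin> Sp0 1" for t
      using that pt(1)[OF that(1)] det_chart_minus_one[OF regS[OF that(1)], of G] chS[OF that(1)]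
      by (auto simp: Sp0_def det_shifted)
    have "reach G r (?S 0) (?S 1)"
      using off by (intro R[OF G] offS IntI Ssym NU(2)) (auto simp: pathstart_def pathfinish_def)
    then obtain \<sigma> where \<sigma>: "path \<sigma>" "path_image \<sigma> \<subseteq> Sym \<inter> ball 0 r" "pathstart \<sigma> = ?S 0" "pathfinish \<sigma> = ?S 1"
       "transverse_path 1 (chart G \<circ> \<sigma>)" unfolding reach_def by blast
    have "simply_connected (Sym \<inter> ball 0 r :: 'd phase_matrix set)"
      by (rule convex_imp_simply_connected[OF convex_Sym_ball])
    then have hom: "homotopic_paths (Sym \<inter> ball 0 r) ?S \<sigma>"
      unfolding simply_connected_eq_homotopic_paths using \<open>path ?S\<close> Simg \<sigma> by (simp add: pathstart_def pathfinish_def)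
    have "homotopic_paths Sp (chart G \<circ> ?S) (chart G \<circ> \<sigma>)"
    proof (rule homotopic_paths_continuous_image[OF hom])
      show "continuous_on (Sym \<inter> ball 0 r) (chart G)"
        using continuous_on_chart[OF continuous_on_id, of "Sym \<inter> ball 0 r" G] reg by auto
      show "chart G \<in> Sym \<inter> ball 0 r \<rightarrow> Sp" using chart_in_Sp[OF G] reg by auto
    qed
    moreover have "homotopic_paths Sp p (chart G \<circ> ?S)"
      by (rule homotopic_paths_eq[OF p(1)]) (use p(2) chS in auto)
    ultimately show ?thesis using \<sigma>(5) homotopic_paths_trans by blast
  qed
  then show thesis using \<delta>(1) that by blast
qed

section \<open>Leaving the hypersurface by rotation\<close>

text \<open>
  The matrix \<open>e\<^bsup>-sJ\<^esup>\<close>, by which the definition of the index perturbs a path.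
\<close>

definition rot :: "real \<Rightarrow> 'd::finite phase_matrix" where
  "rot s = cos s *\<^sub>R mat 1 - sin s *\<^sub>R J"

lemma matrix_exp_rot: "matrix_exp (- (s *\<^sub>R J)) = rot s"
  using matrix_exp_J[of "- s"] by (simp add: rot_def)

lemma rot_Sp: "rot s \<in> Sp"
proof (rule SpI)
  have "transpose (rot s) = cos s *\<^sub>R mat 1 + sin s *\<^sub>R (J :: 'a phase_matrix)"
    by (simp add: rot_def transpose_diff transpose_scalar transpose_mat transpose_J)
  then have "transpose (rot s) ** J ** rot s = (cos s * cos s + sin s * sin s) *\<^sub>R (J :: 'a phase_matrix)"
    by (simp add: rot_def matrix_alg J_J algebra_simps flip: scaleR_add_left)
  then show "transpose (rot s) ** J ** rot s = (J :: 'a phase_matrix)"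
    using sin_cos_squared_add3[of s] by simp
qed

lemma continuous_on_rot [continuous_intros]:
  fixes f :: "'b::t2_space \<Rightarrow> real"
  shows "continuous_on S f \<Longrightarrow> continuous_on S (\<lambda>x. rot (f x))"
  unfolding rot_def by (intro continuous_intros)

lemma rot_0: "rot 0 = mat 1" by (simp add: rot_def)

lemma real_pencil_nonzero:
  fixes M :: "'d::finite phase_matrix"
  assumes "M \<in> Sp" shows "real_pencil M \<noteq> 0"
proof
  assume "real_pencil M = 0"
  then have "cdet (\<i> * of_real 1) M = 0" by (simp add: cdet_eq_sum)
  then show False using cdet_imaginary_nonzero[OF assms, of 1] by simp
qed

text \<open>
  With \<open>t = tan (s / 2)\<close> one has \<open>(1 + t J) e\<^bsup>-sJ\<^esup> = 1 - t J\<close>. Hence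
  \<open>(1 + t J) (e\<^bsup>-sJ\<^esup> M - 1) = (M - 1) - t J (M + 1)\<close>, whose determinant is a
  non-zero polynomial in \<open>t\<close>.
\<close>

lemma rot_off_hypersurface:
  fixes M :: "'d::finite phase_matrix"
  assumes M: "M \<in> Sp"
  shows "\<forall>\<^sub>F s in at_right 0. det (rot s ** M - mat 1) \<noteq> 0"
proof -
  have "finite {x. poly (real_pencil M) x = 0}" using real_pencil_nonzero[OF M] by (rule poly_roots_finite)
  then have "\<not> 0 islimpt {x. poly (real_pencil M) x = 0}" by (rule islimpt_finite)
  then have ev: "\<forall>\<^sub>F x in at 0. poly (real_pencil M) x \<noteq> 0" by (simp add: islimpt_iff_eventually)
  have lim: "filterlim (\<lambda>s. - tan (s / 2)) (at 0) (at_right (0::real))"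
    unfolding filterlim_at
  proof
    show "\<forall>\<^sub>F s in at_right 0. - tan (s / 2) \<in> UNIV \<and> - tan (s / 2) \<noteq> (0::real)"
    proof -
      have "\<forall>\<^sub>F s in at_right 0. s \<in> {0<..<pi}" by (intro eventually_at_right_real) auto
      then show ?thesis
      proof eventually_elim
        case (elim s)
        then have "0 < s / 2" "s / 2 < pi / 2" by auto
        from tan_gt_zero[OF this] show ?case by simp
      qed
    qed
    have "((\<lambda>s. - tan (s / 2)) \<longlongrightarrow> - tan (0 / 2)) (at_right (0::real))"
      by (intro tendsto_intros) auto
    then show "((\<lambda>s. - tan (s / 2)) \<longlongrightarrow> 0) (at_right (0::real))" by simp
  qed
  have "\<forall>\<^sub>F s in at_right 0. poly (real_pencil M) (- tan (s / 2)) \<noteq> 0"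
    using lim ev unfolding filterlim_iff by blast
  moreover have "\<forall>\<^sub>F s in at_right 0. s \<in> {0<..<pi}" by (intro eventually_at_right_real) auto
  ultimately show ?thesis
  proof eventually_elim
    case (elim s)
    let ?t = "tan (s / 2)"
    have c: "cos (s / 2) \<noteq> 0" using elim by (intro cos_gt_zero_pi[THEN less_imp_neq, symmetric]) auto
    have s2: "sin s = 2 * sin (s / 2) * cos (s / 2)" "cos s = cos (s/2) * cos (s/2) - sin (s/2) * sin (s/2)"
      using sin_double[of "s / 2"] cos_double[of "s / 2"] by (simp_all add: power2_eq_square)
    have sq: "sin (s/2) * sin (s/2) = 1 - cos (s/2) * cos (s/2)" using sin_cos_squared_add3[of "s/2"] by linarith
    have 1: "cos s + ?t * sin s = 1" using c by (simp add: s2 tan_def sq field_simps)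
    have 2: "?t * cos s - sin s = - ?t"
    proof -
      have "?t * cos s - sin s = ?t * (cos s - 2 * cos (s/2) * cos (s/2))" using c by (simp add: s2(1) tan_def field_simps)
      also have "cos s - 2 * cos (s/2) * cos (s/2) = - 1" using sq by (simp add: s2(2))
      finally show ?thesis by simp
    qed
    have R: "(mat 1 + ?t *\<^sub>R J) ** rot s = mat 1 - ?t *\<^sub>R (J :: 'd phase_matrix)"
    proof -
      have "(mat 1 + ?t *\<^sub>R J) ** rot s = (cos s + ?t * sin s) *\<^sub>R mat 1 + (?t * cos s - sin s) *\<^sub>R (J :: 'd phase_matrix)"
        by (simp add: rot_def matrix_alg J_J algebra_simps)
      then show ?thesis by (simp add: 1 2)
    qed
    have "(mat 1 + ?t *\<^sub>R J) ** (rot s ** M - mat 1) = (mat 1 - ?t *\<^sub>R J) ** M - (mat 1 + ?t *\<^sub>R J)"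
      by (simp add: matrix_diff_right matrix_mul_assoc R)
    also have "\<dots> = (M - mat 1) + mat (- ?t) ** (J ** (M + mat 1))"
    proof -
      have m: "mat (- ?t) ** X = - (?t *\<^sub>R X)" for X :: "'d phase_matrix" by (simp add: vec_eq_iff)
      show ?thesis unfolding m by (simp add: matrix_alg algebra_simps)
    qed
    finally have "det ((mat 1 + ?t *\<^sub>R J) ** (rot s ** M - mat 1)) = det ((M - mat 1) + mat (- ?t) ** (J ** (M + mat 1)))"
      by (rule arg_cong)
    also have "\<dots> = poly (real_pencil M) (- ?t)" unfolding real_pencil_def by (rule poly_pdet[symmetric])
    finally have "det (mat 1 + ?t *\<^sub>R (J :: 'd phase_matrix)) * det (rot s ** M - mat 1) = poly (real_pencil M) (- ?t)"
      by (simp only: det_mul)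
    then show ?case using elim(1) by auto
  qed
qed

lemma off_Sp0: "M \<in> Sp \<Longrightarrow> M \<notin> Sp0 1 \<longleftrightarrow> det (M - mat 1) \<noteq> 0"
  by (simp add: Sp0_def det_shifted)

text \<open>Rotating by a small angle leaves the hypersurface.\<close>

lemma escape_path:
  fixes M :: "'d::finite phase_matrix"
  assumes M: "M \<in> Sp" and e: "e > 0"
  shows "\<exists>\<rho>. path \<rho> \<and> path_image \<rho> \<subseteq> {N \<in> Sp. norm (spinv M ** N - mat 1) < e} \<and> pathstart \<rho> = M \<and> pathfinish \<rho> \<notin> Sp0 1"
proof -
  have "continuous_on UNIV (\<lambda>s. spinv M ** (rot s ** M))" by (intro continuous_intros)
  then have "((\<lambda>s. spinv M ** (rot s ** M)) \<longlongrightarrow> spinv M ** (rot 0 ** M)) (at 0)"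
    by (simp add: continuous_on_def)
  then have "\<forall>\<^sub>F s in at 0. dist (spinv M ** (rot s ** M)) (mat 1) < e"
    using e by (intro tendstoD) (simp_all add: rot_0 spinv_left[OF M])
  then obtain d where d: "d > 0" "\<And>s. s \<noteq> 0 \<Longrightarrow> \<bar>s\<bar> < d \<Longrightarrow> dist (spinv M ** (rot s ** M)) (mat 1) < e"
    unfolding eventually_at by (auto simp: dist_real_def)
  have "\<forall>\<^sub>F s in at_right 0. s \<in> {0<..<d}" using d by (intro eventually_at_right_real)
  with rot_off_hypersurface[OF M] have "\<forall>\<^sub>F s in at_right 0. det (rot s ** M - mat 1) \<noteq> 0 \<and> s \<in> {0<..<d}"
    by eventually_elim simp
  then obtain s where s: "det (rot s ** M - mat 1) \<noteq> 0" "0 < s" "s < d"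
    using eventually_happens'[of "at_right (0::real)"] by (auto simp: trivial_limit_at_right_real)
  let ?r = "\<lambda>t. rot (t * s) ** M"
  have Spr: "?r t \<in> Sp" for t using Sp_mult[OF rot_Sp M] .
  have "norm (spinv M ** ?r t - mat 1) < e" if "t \<in> {0..1}" for t
  proof (cases "t * s = 0")
    case True
    then show ?thesis using e by (simp only: rot_0) (simp add: spinv_left[OF M])
  next
    case False
    have "t * s \<le> 1 * s" using that s by (intro mult_right_mono) auto
    moreover have "0 \<le> t * s" using that s by simp
    ultimately have "\<bar>t * s\<bar> < d" using s(3) by linarith
    with False d(2)[of "t * s"] show ?thesis by (simp add: dist_norm)
  qed
  moreover have "path ?r" unfolding path_def by (intro continuous_intros)
  moreover have "pathstart ?r = M" by (simp add: pathstart_def rot_0)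
  moreover have "pathfinish ?r \<notin> Sp0 1" using s(1) Spr[of 1] by (simp add: pathfinish_def off_Sp0)
  ultimately show ?thesis using Spr by (intro exI[of _ ?r]) (auto simp: path_image_def)
qed

section \<open>Transverse representatives of arbitrary paths\<close>

lemma norm_matrix_mult_bound:
  obtains K where "K > 0" "\<And>A B :: real^'n::finite^'n. norm (A ** B) \<le> norm A * norm B * K"
  using bounded_bilinear.pos_bounded[OF bounded_bilinear_matrix_mult[where 'a=real]] by blast

definition transversal_class :: "(real \<Rightarrow> 'd::finite phase_matrix) \<Rightarrow> bool" where
  "transversal_class p \<longleftrightarrow> (\<exists>\<eta>. transverse_path 1 \<eta> \<and> homotopic_paths Sp p \<eta>)"

lemma transversal_class_homotopic: "homotopic_paths Sp p q \<Longrightarrow> transversal_class q \<Longrightarrow> transversal_class p"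
  unfolding transversal_class_def using homotopic_paths_trans by blast

lemma transversal_class_join:
  assumes "transversal_class p" "transversal_class q" "pathfinish p = pathstart q"
  shows "transversal_class (p +++ q)"
proof -
  obtain \<eta> \<theta> where "transverse_path 1 \<eta>" "homotopic_paths Sp p \<eta>" "transverse_path 1 \<theta>" "homotopic_paths Sp q \<theta>"
    using assms unfolding transversal_class_def by blast
  moreover from this have "pathfinish \<eta> = pathstart \<theta>"
    using assms(3) homotopic_paths_imp_pathfinish homotopic_paths_imp_pathstart by metis
  ultimately show ?thesis unfolding transversal_class_def
    using transverse_path_join homotopic_paths_join assms(3) by blast
qed

lemma path_subpath_Sp:
  assumes "path p" "path_image p \<subseteq> Sp" "a \<in> {0..1}" "b \<in> {0..1}"
  shows "path (subpath a b p)" "path_image (subpath a b p) \<subseteq> Sp"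
  using path_subpath[OF assms(1,3,4)] order.trans[OF path_image_subpath_subset[OF assms(3,4)] assms(2)] by blast+

text \<open>
  Cut the path into short pieces. Each partial path is completed by a short detour that
  leaves the hypersurface; the induction hypothesis holds for one detour, and then for
  every other one of moderate length, because the loop formed by two detours at the same
  point is itself short.
\<close>

lemma transversal_class_exists:
  fixes p :: "real \<Rightarrow> 'd::finite phase_matrix"
  assumes p: "path p" "path_image p \<subseteq> Sp" and off: "pathstart p \<notin> Sp0 1" "pathfinish p \<notin> Sp0 1"
  shows "transversal_class p"
proof -
  obtain \<delta> where \<delta>: "\<delta> > 0" and loc: "\<And>(G :: 'd phase_matrix) p. G \<in> Sp \<Longrightarrow> path p \<Longrightarrow>
       path_image p \<subseteq> {M \<in> Sp. norm (spinv G ** M - mat 1) < \<delta>} \<Longrightarrow>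
       pathstart p \<notin> Sp0 1 \<Longrightarrow> pathfinish p \<notin> Sp0 1 \<Longrightarrow> transversal_class p"
    unfolding transversal_class_def by (rule transverse_locally[where 'd='d]) blast
  obtain K where K: "K > 0" "\<And>(A :: 'd phase_matrix) (B :: 'd phase_matrix). norm (A ** B) \<le> norm A * norm B * K"
    using norm_matrix_mult_bound by blast
  define V where "V e G = {M \<in> Sp. norm (spinv G ** M - mat 1) < e}" for e and G :: "'d phase_matrix"
  \<comment> \<open>Being \<open>\<delta>2\<close>-close twice implies being \<open>\<delta>\<close>-close: this is the fact \<open>V2\<close>.\<close>
  define \<delta>2 where "\<delta>2 = min 1 (\<delta> / (2 + K))"
  have "\<delta>2 \<le> \<delta> / (2 + K)" by (simp add: \<delta>2_def)
  then have "\<delta>2 * (2 + K) \<le> \<delta>" using K(1) by (simp add: pos_le_divide_eq)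
  moreover have "\<delta>2 > 0" "\<delta>2 \<le> 1" using \<delta> K(1) by (auto simp: \<delta>2_def)
  ultimately have \<delta>2: "\<delta>2 > 0" "\<delta>2 \<le> 1" "\<delta>2 * (2 + K) \<le> \<delta>" by auto
  have \<delta>2': "\<delta>2 \<le> \<delta>"
  proof -
    have "\<delta>2 * 1 \<le> \<delta>2 * (2 + K)" using \<delta>2(1) K(1) by (intro mult_left_mono) auto
    with \<delta>2(3) show ?thesis by simp
  qed
  have V2: "M \<in> V \<delta> G" if "G \<in> Sp" "G' \<in> V \<delta>2 G" "M \<in> V \<delta>2 G'" for G G' M
  proof -
    let ?A = "spinv G ** G' - mat 1" and ?B = "spinv G' ** M - mat 1"
    have "G' \<in> Sp" "M \<in> Sp" using that by (auto simp: V_def)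
    have "(spinv G ** G') ** (spinv G' ** M) = spinv G ** (G' ** spinv G') ** M" by (simp add: matrix_mul_assoc)
    then have "spinv G ** M - mat 1 = ?A ** ?B + ?A + ?B"
      by (simp add: matrix_alg spinv_right[OF \<open>G' \<in> Sp\<close>])
    then have "norm (spinv G ** M - mat 1) = norm (?A ** ?B + ?A + ?B)" by (rule arg_cong)
    then have "norm (spinv G ** M - mat 1) \<le> norm ?A * norm ?B * K + norm ?A + norm ?B"
      using norm_triangle_ineq[of "?A ** ?B + ?A" ?B] norm_triangle_ineq[of "?A ** ?B" ?A] K(2)[of ?A ?B] by linarith
    also have "norm ?A * norm ?B * K \<le> \<delta>2 * 1 * K"
      using that(2,3) \<delta>2 K(1) by (intro mult_right_mono mult_mono) (auto simp: V_def)
    also have "\<delta>2 * 1 * K + norm ?A + norm ?B < \<delta>2 * K + \<delta>2 + \<delta>2" using that(2,3) by (auto simp: V_def)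
    also have "\<dots> \<le> \<delta>" using \<delta>2(3) by (simp add: algebra_simps)
    finally show ?thesis using \<open>M \<in> Sp\<close> by (simp add: V_def)
  qed
  have pSp: "p t \<in> Sp" if "t \<in> {0..1}" for t
    using p(2) that by (metis imageI path_image_def subsetD)
  \<comment> \<open>A uniform step size, by uniform continuity of \<open>p s\<^sup>-\<^sup>1 p t\<close>.\<close>
  have "\<exists>d>0. \<forall>s\<in>{0..1}. \<forall>t\<in>{0..1}. \<bar>s - t\<bar> < d \<longrightarrow> p t \<in> V \<delta>2 (p s)"
  proof -
    have pc: "continuous_on {0..1} p" using p(1) by (simp add: path_def)
    have "continuous_on ({0..1} \<times> {0..1}) (\<lambda>x. spinv (p (fst x)) ** p (snd x))"
      by (intro continuous_intros continuous_on_compose2[OF pc] ; auto intro!: continuous_on_fst continuous_on_snd continuous_on_id)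
    then have "uniformly_continuous_on ({0..1} \<times> {0..1}) (\<lambda>x. spinv (p (fst x)) ** p (snd x))"
      by (rule compact_uniformly_continuous) (intro compact_Times compact_Icc)
    then obtain d where d: "d > 0" "\<And>x y. x \<in> {0..1} \<times> {0..1} \<Longrightarrow> y \<in> {0..1} \<times> {0..1} \<Longrightarrow> dist y x < d \<Longrightarrow>
        dist (spinv (p (fst y)) ** p (snd y)) (spinv (p (fst x)) ** p (snd x)) < \<delta>2"
      unfolding uniformly_continuous_on_def using \<delta>2(1) by metis
    have "p t \<in> V \<delta>2 (p s)" if st: "s \<in> {0..1}" "t \<in> {0..1}" "\<bar>s - t\<bar> < d" for s t
    proof -
      have "dist (s, t) (s, s) < d" using st(3) by (simp add: dist_Pair_Pair dist_real_def abs_minus_commute)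
      with d(2)[of "(s, s)" "(s, t)"] st show ?thesis
        by (simp add: V_def pSp dist_norm spinv_left)
    qed
    with d(1) show ?thesis by blast
  qed
  then obtain d where d: "d > 0" "\<And>s t. s \<in> {0..1} \<Longrightarrow> t \<in> {0..1} \<Longrightarrow> \<bar>s - t\<bar> < d \<Longrightarrow> p t \<in> V \<delta>2 (p s)" by blast
  \<comment> \<open>The invariant: some detour \<open>r\<close> of size \<open>\<delta>2\<close> completes the partial path.\<close>
  define E where "E t \<longleftrightarrow> (\<exists>r. path r \<and> path_image r \<subseteq> V \<delta>2 (p t) \<and> pathstart r = p t \<and> pathfinish r \<notin> Sp0 1 \<and>
      transversal_class (subpath 0 t p +++ r))" for t
  have VSp: "V e G \<subseteq> Sp" for e G by (auto simp: V_def)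
  \<comment> \<open>Exchange of the detour \<open>r\<close> for an arbitrary detour of size \<open>\<delta>\<close>, by inserting the
      short path \<open>r\<^sup>-\<^sup>1 r'\<close>.\<close>
  have E': "transversal_class (subpath 0 t p +++ r')" if t: "t \<in> {0..1}" and Et: "E t"
    and r': "path r'" "path_image r' \<subseteq> V \<delta> (p t)" "pathstart r' = p t" "pathfinish r' \<notin> Sp0 1" for t r'
  proof -
    obtain r where r: "path r" "path_image r \<subseteq> V \<delta>2 (p t)" "pathstart r = p t" "pathfinish r \<notin> Sp0 1" "transversal_class (subpath 0 t p +++ r)"
      using Et unfolding E_def by blast
    have rV: "path_image r \<subseteq> V \<delta> (p t)" using r(2) \<delta>2' by (auto simp: V_def)
    have 0: "transversal_class (reversepath r +++ r')"
    proof (rule loc[OF pSp[OF t]])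
      show "path_image (reversepath r +++ r') \<subseteq> {M \<in> Sp. norm (spinv (p t) ** M - mat 1) < \<delta>}"
        using rV r'(2) r(3) r'(3) by (subst path_image_join) (auto simp: V_def)
    qed (use r r' in auto)
    have 1: "transversal_class ((subpath 0 t p +++ r) +++ (reversepath r +++ r'))"
      by (rule transversal_class_join[OF r(5) 0]) simp
    have s: "path (subpath 0 t p)" "path_image (subpath 0 t p) \<subseteq> Sp" "pathfinish (subpath 0 t p) = p t"
      using path_subpath_Sp[OF p, of 0 t] t by auto
    have rS: "path_image r \<subseteq> Sp" "path_image r' \<subseteq> Sp" using r(2) r'(2) VSp by blast+
    let ?s = "subpath 0 t p"
    have "homotopic_paths Sp (?s +++ r') ((?s +++ r) +++ (reversepath r +++ r'))"
    proof -
      have "homotopic_paths Sp (?s +++ (r +++ (reversepath r +++ r'))) ((?s +++ r) +++ (reversepath r +++ r'))"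
        by (rule homotopic_paths_assoc) (use s r r' rS in \<open>auto simp: path_image_join\<close>)
      moreover have "homotopic_paths Sp r' (r +++ (reversepath r +++ r'))"
      proof -
        have a: "homotopic_paths Sp (r +++ (reversepath r +++ r')) ((r +++ reversepath r) +++ r')"
          by (rule homotopic_paths_assoc) (use s r r' rS in auto)
        have b: "homotopic_paths Sp ((r +++ reversepath r) +++ r') (linepath (p t) (p t) +++ r')"
          using homotopic_paths_join[OF homotopic_paths_rinv[OF r(1) rS(1)], of r' r'] r r' rS
          by (simp add: homotopic_paths_refl)
        have c: "homotopic_paths Sp (linepath (p t) (p t) +++ r') r'"
          using homotopic_paths_lid[OF r'(1) rS(2)] r'(3) by simp
        show ?thesis using homotopic_paths_trans[OF homotopic_paths_trans[OF a b] c] homotopic_paths_sym by blast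
      qed
      then have "homotopic_paths Sp (?s +++ r') (?s +++ (r +++ (reversepath r +++ r')))"
        using s r' by (intro homotopic_paths_join) (auto simp: homotopic_paths_refl)
      ultimately show ?thesis using homotopic_paths_trans by blast
    qed
    with 1 show ?thesis using transversal_class_homotopic by blast
  qed
  \<comment> \<open>The piece of \<open>p\<close> from \<open>a\<close> to \<open>b\<close> followed by a detour at \<open>p b\<close> is a detour at \<open>p a\<close>.\<close>
  have step: "E b" if ab: "a \<in> {0..1}" "b \<in> {0..1}" "a \<le> b" "b - a < d" and Ea: "E a" for a b
  proof -
    obtain r where r: "path r" "path_image r \<subseteq> V \<delta>2 (p b)" "pathstart r = p b" "pathfinish r \<notin> Sp0 1"
      using escape_path[OF pSp[OF ab(2)] \<delta>2(1)] unfolding V_def by blast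
    let ?m = "subpath a b p"
    have m: "path ?m" "path_image ?m \<subseteq> V \<delta>2 (p a)" "pathstart ?m = p a" "pathfinish ?m = p b"
    proof -
      show "path ?m" using ab p(1) by (intro path_subpath) auto
      have "path_image ?m = p ` {a..b}" using ab by (simp add: path_image_subpath)
      also have "\<dots> \<subseteq> V \<delta>2 (p a)" using d(2)[OF ab(1)] ab by auto
      finally show "path_image ?m \<subseteq> V \<delta>2 (p a)" .
    qed auto
    have rS: "path_image r \<subseteq> Sp" "path_image ?m \<subseteq> Sp" using r(2) m(2) VSp by blast+
    have pb: "p b \<in> V \<delta>2 (p a)" using d(2)[OF ab(1,2)] ab by auto
    have "path_image (?m +++ r) \<subseteq> V \<delta> (p a)"
      using m(2) r(2) V2[OF pSp[OF ab(1)] pb] \<delta>2' r(3) m(4)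
      by (subst path_image_join) (auto simp: V_def subset_iff)
    then have "transversal_class (subpath 0 a p +++ (?m +++ r))"
      using r m by (intro E'[OF ab(1) Ea]) auto
    moreover have "homotopic_paths Sp (subpath 0 b p +++ r) (subpath 0 a p +++ (?m +++ r))"
    proof -
      have s: "path (subpath 0 a p)" "path_image (subpath 0 a p) \<subseteq> Sp" using path_subpath_Sp[OF p, of 0 a] ab by auto
      have "homotopic_paths Sp (subpath 0 a p +++ ?m) (subpath 0 b p)"
        by (rule homotopic_join_subpaths[OF p]) (use ab in auto)
      then have "homotopic_paths Sp ((subpath 0 a p +++ ?m) +++ r) (subpath 0 b p +++ r)"
        using r rS m by (intro homotopic_paths_join) (auto simp: homotopic_paths_refl)
      moreover have "homotopic_paths Sp (subpath 0 a p +++ (?m +++ r)) ((subpath 0 a p +++ ?m) +++ r)"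
        by (rule homotopic_paths_assoc) (use s r m rS in auto)
      ultimately show ?thesis using homotopic_paths_trans homotopic_paths_sym by blast
    qed
    ultimately have "transversal_class (subpath 0 b p +++ r)" using transversal_class_homotopic by blast
    with r show "E b" unfolding E_def by blast
  qed
  have E0: "E 0"
  proof -
    let ?r = "linepath (p 0) (p 0)"
    have img: "path_image ?r \<subseteq> V \<delta>2 (p 0)" using pSp[of 0] \<delta>2(1) by (simp add: V_def spinv_left)
    have o: "p 0 \<notin> Sp0 1" using off(1) by (simp add: pathstart_def)
    have "subpath 0 0 p +++ ?r = ?r"
      by (auto simp: fun_eq_iff joinpaths_def subpath_def linepath_def simp flip: scaleR_add_left)
    moreover have "transversal_class ?r"
      by (rule loc[OF pSp[of 0]]) (use img o \<delta>2' in \<open>auto simp: V_def\<close>)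
    ultimately show ?thesis unfolding E_def using img o by (intro exI[of _ ?r]) auto
  qed
  obtain N :: nat where N: "N > 0" "1 / N < d"
    using reals_Archimedean[OF d(1)] by (metis inverse_eq_divide of_nat_0_less_iff zero_less_Suc)
  have "E (k / N)" if "k \<le> N" for k :: nat
    using that
  proof (induction k)
    case 0 then show ?case using E0 by simp
  next
    case (Suc k)
    show ?case
    proof (rule step)
      show "E (k / N)" using Suc by simp
      show "real k / N \<in> {0..1}" "real (Suc k) / N \<in> {0..1}" "real k / N \<le> real (Suc k) / N" using Suc.prems N by (auto simp: field_simps)
      have "real (Suc k) / N - real k / N = 1 / N" by (simp add: diff_divide_distrib[symmetric])
      then show "real (Suc k) / N - real k / N < d" using N by simp
    qed
  qed
  from this[of N] N have E1: "E 1" by simp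
  let ?r = "linepath (p 1) (p 1)"
  have "transversal_class (subpath 0 1 p +++ ?r)"
    by (rule E'[OF _ E1]) (use pSp[of 1] \<delta> off(2) in \<open>auto simp: V_def spinv_left pathfinish_def\<close>)
  moreover have "homotopic_paths Sp (p +++ ?r) p"
    using homotopic_paths_rid[OF p] by (simp only: pathfinish_def)
  then have "homotopic_paths Sp p (subpath 0 1 p +++ ?r)"
    by (simp only: subpath_trivial homotopic_paths_sym)
  ultimately show ?thesis using transversal_class_homotopic by blast
qed

section \<open>The complex linear part of a symplectic matrix\<close>

text \<open>
  The involution \<open>\<i> J\<close>; its eigenspaces are those of \<open>J\<close> for the eigenvalues
  \<open>\<plusminus> \<i>\<close>.
\<close>

definition iJ :: "complex^('d::finite + 'd)^('d + 'd)" where "iJ = mat \<i> ** cpx J"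

text \<open>The projections \<open>Pp\<close> and \<open>Pm\<close> onto the eigenspaces of \<open>J\<close> for \<open>\<i>\<close> and \<open>- \<i>\<close>.\<close>

definition Pp :: "complex^('d::finite + 'd)^('d + 'd)" where "Pp = (1/2) *\<^sub>R (mat 1 - iJ)"
definition Pm :: "complex^('d::finite + 'd)^('d + 'd)" where "Pm = (1/2) *\<^sub>R (mat 1 + iJ)"

lemma iJ_iJ: "iJ ** iJ = (mat 1 :: complex^('d::finite + 'd)^('d + 'd))"
proof -
  let ?J = "cpx J :: complex^('d + 'd)^('d + 'd)"
  have "iJ ** iJ = mat \<i> ** (?J ** mat \<i>) ** ?J" by (simp add: iJ_def matrix_mul_assoc)
  also have "?J ** mat \<i> = mat \<i> ** ?J" by (rule mat_mult_commute)
  also have "mat \<i> ** (mat \<i> ** ?J) ** ?J = mat \<i> ** (mat \<i> ** cpx (J ** J))"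
    by (simp add: cpx_mult matrix_mul_assoc)
  also have "\<dots> = mat 1"
    unfolding J_J by (simp add: vec_eq_iff) (simp add: mat_def)
  finally show ?thesis .
qed

lemma Pp_Pp: "Pp ** Pp = Pp" and Pm_Pm: "Pm ** Pm = Pm" and Pp_Pm: "Pp ** Pm = 0" and Pm_Pp: "Pm ** Pp = 0"
  and Pp_Pm_sum: "Pp + Pm = mat 1" and Pp_minus_Pm: "Pp - Pm = - iJ" and Pp_iJ: "Pp ** iJ = - Pp"
  by (simp_all add: Pp_def Pm_def matrix_alg iJ_iJ scaleR_2[symmetric] scaleR_diff_right scaleR_add_right flip: scaleR_add_left)

lemma Pp_absorb: "Pp ** (Pp ** A) = Pp ** A" "Pm ** (Pm ** A) = Pm ** A" "Pp ** (Pm ** A) = 0" "Pm ** (Pp ** A) = 0"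
  by (simp_all add: matrix_mul_assoc Pp_Pp Pm_Pm Pp_Pm Pm_Pp matrix_zero_left)

lemmas Pp_simps = Pp_Pp Pm_Pm Pp_Pm Pm_Pp Pp_absorb

lemma mat_neg_mult: "mat (- z) ** X = - (mat z ** X)" for X :: "complex^'n^'n"
  by (simp add: vec_eq_iff)

lemma det_nonzero_of_right_inverse: "A ** B = mat 1 \<Longrightarrow> det A \<noteq> 0" for A :: "'a::field^'n^'n"
  by (metis det_I det_mul mult_zero_left zero_neq_one)

text \<open>
  At \<open>z = - \<i>\<close> the pencil is \<open>(1 - \<i> J) M - (1 + \<i> J)\<close>, that is \<open>2 (Pp M - Pm)\<close>, and
  \<open>Pp - Pm = - \<i> J\<close> takes care of the sign.
\<close>

lemma cdet_eq_Pp: "\<exists>c. c \<noteq> 0 \<and> (\<forall>M :: 'd::finite phase_matrix. cdet (- \<i>) M = c * det (Pp ** cpx M + Pm))"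
proof -
  let ?R = "2 *\<^sub>R (- iJ) :: complex^('d + 'd)^('d + 'd)"
  have "?R ** ((1/2) *\<^sub>R (- iJ)) = mat 1" by (simp add: matrix_alg iJ_iJ)
  then have "det ?R \<noteq> 0" by (rule det_nonzero_of_right_inverse)
  moreover have "cdet (- \<i>) M = det ?R * det (Pp ** cpx M + Pm)" for M :: "'d phase_matrix"
  proof -
    have "?R ** (Pp ** cpx M + Pm) = 2 *\<^sub>R (Pp ** cpx M) - 2 *\<^sub>R Pm"
      unfolding Pp_minus_Pm[symmetric] matrix_scaleR_left by (simp add: matrix_alg Pp_simps scaleR_diff_right)
    also have "\<dots> = (mat 1 - iJ) ** cpx M - (mat 1 + iJ)" by (simp add: Pp_def Pm_def matrix_alg)
    also have "\<dots> = cpx (M - mat 1) + mat (- \<i>) ** cpx (J ** (M + mat 1))"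
      by (simp add: iJ_def mat_neg_mult cpx_mult cpx_add cpx_diff cpx_mat matrix_alg matrix_mul_assoc)
    finally show ?thesis unfolding cdet_def by (metis det_mul)
  qed
  ultimately show ?thesis by blast
qed

lemma cpx_rot: "cpx (rot e) = mat (of_real (cos e)) + mat (\<i> * of_real (sin e)) ** iJ"
  by (auto simp: vec_eq_iff iJ_def rot_def mat_def[of "complex_of_real _"] mat_def[of "1::real"] complex_eq_iff)

lemma mat_mat: "mat z ** mat w = (mat (z * w) :: complex^'n^'n)"
  by (simp add: vec_eq_iff) (simp add: mat_def)

text \<open>On its range \<open>Pp\<close> intertwines \<open>J\<close> with \<open>\<i>\<close>.\<close>

lemma Pp_rot: "Pp ** cpx (rot e) = mat (cis (- e)) ** Pp"
proof -
  have "Pp ** cpx (rot e) = mat (of_real (cos e)) ** Pp + mat (\<i> * of_real (sin e)) ** (Pp ** iJ)"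
    unfolding cpx_rot matrix_add_ldistrib mat_mult_commute[of Pp] by (simp add: matrix_mul_assoc mat_mult_commute[of Pp])
  also have "\<dots> = mat (cis (- e)) ** Pp" unfolding Pp_iJ matrix_neg_right
    by (simp add: vec_eq_iff cis.ctr complex_eq_iff algebra_simps)
  finally show ?thesis .
qed

text \<open>
  A rotation multiplies \<open>cdet (- \<i>)\<close> by a constant. So the perturbation in the definition
  of the index does not affect the turning.
\<close>

lemma cdet_rot:
  obtains k where "k \<noteq> 0" "\<And>M :: 'd::finite phase_matrix. cdet (- \<i>) (rot e ** M) = k * cdet (- \<i>) M"
proof -
  obtain c where c: "c \<noteq> 0" "\<And>M :: 'd phase_matrix. cdet (- \<i>) M = c * det (Pp ** cpx M + Pm)"
    using cdet_eq_Pp by blast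
  let ?L = "\<lambda>w. mat w ** Pp + Pm :: complex^('d + 'd)^('d + 'd)"
  have L: "?L w ** (Pp ** A + Pm) = mat w ** (Pp ** A) + Pm" for w A
    by (simp add: matrix_alg Pp_simps flip: matrix_mul_assoc)
  have "?L (cis (- e)) ** ?L (cis e) = mat 1"
  proof -
    have "?L (cis (- e)) ** ?L (cis e) = mat (cis (- e)) ** (mat (cis e) ** Pp) + Pm"
      using L[of "cis (- e)" "mat (cis e)"] by (simp add: mat_mult_commute[of Pp])
    also have "\<dots> = mat 1" by (simp add: matrix_mul_assoc mat_mat cis_mult Pp_Pm_sum)
    finally show ?thesis .
  qed
  then have "det (?L (cis (- e))) \<noteq> 0" by (rule det_nonzero_of_right_inverse)
  moreover have "cdet (- \<i>) (rot e ** M) = det (?L (cis (- e))) * cdet (- \<i>) M" for M :: "'d phase_matrix"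
  proof -
    have "Pp ** cpx (rot e ** M) + Pm = ?L (cis (- e)) ** (Pp ** cpx M + Pm)"
      unfolding L cpx_mult by (simp add: matrix_mul_assoc Pp_rot)
    then show ?thesis by (simp add: c det_mul)
  qed
  ultimately show thesis using that by blast
qed

text \<open>
  The determinant of the compression of \<open>M\<close> to the \<open>\<i>\<close>-eigenspace of \<open>J\<close>, which represents
  the complex linear part of \<open>M\<close>; the summand \<open>Pm\<close> completes it to the whole space.
\<close>

definition cdet_C :: "'d::finite phase_matrix \<Rightarrow> complex" where
  "cdet_C M = det (Pp ** cpx M ** Pp + Pm)"

text \<open>
  The two matrices differ by the factor \<open>1 + N\<close> with \<open>N = Pp M Pm\<close>. As \<open>N\<^sup>2 = 0\<close>, it is
  the square of \<open>h = 1 + N / 2\<close> and \<open>h\<^sup>-\<^sup>1 = 1 - N / 2\<close>, which is conjugate to \<open>h\<close>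
  by \<open>\<i> J\<close>. So \<open>det h = \<plusminus> 1\<close> and \<open>det (1 + N) = 1\<close>.
\<close>

lemma det_Pp_eq: "det (Pp ** cpx M + Pm) = cdet_C M" for M :: "'d::finite phase_matrix"
proof -
  let ?K = "iJ :: complex^('d + 'd)^('d + 'd)"
  define N where "N = Pp ** cpx M ** Pm"
  have NN: "N ** N = 0" unfolding N_def by (simp add: Pp_simps matrix_alg flip: matrix_mul_assoc)
  let ?h = "mat 1 + (1/2) *\<^sub>R N" and ?h' = "mat 1 - (1/2) *\<^sub>R N"
  have RR: "?K ** ?K = mat 1" by (rule iJ_iJ)
  have RN: "iJ ** N ** iJ = - N"
  proof -
    have "(- iJ) ** N ** (- iJ) = - N"
      unfolding Pp_minus_Pm[symmetric] N_def by (simp add: Pp_simps matrix_alg flip: matrix_mul_assoc)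
    then show ?thesis by (simp add: matrix_alg)
  qed
  have "iJ ** ?h ** iJ = ?h'" by (simp add: matrix_alg RR RN)
  then have "det ?h' = det ?K * det ?h * det ?K" by (metis det_mul)
  moreover have "det ?K * det ?K = 1" using arg_cong[OF RR, of det] by (simp add: det_mul)
  moreover have "det ?K * det ?h * det ?K = (det ?K * det ?K) * det ?h" by (simp only: mult_ac)
  ultimately have "det ?h' = det ?h" by (simp only: mult_1_left)
  moreover have "?h ** ?h' = mat 1" by (simp add: matrix_alg NN)
  then have "det ?h * det ?h' = 1" by (metis det_I det_mul)
  moreover have "?h ** ?h = mat 1 + N" by (simp add: matrix_alg NN flip: scaleR_add_left)
  then have "det (mat 1 + N) = det ?h * det ?h" by (metis det_mul)
  ultimately have "det (mat 1 + N) = 1" by simp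
  moreover have "(mat 1 + N) ** (Pp ** cpx M ** Pp + Pm) = Pp ** cpx M + Pm"
  proof -
    have "(mat 1 + N) ** (Pp ** cpx M ** Pp + Pm) = Pp ** cpx M ** (Pp + Pm) + Pm"
      unfolding N_def by (simp add: matrix_alg Pp_simps flip: matrix_mul_assoc)
    then show ?thesis by (simp add: Pp_Pm_sum)
  qed
  ultimately show ?thesis unfolding cdet_C_def by (metis det_mul mult_1)
qed

lemma cdet_eq_cdet_C:
  obtains c where "c \<noteq> 0" "\<And>M :: 'd::finite phase_matrix. cdet (- \<i>) M = c * cdet_C M"
  using cdet_eq_Pp det_Pp_eq by metis

lemma cdet_C_nonzero: "M \<in> Sp \<Longrightarrow> cdet_C M \<noteq> 0"
proof -
  assume M: "M \<in> Sp"
  obtain c where c: "\<And>M :: 'a phase_matrix. cdet (- \<i>) M = c * cdet_C M"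
    using cdet_eq_cdet_C by blast
  have "cdet (- \<i>) M \<noteq> 0" using cdet_minus_imaginary_nonzero[OF M, of 1] by simp
  then show ?thesis by (simp add: c)
qed

text \<open>
  Up to a factor the Hermitian form \<open>\<i> v\<^sup>* J v\<close>. It is invariant under \<open>Sp\<close>, positive
  definite on the range of \<open>Pp\<close> and negative definite on that of \<open>Pm\<close>.
\<close>

definition hermitian_form :: "complex^('d::finite + 'd) \<Rightarrow> real" where
  "hermitian_form v = re_vec v \<bullet> (J *v im_vec v)"

lemma hermitian_form_Sp: "M \<in> Sp \<Longrightarrow> hermitian_form (cpx M *v v) = hermitian_form v"
  by (simp add: hermitian_form_def reim_simps Sp_inner)

lemma reim_scaleR: "re_vec (r *\<^sub>R v) = r *\<^sub>R re_vec v" "im_vec (r *\<^sub>R v) = r *\<^sub>R im_vec v"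
  by (simp_all add: re_vec_def im_vec_def vec_eq_iff)

lemma scaleR_cmatrix_vec: "(r *\<^sub>R A) *v v = r *\<^sub>R (A *v v)" for A :: "complex^'n^'m"
  by (simp add: vec_eq_iff matrix_vector_mult_def scaleR_sum_right)

lemma re_vec_Pp: "re_vec (Pp *v v) = (1/2) *\<^sub>R (re_vec v + J *v im_vec v)"
  and im_vec_Pp: "im_vec (Pp *v v) = (1/2) *\<^sub>R (im_vec v - J *v re_vec v)"
  and re_vec_Pm: "re_vec (Pm *v v) = (1/2) *\<^sub>R (re_vec v - J *v im_vec v)"
  and im_vec_Pm: "im_vec (Pm *v v) = (1/2) *\<^sub>R (im_vec v + J *v re_vec v)"
proof -
  have "iJ *v v = \<i> *s (cpx J *v v)" by (simp add: iJ_def mat_vec flip: matrix_vector_mul_assoc)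
  then show "re_vec (Pp *v v) = (1/2) *\<^sub>R (re_vec v + J *v im_vec v)" "im_vec (Pp *v v) = (1/2) *\<^sub>R (im_vec v - J *v re_vec v)"
    "re_vec (Pm *v v) = (1/2) *\<^sub>R (re_vec v - J *v im_vec v)" "im_vec (Pm *v v) = (1/2) *\<^sub>R (im_vec v + J *v re_vec v)"
    by (simp_all add: Pp_def Pm_def scaleR_cmatrix_vec reim_scaleR matrix_vector_mult_diff_rdistrib matrix_vector_mult_add_rdistrib reim_simps)
qed

text \<open>Shrinking the \<open>Pm\<close> component reduces the negative part of the form.\<close>

lemma hermitian_form_damped:
  assumes "0 \<le> \<tau>" "\<tau> \<le> 1"
  shows "hermitian_form v \<le> hermitian_form ((Pp + \<tau> *\<^sub>R Pm) *v v)"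
proof -
  let ?r = "re_vec v" and ?i = "im_vec v"
  define a b where "a = (1 + \<tau>) / 2" and "b = (1 - \<tau>) / 2"
  have 1: "re_vec ((Pp + \<tau> *\<^sub>R Pm) *v v) = a *\<^sub>R ?r + b *\<^sub>R (J *v ?i)"
    by (simp add: matrix_vector_mult_add_rdistrib scaleR_cmatrix_vec reim_simps reim_scaleR re_vec_Pp re_vec_Pm a_def b_def algebra_simps add_divide_distrib diff_divide_distrib)
  have 2: "im_vec ((Pp + \<tau> *\<^sub>R Pm) *v v) = a *\<^sub>R ?i - b *\<^sub>R (J *v ?r)"
    by (simp add: matrix_vector_mult_add_rdistrib scaleR_cmatrix_vec reim_simps reim_scaleR im_vec_Pp im_vec_Pm a_def b_def algebra_simps add_divide_distrib diff_divide_distrib)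
  have "hermitian_form ((Pp + \<tau> *\<^sub>R Pm) *v v) = (a * a + b * b) * hermitian_form v + a * b * (?r \<bullet> ?r + ?i \<bullet> ?i)"
    unfolding hermitian_form_def 1 2
    by (simp add: matrix_vector_mult_diff_distrib matrix_vector_mult_scaleR J_J_vec inner_add_left inner_add_right J_inner_J inner_commute[of "J *v ?i" ?r] algebra_simps)
  moreover have "0 \<le> (?r - J *v ?i) \<bullet> (?r - J *v ?i)" by simp
  then have "2 * hermitian_form v \<le> ?r \<bullet> ?r + ?i \<bullet> ?i"
    by (simp add: hermitian_form_def inner_diff_left inner_diff_right J_inner_J inner_commute[of "J *v ?i" ?r])
  then have "a * b * (2 * hermitian_form v) \<le> a * b * (?r \<bullet> ?r + ?i \<bullet> ?i)"
    using assms by (intro mult_left_mono) (auto simp: a_def b_def)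
  moreover have "(a * a + b * b) * hermitian_form v + a * b * (2 * hermitian_form v) = (a + b) * (a + b) * hermitian_form v" by (simp add: algebra_simps)
  moreover have "a + b = 1" by (simp add: a_def b_def field_simps)
  ultimately show ?thesis by simp
qed

section \<open>The turning under right translation\<close>

text \<open>
  From the product of the complex linear parts (\<open>\<tau> = 0\<close>) to the complex linear part of
  the product (\<open>\<tau> = 1\<close>).
\<close>

definition interpolating_det :: "'d::finite phase_matrix \<Rightarrow> 'd phase_matrix \<Rightarrow> real \<Rightarrow> complex" where
  "interpolating_det M1 M2 \<tau> = det (Pp ** cpx M1 ** (Pp + \<tau> *\<^sub>R Pm) ** cpx M2 ** Pp + Pm)"

lemma interpolating_det_1: "interpolating_det M1 M2 1 = cdet_C (M1 ** M2)"
  by (simp add: interpolating_det_def Pp_Pm_sum cdet_C_def cpx_mult matrix_mul_assoc)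

lemma interpolating_det_0: "interpolating_det M1 M2 0 = cdet_C M1 * cdet_C M2"
proof -
  have "(Pp ** cpx M1 ** Pp + Pm) ** (Pp ** cpx M2 ** Pp + Pm) = Pp ** cpx M1 ** Pp ** cpx M2 ** Pp + Pm"
    by (simp add: matrix_alg Pp_simps flip: matrix_mul_assoc)
  then show ?thesis by (simp add: interpolating_det_def cdet_C_def flip: det_mul)
qed

text \<open>
  A kernel vector \<open>w\<close> lies in the range of \<open>Pp\<close>, where the form is non-negative. The maps \<open>M2\<close>,
  \<open>Pp + \<tau> Pm\<close> and \<open>M1\<close> do not decrease the form, but send \<open>w\<close> to a vector \<open>x\<close> with \<open>Pp x = 0\<close>,
  where the form is non-positive. So the form of \<open>w\<close> is zero and \<open>w = 0\<close>.
\<close>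

lemma interpolating_det_nonzero:
  fixes M1 M2 :: "'d::finite phase_matrix"
  assumes M: "M1 \<in> Sp" "M2 \<in> Sp" and \<tau>: "0 \<le> \<tau>" "\<tau> \<le> 1"
  shows "interpolating_det M1 M2 \<tau> \<noteq> 0"
proof
  assume "interpolating_det M1 M2 \<tau> = 0"
  then obtain w where w0: "w \<noteq> 0" and w: "(Pp ** cpx M1 ** (Pp + \<tau> *\<^sub>R Pm) ** cpx M2 ** Pp + Pm) *v w = 0"
    unfolding interpolating_det_def det_eq_0_iff_ker by blast
  have "Pm *v ((Pp ** cpx M1 ** (Pp + \<tau> *\<^sub>R Pm) ** cpx M2 ** Pp + Pm) *v w) = Pm *v w"
    unfolding matrix_vector_mul_assoc by (simp add: matrix_alg Pp_simps flip: matrix_mul_assoc)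
  with w have Pmw: "Pm *v w = 0" by simp
  have "Pp *v w + Pm *v w = w" by (simp add: Pp_Pm_sum flip: matrix_vector_mult_add_rdistrib)
  with Pmw have Ppw: "Pp *v w = w" by simp
  define y where "y = cpx M2 *v w"
  define u where "u = (Pp + \<tau> *\<^sub>R Pm) *v y"
  define x where "x = cpx M1 *v u"
  have "(Pp ** cpx M1 ** (Pp + \<tau> *\<^sub>R Pm) ** cpx M2 ** Pp) *v w + Pm *v w = 0"
    using w by (simp add: matrix_vector_mult_add_rdistrib)
  then have "Pp *v x = 0"
    by (simp add: Pmw x_def u_def y_def Ppw flip: matrix_vector_mul_assoc)
  then have "re_vec (Pp *v x) = 0" by (simp add: re_vec_def vec_eq_iff)
  then have "re_vec x = - (J *v im_vec x)" by (simp add: re_vec_Pp eq_neg_iff_add_eq_0)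
  then have hx: "hermitian_form x = - (re_vec x \<bullet> re_vec x)" by (simp add: hermitian_form_def)
  have "re_vec (Pm *v w) = 0" using Pmw by (simp add: re_vec_def vec_eq_iff)
  then have rw: "re_vec w = J *v im_vec w" by (simp add: re_vec_Pm)
  then have "hermitian_form w = re_vec w \<bullet> re_vec w" by (simp add: hermitian_form_def)
  moreover have "hermitian_form w \<le> hermitian_form x"
    using hermitian_form_damped[OF \<tau>, of y] hermitian_form_Sp[OF M(2), of w] hermitian_form_Sp[OF M(1), of u] by (simp add: x_def u_def y_def)
  ultimately have "re_vec w \<bullet> re_vec w = 0" using hx inner_ge_zero[of "re_vec x"] inner_ge_zero[of "re_vec w"] by linarith
  then have r0: "re_vec w = 0" by simp
  with rw have "J *v (J *v im_vec w) = 0" by simp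
  then have "im_vec w = 0" by (simp add: J_J_vec)
  with r0 w0 reim_eq_0 show False by blast
qed

lemma abs_arg_change_interpolating_det:
  fixes M1 M2 :: "'d::finite phase_matrix"
  assumes M: "M1 \<in> Sp" "M2 \<in> Sp"
  shows "\<bar>arg_change (interpolating_det M1 M2) 0 1\<bar> \<le> pi * CARD('d + 'd)"
proof -
  let ?p = "pdet (Pp ** cpx M1 ** Pp ** cpx M2 ** Pp + Pm) (Pp ** cpx M1 ** Pm ** cpx M2 ** Pp)"
  have p: "interpolating_det M1 M2 \<tau> = poly ?p (of_real \<tau>)" for \<tau>
  proof -
    have "mat (of_real \<tau>) ** X = \<tau> *\<^sub>R X" for X :: "complex^('d + 'd)^('d + 'd)" by (simp add: vec_eq_iff) (simp add: scaleR_conv_of_real)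
    then show ?thesis
      unfolding interpolating_det_def poly_pdet by (simp add: matrix_alg algebra_simps)
  qed
  have "\<bar>arg_change (\<lambda>\<tau>. poly ?p (of_real \<tau>)) 0 1\<bar> \<le> pi * degree ?p"
    by (rule abs_arg_change_poly) (use interpolating_det_nonzero[OF M] p in \<open>auto simp: closed_segment_eq_real_ivl\<close>)
  also have "\<dots> \<le> pi * CARD('d + 'd)" by (intro mult_left_mono of_nat_mono degree_pdet) auto
  finally show ?thesis by (simp only: p[abs_def])
qed

lemma turn_eq_cdet_C:
  fixes q :: "real \<Rightarrow> 'd::finite phase_matrix"
  assumes q: "continuous_on (closed_segment a b) q" "\<And>t. t \<in> closed_segment a b \<Longrightarrow> q t \<in> Sp"
  shows "turn q a b = arg_change (\<lambda>t. cdet_C (q t)) a b"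
proof -
  obtain c where c: "c \<noteq> 0" "\<And>M :: 'd phase_matrix. cdet (- \<i>) M = c * cdet_C M"
    using cdet_eq_cdet_C by blast
  have "continuous_on (closed_segment a b) (\<lambda>t. cdet_C (q t))"
    unfolding cdet_C_def by (intro continuous_intros q)
  from arg_change_cmult[OF c(1) this] show ?thesis
    unfolding turn_def c(2) using cdet_C_nonzero q(2) by blast
qed

text \<open>
  Apply the rectangle argument to \<open>interpolating_det (q t) M \<tau>\<close>. The sides \<open>\<tau> = 0\<close>
  and \<open>\<tau> = 1\<close> give the turning of \<open>q\<close> and of \<open>q M\<close>; the other two are polynomial in \<open>\<tau>\<close>.
\<close>

lemma turn_right_translation:
  fixes q :: "real \<Rightarrow> 'd::finite phase_matrix"
  assumes q: "continuous_on (closed_segment a b) q" "\<And>t. t \<in> closed_segment a b \<Longrightarrow> q t \<in> Sp" and M: "M \<in> Sp"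
  shows "\<bar>turn (\<lambda>t. q t ** M) a b - turn q a b\<bar> \<le> 2 * pi * CARD('d + 'd)"
proof -
  let ?F = "\<lambda>x. interpolating_det (q (snd x)) M (fst x)"
  have seg: "closed_segment 0 1 = {0..1::real}" by (simp add: closed_segment_eq_real_ivl)
  have cq: "continuous_on (closed_segment 0 1 \<times> closed_segment a b) (\<lambda>x. q (snd x))" by (rule continuous_on_snd_comp[OF q(1)])
  have c: "continuous_on (closed_segment 0 1 \<times> closed_segment a b) ?F"
    unfolding interpolating_det_def by (intro continuous_intros cq)
  have nz: "?F (s, t) \<noteq> 0" if "s \<in> closed_segment 0 1" "t \<in> closed_segment a b" for s t
    using interpolating_det_nonzero[OF q(2)[OF that(2)] M] that(1) by (simp add: seg)
  have R: "arg_change (\<lambda>t. ?F (1, t)) a b - arg_change (\<lambda>t. ?F (0, t)) a b = arg_change (\<lambda>s. ?F (s, b)) 0 1 - arg_change (\<lambda>s. ?F (s, a)) 0 1"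
    by (rule arg_change_rectangle[OF c nz])
  have "arg_change (\<lambda>t. ?F (1, t)) a b = turn (\<lambda>t. q t ** M) a b"
    by (simp add: interpolating_det_1) (rule turn_eq_cdet_C[symmetric]; use q M Sp_mult in \<open>auto intro!: continuous_intros\<close>)
  moreover have "arg_change (\<lambda>t. ?F (0, t)) a b = turn q a b"
  proof -
    have "arg_change (\<lambda>t. cdet_C M * cdet_C (q t)) a b = arg_change (\<lambda>t. cdet_C (q t)) a b"
    proof (rule arg_change_cmult)
      show "continuous_on (closed_segment a b) (\<lambda>t. cdet_C (q t))" unfolding cdet_C_def by (intro continuous_intros q)
    qed (use q M cdet_C_nonzero in auto)
    then show ?thesis by (simp add: interpolating_det_0 turn_eq_cdet_C[OF q] mult.commute)
  qed
  moreover have "\<bar>arg_change (\<lambda>s. ?F (s, b)) 0 1\<bar> \<le> pi * CARD('d + 'd)" "\<bar>arg_change (\<lambda>s. ?F (s, a)) 0 1\<bar> \<le> pi * CARD('d + 'd)"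
    using abs_arg_change_interpolating_det[OF q(2) M, of b] abs_arg_change_interpolating_det[OF q(2) M, of a] by simp_all
  ultimately show ?thesis using R by linarith
qed

section \<open>The Maslov-type index and the turning of the determinant\<close>

text \<open>
  All transverse representatives have the same crossing number, since it is determined by
  the limit, which is a homotopy invariant.
\<close>

lemma intersection_number_eq:
  fixes p :: "real \<Rightarrow> 'd::finite phase_matrix"
  assumes p: "path p" "path_image p \<subseteq> Sp" and off: "pathstart p \<notin> Sp0 1" "pathfinish p \<notin> Sp0 1"
  shows "has_arg_index p (pi * of_int (intersection_number 1 p))"
proof -
  have ix: "has_arg_index p (pi * of_int (crossing_number 1 \<eta>))"
    if "homotopic_paths Sp p \<eta>" "transverse_path 1 \<eta>" for \<eta>
  proof -
    have "pathstart \<eta> = pathstart p" "pathfinish \<eta> = pathfinish p"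
      using homotopic_paths_imp_pathstart[OF that(1)] homotopic_paths_imp_pathfinish[OF that(1)] by auto
    then show ?thesis
      using has_arg_index_homotopic_paths[OF homotopic_paths_sym[OF that(1)] _ _ transverse_has_arg_index[OF that(2)]] off
      by simp
  qed
  obtain \<eta> where \<eta>: "homotopic_paths Sp p \<eta>" "transverse_path 1 \<eta>"
    using transversal_class_exists[OF p off] unfolding transversal_class_def by blast
  have "intersection_number 1 p = crossing_number 1 \<eta>"
    unfolding intersection_number_def
  proof (rule the_equality)
    show "\<exists>\<eta>'. homotopic_paths Sp p \<eta>' \<and> transverse_path 1 \<eta>' \<and> crossing_number 1 \<eta>' = crossing_number 1 \<eta>"
      using \<eta> by blast
    fix n assume "\<exists>\<eta>'. homotopic_paths Sp p \<eta>' \<and> transverse_path 1 \<eta>' \<and> crossing_number 1 \<eta>' = n"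
    then obtain \<eta>' where "homotopic_paths Sp p \<eta>'" "transverse_path 1 \<eta>'" "crossing_number 1 \<eta>' = n" by blast
    then have "pi * of_int n = pi * of_int (crossing_number 1 \<eta>)"
      using has_arg_index_unique[OF ix ix[OF \<eta>]] by blast
    then show "n = crossing_number 1 \<eta>" by simp
  qed
  with ix[OF \<eta>] show ?thesis by simp
qed

lemma shifted_matrix_mat_1: "shifted_matrix 1 (mat 1) = 0"
  by (simp add: shifted_matrix_one vec_eq_iff)

lemma turn_rot:
  fixes \<gamma> :: "real \<Rightarrow> 'd::finite phase_matrix"
  assumes \<gamma>: "continuous_on {0..1} \<gamma>" "\<gamma> ` {0..1} \<subseteq> Sp"
  shows "turn (\<lambda>t. rot e ** \<gamma> t) 0 1 = turn \<gamma> 0 1"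
proof -
  obtain k where k: "k \<noteq> 0" "\<And>M :: 'd phase_matrix. cdet (- \<i>) (rot e ** M) = k * cdet (- \<i>) M"
    using cdet_rot by blast
  show ?thesis
    unfolding turn_def k(2)
  proof (rule arg_change_cmult[OF k(1)])
    show "continuous_on (closed_segment 0 1) (\<lambda>t. cdet (- \<i>) (\<gamma> t))"
      using \<gamma>(1) by (simp add: closed_segment_eq_real_ivl) (intro continuous_intros)
    show "cdet (- \<i>) (\<gamma> t) \<noteq> 0" if "t \<in> closed_segment 0 1" for t
    proof -
      have "t \<in> {0..1}" using that by (simp add: closed_segment_eq_real_ivl)
      then have "\<gamma> t \<in> Sp" using \<gamma>(2) by blast
      then show ?thesis using cdet_minus_imaginary_nonzero[of "\<gamma> t" 1] by simp
    qed
  qed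
qed

text \<open>
  For small \<open>\<epsilon> > 0\<close> the rotated path has its end points off the hypersurface, and
  varying \<open>\<epsilon>\<close> is a homotopy with such end points. So the intersection number is
  eventually constant, and it is compared with the turning, which rotations do not change.
\<close>

lemma maslov_iota_bound:
  fixes \<gamma> :: "real \<Rightarrow> 'd::finite phase_matrix"
  assumes T: "T \<ge> 0" and \<gamma>: "continuous_on {0..T} \<gamma>" "\<gamma> ` {0..T} \<subseteq> Sp"
  shows "\<bar>pi * of_int (maslov_iota 1 (mat 1) \<gamma> 0 T) - turn \<gamma> 0 T\<bar> \<le> 2 * pi * CARD('d + 'd)"
proof -
  let ?q = "subpath 0 T \<gamma>"
  let ?p = "\<lambda>\<epsilon> t. rot \<epsilon> ** ?q t"
  have sub: "T * t \<in> {0..T}" if "t \<in> {0..1}" for t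
    using that T mult_left_le[of t T] by auto
  have qc: "continuous_on {0..1} ?q" unfolding subpath_def
    by (rule continuous_on_compose2[OF \<gamma>(1)]) (use sub in \<open>auto intro!: continuous_intros\<close>)
  have qS: "?q t \<in> Sp" if "t \<in> {0..1}" for t
    using subsetD[OF \<gamma>(2) imageI[OF sub[OF that]]] by (simp add: subpath_def)
  have pp: "path (?p \<epsilon>)" "path_image (?p \<epsilon>) \<subseteq> Sp" for \<epsilon>
  proof -
    show "path (?p \<epsilon>)" unfolding path_def by (intro continuous_intros qc)
    show "path_image (?p \<epsilon>) \<subseteq> Sp" unfolding path_image_def
      by (intro image_subsetI Sp_mult rot_Sp qS)
  qed
  have inv1: "matrix_inv (mat 1) = (mat 1 :: 'd phase_matrix)"
  proof -
    show ?thesis unfolding matrix_inv_def by (rule some_equality) auto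
  qed
  have path_eq: "subpath 0 T (\<lambda>t. matrix_exp (- (\<epsilon> *\<^sub>R J)) ** \<gamma> t ** matrix_inv (mat 1)) = ?p \<epsilon>" for \<epsilon>
    by (simp add: fun_eq_iff subpath_def inv1 matrix_exp_rot)
  have "?q 0 \<in> Sp" "?q 1 \<in> Sp" using qS by auto
  then have "\<forall>\<^sub>F s in at_right 0. det (rot s ** ?q 0 - mat 1) \<noteq> 0 \<and> det (rot s ** ?q 1 - mat 1) \<noteq> 0"
    using eventually_conj[OF rot_off_hypersurface rot_off_hypersurface] by blast
  then obtain b where b: "b > 0" "\<And>s. 0 < s \<Longrightarrow> s < b \<Longrightarrow> det (rot s ** ?q 0 - mat 1) \<noteq> 0"
     "\<And>s. 0 < s \<Longrightarrow> s < b \<Longrightarrow> det (rot s ** ?q 1 - mat 1) \<noteq> 0"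
    unfolding eventually_at_right_field by blast
  have off: "pathstart (?p s) \<notin> Sp0 1" "pathfinish (?p s) \<notin> Sp0 1" if "0 < s" "s < b" for s
    using b(2,3)[OF that] \<open>?q 0 \<in> Sp\<close> \<open>?q 1 \<in> Sp\<close> by (simp_all add: pathstart_def pathfinish_def off_Sp0 Sp_mult rot_Sp)
  have ix: "has_arg_index (?p s) (pi * of_int (intersection_number 1 (?p s)))" if "0 < s" "s < b" for s
    by (rule intersection_number_eq[OF pp off[OF that]])
  have mono: "intersection_number 1 (?p s) = intersection_number 1 (?p s')" if s: "0 < s" "s \<le> s'" "s' < b" for s s'
  proof -
    have "continuous_on ({s..s'} \<times> {0..1}) (\<lambda>x. rot (fst x) ** ?q (snd x))"
      by (intro continuous_on_matrix_mult continuous_on_rot continuous_on_fst continuous_on_id continuous_on_compose2[OF qc] continuous_on_snd) auto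
    moreover have "(\<lambda>x. rot (fst x) ** ?q (snd x)) ` ({s..s'} \<times> {0..1}) \<subseteq> Sp"
      by (intro image_subsetI Sp_mult rot_Sp qS) auto
    ultimately have "has_arg_index (?p s') (pi * of_int (intersection_number 1 (?p s)))"
      using has_arg_index_homotopy[OF s(2), of "\<lambda>x. rot (fst x) ** ?q (snd x)"] b(2,3) s ix[of s] by simp
    from has_arg_index_unique[OF this ix[of s']] s show ?thesis by simp
  qed
  define n where "n = intersection_number 1 (?p (b / 2))"
  have const: "intersection_number 1 (?p s) = n" if "0 < s" "s < b" for s
    using mono[of s "b/2"] mono[of "b/2" s] that b(1) unfolding n_def by (cases "s \<le> b / 2") auto
  have ev: "\<forall>\<^sub>F \<epsilon> in at_right 0. intersection_number 1 (?p \<epsilon>) = n"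
    unfolding eventually_at_right_field using b(1) const by blast
  have "maslov_iota 1 (mat 1) \<gamma> 0 T = n"
    unfolding maslov_iota_def path_eq
  proof (rule the_equality[where P = "\<lambda>n. \<forall>\<^sub>F \<epsilon> in at_right 0. intersection_number 1 (?p \<epsilon>) = n"])
    show "\<forall>\<^sub>F \<epsilon> in at_right 0. intersection_number 1 (?p \<epsilon>) = n" by (rule ev)
    fix k assume "\<forall>\<^sub>F \<epsilon> in at_right 0. intersection_number 1 (?p \<epsilon>) = k"
    with ev have "\<forall>\<^sub>F \<epsilon> in at_right (0::real). k = n" by eventually_elim simp
    then show "k = n" by (simp add: trivial_limit_at_right_real)
  qed
  moreover have "\<bar>pi * of_int n - turn (?p (b/2)) 0 1\<bar> \<le> 2 * pi * CARD('d + 'd)"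
    unfolding n_def by (rule has_arg_index_bound[OF pp ix]) (use b in auto)
  moreover have "turn (?p (b/2)) 0 1 = turn ?q 0 1"
    by (rule turn_rot[OF qc]) (use qS in auto)
  moreover have "turn ?q 0 1 = turn \<gamma> 0 T"
  proof -
    have "arg_change (\<lambda>t. (\<lambda>s. cdet (- \<i>) (\<gamma> s)) (T * t)) 0 1 = arg_change (\<lambda>s. cdet (- \<i>) (\<gamma> s)) (T * 0) (T * 1)"
    proof (rule arg_change_reparam[of "{0..T}"])
      show "continuous_on {0..T} (\<lambda>s. cdet (- \<i>) (\<gamma> s))" by (intro continuous_intros \<gamma>)
      show "cdet (- \<i>) (\<gamma> t) \<noteq> 0" if "t \<in> {0..T}" for t
        using cdet_minus_imaginary_nonzero[of "\<gamma> t" 1] subsetD[OF \<gamma>(2) imageI[OF that]] by simp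
      show "continuous_on (closed_segment 0 1) ((*) T)" by (intro continuous_intros)
      show "(*) T ` closed_segment 0 1 \<subseteq> {0..T}" using sub by (auto simp: closed_segment_eq_real_ivl)
    qed auto
    then show ?thesis by (simp add: turn_def subpath_def)
  qed
  ultimately show ?thesis by simp
qed

section \<open>Second derivatives are symmetric\<close>

text \<open>
  The mean value theorem twice, first in the direction \<open>u\<close>, then for the gradient in the
  direction \<open>v\<close>.
\<close>

lemma second_difference_mean_value:
  fixes f :: "'a::real_inner \<Rightarrow> real" and g :: "'a \<Rightarrow> 'a"
  assumes f: "\<And>z. (f has_derivative (\<lambda>h. h \<bullet> g z)) (at z)"
    and g: "\<And>z. (g has_derivative A z) (at z)" and h: "h > 0"
  shows "\<exists>s t. 0 < s \<and> s < h \<and> 0 < t \<and> t < h \<and>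
     f (z + h *\<^sub>R u + h *\<^sub>R v) - f (z + h *\<^sub>R u) - f (z + h *\<^sub>R v) + f z = h * h * (u \<bullet> A (z + s *\<^sub>R u + t *\<^sub>R v) v)"
proof -
  have line: "((\<lambda>s. w + s *\<^sub>R u) has_derivative (\<lambda>h. h *\<^sub>R u)) (at s)" for w u :: 'a and s
    by (auto intro!: derivative_eq_intros)
  have df: "((\<lambda>s. f (w + s *\<^sub>R u)) has_real_derivative u \<bullet> g (w + s *\<^sub>R u)) (at s)" for w s
    unfolding has_field_derivative_def using has_derivative_compose[OF line f] by (simp add: mult_commute_abs)
  have dg: "((\<lambda>t. u \<bullet> g (w + t *\<^sub>R v)) has_real_derivative u \<bullet> A (w + t *\<^sub>R v) v) (at t)" for w t
  proof -
    have "linear (A (w + t *\<^sub>R v))" using g has_derivative_linear by blast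
    then have e: "A (w + t *\<^sub>R v) (h *\<^sub>R v) = h *\<^sub>R A (w + t *\<^sub>R v) v" for h by (rule linear_scale)
    have "((\<lambda>t. u \<bullet> g (w + t *\<^sub>R v)) has_derivative (\<lambda>h. u \<bullet> A (w + t *\<^sub>R v) (h *\<^sub>R v))) (at t)"
      by (intro has_derivative_inner_right has_derivative_compose[OF line g])
    then show ?thesis unfolding has_field_derivative_def e by (simp add: mult_commute_abs)
  qed
  let ?p = "\<lambda>s. f ((z + h *\<^sub>R v) + s *\<^sub>R u) - f (z + s *\<^sub>R u)"
  have "\<exists>s. 0 < s \<and> s < h \<and> ?p h - ?p 0 = (h - 0) * (u \<bullet> g ((z + h *\<^sub>R v) + s *\<^sub>R u) - u \<bullet> g (z + s *\<^sub>R u))"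
    by (rule MVT2[OF h]) (intro DERIV_diff df)
  then obtain s where s: "0 < s" "s < h" "?p h - ?p 0 = h * (u \<bullet> g ((z + h *\<^sub>R v) + s *\<^sub>R u) - u \<bullet> g (z + s *\<^sub>R u))" by auto
  let ?q = "\<lambda>t. u \<bullet> g ((z + s *\<^sub>R u) + t *\<^sub>R v)"
  have "\<exists>t. 0 < t \<and> t < h \<and> ?q h - ?q 0 = (h - 0) * (u \<bullet> A ((z + s *\<^sub>R u) + t *\<^sub>R v) v)"
    by (rule MVT2[OF h]) (rule dg)
  then obtain t where t: "0 < t" "t < h" "?q h - ?q 0 = h * (u \<bullet> A ((z + s *\<^sub>R u) + t *\<^sub>R v) v)" by auto
  have "?q h - ?q 0 = u \<bullet> g ((z + h *\<^sub>R v) + s *\<^sub>R u) - u \<bullet> g (z + s *\<^sub>R u)"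
    by (simp add: add_ac)
  with s(3) t(3) have "?p h - ?p 0 = h * (h * (u \<bullet> A ((z + s *\<^sub>R u) + t *\<^sub>R v) v))" by simp
  moreover have "?p h - ?p 0 = f (z + h *\<^sub>R u + h *\<^sub>R v) - f (z + h *\<^sub>R u) - f (z + h *\<^sub>R v) + f z"
    by (simp add: add_ac)
  ultimately show ?thesis using s t by (intro exI[of _ s] exI[of _ t]) (simp add: mult.assoc)
qed

text \<open>The second difference of \<open>f\<close> is symmetric in \<open>u\<close> and \<open>v\<close>.\<close>

lemma second_derivative_symmetric:
  fixes f :: "'a::real_inner \<Rightarrow> real" and g :: "'a \<Rightarrow> 'a"
  assumes f: "\<And>z. (f has_derivative (\<lambda>h. h \<bullet> g z)) (at z)"
    and g: "\<And>z. (g has_derivative A z) (at z)"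
    and cont: "\<And>v. continuous_on UNIV (\<lambda>z. A z v)"
  shows "u \<bullet> A z v = v \<bullet> A z u"
proof (rule ccontr)
  assume ne: "u \<bullet> A z v \<noteq> v \<bullet> A z u"
  define e where "e = \<bar>u \<bullet> A z v - v \<bullet> A z u\<bar> / 2"
  have e: "e > 0" using ne by (simp add: e_def)
  have c: "\<exists>d>0. \<forall>y. dist y z < d \<longrightarrow> \<bar>u \<bullet> A y v - u \<bullet> A z v\<bar> < e" for u v
  proof -
    have "continuous_on UNIV (\<lambda>z. u \<bullet> A z v)" by (intro continuous_intros cont)
    then show ?thesis using e unfolding continuous_on_iff dist_real_def by auto
  qed
  obtain d1 where d1: "d1 > 0" "\<And>y. dist y z < d1 \<Longrightarrow> \<bar>u \<bullet> A y v - u \<bullet> A z v\<bar> < e" using c[of u v] by blast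
  obtain d2 where d2: "d2 > 0" "\<And>y. dist y z < d2 \<Longrightarrow> \<bar>v \<bullet> A y u - v \<bullet> A z u\<bar> < e" using c[of v u] by blast
  define h where "h = min d1 d2 / (norm u + norm v + 1)"
  have nuv: "norm u + norm v + 1 > 0" by (simp add: add_nonneg_pos)
  have h: "h > 0" using d1 d2 nuv by (simp add: h_def)
  have hh: "h * (norm u + norm v) < min d1 d2"
  proof -
    have "h * (norm u + norm v + 1) = min d1 d2" using nuv by (simp add: h_def)
    then have "h * (norm u + norm v) + h = min d1 d2" by (simp add: distrib_left)
    then show ?thesis using h by linarith
  qed
  have near: "dist (z + s *\<^sub>R u + t *\<^sub>R v) z < min d1 d2" if "0 < s" "s < h" "0 < t" "t < h" for s t
  proof -
    have "dist (z + s *\<^sub>R u + t *\<^sub>R v) z = norm (s *\<^sub>R u + t *\<^sub>R v)" by (simp add: dist_norm add.assoc)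
    also have "\<dots> \<le> s * norm u + t * norm v" using norm_triangle_ineq[of "s *\<^sub>R u" "t *\<^sub>R v"] that by simp
    also have "\<dots> \<le> h * norm u + h * norm v" using that by (intro add_mono mult_right_mono) auto
    finally show ?thesis using hh by (simp add: distrib_left)
  qed
  obtain s t where st: "0 < s" "s < h" "0 < t" "t < h"
     "f (z + h *\<^sub>R u + h *\<^sub>R v) - f (z + h *\<^sub>R u) - f (z + h *\<^sub>R v) + f z = h * h * (u \<bullet> A (z + s *\<^sub>R u + t *\<^sub>R v) v)"
    using second_difference_mean_value[OF f g h] by blast
  obtain s' t' where st': "0 < s'" "s' < h" "0 < t'" "t' < h"
     "f (z + h *\<^sub>R v + h *\<^sub>R u) - f (z + h *\<^sub>R v) - f (z + h *\<^sub>R u) + f z = h * h * (v \<bullet> A (z + s' *\<^sub>R v + t' *\<^sub>R u) u)"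
    using second_difference_mean_value[OF f g h] by blast
  have sw: "z + h *\<^sub>R v + h *\<^sub>R u = z + h *\<^sub>R u + h *\<^sub>R v" "z + s' *\<^sub>R v + t' *\<^sub>R u = z + t' *\<^sub>R u + s' *\<^sub>R v" by (simp_all add: add_ac)
  have "h * h * (u \<bullet> A (z + s *\<^sub>R u + t *\<^sub>R v) v) = h * h * (v \<bullet> A (z + t' *\<^sub>R u + s' *\<^sub>R v) u)"
    using st(5) st'(5) unfolding sw by linarith
  with h have eq: "u \<bullet> A (z + s *\<^sub>R u + t *\<^sub>R v) v = v \<bullet> A (z + t' *\<^sub>R u + s' *\<^sub>R v) u" by simp
  have "dist (z + s *\<^sub>R u + t *\<^sub>R v) z < d1" "dist (z + t' *\<^sub>R u + s' *\<^sub>R v) z < d2"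
    using near[OF st(1-4)] near[OF st'(3,4,1,2)] by simp_all
  then have "\<bar>u \<bullet> A (z + s *\<^sub>R u + t *\<^sub>R v) v - u \<bullet> A z v\<bar> < e" "\<bar>v \<bullet> A (z + t' *\<^sub>R u + s' *\<^sub>R v) u - v \<bullet> A z u\<bar> < e"
    using d1(2) d2(2) by blast+
  moreover have "2 * e = \<bar>u \<bullet> A z v - v \<bullet> A z u\<bar>" by (simp add: e_def)
  ultimately show False using eq by (smt (verit))
qed

section \<open>Estimates of Gronwall type\<close>

text \<open>
  The function \<open>(\<bar>u\<bar>\<^sup>2 + e\<^sup>2) exp (- (2 K + 1) t)\<close> decreases. Working
  with squares avoids differentiating the norm.
\<close>

lemma gronwall_forward:
  fixes u :: "real \<Rightarrow> 'a::real_inner"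
  assumes u: "\<And>t. 0 \<le> t \<Longrightarrow> t \<le> T \<Longrightarrow> (u has_vector_derivative u' t) (at t)"
    and b: "\<And>t. 0 \<le> t \<Longrightarrow> t \<le> T \<Longrightarrow> norm (u' t) \<le> K * norm (u t) + e"
    and "0 \<le> K" "0 \<le> e" and t: "0 \<le> t" "t \<le> T"
  shows "norm (u t) ^ 2 \<le> (norm (u 0) ^ 2 + e ^ 2) * exp ((2 * K + 1) * t)"
proof -
  let ?w = "\<lambda>t. (u t \<bullet> u t + e ^ 2) * exp (- ((2 * K + 1) * t))"
  have "?w t \<le> ?w 0"
  proof (rule DERIV_nonpos_imp_nonincreasing[OF t(1)])
    fix s assume s: "0 \<le> s" "s \<le> t"
    then have sT: "s \<le> T" using t by simp
    have d: "((\<lambda>t. u t \<bullet> u t) has_real_derivative 2 * (u s \<bullet> u' s)) (at s)"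
      using bounded_bilinear.has_vector_derivative[OF bounded_bilinear_inner u[OF s(1) sT] u[OF s(1) sT]]
      by (simp add: has_real_derivative_iff_has_vector_derivative inner_commute)
    have D: "(?w has_real_derivative (2 * (u s \<bullet> u' s) - (2 * K + 1) * (u s \<bullet> u s + e ^ 2)) * exp (- ((2 * K + 1) * s))) (at s)"
      by (auto intro!: derivative_eq_intros d simp: algebra_simps)
    have "u s \<bullet> u' s \<le> norm (u s) * norm (u' s)" by (rule norm_cauchy_schwarz)
    also have "\<dots> \<le> norm (u s) * (K * norm (u s) + e)" by (intro mult_left_mono b s sT) auto
    finally have "2 * (u s \<bullet> u' s) \<le> 2 * K * norm (u s) ^ 2 + 2 * (norm (u s) * e)"
      by (simp add: algebra_simps power2_eq_square)
    moreover have "2 * (norm (u s) * e) \<le> norm (u s) ^ 2 + e ^ 2" using sum_squares_bound[of "norm (u s)" e] by simp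
    moreover have "0 \<le> 2 * K * e ^ 2" using assms by simp
    ultimately have "2 * (u s \<bullet> u' s) - (2 * K + 1) * (u s \<bullet> u s + e ^ 2) \<le> 0"
      by (simp add: power2_norm_eq_inner algebra_simps)
    then have "(2 * (u s \<bullet> u' s) - (2 * K + 1) * (u s \<bullet> u s + e ^ 2)) * exp (- ((2 * K + 1) * s)) \<le> 0"
      by (rule mult_nonpos_nonneg) simp
    with D show "\<exists>y. (?w has_real_derivative y) (at s) \<and> y \<le> 0" by blast
  qed
  then have "(u t \<bullet> u t + e ^ 2) * exp (- ((2 * K + 1) * t)) \<le> norm (u 0) ^ 2 + e ^ 2" by (simp add: power2_norm_eq_inner)
  then have "(u t \<bullet> u t + e ^ 2) * exp (- ((2 * K + 1) * t)) * exp ((2 * K + 1) * t) \<le> (norm (u 0) ^ 2 + e ^ 2) * exp ((2 * K + 1) * t)"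
    by (rule mult_right_mono) simp
  then have "u t \<bullet> u t + e ^ 2 \<le> (norm (u 0) ^ 2 + e ^ 2) * exp ((2 * K + 1) * t)"
    by (simp add: mult.assoc flip: exp_add)
  moreover have "norm (u t) ^ 2 \<le> u t \<bullet> u t + e ^ 2" by (simp add: power2_norm_eq_inner)
  ultimately show ?thesis by linarith
qed

lemma gronwall:
  fixes u :: "real \<Rightarrow> 'a::real_inner"
  assumes u: "\<And>t. \<bar>t\<bar> \<le> T \<Longrightarrow> (u has_vector_derivative u' t) (at t)"
    and b: "\<And>t. \<bar>t\<bar> \<le> T \<Longrightarrow> norm (u' t) \<le> K * norm (u t) + e"
    and K: "0 \<le> K" "0 \<le> e" and t: "\<bar>t\<bar> \<le> T"
  shows "norm (u t) ^ 2 \<le> (norm (u 0) ^ 2 + e ^ 2) * exp ((2 * K + 1) * T)"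
proof -
  have "norm (u t) ^ 2 \<le> (norm (u 0) ^ 2 + e ^ 2) * exp ((2 * K + 1) * \<bar>t\<bar>)"
  proof (cases "t \<ge> 0")
    case True
    then show ?thesis using gronwall_forward[of T u u' K e t] u b K t by auto
  next
    case False
    let ?v = "\<lambda>s. u (- s)"
    have v: "(?v has_vector_derivative - u' (- s)) (at s)" if "0 \<le> s" "s \<le> T" for s
    proof -
      have "(uminus has_vector_derivative (-1)) (at s)" by (auto intro!: derivative_eq_intros)
      from vector_diff_chain_at[OF this, of u "u' (- s)"] u[of "- s"] that show ?thesis by (simp add: o_def)
    qed
    have "norm (- u' (- s)) \<le> K * norm (?v s) + e" if "0 \<le> s" "s \<le> T" for s using b[of "- s"] that by simp
    from gronwall_forward[OF v this K, of T "- t"] False t show ?thesis by simp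
  qed
  also have "\<dots> \<le> (norm (u 0) ^ 2 + e ^ 2) * exp ((2 * K + 1) * T)"
    using t K by (intro mult_left_mono) (auto intro!: mult_left_mono)
  finally show ?thesis .
qed

lemma gronwall_zero:
  fixes u :: "real \<Rightarrow> 'a::real_inner"
  assumes "\<And>t. \<bar>t\<bar> \<le> T \<Longrightarrow> (u has_vector_derivative u' t) (at t)"
    and "\<And>t. \<bar>t\<bar> \<le> T \<Longrightarrow> norm (u' t) \<le> K * norm (u t)"
    and "0 \<le> K" "\<bar>t\<bar> \<le> T" "u 0 = 0"
  shows "u t = 0"
  using gronwall[of T u u' K 0 t] assms by simp

section \<open>Limits of solutions\<close>

text \<open>Passage to the limit under the derivative, on an interval around \<open>t\<close>.\<close>

lemma has_vector_derivative_uniform_limit: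
  fixes f :: "nat \<Rightarrow> real \<Rightarrow> 'a::banach"
  assumes f: "\<And>n t. (f n has_vector_derivative F n t) (at t)"
    and lim: "\<And>t. (\<lambda>n. f n t) \<longlonglongrightarrow> g t"
    and unif: "\<And>T e. T > 0 \<Longrightarrow> e > 0 \<Longrightarrow> \<forall>\<^sub>F n in sequentially. \<forall>t. \<bar>t\<bar> \<le> T \<longrightarrow> norm (F n t - G t) \<le> e"
  shows "(g has_vector_derivative G t) (at t)"
proof -
  define T where "T = \<bar>t\<bar> + 1"
  let ?S = "{-T<..<T}"
  have tS: "t \<in> ?S" "open ?S" "T > 0" by (auto simp: T_def)
  have "\<exists>g'. \<forall>x\<in>?S. (\<lambda>n. f n x) \<longlonglongrightarrow> g' x \<and> (g' has_derivative (\<lambda>h. h *\<^sub>R G x)) (at x within ?S)"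
  proof (rule has_derivative_sequence)
    show "convex ?S" by simp
    show "(f n has_derivative (\<lambda>h. h *\<^sub>R F n x)) (at x within ?S)" if "x \<in> ?S" for n x
      using f[of n x] unfolding has_vector_derivative_def by (rule has_derivative_at_withinI)
    show "\<forall>\<^sub>F n in sequentially. \<forall>x\<in>?S. \<forall>h. norm (h *\<^sub>R F n x - h *\<^sub>R G x) \<le> e * norm h" if "e > 0" for e
      using unif[OF tS(3) that]
    proof eventually_elim
      case (elim n)
      have "norm (h *\<^sub>R F n x - h *\<^sub>R G x) \<le> e * norm h" if "x \<in> ?S" for x h
      proof -
        have "norm (h *\<^sub>R F n x - h *\<^sub>R G x) = \<bar>h\<bar> * norm (F n x - G x)" by (simp flip: scaleR_diff_right)
        also have "\<dots> \<le> \<bar>h\<bar> * e" using elim that by (intro mult_left_mono) auto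
        finally show ?thesis by (simp add: mult.commute)
      qed
      then show ?case by blast
    qed
    show "t \<in> ?S" by (rule tS(1))
    show "(\<lambda>n. f n t) \<longlonglongrightarrow> g t" by (rule lim)
  qed
  then obtain g' where g': "\<And>x. x \<in> ?S \<Longrightarrow> (\<lambda>n. f n x) \<longlonglongrightarrow> g' x" "\<And>x. x \<in> ?S \<Longrightarrow> (g' has_derivative (\<lambda>h. h *\<^sub>R G x)) (at x within ?S)"
    by blast
  have eq: "g' x = g x" if "x \<in> ?S" for x using LIMSEQ_unique[OF g'(1)[OF that] lim] .
  have "(g' has_derivative (\<lambda>h. h *\<^sub>R G t)) (at t)"
    using g'(2)[OF tS(1)] at_within_open[OF tS(1,2)] by simp
  then have "(g' has_vector_derivative G t) (at t)" by (simp add: has_vector_derivative_def)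
  from has_vector_derivative_transform_within_open[OF this tS(2,1) eq] show ?thesis by simp
qed

section \<open>Gradient, Hessian and uniqueness of orbits\<close>

lemma bounded_bilinear_matrix_vector:
  "bounded_bilinear ((*v) :: real^'n^'m \<Rightarrow> real^'n \<Rightarrow> real^'m)"
  unfolding bilinear_conv_bounded_bilinear[symmetric] bilinear_def
  by (auto intro!: linearI simp: matrix_vector_mult_add_rdistrib matrix_vector_right_distrib matrix_vector_mult_scaleR scaleR_matrix_vector_assoc)

lemma gradient_has_derivative:
  fixes H :: "'d::finite phase \<Rightarrow> real"
  assumes "H differentiable (at z)"
  shows "(H has_derivative (\<lambda>h. h \<bullet> gradient H z)) (at z)"
proof -
  obtain D where D: "(H has_derivative D) (at z)" using assms unfolding differentiable_def by blast
  then have lin: "linear D" by (rule has_derivative_linear)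
  define g where "g = (\<Sum>b\<in>Basis. D b *\<^sub>R b)"
  have Dg: "D h = h \<bullet> g" for h
  proof -
    have "D h = D (\<Sum>b\<in>Basis. (h \<bullet> b) *\<^sub>R b)" by (simp add: euclidean_representation)
    also have "\<dots> = (\<Sum>b\<in>Basis. (h \<bullet> b) * D b)" by (simp add: linear_sum[OF lin] linear_scale[OF lin])
    also have "\<dots> = h \<bullet> g" by (simp add: g_def inner_sum_right mult.commute)
    finally show ?thesis .
  qed
  have "D = (\<lambda>h. h \<bullet> g)" using Dg by blast
  with D have "GDERIV H z :> g" unfolding gderiv_def by simp
  moreover have "g' = g" if "GDERIV H z :> g'" for g'
  proof -
    have "(\<lambda>h. h \<bullet> g') = (\<lambda>h. h \<bullet> g)"
      using that D Dg has_derivative_unique[of H D z] unfolding gderiv_def by (metis ext)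
    then have "(g' - g) \<bullet> g' = (g' - g) \<bullet> g" by metis
    then have "(g' - g) \<bullet> (g' - g) = 0" by (simp add: inner_diff_right)
    then show ?thesis by simp
  qed
  ultimately have "gradient H z = g" unfolding gradient_def by (rule the_equality)
  with \<open>GDERIV H z :> g\<close> show ?thesis by (simp add: gderiv_def)
qed

lemma hessian_has_derivative:
  assumes "gradient H differentiable (at z)"
  shows "(gradient H has_derivative (\<lambda>h. hessian H z *v h)) (at z)"
  using assms jacobian_works unfolding hessian_def by blast

lemma hessian_symmetric:
  fixes H :: "'d::finite phase \<Rightarrow> real"
  assumes C2: "C2_function H"
  shows "transpose (hessian H z) = hessian H z"
proof -
  have f: "(H has_derivative (\<lambda>h. h \<bullet> gradient H z)) (at z)" for z
    using C2 gradient_has_derivative unfolding C2_function_def by blast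
  have g: "(gradient H has_derivative ((*v) (hessian H z))) (at z)" for z
    using C2 hessian_has_derivative unfolding C2_function_def by blast
  have "continuous_on UNIV (\<lambda>z. hessian H z *v v)" for v
    using C2 unfolding C2_function_def
    by (intro bounded_bilinear.continuous_on[OF bounded_bilinear_matrix_vector] continuous_on_const) auto
  then have sym: "u \<bullet> (hessian H z *v v) = v \<bullet> (hessian H z *v u)" for u v
    by (rule second_derivative_symmetric[OF f g])
  have "hessian H z $ i $ j = hessian H z $ j $ i" for i j
    using sym[of "axis i 1" "axis j 1"]
    by (simp add: inner_axis' matrix_vector_mult_basis column_def)
  then show ?thesis by (simp add: transpose_def vec_eq_iff)
qed

lemma norm_J_vec: "norm (J *v v) = norm v"
  by (simp add: norm_eq_sqrt_inner J_inner_J)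

lemma gradient_lipschitz_on_ball:
  fixes H :: "'d::finite phase \<Rightarrow> real"
  assumes C2: "C2_function H"
  obtains L where "L \<ge> 0" "\<And>a b. a \<in> cball 0 R \<Longrightarrow> b \<in> cball 0 R \<Longrightarrow> norm (gradient H a - gradient H b) \<le> L * norm (a - b)"
proof -
  obtain K where K: "K > 0" "\<And>(A :: 'd phase_matrix) v. norm (A *v v) \<le> norm A * norm v * K"
    using bounded_bilinear.pos_bounded[OF bounded_bilinear_matrix_vector] by blast
  have "compact (hessian H ` cball 0 R)"
    using C2 unfolding C2_function_def by (intro compact_continuous_image compact_cball) (auto intro: continuous_on_subset)
  then have "bounded (hessian H ` cball 0 R)" by (rule compact_imp_bounded)
  then obtain B where "\<forall>x\<in>hessian H ` cball 0 R. norm x \<le> B" unfolding bounded_iff by blast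
  then have B: "\<And>z. z \<in> cball 0 R \<Longrightarrow> norm (hessian H z) \<le> B" by blast
  define L where "L = max B 0 * K"
  show thesis
  proof
    show "L \<ge> 0" using K by (simp add: L_def)
    fix a b :: "'d phase" assume ab: "a \<in> cball 0 R" "b \<in> cball 0 R"
    show "norm (gradient H a - gradient H b) \<le> L * norm (a - b)"
    proof (rule differentiable_bound[where S = "cball 0 R" and f' = "\<lambda>z h. hessian H z *v h"])
      show "(gradient H has_derivative (*v) (hessian H z)) (at z within cball 0 R)" for z
        using C2 hessian_has_derivative has_derivative_at_withinI unfolding C2_function_def by blast
      show "onorm ((*v) (hessian H z)) \<le> L" if "z \<in> cball 0 R" for z
      proof (rule onorm_le)
        fix h
        have "norm (hessian H z *v h) \<le> norm (hessian H z) * norm h * K" by (rule K)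
        also have "\<dots> \<le> max B 0 * norm h * K" using B[OF that] K by (intro mult_right_mono) auto
        finally show "norm (hessian H z *v h) \<le> L * norm h" by (simp add: L_def mult_ac)
      qed
    qed (use ab in auto)
  qed
qed

lemma hamiltonian_orbit_unique:
  fixes H :: "'d::finite phase \<Rightarrow> real"
  assumes C2: "C2_function H" and x: "hamiltonian_orbit H x" and y: "hamiltonian_orbit H y" and "x 0 = y 0"
  shows "x = y"
proof
  fix t :: real
  define T where "T = \<bar>t\<bar>"
  have cx: "continuous_on S x" and cy: "continuous_on S y" for S
    using x y unfolding hamiltonian_orbit_def
    by (meson continuous_at_imp_continuous_on has_vector_derivative_continuous)+
  have "bounded (x ` {-T..T} \<union> y ` {-T..T})"
    by (intro compact_imp_bounded compact_Un compact_continuous_image cx cy) auto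
  then obtain R where R: "x ` {-T..T} \<union> y ` {-T..T} \<subseteq> cball 0 R"
    unfolding bounded_iff by (auto simp: subset_eq)
  obtain L where L: "L \<ge> 0" "\<And>a b. a \<in> cball 0 R \<Longrightarrow> b \<in> cball 0 R \<Longrightarrow> norm (gradient H a - gradient H b) \<le> L * norm (a - b)"
    using gradient_lipschitz_on_ball[OF C2] by blast
  have "x t - y t = 0"
  proof (rule gronwall_zero[where T = T and K = L and u = "\<lambda>t. x t - y t"])
    show "((\<lambda>t. x t - y t) has_vector_derivative J *v gradient H (x s) - J *v gradient H (y s)) (at s)" for s
      using x y unfolding hamiltonian_orbit_def by (intro has_vector_derivative_diff) auto
    show "norm (J *v gradient H (x s) - J *v gradient H (y s)) \<le> L * norm (x s - y s)" if "\<bar>s\<bar> \<le> T" for s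
    proof -
      have "s \<in> {-T..T}" using that by auto
      then have "x s \<in> cball 0 R" "y s \<in> cball 0 R" using R by blast+
      then show ?thesis using L(2) by (simp add: norm_J_vec flip: matrix_vector_mult_diff_distrib)
    qed
  qed (use L assms(4) T_def in auto)
  then show "x t = y t" by simp
qed

lemma orbit_from_eq:
  assumes "C2_function H" "hamiltonian_orbit H y" "y 0 = \<xi>"
  shows "orbit_from H \<xi> = y"
  unfolding orbit_from_def
  using hamiltonian_orbit_unique[OF assms(1)] assms(2,3) by (intro the_equality) auto

section \<open>Linear Hamiltonian systems\<close>

lemma fundamental_solution_continuous: "is_fundamental_solution B \<gamma> \<Longrightarrow> continuous_on S \<gamma>"
  unfolding is_fundamental_solution_def
  by (meson continuous_at_imp_continuous_on has_vector_derivative_continuous)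

lemma bounded_linear_transpose: "bounded_linear (transpose :: real^'n^'m \<Rightarrow> real^'m^'n)"
  by (auto intro!: linearI simp: linear_conv_bounded_linear[symmetric] transpose_add transpose_scalar)

text \<open>For symmetric \<open>B\<close> the derivative of \<open>\<gamma>\<^sup>T J \<gamma>\<close> is zero.\<close>

lemma hamiltonian_flow_Sp:
  fixes \<gamma> :: "real \<Rightarrow> 'd::finite phase_matrix"
  assumes sym: "\<And>t. transpose (B t) = B t" and \<gamma>: "is_fundamental_solution B \<gamma>"
  shows "\<gamma> t \<in> Sp"
proof -
  have d: "(\<gamma> has_vector_derivative J ** B t ** \<gamma> t) (at t)" for t using \<gamma> by (simp add: is_fundamental_solution_def)
  let ?f = "\<lambda>t. transpose (\<gamma> t) ** J ** \<gamma> t"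
  have "(?f has_vector_derivative 0) (at t)" for t
  proof -
    have "((\<lambda>t. transpose (\<gamma> t)) has_vector_derivative transpose (J ** B t ** \<gamma> t)) (at t)"
      by (rule bounded_linear.has_vector_derivative[OF bounded_linear_transpose d])
    from has_vector_derivative_matrix_mult[OF has_vector_derivative_matrix_mult[OF this has_vector_derivative_const[of J]] d]
    have "(?f has_vector_derivative transpose (\<gamma> t) ** J ** (J ** B t ** \<gamma> t) + (transpose (J ** B t ** \<gamma> t) ** J) ** \<gamma> t) (at t)"
      by simp
    moreover have "transpose (\<gamma> t) ** J ** (J ** B t ** \<gamma> t) = - (transpose (\<gamma> t) ** B t ** \<gamma> t)"
    proof -
      have "transpose (\<gamma> t) ** J ** (J ** B t ** \<gamma> t) = transpose (\<gamma> t) ** (J ** J) ** (B t ** \<gamma> t)" by (simp add: matrix_mul_assoc)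
      then show ?thesis by (simp add: J_J matrix_neg_left matrix_neg_right matrix_mul_assoc)
    qed
    moreover have "transpose (J ** B t ** \<gamma> t) ** J ** \<gamma> t = transpose (\<gamma> t) ** B t ** \<gamma> t"
    proof -
      have "transpose (J ** B t ** \<gamma> t) ** J ** \<gamma> t = - (transpose (\<gamma> t) ** B t ** (J ** J) ** \<gamma> t)"
        by (simp add: matrix_transpose_mul transpose_J sym matrix_neg_left matrix_neg_right matrix_mul_assoc)
      then show ?thesis by (simp add: J_J matrix_neg_left matrix_neg_right)
    qed
    ultimately show ?thesis by simp
  qed
  then obtain c where "\<And>t. t \<in> UNIV \<Longrightarrow> ?f t = c"
    using has_vector_derivative_zero_constant[of UNIV ?f] by auto
  then have "?f t = ?f 0" by simp
  also have "\<dots> = J" using \<gamma> by (simp add: is_fundamental_solution_def transpose_mat)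
  finally show ?thesis by (rule SpI)
qed

lemma linear_system_bound:
  fixes B :: "real \<Rightarrow> 'd::finite phase_matrix"
  assumes \<gamma>: "is_fundamental_solution B \<gamma>" and B: "\<And>t. \<bar>t\<bar> \<le> T \<Longrightarrow> norm (B t) \<le> b"
    and K: "K \<ge> 0" "\<And>(A :: 'd phase_matrix) (C :: 'd phase_matrix). norm (J ** A ** C) \<le> K * norm A * norm C"
    and t: "\<bar>t\<bar> \<le> T"
  shows "norm (\<gamma> t) ^ 2 \<le> norm (mat 1 :: 'd phase_matrix) ^ 2 * exp ((2 * (K * b) + 1) * T)"
proof -
  have b0: "b \<ge> 0" using B[OF t] norm_ge_zero order.trans by blast
  have "norm (\<gamma> t) ^ 2 \<le> (norm (\<gamma> 0) ^ 2 + 0 ^ 2) * exp ((2 * (K * b) + 1) * T)"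
  proof (rule gronwall[where u' = "\<lambda>t. J ** B t ** \<gamma> t", OF _ _ _ _ t])
    show "(\<gamma> has_vector_derivative J ** B s ** \<gamma> s) (at s)" for s using \<gamma> by (simp add: is_fundamental_solution_def)
    show "norm (J ** B s ** \<gamma> s) \<le> K * b * norm (\<gamma> s) + 0" if "\<bar>s\<bar> \<le> T" for s
    proof -
      have "norm (J ** B s ** \<gamma> s) \<le> K * norm (B s) * norm (\<gamma> s)" by (rule K)
      also have "\<dots> \<le> K * b * norm (\<gamma> s)" using B[OF that] K by (intro mult_right_mono mult_left_mono) auto
      finally show ?thesis by simp
    qed
  qed (use K b0 in auto)
  then show ?thesis using \<gamma> by (simp add: is_fundamental_solution_def)
qed

lemma linear_system_compare:
  fixes B B' :: "real \<Rightarrow> 'd::finite phase_matrix"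
  assumes \<gamma>: "is_fundamental_solution B \<gamma>" and \<gamma>': "is_fundamental_solution B' \<gamma>'"
    and B: "\<And>t. \<bar>t\<bar> \<le> T \<Longrightarrow> norm (B t) \<le> b" and G: "\<And>t. \<bar>t\<bar> \<le> T \<Longrightarrow> norm (\<gamma>' t) \<le> g"
    and BB: "\<And>t. \<bar>t\<bar> \<le> T \<Longrightarrow> norm (B t - B' t) \<le> e"
    and K: "K \<ge> 0" "\<And>(A :: 'd phase_matrix) (C :: 'd phase_matrix). norm (J ** A ** C) \<le> K * norm A * norm C"
    and t: "\<bar>t\<bar> \<le> T"
  shows "norm (\<gamma> t - \<gamma>' t) ^ 2 \<le> (K * e * g) ^ 2 * exp ((2 * (K * b) + 1) * T)"
proof -
  have b0: "b \<ge> 0" "g \<ge> 0" "e \<ge> 0" using B[OF t] G[OF t] BB[OF t] norm_ge_zero order.trans by blast+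
  have "norm (\<gamma> t - \<gamma>' t) ^ 2 \<le> (norm (\<gamma> 0 - \<gamma>' 0) ^ 2 + (K * e * g) ^ 2) * exp ((2 * (K * b) + 1) * T)"
  proof (rule gronwall[where u' = "\<lambda>t. J ** B t ** \<gamma> t - J ** B' t ** \<gamma>' t" and u = "\<lambda>t. \<gamma> t - \<gamma>' t", OF _ _ _ _ t])
    show "((\<lambda>t. \<gamma> t - \<gamma>' t) has_vector_derivative J ** B s ** \<gamma> s - J ** B' s ** \<gamma>' s) (at s)" for s
      using \<gamma> \<gamma>' unfolding is_fundamental_solution_def by (intro has_vector_derivative_diff) auto
    show "norm (J ** B s ** \<gamma> s - J ** B' s ** \<gamma>' s) \<le> K * b * norm (\<gamma> s - \<gamma>' s) + K * e * g" if s: "\<bar>s\<bar> \<le> T" for s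
    proof -
      have "J ** B s ** \<gamma> s - J ** B' s ** \<gamma>' s = J ** B s ** (\<gamma> s - \<gamma>' s) + J ** (B s - B' s) ** \<gamma>' s"
        by (simp add: matrix_alg)
      then have "norm (J ** B s ** \<gamma> s - J ** B' s ** \<gamma>' s) \<le> norm (J ** B s ** (\<gamma> s - \<gamma>' s)) + norm (J ** (B s - B' s) ** \<gamma>' s)"
        using norm_triangle_ineq by metis
      also have "\<dots> \<le> K * norm (B s) * norm (\<gamma> s - \<gamma>' s) + K * norm (B s - B' s) * norm (\<gamma>' s)" by (intro add_mono K)
      also have "\<dots> \<le> K * b * norm (\<gamma> s - \<gamma>' s) + K * e * g"
        using B[OF s] G[OF s] BB[OF s] K b0 by (intro add_mono mult_mono mult_right_mono mult_left_mono) auto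
      finally show ?thesis .
    qed
  qed (use K b0 in auto)
  then show ?thesis using \<gamma> \<gamma>' by (simp add: is_fundamental_solution_def)
qed

lemma J_mult_bound:
  obtains K where "K \<ge> 0" "\<And>(A :: 'd::finite phase_matrix) (C :: 'd phase_matrix). norm (J ** A ** C) \<le> K * norm A * norm C"
proof -
  obtain K where K: "K > 0" "\<And>(A :: 'd phase_matrix) (B :: 'd phase_matrix). norm (A ** B) \<le> norm A * norm B * K"
    using norm_matrix_mult_bound by blast
  have "norm (J ** A ** C) \<le> (norm (J :: 'd phase_matrix) * K * K) * norm A * norm C" for A C :: "'d phase_matrix"
  proof -
    have "norm (J ** A ** C) \<le> norm (J ** A) * norm C * K" by (rule K)
    also have "\<dots> \<le> (norm (J :: 'd phase_matrix) * norm A * K) * norm C * K" using K by (intro mult_right_mono) auto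
    finally show ?thesis by (simp add: mult_ac)
  qed
  then show thesis using K by (intro that[of "norm (J :: 'd phase_matrix) * K * K"]) auto
qed

text \<open>Uniqueness: compare two solutions of the same system.\<close>

lemma fundamental_solution_eq:
  fixes B :: "real \<Rightarrow> 'd::finite phase_matrix"
  assumes \<gamma>: "is_fundamental_solution B \<gamma>" and B: "\<And>t. norm (B t) \<le> b"
  shows "fundamental_solution B = \<gamma>"
  unfolding fundamental_solution_def
proof (rule the_equality)
  show "is_fundamental_solution B \<gamma>" by fact
  fix \<delta> assume \<delta>: "is_fundamental_solution B \<delta>"
  obtain K where K: "K \<ge> 0" "\<And>(A :: 'd phase_matrix) (C :: 'd phase_matrix). norm (J ** A ** C) \<le> K * norm A * norm C"
    using J_mult_bound by blast
  have "\<delta> t = \<gamma> t" for t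
  proof -
    have "bounded (\<gamma> ` {-\<bar>t\<bar>..\<bar>t\<bar>})"
      by (intro compact_imp_bounded compact_continuous_image fundamental_solution_continuous[OF \<gamma>]) auto
    then obtain g where "\<forall>x\<in>\<gamma> ` {-\<bar>t\<bar>..\<bar>t\<bar>}. norm x \<le> g" unfolding bounded_iff by blast
    then have g: "\<And>s. \<bar>s\<bar> \<le> \<bar>t\<bar> \<Longrightarrow> norm (\<gamma> s) \<le> g" by (auto simp: abs_le_iff)
    have "norm (\<delta> t - \<gamma> t) ^ 2 \<le> (K * 0 * g) ^ 2 * exp ((2 * (K * b) + 1) * \<bar>t\<bar>)"
      by (rule linear_system_compare[OF \<delta> \<gamma> B g _ K]) auto
    then show ?thesis by simp
  qed
  then show "\<delta> = \<gamma>" by blast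
qed

section \<open>Quasi-additive functions over a minimal isometric flow\<close>

text \<open>
  The properties of the turning along a quasi-periodic orbit on which the convergence of
  its mean rests. The flow preserves \<open>d\<close>, and every point of \<open>X\<close> is \<open>\<delta>\<close>-close to the
  orbit of \<open>x0\<close> within a time bounded in terms of \<open>\<delta>\<close> alone. One constant \<open>C\<close> bounds the
  defect of additivity, the values at short times up to \<open>h\<close>, and, for each \<open>T\<close>, the difference
  at time \<open>T\<close> of sufficiently close points; it must not depend on \<open>T\<close>.
\<close>

locale rotation_cocycle =
  fixes X :: "'a set" and \<phi> :: "'a \<Rightarrow> real \<Rightarrow> 'a" and d :: "'a \<Rightarrow> 'a \<Rightarrow> real" and x0 :: 'a
    and r :: "'a \<Rightarrow> real \<Rightarrow> real" and C h :: real
  assumes x0: "x0 \<in> X" and flow_in: "\<xi> \<in> X \<Longrightarrow> \<phi> \<xi> t \<in> X"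
    and flow_add: "\<xi> \<in> X \<Longrightarrow> \<phi> (\<phi> \<xi> s) t = \<phi> \<xi> (s + t)"
    and d_inv: "\<xi> \<in> X \<Longrightarrow> \<eta> \<in> X \<Longrightarrow> d (\<phi> \<xi> t) (\<phi> \<eta> t) = d \<xi> \<eta>"
    and dense: "\<delta> > 0 \<Longrightarrow> \<exists>L\<ge>0. \<forall>\<xi>\<in>X. \<exists>s. \<bar>s\<bar> \<le> L \<and> d \<xi> (\<phi> x0 s) < \<delta>"
    and quasi: "\<xi> \<in> X \<Longrightarrow> \<bar>r \<xi> (s + t) - r \<xi> s - r (\<phi> \<xi> s) t\<bar> \<le> C"
    and h: "h > 0" and small: "\<xi> \<in> X \<Longrightarrow> \<bar>t\<bar> \<le> h \<Longrightarrow> \<bar>r \<xi> t\<bar> \<le> C"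
    and close: "T > 0 \<Longrightarrow> \<exists>\<delta>>0. \<forall>\<xi>\<in>X. \<forall>\<eta>\<in>X. d \<xi> \<eta> < \<delta> \<longrightarrow> \<bar>r \<xi> T - r \<eta> T\<bar> \<le> C"
begin

lemma C_nonneg: "C \<ge> 0"
  using small[OF x0, of 0] h by linarith

lemma linear_growth: "\<xi> \<in> X \<Longrightarrow> \<bar>r \<xi> t\<bar> \<le> (2 * C / h) * \<bar>t\<bar> + 3 * C"
proof -
  assume \<xi>: "\<xi> \<in> X"
  have step: "\<bar>r \<xi> t\<bar> \<le> 2 * C * n + C" if "\<bar>t\<bar> \<le> real n * h" for n t
    using that
  proof (induction n arbitrary: t)
    case 0
    then show ?case using small[OF \<xi>, of 0] h by simp
  next
    case (Suc n)
    \<comment> \<open>Split off the last of \<open>n + 1\<close> equal pieces; this treats both signs of \<open>t\<close> at once.\<close>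
    define s where "s = t * (n / Suc n)"
    have ts: "t - s = t / Suc n" by (simp add: s_def field_simps)
    have "\<bar>t\<bar> / Suc n \<le> h" using Suc.prems by (simp add: divide_le_eq mult.commute)
    then have 1: "\<bar>t - s\<bar> \<le> h" by (simp add: ts)
    have "\<bar>s\<bar> = n * (\<bar>t\<bar> / Suc n)" by (simp add: s_def abs_mult)
    also have "\<dots> \<le> n * h" using \<open>\<bar>t\<bar> / Suc n \<le> h\<close> by (intro mult_left_mono) auto
    finally have "\<bar>r \<xi> s\<bar> \<le> 2 * C * n + C" by (rule Suc.IH)
    moreover have "\<bar>r (\<phi> \<xi> s) (t - s)\<bar> \<le> C" by (rule small[OF flow_in[OF \<xi>] 1])
    moreover have "\<bar>r \<xi> t - r \<xi> s - r (\<phi> \<xi> s) (t - s)\<bar> \<le> C" using quasi[OF \<xi>, of s "t - s"] by simp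
    ultimately show ?case by (simp add: algebra_simps)
  qed
  define n where "n = nat \<lceil>\<bar>t\<bar> / h\<rceil>"
  have n: "\<bar>t\<bar> / h \<le> n" "real n \<le> \<bar>t\<bar> / h + 1" using h by (auto simp: n_def)
  have "\<bar>t\<bar> \<le> n * h" using n(1) h by (simp add: divide_le_eq)
  then have "\<bar>r \<xi> t\<bar> \<le> 2 * C * n + C" by (rule step)
  also have "2 * C * n \<le> 2 * C * (\<bar>t\<bar> / h + 1)" using n(2) C_nonneg by (intro mult_left_mono) auto
  finally show ?thesis by (simp add: algebra_simps)
qed

text \<open>Each of the \<open>n\<close> concatenations costs \<open>C\<close>.\<close>

lemma birkhoff_sum: "\<xi> \<in> X \<Longrightarrow> \<bar>r \<xi> (real n * T) - (\<Sum>k<n. r (\<phi> \<xi> (real k * T)) T)\<bar> \<le> n * C + C"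
proof (induction n)
  case 0
  then show ?case using small[of \<xi> 0] h by simp
next
  case (Suc n)
  have "\<bar>r \<xi> (real n * T + T) - r \<xi> (real n * T) - r (\<phi> \<xi> (real n * T)) T\<bar> \<le> C" by (rule quasi[OF Suc.prems])
  moreover have "real (Suc n) * T = real n * T + T" by (simp add: algebra_simps)
  ultimately show ?case using Suc.IH[OF Suc.prems] by (simp add: algebra_simps)
qed

lemma floor_split:
  assumes "T > 0" "S \<ge> 0"
  obtains n :: nat where "real n \<le> S / T" "0 \<le> S - real n * T" "S - real n * T \<le> T" "\<bar>real n - S / T\<bar> \<le> 1"
proof -
  define n where "n = nat \<lfloor>S / T\<rfloor>"
  have "0 \<le> S / T" using assms by simp
  then have n: "real n \<le> S / T" "S / T < real n + 1" by (auto simp: n_def)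
  have "real n * T \<le> S" "S \<le> (real n + 1) * T" using n assms(1) by (simp_all add: pos_le_divide_eq pos_divide_less_eq less_imp_le)
  then show thesis using n by (intro that[of n]) (auto simp: algebra_simps)
qed

lemma round_down:
  assumes \<xi>: "\<xi> \<in> X" and "T > 0" "0 \<le> S - real n * T" "S - real n * T \<le> T"
  shows "\<bar>r \<xi> S - r \<xi> (real n * T)\<bar> \<le> 4 * C + (2 * C / h) * T"
proof -
  have "\<bar>r \<xi> S - r \<xi> (real n * T) - r (\<phi> \<xi> (real n * T)) (S - real n * T)\<bar> \<le> C"
    using quasi[OF \<xi>, of "real n * T" "S - real n * T"] by simp
  moreover have "\<bar>r (\<phi> \<xi> (real n * T)) (S - real n * T)\<bar> \<le> (2 * C / h) * \<bar>S - real n * T\<bar> + 3 * C"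
    by (rule linear_growth[OF flow_in[OF \<xi>]])
  moreover have "(2 * C / h) * \<bar>S - real n * T\<bar> \<le> (2 * C / h) * T"
    using assms C_nonneg h by (intro mult_left_mono) auto
  ultimately show ?thesis by linarith
qed

text \<open>
  Choose \<open>\<eta> = \<phi> x0 s\<close> close to \<open>\<xi>\<close>. As the flow is isometric, the orbits of
  \<open>\<xi>\<close> and \<open>\<eta>\<close> are close at all times, so their Birkhoff sums over steps of length \<open>T\<close>
  differ by at most \<open>C\<close> per step. Passing from \<open>\<eta>\<close> to \<open>x0\<close> is a shift by the bounded time
  \<open>s\<close>, which contributes to the constant \<open>c\<close>.
\<close>

lemma compare_points:
  assumes T: "T > 0"
  shows "\<exists>c\<ge>0. \<forall>S\<ge>0. \<forall>\<xi>\<in>X. \<bar>r \<xi> S - r x0 S\<bar> \<le> (3 * C / T) * S + c"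
proof -
  obtain \<delta> where \<delta>: "\<delta> > 0" "\<And>\<xi> \<eta>. \<xi> \<in> X \<Longrightarrow> \<eta> \<in> X \<Longrightarrow> d \<xi> \<eta> < \<delta> \<Longrightarrow> \<bar>r \<xi> T - r \<eta> T\<bar> \<le> C"
    using close[OF T] by blast
  obtain L where L: "L \<ge> 0" "\<And>\<xi>. \<xi> \<in> X \<Longrightarrow> \<exists>s. \<bar>s\<bar> \<le> L \<and> d \<xi> (\<phi> x0 s) < \<delta>" using dense[OF \<delta>(1)] by blast
  define q where "q = (2 * C / h) * L + 3 * C"
  define p where "p = 4 * C + (2 * C / h) * T"
  have pq: "p \<ge> 0" "q \<ge> 0" using C_nonneg h L T by (auto simp: p_def q_def)
  have main: "\<bar>r \<xi> S - r x0 S\<bar> \<le> (3 * C / T) * S + (4 * C + 2 * q + 2 * p)" if S: "S \<ge> 0" and \<xi>: "\<xi> \<in> X" for S \<xi>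
  proof -
    obtain n :: nat where n: "real n \<le> S / T" "0 \<le> S - real n * T" "S - real n * T \<le> T" using floor_split[OF T S] by metis
    obtain s where s: "\<bar>s\<bar> \<le> L" "d \<xi> (\<phi> x0 s) < \<delta>" using L(2)[OF \<xi>] by blast
    define \<eta> where "\<eta> = \<phi> x0 s"
    have \<eta>: "\<eta> \<in> X" unfolding \<eta>_def by (rule flow_in[OF x0])
    let ?N = "real n * T"
    have "\<bar>(\<Sum>k<n. r (\<phi> \<xi> (real k * T)) T) - (\<Sum>k<n. r (\<phi> \<eta> (real k * T)) T)\<bar> \<le> (\<Sum>k<n. C)"
      unfolding sum_subtractf[symmetric]
      by (rule order.trans[OF sum_abs]) (intro sum_mono \<delta>(2) flow_in \<xi> \<eta>; use d_inv[OF \<xi> \<eta>] s in \<open>simp add: \<eta>_def\<close>)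
    then have 1: "\<bar>r \<xi> ?N - r \<eta> ?N\<bar> \<le> 3 * C * n + 2 * C"
      using birkhoff_sum[OF \<xi>, of n T] birkhoff_sum[OF \<eta>, of n T] by (simp add: algebra_simps)
    have bound: "\<bar>r \<zeta> s\<bar> \<le> q" if "\<zeta> \<in> X" for \<zeta>
    proof -
      have "(2 * C / h) * \<bar>s\<bar> \<le> (2 * C / h) * L" using s(1) C_nonneg h by (intro mult_left_mono) auto
      then show ?thesis using linear_growth[OF that, of s] by (simp add: q_def)
    qed
    have "\<bar>r x0 (s + ?N) - r x0 s - r \<eta> ?N\<bar> \<le> C" unfolding \<eta>_def by (rule quasi[OF x0])
    moreover have "\<bar>r x0 (s + ?N) - r x0 ?N - r (\<phi> x0 ?N) s\<bar> \<le> C" using quasi[OF x0, of ?N s] by (simp add: add.commute)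
    ultimately have 2: "\<bar>r \<eta> ?N - r x0 ?N\<bar> \<le> 2 * C + 2 * q"
      using bound[OF x0] bound[OF flow_in[OF x0, of ?N]] by linarith
    have 3: "\<bar>r \<xi> S - r \<xi> ?N\<bar> \<le> p" "\<bar>r x0 S - r x0 ?N\<bar> \<le> p"
      unfolding p_def by (rule round_down[OF _ T n(2,3)]; fact \<xi> x0)+
    have "3 * C * n \<le> 3 * C * (S / T)" using n(1) C_nonneg by (intro mult_left_mono) auto
    then have "3 * C * n \<le> (3 * C / T) * S" by simp
    with 1 2 3 show ?thesis by linarith
  qed
  show ?thesis by (rule exI[of _ "4 * C + 2 * q + 2 * p"]) (use main pq C_nonneg in auto)
qed

text \<open>Take \<open>T\<close> large compared with \<open>C / e\<close>.\<close>

lemma uniform_comparison: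
  assumes e: "e > 0"
  shows "\<exists>S0>0. \<forall>S\<ge>S0. \<forall>\<xi>\<in>X. \<bar>r \<xi> S - r x0 S\<bar> \<le> e * S"
proof -
  \<comment> \<open>So that the rate \<open>3 C / T\<close> is at most \<open>e / 2\<close>.\<close>
  define T where "T = 6 * C / e + 1"
  have T: "T > 0" using e C_nonneg by (simp add: T_def add_nonneg_pos)
  obtain c where c: "c \<ge> 0" "\<And>S \<xi>. S \<ge> 0 \<Longrightarrow> \<xi> \<in> X \<Longrightarrow> \<bar>r \<xi> S - r x0 S\<bar> \<le> (3 * C / T) * S + c" using compare_points[OF T] by blast
  have "6 * C \<le> e * T" using e by (simp add: T_def distrib_left)
  then have CT: "3 * C / T \<le> e / 2" using T by (simp add: divide_le_eq)
  have "\<bar>r \<xi> S - r x0 S\<bar> \<le> e * S" if "S \<ge> 2 * c / e + 1" "\<xi> \<in> X" for S \<xi>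
  proof -
    have S0: "S \<ge> 0" using that(1) c(1) e by (smt (verit) divide_nonneg_pos)
    have "2 * c / e \<le> S" using that(1) by simp
    then have "c \<le> (e / 2) * S" using e by (simp add: divide_le_eq mult.commute)
    moreover have "(3 * C / T) * S \<le> (e / 2) * S" using CT S0 by (intro mult_right_mono) auto
    moreover have "(e / 2) * S + (e / 2) * S = e * S" by (simp add: field_simps)
    ultimately show ?thesis using c(2)[OF S0 that(2)] by linarith
  qed
  moreover have "2 * c / e + 1 > 0" using c e by (simp add: add_nonneg_pos)
  ultimately show ?thesis by blast
qed

text \<open>
  Each summand \<open>r (\<phi> x0 (k T)) T\<close> of the Birkhoff sum is \<open>r x0 T\<close> up to \<open>(e / 4) T\<close>, by
  uniformity over the points of \<open>X\<close>.
\<close>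

lemma mean_cauchy:
  assumes e: "e > 0"
  shows "\<exists>T>0. \<exists>S0>0. \<forall>S\<ge>S0. \<bar>r x0 S / S - r x0 T / T\<bar> \<le> e"
proof -
  obtain T0 where T0: "T0 > 0" "\<And>S \<xi>. S \<ge> T0 \<Longrightarrow> \<xi> \<in> X \<Longrightarrow> \<bar>r \<xi> S - r x0 S\<bar> \<le> (e / 4) * S"
    using uniform_comparison[of "e / 4"] e by auto
  define T where "T = max T0 (4 * C / e)"
  have T: "T > 0" "T \<ge> T0" "4 * C / e \<le> T" using T0 by (auto simp: T_def)
  have CT: "C / T \<le> e / 4" using T(1,3) e by (simp add: divide_le_eq mult.commute pos_divide_le_eq)
  define p where "p = 4 * C + (2 * C / h) * T"
  define c where "c = p + C + \<bar>r x0 T\<bar>"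
  have c: "c \<ge> 0" using C_nonneg h T by (auto simp: c_def p_def)
  have "\<bar>r x0 S / S - r x0 T / T\<bar> \<le> e" if S: "S \<ge> 4 * c / e + 1" for S
  proof -
    have S1: "S > 0" using S c e by (smt (verit) divide_nonneg_pos)
    obtain n :: nat where n: "real n \<le> S / T" "0 \<le> S - real n * T" "S - real n * T \<le> T" "\<bar>real n - S / T\<bar> \<le> 1" using floor_split[OF T(1) less_imp_le[OF S1]] by metis
    let ?N = "real n * T"
    have 1: "\<bar>r x0 S - r x0 ?N\<bar> \<le> p" unfolding p_def by (rule round_down[OF x0 T(1) n(2,3)])
    have "\<bar>(\<Sum>k<n. r (\<phi> x0 (real k * T)) T) - (\<Sum>k<n. r x0 T)\<bar> \<le> (\<Sum>k<n. (e / 4) * T)"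
      unfolding sum_subtractf[symmetric]
      by (rule order.trans[OF sum_abs]) (intro sum_mono T0(2) T flow_in x0)
    moreover have "(\<Sum>k<n. r x0 T) = n * r x0 T" "(\<Sum>k<n. (e / 4) * T) = n * ((e / 4) * T)" by simp_all
    ultimately have 2: "\<bar>r x0 ?N - n * r x0 T\<bar> \<le> n * C + C + n * ((e / 4) * T)"
      using birkhoff_sum[OF x0, of n T] by linarith
    have 3: "\<bar>n * r x0 T - (S / T) * r x0 T\<bar> \<le> \<bar>r x0 T\<bar>"
    proof -
      have "\<bar>n * r x0 T - (S / T) * r x0 T\<bar> = \<bar>n - S / T\<bar> * \<bar>r x0 T\<bar>" by (simp add: left_diff_distrib flip: abs_mult)
      also have "\<dots> \<le> 1 * \<bar>r x0 T\<bar>" by (intro mult_right_mono n) auto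
      finally show ?thesis by simp
    qed
    have 4: "n * C \<le> (e / 4) * S"
    proof -
      have "n * C \<le> (S / T) * C" using n(1) C_nonneg by (intro mult_right_mono) auto
      also have "\<dots> = (C / T) * S" by simp
      also have "\<dots> \<le> (e / 4) * S" using CT S1 by (intro mult_right_mono) auto
      finally show ?thesis .
    qed
    have 5: "n * ((e / 4) * T) \<le> (e / 4) * S"
    proof -
      have "?N * (e / 4) \<le> S * (e / 4)" using n(2) e by (intro mult_right_mono) auto
      then show ?thesis by (simp add: mult_ac)
    qed
    have "4 * c / e \<le> S" using S by simp
    then have 6: "c \<le> (e / 4) * S" using e by (simp add: pos_divide_le_eq mult.commute)
    have "4 * ((e / 4) * S) = e * S" "0 \<le> (e / 4) * S" using e S1 by simp_all
    then have "\<bar>r x0 S - (S / T) * r x0 T\<bar> \<le> e * S" using 1 2 3 4 5 6 unfolding c_def by linarith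
    then have "\<bar>r x0 S - (S / T) * r x0 T\<bar> / S \<le> e" using S1 by (simp add: pos_divide_le_eq)
    moreover have "r x0 S / S - r x0 T / T = (r x0 S - (S / T) * r x0 T) / S" using S1 by (simp add: diff_divide_distrib)
    ultimately show ?thesis using S1 by (simp add: abs_divide)
  qed
  moreover have "4 * c / e + 1 > 0" using c e by (simp add: add_nonneg_pos)
  ultimately show ?thesis using T(1) by blast
qed

text \<open>
  The means along \<open>x0\<close> form a Cauchy family by the previous lemma, and all points of \<open>X\<close> have
  the same means asymptotically. For backward times, quasi-additivity relates
  \<open>r \<xi> (- S)\<close> to \<open>- r (\<phi> \<xi> (- S)) S\<close> up to \<open>2 C\<close>, and uniformity over \<open>X\<close> applies to
  the moving base point.
\<close>

theorem mean_converges_uniformly: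
  "\<exists>L. \<forall>e>0. \<exists>S0>0. \<forall>S\<ge>S0. \<forall>\<xi>\<in>X. \<bar>r \<xi> S / S - L\<bar> \<le> e \<and> \<bar>r \<xi> (- S) / (- S) - L\<bar> \<le> e"
proof -
  let ?f = "\<lambda>n::nat. r x0 n / n"
  have "Cauchy ?f"
  proof (rule metric_CauchyI)
    fix e :: real assume e: "e > 0"
    obtain T S0 where T: "\<And>S. S \<ge> S0 \<Longrightarrow> \<bar>r x0 S / S - r x0 T / T\<bar> \<le> e / 3" using mean_cauchy[of "e / 3"] e by auto
    obtain M :: nat where M: "S0 \<le> M" using real_arch_simple by blast
    have "dist (?f m) (?f n) < e" if "m \<ge> M" "n \<ge> M" for m n
    proof -
      have "S0 \<le> m" "S0 \<le> n" using M that by linarith+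
      from T[OF this(1)] T[OF this(2)] e show ?thesis unfolding dist_real_def by linarith
    qed
    then show "\<exists>M. \<forall>m\<ge>M. \<forall>n\<ge>M. dist (?f m) (?f n) < e" by blast
  qed
  then obtain L where L: "?f \<longlonglongrightarrow> L" using Cauchy_convergent_iff convergent_def by metis
  have "\<exists>S0>0. \<forall>S\<ge>S0. \<forall>\<xi>\<in>X. \<bar>r \<xi> S / S - L\<bar> \<le> e \<and> \<bar>r \<xi> (- S) / (- S) - L\<bar> \<le> e" if e: "e > 0" for e
  proof -
    obtain T S1 where T: "S1 > 0" "\<And>S. S \<ge> S1 \<Longrightarrow> \<bar>r x0 S / S - r x0 T / T\<bar> \<le> e / 8" using mean_cauchy[of "e / 8"] e by auto
    obtain S2 where S2: "S2 > 0" "\<And>S \<xi>. S \<ge> S2 \<Longrightarrow> \<xi> \<in> X \<Longrightarrow> \<bar>r \<xi> S - r x0 S\<bar> \<le> (e / 4) * S" using uniform_comparison[of "e / 4"] e by auto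
    have LT: "\<bar>L - r x0 T / T\<bar> \<le> e / 8"
    proof (rule tendsto_upperbound)
      show "(\<lambda>n. \<bar>?f n - r x0 T / T\<bar>) \<longlonglongrightarrow> \<bar>L - r x0 T / T\<bar>" by (intro tendsto_intros L)
      obtain M :: nat where M: "S1 \<le> M" using real_arch_simple by blast
      show "\<forall>\<^sub>F n in sequentially. \<bar>?f n - r x0 T / T\<bar> \<le> e / 8"
        using eventually_ge_at_top[of M] by eventually_elim (use M in \<open>intro T(2); linarith\<close>)
    qed auto
    define S0 where "S0 = max S1 (max S2 (4 * C / e))"
    have fwd: "\<bar>r \<xi> S / S - L\<bar> \<le> e / 2" if S: "S \<ge> S0" "\<xi> \<in> X" for S \<xi>
    proof -
      have SS: "S \<ge> S1" "S \<ge> S2" "S > 0" using S(1) T(1) by (auto simp: S0_def)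
      have "\<bar>r \<xi> S - r x0 S\<bar> / S \<le> e / 4" using S2(2)[OF SS(2) S(2)] SS(3) by (simp add: pos_divide_le_eq)
      then have "\<bar>r \<xi> S / S - r x0 S / S\<bar> \<le> e / 4" using SS(3) by (simp add: abs_divide flip: diff_divide_distrib)
      with T(2)[OF SS(1)] LT show ?thesis by linarith
    qed
    have bwd: "\<bar>r \<xi> (- S) / (- S) - L\<bar> \<le> e" if S: "S \<ge> S0" "\<xi> \<in> X" for S \<xi>
    proof -
      have SS: "S > 0" "4 * C / e \<le> S" using S(1) T(1) by (auto simp: S0_def)
      let ?\<eta> = "\<phi> \<xi> (- S)"
      have "\<bar>r \<xi> (- S + S) - r \<xi> (- S) - r ?\<eta> S\<bar> \<le> C" by (rule quasi[OF S(2)])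
      moreover have "\<bar>r \<xi> 0\<bar> \<le> C" using small[OF S(2), of 0] h by simp
      ultimately have "\<bar>r \<xi> (- S) + r ?\<eta> S\<bar> \<le> 2 * C" by simp
      also have "\<dots> \<le> (e / 2) * S" using SS(2) e by (simp add: pos_divide_le_eq mult.commute)
      finally have "\<bar>r \<xi> (- S) + r ?\<eta> S\<bar> / S \<le> e / 2" using SS(1) by (simp add: pos_divide_le_eq)
      moreover have "r \<xi> (- S) / (- S) - r ?\<eta> S / S = - ((r \<xi> (- S) + r ?\<eta> S) / S)" by (simp add: add_divide_distrib)
      ultimately have "\<bar>r \<xi> (- S) / (- S) - r ?\<eta> S / S\<bar> \<le> e / 2" using SS(1) by (simp add: abs_divide)
      moreover have "\<bar>X - L\<bar> \<le> e" if "\<bar>X - Y\<bar> \<le> e / 2" "\<bar>Y - L\<bar> \<le> e / 2" for X Y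
        using that by linarith
      ultimately show ?thesis using fwd[OF S(1) flow_in[OF S(2)]] by blast
    qed
    have "S0 > 0" using T(1) by (simp add: S0_def)
    then show ?thesis using fwd bwd e by (intro exI[of _ S0]) force
  qed
  then show ?thesis by blast
qed

end

section \<open>The flow on the closure of a quasi-periodic orbit\<close>

text \<open>
  The flow on the torus by translations is carried over to the orbit closure. Since
  translations multiply the circle coordinates by complex numbers of modulus one, they
  preserve the sum \<open>d\<close> of the coordinate distances, which by compactness controls the
  Euclidean distance.
\<close>

lemma quasi_periodic_flow:
  fixes x :: "real \<Rightarrow> 'd::finite phase"
  assumes qp: "quasi_periodic x"
  obtains \<phi> :: "'d phase \<Rightarrow> real \<Rightarrow> 'd phase" and d :: "'d phase \<Rightarrow> 'd phase \<Rightarrow> real"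
  where "compact (orbit_closure x)"
    "\<And>t. \<phi> (x 0) t = x t"
    "\<And>\<xi> t. \<xi> \<in> orbit_closure x \<Longrightarrow> \<phi> \<xi> t \<in> orbit_closure x"
    "\<And>\<xi>. \<xi> \<in> orbit_closure x \<Longrightarrow> \<phi> \<xi> 0 = \<xi>"
    "\<And>\<xi> s t. \<xi> \<in> orbit_closure x \<Longrightarrow> \<phi> (\<phi> \<xi> s) t = \<phi> \<xi> (s + t)"
    "\<And>\<xi> \<eta> t. \<xi> \<in> orbit_closure x \<Longrightarrow> \<eta> \<in> orbit_closure x \<Longrightarrow> d (\<phi> \<xi> t) (\<phi> \<eta> t) = d \<xi> \<eta>"
    "\<And>e. e > 0 \<Longrightarrow> \<exists>\<delta>>0. \<forall>\<xi>\<in>orbit_closure x. \<forall>\<eta>\<in>orbit_closure x. d \<xi> \<eta> < \<delta> \<longrightarrow> dist \<xi> \<eta> < e"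
    "\<And>\<delta>. \<delta> > 0 \<Longrightarrow> \<exists>L\<ge>0. \<forall>\<xi>\<in>orbit_closure x. \<exists>s. \<bar>s\<bar> \<le> L \<and> d \<xi> (x s) < \<delta>"
proof -
  let ?X = "orbit_closure x"
  obtain m D E \<omega> where hom: "homeomorphic_maps (torus m) (top_of_set ?X) D E"
    and xt: "\<And>t. x t = D (torus_translate m (E (x 0)) (\<lambda>i. \<omega> i * t))"
    using qp unfolding quasi_periodic_def by blast
  have cD: "continuous_map (torus m) (top_of_set ?X) D" and cE: "continuous_map (top_of_set ?X) (torus m) E"
    and ED: "\<And>\<theta>. \<theta> \<in> topspace (torus m) \<Longrightarrow> E (D \<theta>) = \<theta>" and DE: "\<And>\<xi>. \<xi> \<in> ?X \<Longrightarrow> D (E \<xi>) = \<xi>"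
    using hom by (auto simp: homeomorphic_maps_def)
  have top: "topspace (torus m) = (\<Pi>\<^sub>E i\<in>{..<m}. sphere 0 1)" by (simp add: torus_def)
  have Etop: "E \<xi> \<in> topspace (torus m)" if "\<xi> \<in> ?X" for \<xi>
    using continuous_map_image_subset_topspace[OF cE] that by auto
  have DX: "D \<theta> \<in> ?X" if "\<theta> \<in> topspace (torus m)" for \<theta>
    using continuous_map_image_subset_topspace[OF cD] that by auto
  have trans_top: "torus_translate m \<theta> v \<in> topspace (torus m)" if "\<theta> \<in> topspace (torus m)" for \<theta> v
    using that unfolding top torus_translate_def by (auto simp: norm_mult PiE_iff)
  define \<phi> where "\<phi> \<xi> t = D (torus_translate m (E \<xi>) (\<lambda>i. \<omega> i * t))" for \<xi> t
  define d where "d \<xi> \<eta> = (\<Sum>i<m. norm (E \<xi> i - E \<eta> i))" for \<xi> \<eta>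
  have "compact_space (torus m)"
    unfolding torus_def by (simp add: compact_space_product_topology compact_space_subtopology compact_sphere)
  moreover have "torus m homeomorphic_space top_of_set ?X" using hom unfolding homeomorphic_space_def by blast
  ultimately have "compact_space (top_of_set ?X)" using homeomorphic_compact_space by blast
  then have cX: "compact ?X" by (simp add: compact_space_def compactin_subtopology)
  have E\<phi>: "E (\<phi> \<xi> t) = torus_translate m (E \<xi>) (\<lambda>i. \<omega> i * t)" if "\<xi> \<in> ?X" for \<xi> t
    unfolding \<phi>_def by (rule ED[OF trans_top[OF Etop[OF that]]])
  have E\<phi>i: "E (\<phi> \<xi> t) i = E \<xi> i * cis (2 * pi * (\<omega> i * t))" if "\<xi> \<in> ?X" "i < m" for \<xi> t i
    unfolding E\<phi>[OF that(1)] using that(2) by (simp add: torus_translate_def)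
  have \<phi>X: "\<phi> \<xi> t \<in> ?X" if "\<xi> \<in> ?X" for \<xi> t unfolding \<phi>_def by (rule DX[OF trans_top[OF Etop[OF that]]])
  have ext: "torus_translate m (E \<xi>) (\<lambda>i. 0) = E \<xi>" if "\<xi> \<in> ?X" for \<xi>
    using Etop[OF that] unfolding top torus_translate_def by (auto simp: fun_eq_iff PiE_iff extensional_def restrict_def)
  have \<phi>0: "\<phi> \<xi> 0 = \<xi>" if "\<xi> \<in> ?X" for \<xi> unfolding \<phi>_def using ext[OF that] DE[OF that] by simp
  have \<phi>add: "\<phi> (\<phi> \<xi> s) t = \<phi> \<xi> (s + t)" if "\<xi> \<in> ?X" for \<xi> s t
  proof -
    have "torus_translate m (E (\<phi> \<xi> s)) (\<lambda>i. \<omega> i * t) = torus_translate m (E \<xi>) (\<lambda>i. \<omega> i * (s + t))"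
      unfolding E\<phi>[OF that] by (auto simp: fun_eq_iff torus_translate_def restrict_def mult.assoc cis_mult algebra_simps)
    then show ?thesis by (simp add: \<phi>_def[of _ t] \<phi>_def[of \<xi> "s + t"])
  qed
  have dinv: "d (\<phi> \<xi> t) (\<phi> \<eta> t) = d \<xi> \<eta>" if "\<xi> \<in> ?X" "\<eta> \<in> ?X" for \<xi> \<eta> t
    unfolding d_def by (intro sum.cong refl) (simp add: E\<phi>i that norm_mult flip: left_diff_distrib)
  have cEi: "continuous_on ?X (\<lambda>\<xi>. E \<xi> i)" if "i < m" for i
    using cE that unfolding torus_def continuous_map_componentwise by (auto simp: continuous_map_in_subtopology)
  have cd: "continuous_on (?X \<times> ?X) (\<lambda>p. d (fst p) (snd p))"
    unfolding d_def
    by (intro continuous_intros continuous_on_compose2[OF cEi]) (auto intro!: continuous_on_fst continuous_on_snd continuous_on_id)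
  have d0: "\<xi> = \<eta>" if "\<xi> \<in> ?X" "\<eta> \<in> ?X" "d \<xi> \<eta> = 0" for \<xi> \<eta>
  proof -
    have "\<forall>i\<in>{..<m}. norm (E \<xi> i - E \<eta> i) = 0"
      using that(3) unfolding d_def by (subst (asm) sum_nonneg_eq_0_iff) auto
    then have "E \<xi> i = E \<eta> i" for i
      using Etop[OF that(1)] Etop[OF that(2)] unfolding top by (cases "i < m") (auto simp: PiE_iff extensional_def)
    then have "E \<xi> = E \<eta>" by blast
    then show ?thesis using DE that by metis
  qed
  have dnn: "d \<xi> \<eta> \<ge> 0" for \<xi> \<eta> unfolding d_def by (intro sum_nonneg) auto
  have dtri: "d \<xi> \<zeta> \<le> d \<xi> \<eta> + d \<eta> \<zeta>" for \<xi> \<eta> \<zeta>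
    unfolding d_def sum.distrib[symmetric]
    by (intro sum_mono) (metis dist_norm dist_triangle)
  have small: "\<exists>\<delta>>0. \<forall>\<xi>\<in>?X. \<forall>\<eta>\<in>?X. d \<xi> \<eta> < \<delta> \<longrightarrow> dist \<xi> \<eta> < e" if e: "e > 0" for e
  proof -
    \<comment> \<open>On the compact set of pairs at distance at least \<open>e\<close> the function \<open>d\<close> has a positive
        minimum.\<close>
    let ?K = "(?X \<times> ?X) \<inter> {p. e \<le> dist (fst p) (snd p)}"
    have K: "compact ?K"
      by (intro compact_Int_closed compact_Times cX closed_Collect_le continuous_intros)
    show ?thesis
    proof (cases "?K = {}")
      case True
      have "dist \<xi> \<eta> < e" if "\<xi> \<in> ?X" "\<eta> \<in> ?X" for \<xi> \<eta>
      proof -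
        have "(\<xi>, \<eta>) \<notin> ?K" using True by blast
        then show ?thesis using that by auto
      qed
      then show ?thesis by (intro exI[of _ 1]) auto
    next
      case False
      have "continuous_on ?K (\<lambda>p. d (fst p) (snd p))" by (rule continuous_on_subset[OF cd]) auto
      from continuous_attains_inf[OF K False this] obtain p where p: "p \<in> ?K" "\<And>q. q \<in> ?K \<Longrightarrow> d (fst p) (snd p) \<le> d (fst q) (snd q)"
        by blast
      have "d (fst p) (snd p) \<noteq> 0" using d0[of "fst p" "snd p"] p(1) e by auto
      then have pos: "d (fst p) (snd p) > 0" using dnn[of "fst p" "snd p"] by linarith
      have "dist \<xi> \<eta> < e" if "\<xi> \<in> ?X" "\<eta> \<in> ?X" "d \<xi> \<eta> < d (fst p) (snd p)" for \<xi> \<eta>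
      proof (rule ccontr)
        assume "\<not> dist \<xi> \<eta> < e"
        then have "(\<xi>, \<eta>) \<in> ?K" using that by auto
        from p(2)[OF this] that show False by simp
      qed
      with pos show ?thesis by blast
    qed
  qed
  have xX: "x s \<in> ?X" for s unfolding orbit_closure_def by (rule subsetD[OF closure_subset rangeI])
  have near: "\<exists>s. d \<xi> (x s) < \<delta>" if \<xi>: "\<xi> \<in> ?X" and "\<delta> > 0" for \<xi> \<delta>
  proof -
    have "continuous_on ?X (\<lambda>\<eta>. d (fst (\<xi>, \<eta>)) (snd (\<xi>, \<eta>)))"
      by (rule continuous_on_compose2[OF cd]) (use \<xi> in \<open>auto intro!: continuous_on_Pair continuous_on_const continuous_on_id\<close>)
    then have "continuous_on ?X (\<lambda>\<eta>. d \<xi> \<eta>)" by simp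
    then obtain e where e: "e > 0" "\<And>\<eta>. \<eta> \<in> ?X \<Longrightarrow> dist \<eta> \<xi> < e \<Longrightarrow> dist (d \<xi> \<eta>) (d \<xi> \<xi>) < \<delta>"
      unfolding continuous_on_iff using \<xi> \<open>\<delta> > 0\<close> by meson
    have "\<xi> \<in> closure (range x)" using \<xi> by (simp add: orbit_closure_def)
    then obtain s where "dist (x s) \<xi> < e" using e(1) unfolding closure_approachable by blast
    with e(2)[OF xX this] have "\<bar>d \<xi> (x s)\<bar> < \<delta>" by (simp add: d_def dist_real_def)
    then show ?thesis by (intro exI[of _ s]) auto
  qed
  \<comment> \<open>Otherwise there are points \<open>f n\<close> at distance at least \<open>\<delta>\<close> from \<open>x s\<close> for all
      \<open>\<bar>s\<bar> \<le> n\<close>, and an accumulation point of these contradicts density of the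
      orbit.\<close>
  have dense: "\<exists>L\<ge>0. \<forall>\<xi>\<in>?X. \<exists>s. \<bar>s\<bar> \<le> L \<and> d \<xi> (x s) < \<delta>" if \<delta>: "\<delta> > 0" for \<delta>
  proof (rule ccontr)
    assume "\<not> ?thesis"
    then have "\<forall>n::nat. \<exists>\<xi>\<in>?X. \<forall>s. \<bar>s\<bar> \<le> n \<longrightarrow> \<delta> \<le> d \<xi> (x s)" by (metis linorder_not_less of_nat_0_le_iff)
    then obtain f where f: "\<And>n::nat. f n \<in> ?X" "\<And>n s. \<bar>s\<bar> \<le> real n \<Longrightarrow> \<delta> \<le> d (f n) (x s)" by metis
    obtain l \<sigma> where l: "l \<in> ?X" "strict_mono \<sigma>" "(f \<circ> \<sigma>) \<longlonglongrightarrow> l"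
      using cX f(1) unfolding compact_def by metis
    obtain s where s: "d l (x s) < \<delta> / 2" using near[OF l(1), of "\<delta> / 2"] \<delta> by auto
    have "continuous_on ?X (\<lambda>\<eta>. d (fst (\<eta>, l)) (snd (\<eta>, l)))"
      by (rule continuous_on_compose2[OF cd]) (use l(1) in \<open>auto intro!: continuous_on_Pair continuous_on_const continuous_on_id\<close>)
    then have "continuous_on ?X (\<lambda>\<eta>. d \<eta> l)" by simp
    then have "(\<lambda>n. d ((f \<circ> \<sigma>) n) l) \<longlonglongrightarrow> d l l"
      by (rule continuous_on_tendsto_compose[OF _ l(3,1)]) (use f(1) in auto)
    then have "(\<lambda>n. d ((f \<circ> \<sigma>) n) l) \<longlonglongrightarrow> 0" by (simp add: d_def)
    then have "\<forall>\<^sub>F n in sequentially. d ((f \<circ> \<sigma>) n) l < \<delta> / 2" by (rule order_tendstoD(2)) (use \<delta> in simp)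
    then obtain N where N: "\<And>n. n \<ge> N \<Longrightarrow> d ((f \<circ> \<sigma>) n) l < \<delta> / 2" unfolding eventually_sequentially by blast
    obtain M :: nat where M: "\<bar>s\<bar> \<le> M" using real_arch_simple by blast
    define n where "n = max M N"
    have n: "d (f (\<sigma> n)) l < \<delta> / 2" "M \<le> n" using N[of n] by (auto simp: n_def)
    have "n \<le> \<sigma> n" using l(2) by (rule seq_suble)
    then have "\<bar>s\<bar> \<le> \<sigma> n" using M n(2) by linarith
    from f(2)[OF this] n(1) s dtri[of "f (\<sigma> n)" "x s" l] show False by simp
  qed
  have \<phi>x: "\<phi> (x 0) t = x t" for t using xt[of t] by (simp add: \<phi>_def)
  show thesis
    by (rule that[of \<phi> d, OF cX \<phi>x \<phi>X \<phi>0 \<phi>add dinv small dense])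
qed

section \<open>Linear systems along the orbit closure\<close>

text \<open>
  The fundamental solutions of uniformly convergent coefficients form a Cauchy sequence,
  uniformly on bounded time intervals, by the comparison estimate. This supplies a
  fundamental solution along every orbit in the closure, where the coefficients are limits
  of translates of those along the given orbit.
\<close>

lemma linear_system_limit:
  fixes B :: "real \<Rightarrow> 'd::finite phase_matrix"
  assumes sol: "\<And>n::nat. is_fundamental_solution (Bn n) (\<gamma>n n)"
    and b: "\<And>n t. norm (Bn n t) \<le> b" "\<And>t. norm (B t) \<le> b"
    and unif: "\<And>e. e > 0 \<Longrightarrow> \<forall>\<^sub>F n in sequentially. \<forall>t. norm (Bn n t - B t) \<le> e"
  shows "\<exists>\<Gamma>. is_fundamental_solution B \<Gamma>"
proof -
  obtain K where K: "K \<ge> 0" "\<And>(A :: 'd phase_matrix) (C :: 'd phase_matrix). norm (J ** A ** C) \<le> K * norm A * norm C"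
    using J_mult_bound by blast
  have b0: "b \<ge> 0" using b(2)[of 0] norm_ge_zero order.trans by blast
  define g where "g T = norm (mat 1 :: 'd phase_matrix) * exp ((2 * (K * b) + 1) * T)" for T
  have g: "norm (\<gamma>n n t) \<le> g T" if t: "\<bar>t\<bar> \<le> T" for n t T
  proof (rule power2_le_imp_le)
    have T0: "0 \<le> (2 * (K * b) + 1) * T" using t K b0 by (intro mult_nonneg_nonneg) auto
    have "norm (\<gamma>n n t) ^ 2 \<le> norm (mat 1 :: 'd phase_matrix) ^ 2 * exp ((2 * (K * b) + 1) * T)"
      by (rule linear_system_bound[OF sol b(1) K t])
    also have "\<dots> \<le> norm (mat 1 :: 'd phase_matrix) ^ 2 * (exp ((2 * (K * b) + 1) * T)) ^ 2"
      using T0 by (intro mult_left_mono self_le_power) auto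
    finally show "norm (\<gamma>n n t) ^ 2 \<le> g T ^ 2" by (simp add: g_def power_mult_distrib)
    show "0 \<le> g T" by (simp add: g_def)
  qed
  have cauchy: "\<exists>N. \<forall>m\<ge>N. \<forall>n\<ge>N. \<forall>t. \<bar>t\<bar> \<le> T \<longrightarrow> norm (\<gamma>n m t - \<gamma>n n t) \<le> e" if e: "e > 0" for e T
  proof -
    \<comment> \<open>The factor \<open>E + 1 \<ge> \<surd>E\<close> allows taking square roots in the comparison
        estimate.\<close>
    define E where "E = exp ((2 * (K * b) + 1) * T)"
    define Q where "Q = K * \<bar>g T\<bar> * (E + 1) + 1"
    have Q: "Q > 0" using K by (simp add: Q_def E_def add_nonneg_pos)
    define \<epsilon> where "\<epsilon> = e / Q"
    have \<epsilon>: "\<epsilon> > 0" using e Q by (simp add: \<epsilon>_def)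
    obtain N where N: "\<And>n t. n \<ge> N \<Longrightarrow> norm (Bn n t - B t) \<le> \<epsilon> / 2"
      using unif[of "\<epsilon> / 2"] \<epsilon> unfolding eventually_sequentially by auto
    have "norm (\<gamma>n m t - \<gamma>n n t) \<le> e" if mn: "m \<ge> N" "n \<ge> N" and t: "\<bar>t\<bar> \<le> T" for m n t
    proof (rule power2_le_imp_le)
      have BB: "norm (Bn m s - Bn n s) \<le> \<epsilon>" for s
        using N[OF mn(1), of s] N[OF mn(2), of s] norm_triangle_ineq4[of "Bn m s - B s" "Bn n s - B s"] by simp
      have "norm (\<gamma>n m t - \<gamma>n n t) ^ 2 \<le> (K * \<epsilon> * g T) ^ 2 * exp ((2 * (K * b) + 1) * T)"
        by (rule linear_system_compare[OF sol sol b(1) g BB K t])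
      also have "\<dots> \<le> (K * \<epsilon> * g T) ^ 2 * (E + 1) ^ 2"
      proof -
        have "E \<le> (E + 1) ^ 2" by (simp add: E_def power2_eq_square algebra_simps add_nonneg_nonneg)
        then show ?thesis unfolding E_def by (intro mult_left_mono) auto
      qed
      also have "\<dots> = (\<epsilon> * (K * \<bar>g T\<bar> * (E + 1))) ^ 2" by (simp add: power_mult_distrib)
      also have "\<dots> \<le> (\<epsilon> * Q) ^ 2"
        using \<epsilon> K by (intro power_mono mult_left_mono) (auto simp: Q_def E_def intro!: mult_nonneg_nonneg add_nonneg_nonneg)
      also have "\<epsilon> * Q = e" using Q by (simp add: \<epsilon>_def)
      finally show "norm (\<gamma>n m t - \<gamma>n n t) ^ 2 \<le> e ^ 2" .
    qed (use e in simp)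
    then show ?thesis by blast
  qed
  have "\<exists>l. (\<lambda>n. \<gamma>n n t) \<longlonglongrightarrow> l" for t
  proof -
    have "Cauchy (\<lambda>n. \<gamma>n n t)"
    proof (rule metric_CauchyI)
      fix e :: real assume "e > 0"
      then have "e / 2 > 0" by simp
      from cauchy[OF this, of "\<bar>t\<bar>"] obtain N where N: "\<And>m n. m \<ge> N \<Longrightarrow> n \<ge> N \<Longrightarrow> norm (\<gamma>n m t - \<gamma>n n t) \<le> e / 2" by blast
      have "dist (\<gamma>n m t) (\<gamma>n n t) < e" if "m \<ge> N" "n \<ge> N" for m n
        using N[OF that] \<open>e > 0\<close> by (simp add: dist_norm)
      then show "\<exists>M. \<forall>m\<ge>M. \<forall>n\<ge>M. dist (\<gamma>n m t) (\<gamma>n n t) < e" by blast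
    qed
    then show ?thesis using Cauchy_convergent_iff convergent_def by metis
  qed
  then obtain \<Gamma> where \<Gamma>: "\<And>t. (\<lambda>n. \<gamma>n n t) \<longlonglongrightarrow> \<Gamma> t" by metis
  have uc: "\<exists>N. \<forall>n\<ge>N. \<forall>t. \<bar>t\<bar> \<le> T \<longrightarrow> norm (\<gamma>n n t - \<Gamma> t) \<le> e" if e: "e > 0" for e T
  proof -
    obtain N where N: "\<And>m n t. m \<ge> N \<Longrightarrow> n \<ge> N \<Longrightarrow> \<bar>t\<bar> \<le> T \<Longrightarrow> norm (\<gamma>n m t - \<gamma>n n t) \<le> e" using cauchy[OF e] by blast
    have "norm (\<gamma>n n t - \<Gamma> t) \<le> e" if "n \<ge> N" "\<bar>t\<bar> \<le> T" for n t
    proof (rule tendsto_upperbound)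
      show "(\<lambda>m. norm (\<gamma>n n t - \<gamma>n m t)) \<longlonglongrightarrow> norm (\<gamma>n n t - \<Gamma> t)" by (intro tendsto_intros \<Gamma>)
      show "\<forall>\<^sub>F m in sequentially. norm (\<gamma>n n t - \<gamma>n m t) \<le> e"
        using eventually_ge_at_top[of N] by eventually_elim (use N that in blast)
    qed auto
    then show ?thesis by blast
  qed
  have "(\<Gamma> has_vector_derivative J ** B t ** \<Gamma> t) (at t)" for t
  proof (rule has_vector_derivative_uniform_limit[where f = \<gamma>n and F = "\<lambda>n t. J ** Bn n t ** \<gamma>n n t" and G = "\<lambda>t. J ** B t ** \<Gamma> t"])
    show "(\<gamma>n n has_vector_derivative J ** Bn n t ** \<gamma>n n t) (at t)" for n t using sol[of n] by (simp add: is_fundamental_solution_def)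
    show "(\<lambda>n. \<gamma>n n t) \<longlonglongrightarrow> \<Gamma> t" for t by (rule \<Gamma>)
    show "\<forall>\<^sub>F n in sequentially. \<forall>t. \<bar>t\<bar> \<le> T \<longrightarrow> norm (J ** Bn n t ** \<gamma>n n t - J ** B t ** \<Gamma> t) \<le> e" if T: "T > 0" and e: "e > 0" for T e
    proof -
      define P where "P = K * (\<bar>g T\<bar> + b) + 1"
      have P: "P > 0" using K b0 by (simp add: P_def add_nonneg_pos)
      define \<epsilon> where "\<epsilon> = e / P"
      have \<epsilon>: "\<epsilon> > 0" using e P by (simp add: \<epsilon>_def)
      obtain N where N: "\<And>n t. n \<ge> N \<Longrightarrow> \<bar>t\<bar> \<le> T \<Longrightarrow> norm (\<gamma>n n t - \<Gamma> t) \<le> \<epsilon>" using uc[OF \<epsilon>] by blast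
      show ?thesis using eventually_ge_at_top[of N] unif[OF \<epsilon>]
      proof eventually_elim
        case (elim n)
        show ?case
        proof (intro allI impI)
          fix t assume t: "\<bar>t\<bar> \<le> T"
          have "J ** Bn n t ** \<gamma>n n t - J ** B t ** \<Gamma> t = J ** (Bn n t - B t) ** \<gamma>n n t + J ** B t ** (\<gamma>n n t - \<Gamma> t)"
            by (simp add: matrix_alg)
          then have "norm (J ** Bn n t ** \<gamma>n n t - J ** B t ** \<Gamma> t) \<le> norm (J ** (Bn n t - B t) ** \<gamma>n n t) + norm (J ** B t ** (\<gamma>n n t - \<Gamma> t))"
            using norm_triangle_ineq by metis
          also have "\<dots> \<le> K * norm (Bn n t - B t) * norm (\<gamma>n n t) + K * norm (B t) * norm (\<gamma>n n t - \<Gamma> t)" by (intro add_mono K)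
          also have "\<dots> \<le> K * \<epsilon> * \<bar>g T\<bar> + K * b * \<epsilon>"
          proof (intro add_mono mult_mono mult_left_mono)
            show "norm (\<gamma>n n t) \<le> \<bar>g T\<bar>" using g[OF t, of n] by linarith
          qed (use elim N t b K \<epsilon> b0 in auto)
          also have "\<dots> = \<epsilon> * (K * (\<bar>g T\<bar> + b))" by (simp add: algebra_simps)
          also have "\<dots> \<le> \<epsilon> * P" using \<epsilon> by (intro mult_left_mono) (auto simp: P_def)
          also have "\<dots> = e" using P by (simp add: \<epsilon>_def)
          finally show "norm (J ** Bn n t ** \<gamma>n n t - J ** B t ** \<Gamma> t) \<le> e" .
        qed
      qed
    qed
  qed
  moreover have "\<Gamma> 0 = mat 1"
  proof -
    have "(\<lambda>n. \<gamma>n n 0) = (\<lambda>n. mat 1)" using sol by (simp add: is_fundamental_solution_def)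
    then show ?thesis using LIMSEQ_unique[OF \<Gamma>[of 0]] by simp
  qed
  ultimately show ?thesis unfolding is_fundamental_solution_def by blast
qed

lemma fundamental_solution_shift:
  fixes B :: "real \<Rightarrow> 'd::finite phase_matrix"
  assumes \<gamma>: "is_fundamental_solution B \<gamma>" and Sp: "\<gamma> s \<in> Sp"
  shows "is_fundamental_solution (\<lambda>t. B (s + t)) (\<lambda>t. \<gamma> (s + t) ** spinv (\<gamma> s))"
  unfolding is_fundamental_solution_def
proof (intro conjI allI)
  show "\<gamma> (s + 0) ** spinv (\<gamma> s) = mat 1" using spinv_right[OF Sp] by simp
  fix t
  have "(\<gamma> has_vector_derivative J ** B (s + t) ** \<gamma> (s + t)) (at (s + t))" using \<gamma> by (simp add: is_fundamental_solution_def)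
  moreover have "((\<lambda>t. s + t) has_vector_derivative 1) (at t)" by (auto intro!: derivative_eq_intros)
  ultimately have "((\<lambda>t. \<gamma> (s + t)) has_vector_derivative J ** B (s + t) ** \<gamma> (s + t)) (at t)"
    using vector_diff_chain_at[of "\<lambda>t. s + t" 1 t \<gamma>] by (simp add: o_def)
  from has_vector_derivative_matrix_mult[OF this has_vector_derivative_const[of "spinv (\<gamma> s)"]]
  show "((\<lambda>t. \<gamma> (s + t) ** spinv (\<gamma> s)) has_vector_derivative J ** B (s + t) ** (\<gamma> (s + t) ** spinv (\<gamma> s))) (at t)"
    by (simp add: matrix_mul_assoc)
qed

section \<open>From the turning to the mean index\<close>

text \<open>
  The part of \<open>Sp\<close> in a ball is compact, so \<open>\<bar>cdet (- \<i>)\<bar>\<close> has a positive minimum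
  there and \<open>cdet (- \<i>)\<close> is uniformly continuous.
\<close>

lemma cdet_near:
  obtains \<delta> where "\<delta> > 0"
    "\<And>(M :: 'd::finite phase_matrix) (M' :: 'd phase_matrix). M \<in> Sp \<Longrightarrow> M' \<in> Sp \<Longrightarrow> norm M \<le> R \<Longrightarrow> norm M' \<le> R \<Longrightarrow> norm (M' - M) < \<delta> \<Longrightarrow>
        norm (cdet (- \<i>) M' - cdet (- \<i>) M) < norm (cdet (- \<i>) M)"
proof -
  let ?K = "{M :: 'd phase_matrix. transpose M ** J ** M = J} \<inter> cball 0 R"
  have K: "compact ?K"
    by (intro closed_Int_compact closed_Collect_eq continuous_intros compact_cball)
  have KSp: "M \<in> Sp" if "M \<in> ?K" for M using that by (intro SpI) auto
  have SpK: "M \<in> ?K" if "M \<in> Sp" "norm M \<le> R" for M using that by (auto simp: SpD)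
  show thesis
  proof (cases "?K = {}")
    case True
    then show thesis using SpK by (intro that[of 1]) auto
  next
    case False
    have c: "continuous_on ?K (\<lambda>M. cdet (- \<i>) M)" by (intro continuous_intros)
    have "continuous_on ?K (\<lambda>M. norm (cdet (- \<i>) M))" by (intro continuous_intros c)
    from continuous_attains_inf[OF K False this] obtain M0 where M0: "M0 \<in> ?K" "\<And>M. M \<in> ?K \<Longrightarrow> norm (cdet (- \<i>) M0) \<le> norm (cdet (- \<i>) M)" by blast
    have "cdet (- \<i>) M0 \<noteq> 0" using cdet_minus_imaginary_nonzero[OF KSp[OF M0(1)], of 1] by simp
    then have pos: "norm (cdet (- \<i>) M0) > 0" by simp
    have "uniformly_continuous_on ?K (\<lambda>M. cdet (- \<i>) M)" by (rule compact_uniformly_continuous[OF c K])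
    from this[unfolded uniformly_continuous_on_def, rule_format, OF pos]
    obtain \<delta> where \<delta>: "\<delta> > 0" "\<And>M M'. M \<in> ?K \<Longrightarrow> M' \<in> ?K \<Longrightarrow> dist M' M < \<delta> \<Longrightarrow> dist (cdet (- \<i>) M') (cdet (- \<i>) M) < norm (cdet (- \<i>) M0)"
      by blast
    show thesis
    proof (rule that[OF \<delta>(1)])
      fix M M' :: "'d phase_matrix"
      assume "M \<in> Sp" "M' \<in> Sp" "norm M \<le> R" "norm M' \<le> R" "norm (M' - M) < \<delta>"
      then have "M \<in> ?K" "M' \<in> ?K" using SpK by blast+
      then show "norm (cdet (- \<i>) M' - cdet (- \<i>) M) < norm (cdet (- \<i>) M)"
        using \<delta>(2)[of M M'] M0(2)[of M] \<open>norm (M' - M) < \<delta>\<close> by (simp add: dist_norm)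
    qed
  qed
qed

lemma turn_near:
  fixes p q :: "real \<Rightarrow> 'd::finite phase_matrix"
  assumes "continuous_on (closed_segment a b) p" "continuous_on (closed_segment a b) q"
    and "\<And>t. t \<in> closed_segment a b \<Longrightarrow> norm (cdet (- \<i>) (q t) - cdet (- \<i>) (p t)) < norm (cdet (- \<i>) (p t))"
  shows "\<bar>turn q a b - turn p a b\<bar> \<le> pi"
  unfolding turn_def by (rule arg_change_near) (use assms in \<open>auto intro!: continuous_intros\<close>)

lemma maslov_index_eq:
  fixes \<gamma> :: "real \<Rightarrow> 'd::finite phase_matrix"
  shows "maslov_index 1 \<gamma> T = of_int (maslov_iota 1 (mat 1) \<gamma> 0 T) - of_nat (complex_nullity (0 :: complex^('d + 'd)^('d + 'd))) / 2"
  by (simp add: maslov_index_def shifted_matrix_mat_1)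

text \<open>
  The sign \<open>\<sigma>\<close> covers both time directions: \<open>\<sigma> = 1\<close> for the forward mean,
  \<open>\<sigma> = - 1\<close> for the backward one, whose denominator is \<open>- S\<close>.
\<close>

lemma mean_index_tendsto:
  fixes \<gamma> :: "real \<Rightarrow> 'd::finite phase_matrix"
  assumes \<gamma>: "continuous_on UNIV \<gamma>" "\<And>t. \<gamma> t \<in> Sp"
    and lim: "\<And>e. e > 0 \<Longrightarrow> \<exists>S0>0. \<forall>S\<ge>S0. \<bar>turn \<gamma> 0 S / (\<sigma> * S) - L\<bar> \<le> e" and \<sigma>: "\<bar>\<sigma>\<bar> = 1"
  shows "((\<lambda>S. maslov_index 1 \<gamma> S / (\<sigma> * S)) \<longlongrightarrow> L / pi) at_top"
proof -
  let ?n = "CARD('d + 'd)" and ?c = "of_nat (complex_nullity (0 :: complex^('d + 'd)^('d + 'd))) / 2 :: real"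
  have 1: "((\<lambda>S. turn \<gamma> 0 S / (\<sigma> * S)) \<longlongrightarrow> L) at_top"
  proof (rule tendstoI)
    fix e :: real assume "e > 0"
    then obtain S0 where S0: "\<And>S. S \<ge> S0 \<Longrightarrow> \<bar>turn \<gamma> 0 S / (\<sigma> * S) - L\<bar> \<le> e / 2" using lim[of "e / 2"] by auto
    show "\<forall>\<^sub>F S in at_top. dist (turn \<gamma> 0 S / (\<sigma> * S)) L < e"
      using eventually_ge_at_top[of S0]
    proof eventually_elim
      case (elim S)
      have "e / 2 < e" using \<open>e > 0\<close> by simp
      from le_less_trans[OF S0[OF elim] this] show ?case by (simp only: dist_real_def)
    qed
  qed
  have 2: "((\<lambda>S. maslov_index 1 \<gamma> S / (\<sigma> * S) - (turn \<gamma> 0 S / (\<sigma> * S)) / pi) \<longlongrightarrow> 0) at_top"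
  proof (rule Lim_null_comparison)
    show "((\<lambda>S. (2 * ?n + ?c) / S) \<longlongrightarrow> 0) at_top"
      by (intro tendsto_divide_0[OF tendsto_const] filterlim_at_top_imp_at_infinity filterlim_ident)
    show "\<forall>\<^sub>F S in at_top. norm (maslov_index 1 \<gamma> S / (\<sigma> * S) - (turn \<gamma> 0 S / (\<sigma> * S)) / pi) \<le> (2 * ?n + ?c) / S"
      using eventually_gt_at_top[of 0]
    proof eventually_elim
      case (elim S)
      let ?i = "real_of_int (maslov_iota 1 (mat 1) \<gamma> 0 S)"
      have "\<bar>pi * ?i - turn \<gamma> 0 S\<bar> \<le> 2 * pi * ?n"
        by (rule maslov_iota_bound) (use elim \<gamma> in \<open>auto intro: continuous_on_subset\<close>)
      then have "\<bar>pi * ?i - turn \<gamma> 0 S\<bar> / pi \<le> 2 * ?n" by (simp add: divide_le_eq mult_ac)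
      moreover have "\<bar>pi * ?i - turn \<gamma> 0 S\<bar> / pi = \<bar>?i - turn \<gamma> 0 S / pi\<bar>"
      proof -
        have "?i - turn \<gamma> 0 S / pi = (pi * ?i - turn \<gamma> 0 S) / pi" by (simp add: diff_divide_distrib)
        then show ?thesis by (simp add: abs_divide)
      qed
      ultimately have "\<bar>?i - turn \<gamma> 0 S / pi\<bar> \<le> 2 * ?n" by simp
      then have "\<bar>maslov_index 1 \<gamma> S - turn \<gamma> 0 S / pi\<bar> \<le> 2 * ?n + ?c" unfolding maslov_index_eq by linarith
      then have "\<bar>maslov_index 1 \<gamma> S - turn \<gamma> 0 S / pi\<bar> / S \<le> (2 * ?n + ?c) / S" using elim by (intro divide_right_mono) auto
      moreover have "maslov_index 1 \<gamma> S / (\<sigma> * S) - (turn \<gamma> 0 S / (\<sigma> * S)) / pi = (maslov_index 1 \<gamma> S - turn \<gamma> 0 S / pi) / (\<sigma> * S)"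
        by (simp add: diff_divide_distrib)
      ultimately show ?case using elim \<sigma> by (simp add: abs_mult)
    qed
  qed
  have "((\<lambda>S. (maslov_index 1 \<gamma> S / (\<sigma> * S) - (turn \<gamma> 0 S / (\<sigma> * S)) / pi) + (turn \<gamma> 0 S / (\<sigma> * S)) / pi) \<longlongrightarrow> 0 + L / pi) at_top"
    by (intro tendsto_add 2 tendsto_divide 1 tendsto_const) auto
  then show ?thesis by simp
qed

lemma Liminf_Limsup_singleton:
  fixes f :: "real \<Rightarrow> real"
  assumes "(f \<longlongrightarrow> L) at_top"
  shows "{Liminf at_top (\<lambda>l. ereal (f l)) .. Limsup at_top (\<lambda>l. ereal (f l))} = {ereal L}"
proof -
  have "((\<lambda>l. ereal (f l)) \<longlongrightarrow> ereal L) at_top" using assms by simp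
  then have "Liminf at_top (\<lambda>l. ereal (f l)) = ereal L" "Limsup at_top (\<lambda>l. ereal (f l)) = ereal L"
    by (intro lim_imp_Liminf lim_imp_Limsup; simp)+
  then show ?thesis by simp
qed

section \<open>Mean indices over the orbit closure\<close>

text \<open>
  The setting of the theorem, with the flow \<open>\<phi>\<close> on the orbit closure \<open>X\<close> and the
  invariant distance \<open>d\<close> obtained from quasi-periodicity.
\<close>

locale quasi_periodic_hamiltonian =
  fixes H :: "'d::finite phase \<Rightarrow> real" and x :: "real \<Rightarrow> 'd phase" and \<gamma> :: "real \<Rightarrow> 'd phase_matrix"
    and \<phi> :: "'d phase \<Rightarrow> real \<Rightarrow> 'd phase" and d :: "'d phase \<Rightarrow> 'd phase \<Rightarrow> real" and X
  assumes C2: "C2_function H" and orbit: "hamiltonian_orbit H x"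
    and \<gamma>: "is_fundamental_solution (\<lambda>t. hessian H (x t)) \<gamma>"
    and X_def: "X = orbit_closure x" and compact_X: "compact X"
    and \<phi>_x: "\<phi> (x 0) t = x t" and \<phi>_in: "\<xi> \<in> X \<Longrightarrow> \<phi> \<xi> t \<in> X" and \<phi>_0: "\<xi> \<in> X \<Longrightarrow> \<phi> \<xi> 0 = \<xi>"
    and \<phi>_add: "\<xi> \<in> X \<Longrightarrow> \<phi> (\<phi> \<xi> s) t = \<phi> \<xi> (s + t)"
    and d_inv: "\<xi> \<in> X \<Longrightarrow> \<eta> \<in> X \<Longrightarrow> d (\<phi> \<xi> t) (\<phi> \<eta> t) = d \<xi> \<eta>"
    and d_dist: "e > 0 \<Longrightarrow> \<exists>\<delta>>0. \<forall>\<xi>\<in>X. \<forall>\<eta>\<in>X. d \<xi> \<eta> < \<delta> \<longrightarrow> dist \<xi> \<eta> < e"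
    and d_dense: "\<delta> > 0 \<Longrightarrow> \<exists>L\<ge>0. \<forall>\<xi>\<in>X. \<exists>s. \<bar>s\<bar> \<le> L \<and> d \<xi> (x s) < \<delta>"
begin

lemma x_in: "x s \<in> X"
  unfolding X_def orbit_closure_def by (rule subsetD[OF closure_subset rangeI])

lemma \<phi>_x_add: "\<phi> (x s) t = x (s + t)"
  using \<phi>_add[OF x_in, of 0 s t] by (simp add: \<phi>_x)

lemma d_uniform:
  fixes g :: "'d phase \<Rightarrow> 'b::real_normed_vector"
  assumes g: "continuous_on UNIV g" and e: "e > 0"
  shows "\<exists>\<delta>>0. \<forall>\<xi>\<in>X. \<forall>\<eta>\<in>X. d \<xi> \<eta> < \<delta> \<longrightarrow> (\<forall>t. norm (g (\<phi> \<xi> t) - g (\<phi> \<eta> t)) < e)"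
proof -
  have "uniformly_continuous_on X g" by (rule compact_uniformly_continuous[OF continuous_on_subset[OF g] compact_X]) simp
  then obtain e' where e': "e' > 0" "\<And>a b. a \<in> X \<Longrightarrow> b \<in> X \<Longrightarrow> dist b a < e' \<Longrightarrow> dist (g b) (g a) < e"
    unfolding uniformly_continuous_on_def using e by metis
  obtain \<delta> where \<delta>: "\<delta> > 0" "\<And>\<xi> \<eta>. \<xi> \<in> X \<Longrightarrow> \<eta> \<in> X \<Longrightarrow> d \<xi> \<eta> < \<delta> \<Longrightarrow> dist \<xi> \<eta> < e'" using d_dist[OF e'(1)] by blast
  have "norm (g (\<phi> \<xi> t) - g (\<phi> \<eta> t)) < e" if "\<xi> \<in> X" "\<eta> \<in> X" "d \<xi> \<eta> < \<delta>" for \<xi> \<eta> t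
  proof -
    have "dist (\<phi> \<xi> t) (\<phi> \<eta> t) < e'" using \<delta>(2)[OF \<phi>_in[OF that(1)] \<phi>_in[OF that(2)], of t t] d_inv[OF that(1,2)] that(3) by simp
    then show ?thesis using e'(2)[OF \<phi>_in[OF that(2)] \<phi>_in[OF that(1)]] by (simp add: dist_norm)
  qed
  with \<delta>(1) show ?thesis by blast
qed

text \<open>
  One sequence of time shifts serves all continuous functions \<open>g\<close>, and the approximation is
  uniform over all times because the flow is isometric.
\<close>

lemma approximating_times:
  assumes "\<xi> \<in> X"
  obtains s :: "nat \<Rightarrow> real" where
    "\<And>(g :: 'd phase \<Rightarrow> 'b::real_normed_vector) e. continuous_on UNIV g \<Longrightarrow> e > 0 \<Longrightarrow>
       \<forall>\<^sub>F n in sequentially. \<forall>t. norm (g (x (s n + t)) - g (\<phi> \<xi> t)) \<le> e"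
proof -
  have "\<exists>s. d \<xi> (x s) < 1 / Suc n" for n :: nat using d_dense[of "1 / Suc n"] assms by auto
  then obtain s where s: "\<And>n::nat. d \<xi> (x (s n)) < 1 / Suc n" by metis
  show thesis
  proof (rule that[of s])
    fix g :: "'d phase \<Rightarrow> 'b" and e :: real assume g: "continuous_on UNIV g" "e > 0"
    obtain \<delta> where \<delta>: "\<delta> > 0" "\<And>\<xi> \<eta> t. \<xi> \<in> X \<Longrightarrow> \<eta> \<in> X \<Longrightarrow> d \<xi> \<eta> < \<delta> \<Longrightarrow> norm (g (\<phi> \<xi> t) - g (\<phi> \<eta> t)) < e"
      using d_uniform[OF g] by blast
    obtain N :: nat where N: "1 / Suc N < \<delta>" using reals_Archimedean[OF \<delta>(1)] by (auto simp: inverse_eq_divide)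
    have "norm (g (x (s n + t)) - g (\<phi> \<xi> t)) \<le> e" if "n \<ge> N" for n t
    proof -
      have "1 / Suc n \<le> 1 / Suc N" using that by (simp add: frac_le)
      then have "d \<xi> (x (s n)) < \<delta>" using s[of n] N by linarith
      from \<delta>(2)[OF assms x_in this, of t] show ?thesis by (simp add: \<phi>_x_add norm_minus_commute)
    qed
    then show "\<forall>\<^sub>F n in sequentially. \<forall>t. norm (g (x (s n + t)) - g (\<phi> \<xi> t)) \<le> e"
      unfolding eventually_sequentially by blast
  qed
qed

lemma continuous_gradient: "continuous_on UNIV (gradient H)"
  using C2 unfolding C2_function_def by (metis differentiable_imp_continuous_within continuous_at_imp_continuous_on)

lemma continuous_hessian: "continuous_on UNIV (hessian H)"
  using C2 unfolding C2_function_def by blast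

text \<open>
  The translates \<open>x (s n + \<cdot>)\<close> converge to \<open>\<phi> \<xi>\<close> uniformly, and so do their
  derivatives.
\<close>

lemma flow_orbit:
  assumes \<xi>: "\<xi> \<in> X" shows "hamiltonian_orbit H (\<phi> \<xi>)"
  unfolding hamiltonian_orbit_def
proof
  fix t
  obtain s where s: "\<And>(g :: 'd phase \<Rightarrow> 'd phase) e. continuous_on UNIV g \<Longrightarrow> e > 0 \<Longrightarrow>
       \<forall>\<^sub>F n in sequentially. \<forall>t. norm (g (x (s n + t)) - g (\<phi> \<xi> t)) \<le> e"
    using approximating_times[OF \<xi>, where 'b = "'d phase"] by blast
  show "(\<phi> \<xi> has_vector_derivative J *v gradient H (\<phi> \<xi> t)) (at t)"
  proof (rule has_vector_derivative_uniform_limit[where f = "\<lambda>n t. x (s n + t)" and F = "\<lambda>n t. J *v gradient H (x (s n + t))" and G = "\<lambda>t. J *v gradient H (\<phi> \<xi> t)"])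
    show "((\<lambda>t. x (s n + t)) has_vector_derivative J *v gradient H (x (s n + t))) (at t)" for n t
    proof -
      have "((\<lambda>t. s n + t) has_vector_derivative 1) (at t)" by (auto intro!: derivative_eq_intros)
      moreover have "(x has_vector_derivative J *v gradient H (x (s n + t))) (at (s n + t))" using orbit by (simp add: hamiltonian_orbit_def)
      ultimately show ?thesis using vector_diff_chain_at[of "\<lambda>t. s n + t" 1 t x] by (simp add: o_def)
    qed
    show "(\<lambda>n. x (s n + t)) \<longlonglongrightarrow> \<phi> \<xi> t" for t
    proof (rule metric_LIMSEQ_I)
      fix e :: real assume "e > 0"
      then have "\<forall>\<^sub>F n in sequentially. \<forall>t. norm (x (s n + t) - \<phi> \<xi> t) \<le> e / 2" using s[OF continuous_on_id, of "e / 2"] by simp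
      then obtain N where N: "\<And>n. n \<ge> N \<Longrightarrow> norm (x (s n + t) - \<phi> \<xi> t) \<le> e / 2" unfolding eventually_sequentially by blast
      have "dist (x (s n + t)) (\<phi> \<xi> t) < e" if "n \<ge> N" for n using N[OF that] \<open>e > 0\<close> by (simp add: dist_norm)
      then show "\<exists>N. \<forall>n\<ge>N. dist (x (s n + t)) (\<phi> \<xi> t) < e" by blast
    qed
    show "\<forall>\<^sub>F n in sequentially. \<forall>t. \<bar>t\<bar> \<le> T \<longrightarrow> norm (J *v gradient H (x (s n + t)) - J *v gradient H (\<phi> \<xi> t)) \<le> e"
      if "T > 0" "e > 0" for T e
      using s[OF continuous_gradient that(2)] by eventually_elim (simp add: norm_J_vec flip: matrix_vector_mult_diff_distrib)
  qed
qed

lemma orbit_from_flow: "\<xi> \<in> X \<Longrightarrow> orbit_from H \<xi> = \<phi> \<xi>"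
  using orbit_from_eq[OF C2 flow_orbit \<phi>_0] by blast

lemma hessian_bound: obtains b where "b \<ge> 0" "\<And>\<xi> t. \<xi> \<in> X \<Longrightarrow> norm (hessian H (\<phi> \<xi> t)) \<le> b"
proof -
  have "bounded (hessian H ` X)" by (intro compact_imp_bounded compact_continuous_image compact_X continuous_on_subset[OF continuous_hessian]) auto
  then obtain b where "\<forall>A\<in>hessian H ` X. norm A \<le> b" unfolding bounded_iff by blast
  then have b: "norm (hessian H (\<phi> \<xi> t)) \<le> b" if "\<xi> \<in> X" for \<xi> t using \<phi>_in[OF that] by blast
  have "b \<ge> 0" using b[OF x_in[of 0], of 0] norm_ge_zero order.trans by blast
  with b show thesis using that by blast
qed

abbreviation B :: "'d phase \<Rightarrow> real \<Rightarrow> 'd phase_matrix" where "B \<xi> t \<equiv> hessian H (\<phi> \<xi> t)"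

lemma \<gamma>_Sp: "\<gamma> t \<in> Sp"
  by (rule hamiltonian_flow_Sp[OF hessian_symmetric[OF C2] \<gamma>])

lemma fundamental_exists:
  assumes \<xi>: "\<xi> \<in> X" shows "\<exists>\<Gamma>. is_fundamental_solution (B \<xi>) \<Gamma>"
proof -
  obtain b where b0: "b \<ge> 0" and b: "\<And>\<xi> t. \<xi> \<in> X \<Longrightarrow> norm (B \<xi> t) \<le> b" using hessian_bound by blast
  obtain s where s: "\<And>(g :: 'd phase \<Rightarrow> 'd phase_matrix) e. continuous_on UNIV g \<Longrightarrow> e > 0 \<Longrightarrow>
       \<forall>\<^sub>F n in sequentially. \<forall>t. norm (g (x (s n + t)) - g (\<phi> \<xi> t)) \<le> e"
    using approximating_times[OF \<xi>, where 'b = "'d phase_matrix"] by blast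
  show ?thesis
  proof (rule linear_system_limit)
    show "is_fundamental_solution (\<lambda>t. hessian H (x (s n + t))) (\<lambda>t. \<gamma> (s n + t) ** spinv (\<gamma> (s n)))" for n
      by (rule fundamental_solution_shift[OF \<gamma> \<gamma>_Sp])
    show "norm (hessian H (x (s n + t))) \<le> b" for n t using b[OF x_in, of "s n" t] by (simp add: \<phi>_x_add)
    show "norm (B \<xi> t) \<le> b" for t by (rule b[OF \<xi>])
    show "\<forall>\<^sub>F n in sequentially. \<forall>t. norm (hessian H (x (s n + t)) - B \<xi> t) \<le> e" if "e > 0" for e
      by (rule s[OF continuous_hessian that])
  qed
qed

definition \<Gamma> :: "'d phase \<Rightarrow> real \<Rightarrow> 'd phase_matrix" where "\<Gamma> \<xi> = fundamental_solution (B \<xi>)"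

lemma \<Gamma>_fundamental: "\<xi> \<in> X \<Longrightarrow> is_fundamental_solution (B \<xi>) (\<Gamma> \<xi>)"
proof -
  assume \<xi>: "\<xi> \<in> X"
  obtain b where b0: "b \<ge> 0" and b: "\<And>\<xi> t. \<xi> \<in> X \<Longrightarrow> norm (B \<xi> t) \<le> b" using hessian_bound by blast
  obtain G where G: "is_fundamental_solution (B \<xi>) G" using fundamental_exists[OF \<xi>] by blast
  from fundamental_solution_eq[OF G b[OF \<xi>]] G show ?thesis by (simp add: \<Gamma>_def)
qed

lemma \<Gamma>_unique: "\<xi> \<in> X \<Longrightarrow> is_fundamental_solution (B \<xi>) G \<Longrightarrow> G = \<Gamma> \<xi>"
proof -
  assume \<xi>: "\<xi> \<in> X" and G: "is_fundamental_solution (B \<xi>) G"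
  obtain b where b0: "b \<ge> 0" and b: "\<And>\<xi> t. \<xi> \<in> X \<Longrightarrow> norm (B \<xi> t) \<le> b" using hessian_bound by blast
  from fundamental_solution_eq[OF G b[OF \<xi>]] show ?thesis by (simp add: \<Gamma>_def)
qed

lemma \<Gamma>_Sp: "\<xi> \<in> X \<Longrightarrow> \<Gamma> \<xi> t \<in> Sp"
  by (rule hamiltonian_flow_Sp[OF hessian_symmetric[OF C2] \<Gamma>_fundamental])

lemma \<Gamma>_continuous: "\<xi> \<in> X \<Longrightarrow> continuous_on S (\<Gamma> \<xi>)"
  by (rule fundamental_solution_continuous[OF \<Gamma>_fundamental])

lemma \<Gamma>_cocycle: "\<xi> \<in> X \<Longrightarrow> \<Gamma> \<xi> (s + t) = \<Gamma> (\<phi> \<xi> s) t ** \<Gamma> \<xi> s"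
proof -
  assume \<xi>: "\<xi> \<in> X"
  have "is_fundamental_solution (\<lambda>t. B \<xi> (s + t)) (\<lambda>t. \<Gamma> \<xi> (s + t) ** spinv (\<Gamma> \<xi> s))"
    by (rule fundamental_solution_shift[OF \<Gamma>_fundamental[OF \<xi>] \<Gamma>_Sp[OF \<xi>]])
  then have "is_fundamental_solution (B (\<phi> \<xi> s)) (\<lambda>t. \<Gamma> \<xi> (s + t) ** spinv (\<Gamma> \<xi> s))" by (simp add: \<phi>_add[OF \<xi>])
  from \<Gamma>_unique[OF \<phi>_in[OF \<xi>] this] have "\<Gamma> (\<phi> \<xi> s) t = \<Gamma> \<xi> (s + t) ** spinv (\<Gamma> \<xi> s)" by metis
  then show ?thesis by (simp add: spinv_left[OF \<Gamma>_Sp[OF \<xi>]] flip: matrix_mul_assoc)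
qed

lemma \<Gamma>_bound:
  obtains g where "\<And>T \<xi> t. \<xi> \<in> X \<Longrightarrow> \<bar>t\<bar> \<le> T \<Longrightarrow> norm (\<Gamma> \<xi> t) \<le> g T"
proof -
  obtain b where b0: "b \<ge> 0" and b: "\<And>\<xi> t. \<xi> \<in> X \<Longrightarrow> norm (B \<xi> t) \<le> b" using hessian_bound by blast
  obtain K where K: "K \<ge> 0" "\<And>(A :: 'd phase_matrix) (C :: 'd phase_matrix). norm (J ** A ** C) \<le> K * norm A * norm C"
    using J_mult_bound by blast
  show thesis
  proof (rule that)
    show "norm (\<Gamma> \<xi> t) \<le> sqrt (norm (mat 1 :: 'd phase_matrix) ^ 2 * exp ((2 * (K * b) + 1) * T))" if "\<xi> \<in> X" "\<bar>t\<bar> \<le> T" for \<xi> t T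
      by (rule real_le_rsqrt, rule linear_system_bound[OF \<Gamma>_fundamental[OF that(1)] b[OF that(1)] K that(2)])
  qed
qed

text \<open>
  Close points have uniformly close Hessians along their orbits; then the comparison of
  linear systems applies.
\<close>

lemma \<Gamma>_close:
  assumes e: "e > 0"
  shows "\<exists>\<delta>>0. \<forall>\<xi>\<in>X. \<forall>\<eta>\<in>X. d \<xi> \<eta> < \<delta> \<longrightarrow> (\<forall>t. \<bar>t\<bar> \<le> T \<longrightarrow> norm (\<Gamma> \<xi> t - \<Gamma> \<eta> t) < e)"
proof -
  obtain b where b0: "b \<ge> 0" and b: "\<And>\<xi> t. \<xi> \<in> X \<Longrightarrow> norm (B \<xi> t) \<le> b" using hessian_bound by blast
  obtain K where K: "K \<ge> 0" "\<And>(A :: 'd phase_matrix) (C :: 'd phase_matrix). norm (J ** A ** C) \<le> K * norm A * norm C"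
    using J_mult_bound by blast
  obtain g where g: "\<And>T \<xi> t. \<xi> \<in> X \<Longrightarrow> \<bar>t\<bar> \<le> T \<Longrightarrow> norm (\<Gamma> \<xi> t) \<le> g T" using \<Gamma>_bound by blast
  define E where "E = sqrt (exp ((2 * (K * b) + 1) * T))"
  define Q where "Q = K * \<bar>g T\<bar> * E + 1"
  have E: "E \<ge> 0" "E ^ 2 = exp ((2 * (K * b) + 1) * T)" by (simp_all add: E_def)
  have Q: "Q > 0" using K E by (simp add: Q_def add_nonneg_pos)
  define \<epsilon> where "\<epsilon> = e / Q"
  have \<epsilon>: "\<epsilon> > 0" using e Q by (simp add: \<epsilon>_def)
  obtain \<delta> where \<delta>: "\<delta> > 0" "\<And>\<xi> \<eta> t. \<xi> \<in> X \<Longrightarrow> \<eta> \<in> X \<Longrightarrow> d \<xi> \<eta> < \<delta> \<Longrightarrow> norm (B \<xi> t - B \<eta> t) < \<epsilon>"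
    using d_uniform[OF continuous_hessian \<epsilon>] by blast
  have "norm (\<Gamma> \<xi> t - \<Gamma> \<eta> t) < e" if X: "\<xi> \<in> X" "\<eta> \<in> X" "d \<xi> \<eta> < \<delta>" and t: "\<bar>t\<bar> \<le> T" for \<xi> \<eta> t
  proof -
    have "norm (\<Gamma> \<xi> t - \<Gamma> \<eta> t) ^ 2 \<le> (K * \<epsilon> * g T) ^ 2 * exp ((2 * (K * b) + 1) * T)"
      by (rule linear_system_compare[OF \<Gamma>_fundamental[OF X(1)] \<Gamma>_fundamental[OF X(2)] b[OF X(1)] g[OF X(2)] less_imp_le[OF \<delta>(2)[OF X]] K t])
    also have "\<dots> = (\<epsilon> * (K * \<bar>g T\<bar> * E)) ^ 2" by (simp add: power_mult_distrib E(2))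
    finally have "norm (\<Gamma> \<xi> t - \<Gamma> \<eta> t) \<le> \<epsilon> * (K * \<bar>g T\<bar> * E)"
      by (rule power2_le_imp_le) (use \<epsilon> K E in auto)
    also have "\<dots> < \<epsilon> * Q" using \<epsilon> by (intro mult_strict_left_mono) (auto simp: Q_def)
    also have "\<epsilon> * Q = e" using Q by (simp add: \<epsilon>_def)
    finally show ?thesis .
  qed
  with \<delta>(1) show ?thesis by blast
qed

definition r :: "'d phase \<Rightarrow> real \<Rightarrow> real" where "r \<xi> t = turn (\<Gamma> \<xi>) 0 t"

text \<open>
  By additivity of the turning and the cocycle relation the defect is the effect of the
  right translation by \<open>\<Gamma> \<xi> s\<close> on the turning of \<open>\<Gamma> (\<phi> \<xi> s)\<close>.
\<close>

lemma r_quasi: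
  assumes \<xi>: "\<xi> \<in> X"
  shows "\<bar>r \<xi> (s + t) - r \<xi> s - r (\<phi> \<xi> s) t\<bar> \<le> 2 * pi * CARD('d + 'd)"
proof -
  let ?c = "\<lambda>\<tau>. cdet (- \<i>) (\<Gamma> \<xi> \<tau>)"
  have c: "continuous_on UNIV ?c" by (intro continuous_intros \<Gamma>_continuous \<xi>)
  have nz: "?c \<tau> \<noteq> 0" for \<tau> using cdet_minus_imaginary_nonzero[OF \<Gamma>_Sp[OF \<xi>], of 1] by simp
  have "r \<xi> (s + t) = r \<xi> s + arg_change ?c s (s + t)"
    unfolding r_def turn_def using arg_change_combine[OF convex_UNIV c nz, of 0 s "s + t"] by simp
  moreover have "arg_change ?c s (s + t) = turn (\<lambda>\<tau>. \<Gamma> (\<phi> \<xi> s) \<tau> ** \<Gamma> \<xi> s) 0 t"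
  proof -
    have "arg_change (\<lambda>\<tau>. ?c (s + \<tau>)) 0 t = arg_change ?c (s + 0) (s + t)"
      by (rule arg_change_reparam[OF convex_UNIV c nz]) (auto intro!: continuous_intros)
    then show ?thesis by (simp add: turn_def \<Gamma>_cocycle[OF \<xi>])
  qed
  moreover have "\<bar>turn (\<lambda>\<tau>. \<Gamma> (\<phi> \<xi> s) \<tau> ** \<Gamma> \<xi> s) 0 t - r (\<phi> \<xi> s) t\<bar> \<le> 2 * pi * CARD('d + 'd)"
    unfolding r_def by (rule turn_right_translation[OF \<Gamma>_continuous[OF \<phi>_in[OF \<xi>]] \<Gamma>_Sp[OF \<phi>_in[OF \<xi>]] \<Gamma>_Sp[OF \<xi>]])
  ultimately show ?thesis by linarith
qed

lemma pi_le_C: "pi \<le> 2 * pi * CARD('d + 'd)"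
proof -
  have "1 \<le> CARD('d + 'd)" by (simp add: Suc_le_eq)
  then have "(1::real) \<le> real CARD('d + 'd)" by simp
  then have "pi * 1 \<le> pi * (2 * CARD('d + 'd))" by (intro mult_left_mono) auto
  then show ?thesis by (simp add: mult_ac)
qed

lemma segment_abs: "t \<in> closed_segment 0 T \<Longrightarrow> \<bar>t\<bar> \<le> \<bar>T\<bar>" for t T :: real
  by (auto simp: closed_segment_eq_real_ivl split: if_splits)

lemma r_close:
  assumes T: "T > 0"
  shows "\<exists>\<delta>>0. \<forall>\<xi>\<in>X. \<forall>\<eta>\<in>X. d \<xi> \<eta> < \<delta> \<longrightarrow> \<bar>r \<xi> T - r \<eta> T\<bar> \<le> 2 * pi * CARD('d + 'd)"
proof -
  obtain g where g: "\<And>T \<xi> t. \<xi> \<in> X \<Longrightarrow> \<bar>t\<bar> \<le> T \<Longrightarrow> norm (\<Gamma> \<xi> t) \<le> g T" using \<Gamma>_bound by blast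
  obtain e where e: "e > 0" "\<And>(M :: 'd phase_matrix) (M' :: 'd phase_matrix). M \<in> Sp \<Longrightarrow> M' \<in> Sp \<Longrightarrow> norm M \<le> g T \<Longrightarrow> norm M' \<le> g T \<Longrightarrow> norm (M' - M) < e \<Longrightarrow>
        norm (cdet (- \<i>) M' - cdet (- \<i>) M) < norm (cdet (- \<i>) M)"
    by (rule cdet_near[where R = "g T" and 'd = 'd]) blast
  obtain \<delta> where \<delta>: "\<delta> > 0" "\<And>\<xi> \<eta> t. \<xi> \<in> X \<Longrightarrow> \<eta> \<in> X \<Longrightarrow> d \<xi> \<eta> < \<delta> \<Longrightarrow> \<bar>t\<bar> \<le> T \<Longrightarrow> norm (\<Gamma> \<xi> t - \<Gamma> \<eta> t) < e"
    using \<Gamma>_close[OF e(1)] by blast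
  have "\<bar>r \<xi> T - r \<eta> T\<bar> \<le> pi" if X: "\<xi> \<in> X" "\<eta> \<in> X" "d \<xi> \<eta> < \<delta>" for \<xi> \<eta>
    unfolding r_def
  proof (rule turn_near[OF \<Gamma>_continuous[OF X(2)] \<Gamma>_continuous[OF X(1)]])
    fix t assume "t \<in> closed_segment 0 T"
    then have t: "\<bar>t\<bar> \<le> T" using segment_abs[of t T] T by simp
    show "norm (cdet (- \<i>) (\<Gamma> \<xi> t) - cdet (- \<i>) (\<Gamma> \<eta> t)) < norm (cdet (- \<i>) (\<Gamma> \<eta> t))"
      by (rule e(2)[OF \<Gamma>_Sp[OF X(2)] \<Gamma>_Sp[OF X(1)] g[OF X(2) t] g[OF X(1) t] \<delta>(2)[OF X t]])
  qed
  with \<delta>(1) pi_le_C show ?thesis by (meson order.trans)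
qed

text \<open>
  For short times the fundamental solution stays close to the identity, uniformly over \<open>X\<close>.
\<close>

lemma r_small: "\<exists>h>0. \<forall>\<xi>\<in>X. \<forall>t. \<bar>t\<bar> \<le> h \<longrightarrow> \<bar>r \<xi> t\<bar> \<le> 2 * pi * CARD('d + 'd)"
proof -
  obtain b where b0: "b \<ge> 0" and b: "\<And>\<xi> t. \<xi> \<in> X \<Longrightarrow> norm (B \<xi> t) \<le> b" using hessian_bound by blast
  obtain K where K: "K \<ge> 0" "\<And>(A :: 'd phase_matrix) (C :: 'd phase_matrix). norm (J ** A ** C) \<le> K * norm A * norm C"
    using J_mult_bound by blast
  obtain g0 where g0: "\<And>T \<xi> t. \<xi> \<in> X \<Longrightarrow> \<bar>t\<bar> \<le> T \<Longrightarrow> norm (\<Gamma> \<xi> t) \<le> g0 T" using \<Gamma>_bound by blast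
  define g where "g = g0 1"
  have g: "norm (\<Gamma> \<xi> t) \<le> g" if "\<xi> \<in> X" "\<bar>t\<bar> \<le> 1" for \<xi> t using g0[OF that] by (simp add: g_def)
  have g_nn: "g \<ge> 0" using g[OF x_in[of 0], of 0] by (intro order.trans[OF norm_ge_zero[of "\<Gamma> (x 0) 0"]]) simp
  obtain e where e: "e > 0" "\<And>(M :: 'd phase_matrix) (M' :: 'd phase_matrix). M \<in> Sp \<Longrightarrow> M' \<in> Sp \<Longrightarrow> norm M \<le> g \<Longrightarrow> norm M' \<le> g \<Longrightarrow> norm (M' - M) < e \<Longrightarrow>
        norm (cdet (- \<i>) M' - cdet (- \<i>) M) < norm (cdet (- \<i>) M)"
    by (rule cdet_near[where R = g and 'd = 'd]) blast
  define Q where "Q = K * b * g + 1"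
  have Q: "Q > 0" using K b0 g_nn by (simp add: Q_def add_nonneg_pos)
  define h where "h = min 1 (e / (2 * Q))"
  have h: "h > 0" "h \<le> 1" "Q * h < e"
  proof -
    show "h > 0" "h \<le> 1" using e Q by (auto simp: h_def)
    have "Q * h \<le> Q * (e / (2 * Q))" using Q by (intro mult_left_mono) (auto simp: h_def)
    also have "\<dots> = e / 2" using Q by simp
    finally show "Q * h < e" using e(1) by linarith
  qed
  have "\<bar>r \<xi> t\<bar> \<le> pi" if \<xi>: "\<xi> \<in> X" and t: "\<bar>t\<bar> \<le> h" for \<xi> t
  proof -
    have close: "norm (\<Gamma> \<xi> s - \<Gamma> \<xi> 0) < e" if s: "\<bar>s\<bar> \<le> h" for s
    proof -
      have "norm (\<Gamma> \<xi> s - \<Gamma> \<xi> 0) \<le> Q * norm (s - 0)"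
      proof (rule differentiable_bound[where S = "{-1..1}" and f' = "\<lambda>t u. u *\<^sub>R (J ** B \<xi> t ** \<Gamma> \<xi> t)"])
        show "(\<Gamma> \<xi> has_derivative (\<lambda>u. u *\<^sub>R (J ** B \<xi> t ** \<Gamma> \<xi> t))) (at t within {- 1..1})" for t
          using \<Gamma>_fundamental[OF \<xi>] unfolding is_fundamental_solution_def has_vector_derivative_def
          by (blast intro: has_derivative_at_withinI)
        show "onorm (\<lambda>u. u *\<^sub>R (J ** B \<xi> t ** \<Gamma> \<xi> t)) \<le> Q" if "t \<in> {-1..1}" for t
        proof (rule onorm_le)
          fix u :: real
          have "norm (J ** B \<xi> t ** \<Gamma> \<xi> t) \<le> K * norm (B \<xi> t) * norm (\<Gamma> \<xi> t)" by (rule K)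
          also have "\<dots> \<le> K * b * g" using that K b0 b[OF \<xi>] g[OF \<xi>] by (intro mult_mono mult_left_mono) auto
          also have "\<dots> \<le> Q" by (simp add: Q_def)
          finally have "\<bar>u\<bar> * norm (J ** B \<xi> t ** \<Gamma> \<xi> t) \<le> \<bar>u\<bar> * Q" by (intro mult_left_mono) auto
          then show "norm (u *\<^sub>R (J ** B \<xi> t ** \<Gamma> \<xi> t)) \<le> Q * norm u" by (simp add: mult.commute)
        qed
      qed (use s h in auto)
      also have "\<dots> \<le> Q * h" using s Q by (intro mult_left_mono) auto
      finally show ?thesis using h(3) by linarith
    qed
    have "\<bar>turn (\<Gamma> \<xi>) 0 t - turn (\<lambda>s. \<Gamma> \<xi> 0) 0 t\<bar> \<le> pi"
    proof (rule turn_near[OF continuous_on_const \<Gamma>_continuous[OF \<xi>]])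
      fix s assume "s \<in> closed_segment 0 t"
      then have s: "\<bar>s\<bar> \<le> h" using segment_abs[of s t] t by simp
      show "norm (cdet (- \<i>) (\<Gamma> \<xi> s) - cdet (- \<i>) (\<Gamma> \<xi> 0)) < norm (cdet (- \<i>) (\<Gamma> \<xi> 0))"
        by (rule e(2)[OF \<Gamma>_Sp[OF \<xi>] \<Gamma>_Sp[OF \<xi>] _ _ close[OF s]]) (use g[OF \<xi>] s h in auto)
    qed
    moreover have "turn (\<lambda>s. \<Gamma> \<xi> 0) 0 t = 0"
      unfolding turn_def using cdet_minus_imaginary_nonzero[OF \<Gamma>_Sp[OF \<xi>], of 1] by (intro arg_change_const) simp
    ultimately show ?thesis by (simp add: r_def)
  qed
  with h(1) pi_le_C show ?thesis by (meson order.trans)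
qed

lemma r_mean: "\<exists>L. \<forall>e>0. \<exists>S0>0. \<forall>S\<ge>S0. \<forall>\<xi>\<in>X. \<bar>r \<xi> S / S - L\<bar> \<le> e \<and> \<bar>r \<xi> (- S) / (- S) - L\<bar> \<le> e"
proof -
  obtain h where h: "h > 0" "\<And>\<xi> t. \<xi> \<in> X \<Longrightarrow> \<bar>t\<bar> \<le> h \<Longrightarrow> \<bar>r \<xi> t\<bar> \<le> 2 * pi * CARD('d + 'd)" using r_small by blast
  interpret rotation_cocycle X \<phi> d "x 0" r "2 * pi * CARD('d + 'd)" h
  proof
    show "\<exists>L\<ge>0. \<forall>\<xi>\<in>X. \<exists>s. \<bar>s\<bar> \<le> L \<and> d \<xi> (\<phi> (x 0) s) < \<delta>" if "\<delta> > 0" for \<delta>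
      using d_dense[OF that] by (simp add: \<phi>_x)
  qed (use x_in \<phi>_in \<phi>_add d_inv r_quasi h r_close in auto)
  show ?thesis by (rule mean_converges_uniformly)
qed

theorem mean_indices:
  "\<exists>L :: real. ((\<lambda>T. maslov_index 1 \<gamma> T / T) \<longlongrightarrow> L) at_top \<and>
     mean_index_set H X = {ereal L} \<and> mean_index_minus_set H X = {ereal L}"
proof -
  obtain L0 where L0: "\<And>e. e > 0 \<Longrightarrow> \<exists>S0>0. \<forall>S\<ge>S0. \<forall>\<xi>\<in>X. \<bar>r \<xi> S / S - L0\<bar> \<le> e \<and> \<bar>r \<xi> (- S) / (- S) - L0\<bar> \<le> e"
    using r_mean by blast
  have fwd: "((\<lambda>S. maslov_index 1 (\<Gamma> \<xi>) S / S) \<longlongrightarrow> L0 / pi) at_top" if \<xi>: "\<xi> \<in> X" for \<xi>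
  proof -
    have "((\<lambda>S. maslov_index 1 (\<Gamma> \<xi>) S / (1 * S)) \<longlongrightarrow> L0 / pi) at_top"
      by (rule mean_index_tendsto[OF \<Gamma>_continuous[OF \<xi>] \<Gamma>_Sp[OF \<xi>]])
         (use L0 \<xi> in \<open>auto simp: r_def\<close>, meson)
    then show ?thesis by simp
  qed
  have bwd: "((\<lambda>S. maslov_index 1 (\<lambda>t. \<Gamma> \<xi> (- t)) S / (- S)) \<longlongrightarrow> L0 / pi) at_top" if \<xi>: "\<xi> \<in> X" for \<xi>
  proof -
    have t: "turn (\<lambda>t. \<Gamma> \<xi> (- t)) 0 S = r \<xi> (- S)" for S
    proof -
      have "arg_change (\<lambda>t. (\<lambda>s. cdet (- \<i>) (\<Gamma> \<xi> s)) (- t)) 0 S = arg_change (\<lambda>s. cdet (- \<i>) (\<Gamma> \<xi> s)) (- 0) (- S)"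
      proof (rule arg_change_reparam[OF convex_UNIV])
        show "continuous_on UNIV (\<lambda>s. cdet (- \<i>) (\<Gamma> \<xi> s))" by (intro continuous_intros \<Gamma>_continuous \<xi>)
        show "cdet (- \<i>) (\<Gamma> \<xi> t) \<noteq> 0" for t using cdet_minus_imaginary_nonzero[OF \<Gamma>_Sp[OF \<xi>], of 1] by simp
      qed (auto intro!: continuous_intros)
      then show ?thesis by (simp add: turn_def r_def)
    qed
    have "((\<lambda>S. maslov_index 1 (\<lambda>t. \<Gamma> \<xi> (- t)) S / (- 1 * S)) \<longlongrightarrow> L0 / pi) at_top"
    proof (rule mean_index_tendsto)
      show "continuous_on UNIV (\<lambda>t. \<Gamma> \<xi> (- t))"
        by (rule continuous_on_compose2[OF \<Gamma>_continuous[OF \<xi>, of UNIV]]) (auto intro!: continuous_intros)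
      show "\<Gamma> \<xi> (- t) \<in> Sp" for t by (rule \<Gamma>_Sp[OF \<xi>])
      show "\<exists>S0>0. \<forall>S\<ge>S0. \<bar>turn (\<lambda>t. \<Gamma> \<xi> (- t)) 0 S / (- 1 * S) - L0\<bar> \<le> e" if "e > 0" for e
        unfolding t using L0[OF that] \<xi> by (metis mult_minus1)
    qed simp
    then show ?thesis by simp
  qed
  have fs: "fundamental_solution (\<lambda>t. hessian H (orbit_from H \<xi> t)) = \<Gamma> \<xi>" if "\<xi> \<in> X" for \<xi>
    by (simp add: orbit_from_flow[OF that] \<Gamma>_def)
  have "mean_index (\<lambda>t. hessian H (orbit_from H \<xi> t)) = {ereal (L0 / pi)}" if "\<xi> \<in> X" for \<xi>
    unfolding mean_index_def forward_mean_def fs[OF that] by (rule Liminf_Limsup_singleton[OF fwd[OF that]])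
  moreover have "mean_index_minus (\<lambda>t. hessian H (orbit_from H \<xi> t)) = {ereal (L0 / pi)}" if "\<xi> \<in> X" for \<xi>
    unfolding mean_index_minus_def backward_mean_def fs[OF that] by (rule Liminf_Limsup_singleton[OF bwd[OF that]])
  ultimately have "mean_index_set H X = {ereal (L0 / pi)}" "mean_index_minus_set H X = {ereal (L0 / pi)}"
    unfolding mean_index_set_def mean_index_minus_set_def using x_in by auto
  moreover have "\<gamma> = \<Gamma> (x 0)" by (rule \<Gamma>_unique[OF x_in]) (use \<gamma> in \<open>simp add: \<phi>_x\<close>)
  ultimately show ?thesis using fwd[OF x_in[of 0]] by blast
qed

end

theorem theorem1p3:
  fixes H :: "'d::finite phase \<Rightarrow> real"
    and x :: "real \<Rightarrow> 'd phase"
    and \<gamma> :: "real \<Rightarrow> 'd phase_matrix"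
  assumes "C2_function H"
    and "hamiltonian_orbit H x"
    and "quasi_periodic x"
    and "is_fundamental_solution (\<lambda>t. hessian H (x t)) \<gamma>"
  shows "\<exists>L :: real. ((\<lambda>T. maslov_index 1 \<gamma> T / T) \<longlongrightarrow> L) at_top \<and>
           mean_index_set H (orbit_closure x) = {ereal L} \<and>
           mean_index_minus_set H (orbit_closure x) = {ereal L}"
proof -
  obtain \<phi> d where flow: "compact (orbit_closure x)"
    "\<And>t. \<phi> (x 0) t = x t"
    "\<And>\<xi> t. \<xi> \<in> orbit_closure x \<Longrightarrow> \<phi> \<xi> t \<in> orbit_closure x"
    "\<And>\<xi>. \<xi> \<in> orbit_closure x \<Longrightarrow> \<phi> \<xi> 0 = \<xi>"
    "\<And>\<xi> s t. \<xi> \<in> orbit_closure x \<Longrightarrow> \<phi> (\<phi> \<xi> s) t = \<phi> \<xi> (s + t)"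
    "\<And>\<xi> \<eta> t. \<xi> \<in> orbit_closure x \<Longrightarrow> \<eta> \<in> orbit_closure x \<Longrightarrow> d (\<phi> \<xi> t) (\<phi> \<eta> t) = (d \<xi> \<eta> :: real)"
    "\<And>e. e > 0 \<Longrightarrow> \<exists>\<delta>>0. \<forall>\<xi>\<in>orbit_closure x. \<forall>\<eta>\<in>orbit_closure x. d \<xi> \<eta> < \<delta> \<longrightarrow> dist \<xi> \<eta> < e"
    "\<And>\<delta>. \<delta> > 0 \<Longrightarrow> \<exists>L\<ge>0. \<forall>\<xi>\<in>orbit_closure x. \<exists>s. \<bar>s\<bar> \<le> L \<and> d \<xi> (x s) < \<delta>"
    by (rule quasi_periodic_flow[OF assms(3)]) blast
  interpret quasi_periodic_hamiltonian H x \<gamma> \<phi> d "orbit_closure x"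
    by unfold_locales (use assms flow in auto)
  show ?thesis by (rule mean_indices)
qed

end
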